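(* Work in the setting of the context. Let $z_0\in\mathfrak X$ and suppose that, in addition to (A), (B), (C), the assumptions (V1), (V2'), ($\Phi'$), (B1-a), (B1-b), (B1-c), (C1), (D1) listed in the context hold for $z_0$ and some $r_0\in(0,R_0]$. Then there exists $C_2=C_2(z_0,r_0)>1$ such that for any $r<r_0/(2n_0)$, any open set $D\subset B(z_0,r)$ and any non-negative functions $u$ and $v$ on $\mathfrak X$ which are regular harmonic with respect to $X$ in $D$ and vanish on $B(z_0,r)\cap\left(\overline{D}^c\cup D^{\mathrm{reg}}\right)$, it holds that $$C_2^{-1} \frac{u(y)}{v(y)} \le \frac{u(x)}{v(x)}\le C_2 \frac{u(y)}{v(y)}\qquad \text{for all }x,y\in D\cap B(z_0,r/8).$$
   Context: **Space.** $(\mathfrak X,d)$ is a metric space in which all bounded closed sets are compact; $m$ is a $\sigma$-finite measure on $\mathfrak X$ with full support. The localization radius $R_0\in(0,\infty]$ is such that $\mathfrak X\setminus B(x,2r)\ne\emptyset$ for all $x\in\mathfrak X$ and $r<R_0$. $B(x,r)$ is the open ball and $\overline B(x,r)$ its closure; $A(x,r,R)=\{y: r<d(x,y)<R\}$ and $\overline A(x,r,R)$ is its closure; complements are in $\mathfrak X$. $C_0(\mathfrak X)$ is the space of bounded continuous functions vanishing at infinity. **Process.** $X=(X_t,\mathbb P_x)$ is a Markov process on $\mathfrak X$ (not assumed conservative) with semigroup $(P_t)$, cemetery $\partial$, lifetime $\zeta$; conventions $X_\zeta=\partial$ and $u(\partial)=0$ for every function $u$. For open $D$, $\tau_D=\inf\{t>0: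 X_t\notin D\}$. Objects for the dual process carry a hat. (A) $X$ is a Hunt process admitting a strong dual $\widehat X$ with respect to $m$, and $\widehat X$ is also a Hunt process. The semigroups $(P_t)$, $(\widehat P_t)$ are both Feller and strongly Feller. Every semi-polar set of $X$ is polar. Under (A), for open $D$ the process $X$ killed on exiting $D$ has a unique (possibly infinite) Green function $G_D(x,y)$ with $\mathbb E_x\int_0^{\tau_D}f(X_t)dt=\int_D f(y)G_D(x,y)m(dy)$ for non-negative Borel $f$, and $G_D(x,y)=\widehat G_D(y,x)$. $\mathcal A$, $\widehat{\mathcal A}$ are the generators of $(P_t)$, $(\widehat P_t)$ in $C_0(\mathfrak X)$. (B) There is a linear subspace $\mathcal D$ of $\mathcal D(\mathcal A)\cap\mathcal D(\widehat{\mathcal A})$ such that for any compact $K$ and open $D$ with $K\subset D\subset\mathfrak X$, the collection $\mathcal D(K,D)$ of all $f\in\mathcal D$ with $f=1$ on $K$, $f=0$ on $\mathfrak X\setminus D$, $0\le f\le1$ on $\mathfrak X$, and $m(\partial\{f>0\})=0$, is nonempty. Under (B) the jumps of $X$ are described by a Lévy kernel $J$ (with $J(x,\{x\})=0$) satisfying $\int f(y)J(x,dy)=\lim_{t\downarrow0}\mathbb E_xf(X_t)/t$ for bounded continuous $f$ and $x\notin\mathrm{supp} f$; $\widehat J$ is defined similarly. (C) The Lévy kernels of $X$ and $\widehat X$ are $j(x,y)m(dy)$ and $\widehat j(x,y)m(dy)$, with $j(x,y)=\widehat j(y,x)>0$ for all $x\ne y$. **Harmonicity.** A non-negative $u$ is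 regular harmonic in open $D$ with respect to $X$ if $u(x)=\mathbb E_x(u(X_{\tau_D}))$ for all $x\in D$. $D^{\mathrm{reg}}$ is the set of $x\in\partial D$ with $\mathbb P_x(\tau_D=0)=1$. **Assumptions at the point $z_0$** ($r_0\in(0,R_0]$; $r_0/(2n_0)$ means $\infty$ if $r_0=\infty$). Put $V(r)=m(B(z_0,r))$. (V1) There is $c>1$ with $V(2r)\le cV(r)$ for all $r>0$. (V2') There are $c>1$ and $n_0\in\mathbb N$, $n_0\ge2$, with $V(n_0r)\ge cV(r)$ for all $r\le r_0$. ($\Phi'$) There is an increasing function $\Phi:[0,\infty)\to[0,\infty)$ and $c>1$ with $\Phi(2r)\le c\,\Phi(r)$ for all $r>0$. (B1-a) For any $a\in(1/2,1)$ there is $c=c(z_0,a)$ such that for any $r<r_0$, $\inf_{f\in\mathcal D(\overline B(z_0,ar),B(z_0,r))}\sup_{x\in\mathfrak X}\max(\mathcal Af(x),\widehat{\mathcal A}f(x))\le c/\Phi(r)$. (B1-b) For any $a\in(1/2,1)$ there is $c=c(z_0,a)$ such that for any $r<r_0$ and any $f\in\mathcal D(\overline B(z_0,ar),B(z_0,r))$, $\max(\mathcal Af(x),\widehat{\mathcal A}f(x))\le cV(r)j(x,z_0)$ for $x\in\overline A(z_0,ar,(a+1)r)$. (B1-c) For any $1/2<b<a<1$ there is $c=c(z_0,a,b)$ such that for any $r<r_0$, $\inf_{f\in\mathcal D(\overline A(z_0,br,ar),A(z_0,r/2,r))}\sup_{x\in\mathfrak X}\max(\mathcal Af(x),\widehat{\mathcal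 A}f(x))\le c/\Phi(r)$. (C1) For any $a\in(1/2,1)$ there are $c\ge1$, $c'>0$ depending on $a,r_0,z_0$ such that for $r<r_0$, $x\in B(z_0,ar)$, $y\in\mathfrak X\setminus B(z_0,r)$: $c^{-1}j(z_0,y)\le j(x,y)\le c\,j(z_0,y)$, $c^{-1}\widehat j(z_0,y)\le\widehat j(x,y)\le c\,\widehat j(z_0,y)$, and $\inf_{y\in\overline A(z_0,ar,r)}\min(j(z_0,y),\widehat j(z_0,y))\ge\frac{c'}{V(r)\Phi(r)}$. (D1) For any $a\in(1/2,1)$ there is $c=c(z_0,r_0,a)$ such that for all $r<r_0$, $\sup_{x\in\overline A(z_0,ar,r)}\sup_{y\in B(z_0,r/2)}\max(G_{B(z_0,r)}(x,y),\widehat G_{B(z_0,r)}(x,y))\le c\,\Phi(r)/V(r)$. *)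

theory Defs
  imports "HOL-Probability.Probability"
begin

section \<open>The state space with cemetery\<close>

text \<open>
  The underlying space is a type of class \<^class>\<open>heine_borel\<close> (metric spaces in which closed
  bounded sets are compact). The cemetery is \<open>None\<close>; it is the point at infinity of the one-point
  compactification, hence an isolated point exactly when the space is compact.
\<close>

abbreviation cemetery_topology :: "'a::topological_space option topology" where
  "cemetery_topology \<equiv> Alexandroff_compactification euclidean"

definition cemetery_borel :: "'a::topological_space option measure" where
  "cemetery_borel = sigma UNIV {U. openin cemetery_topology U}"

definition ext0 :: "('a \<Rightarrow> 'b::zero) \<Rightarrow> 'a option \<Rightarrow> 'b" where
  "ext0 f z = (case z of None \<Rightarrow> 0 | Some x \<Rightarrow> f x)"

definition annulus :: "'a::metric_space \<Rightarrow> real \<Rightarrow> real \<Rightarrow> 'a set" where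
  "annulus z r R = {y. r < dist z y \<and> dist z y < R}"

definition C0 :: "('a::topological_space \<Rightarrow> real) set" where
  "C0 = {f. continuous_on UNIV f \<and> (\<forall>e>0. compact {x. e \<le> \<bar>f x\<bar>})}"

section \<open>Hunt processes\<close>

text \<open>
  The time set is \<open>[0, \<infinity>]\<close>, and \<open>X\<^sub>\<infinity>\<close> is the cemetery. The measures \<open>law Z z\<close> live on
  the sigma-algebra generated by the process; whatever needs the usual augmentation
  (such as exit times) is integrated with respect to the completion.
\<close>

record ('a, 'w) process =
  sample_space :: "'w set"
  state :: "ennreal \<Rightarrow> 'w \<Rightarrow> 'a option"
  law :: "'a option \<Rightarrow> 'w measure"

definition natural_filtration ::
    "('a::topological_space, 'w) process \<Rightarrow> ennreal \<Rightarrow> 'w measure" where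
  "natural_filtration Z t = sigma (sample_space Z)
     {state Z s -` B \<inter> sample_space Z | s B. s \<le> t \<and> B \<in> sets cemetery_borel}"

definition right_filtration ::
    "('a::topological_space, 'w) process \<Rightarrow> ennreal \<Rightarrow> 'w measure" where
  "right_filtration Z t = sigma (sample_space Z)
     {A \<in> sets (natural_filtration Z \<top>). \<forall>s>t. A \<in> sets (natural_filtration Z s)}"

text \<open>
  Strong Markov property and quasi-left-continuity are required for the smallest right-continuous
  filtration to which the process is adapted. This is equivalent to requiring them for some
  right-continuous filtration, and to requiring them for the augmented filtration.
\<close>

definition strong_markov :: "('a::topological_space, 'w) process \<Rightarrow> bool" where
  "strong_markov Z \<longleftrightarrow>
     (\<forall>T. stopping_time (right_filtration Z) T \<longrightarrow>
       (\<forall>z s. \<forall>B\<in>sets cemetery_borel.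
         \<forall>A\<in>sets (filtration.pre_sigma (sample_space Z) (right_filtration Z) T).
          emeasure (law Z z) {\<omega>\<in>A. T \<omega> < \<top> \<and> state Z (T \<omega> + s) \<omega> \<in> B} =
          (\<integral>\<^sup>+\<omega>\<in>{\<omega>\<in>A. T \<omega> < \<top>}.
             emeasure (law Z (state Z (T \<omega>) \<omega>)) {\<omega>'\<in>sample_space Z. state Z s \<omega>' \<in> B}
           \<partial>law Z z)))"

definition quasi_left_continuous :: "('a::topological_space, 'w) process \<Rightarrow> bool" where
  "quasi_left_continuous Z \<longleftrightarrow>
     (\<forall>T :: nat \<Rightarrow> 'w \<Rightarrow> ennreal.
        (\<forall>n. stopping_time (right_filtration Z) (T n)) \<and>
        (\<forall>\<omega>\<in>sample_space Z. incseq (\<lambda>n. T n \<omega>)) \<longrightarrow>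
        (\<forall>z. AE \<omega> in law Z z. (SUP n. T n \<omega>) < \<top> \<longrightarrow>
           limitin cemetery_topology (\<lambda>n. state Z (T n \<omega>) \<omega>)
             (state Z (SUP n. T n \<omega>) \<omega>) sequentially))"

definition hunt_process :: "('a::topological_space, 'w) process \<Rightarrow> bool" where
  "hunt_process Z \<longleftrightarrow>
     (\<forall>z. prob_space (law Z z) \<and> space (law Z z) = sample_space Z \<and>
          sets (law Z z) = sets (natural_filtration Z \<top>)) \<and>
     (\<forall>t. \<forall>B\<in>sets cemetery_borel.
        (\<lambda>z. emeasure (law Z z) {\<omega>\<in>sample_space Z. state Z t \<omega> \<in> B})
          \<in> borel_measurable cemetery_borel) \<and>
     (\<forall>z. AE \<omega> in law Z z. state Z 0 \<omega> = z) \<and>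
     (\<forall>\<omega>\<in>sample_space Z.
        state Z \<top> \<omega> = None \<and>
        (\<forall>s t. s \<le> t \<and> state Z s \<omega> = None \<longrightarrow> state Z t \<omega> = None) \<and>
        (\<forall>t<\<top>. limitin cemetery_topology (\<lambda>s. state Z s \<omega>) (state Z t \<omega>) (at_right t)) \<and>
        (\<forall>t<\<top>. 0 < t \<longrightarrow>
           (\<exists>l. limitin cemetery_topology (\<lambda>s. state Z s \<omega>) l (at_left t))) \<and>
        (\<forall>s. \<exists>\<omega>'\<in>sample_space Z. \<forall>t. state Z t \<omega>' = state Z (s + t) \<omega>)) \<and>
     strong_markov Z \<and> quasi_left_continuous Z"

definition hitting_time :: "('a, 'w) process \<Rightarrow> 'a option set \<Rightarrow> 'w \<Rightarrow> ennreal" where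
  "hitting_time Z S \<omega> = Inf {t. 0 < t \<and> state Z t \<omega> \<in> S}"

text \<open>Being in the cemetery counts as having left \<open>D\<close>.\<close>

definition exit_time :: "('a, 'w) process \<Rightarrow> 'a set \<Rightarrow> 'w \<Rightarrow> ennreal" where
  "exit_time Z D = hitting_time Z (- (Some ` D))"

section \<open>Semigroup, generator, Levy kernel\<close>

definition semigroup_op ::
    "('a, 'w) process \<Rightarrow> real \<Rightarrow> ('a \<Rightarrow> real) \<Rightarrow> 'a \<Rightarrow> real" where
  "semigroup_op Z t f x = (\<integral>\<omega>. ext0 f (state Z (ennreal t) \<omega>) \<partial>law Z (Some x))"

definition feller :: "('a::topological_space, 'w) process \<Rightarrow> bool" where
  "feller Z \<longleftrightarrow> (\<forall>f\<in>C0. (\<forall>t\<ge>0. semigroup_op Z t f \<in> C0) \<and>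
     uniform_limit UNIV (\<lambda>t. semigroup_op Z t f) f (at_right 0))"

definition strongly_feller :: "('a::topological_space, 'w) process \<Rightarrow> bool" where
  "strongly_feller Z \<longleftrightarrow>
     (\<forall>f\<in>borel_measurable borel. bounded (range f) \<longrightarrow>
       (\<forall>t>0. continuous_on UNIV (semigroup_op Z t f) \<and> bounded (range (semigroup_op Z t f))))"

definition generates ::
    "('a::topological_space, 'w) process \<Rightarrow> ('a \<Rightarrow> real) \<Rightarrow> ('a \<Rightarrow> real) \<Rightarrow> bool" where
  "generates Z f g \<longleftrightarrow> f \<in> C0 \<and> g \<in> C0 \<and>
     uniform_limit UNIV (\<lambda>t x. (semigroup_op Z t f x - f x) / t) g (at_right 0)"

definition gen_domain :: "('a::topological_space, 'w) process \<Rightarrow> ('a \<Rightarrow> real) set" where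
  "gen_domain Z = {f. \<exists>g. generates Z f g}"

definition gen :: "('a::topological_space, 'w) process \<Rightarrow> ('a \<Rightarrow> real) \<Rightarrow> 'a \<Rightarrow> real" where
  "gen Z f = (THE g. generates Z f g)"

definition levy_kernel ::
    "('a::topological_space, 'w) process \<Rightarrow> ('a \<Rightarrow> 'a measure) \<Rightarrow> bool" where
  "levy_kernel Z J \<longleftrightarrow>
     (\<forall>x. sets (J x) = sets borel \<and> emeasure (J x) {x} = 0) \<and>
     (\<forall>B\<in>sets borel. (\<lambda>x. emeasure (J x) B) \<in> borel_measurable borel) \<and>
     (\<forall>f x. continuous_on UNIV f \<and> bounded (range f) \<and> x \<notin> closure {y. f y \<noteq> 0} \<longrightarrow>
        integrable (J x) f \<and>
        ((\<lambda>t. semigroup_op Z t f x / t) \<longlongrightarrow> (\<integral>y. f y \<partial>J x)) (at_right 0))"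

section \<open>Duality, exceptional sets, Green functions\<close>

definition resolvent ::
    "('a, 'w) process \<Rightarrow> real \<Rightarrow> ('a \<Rightarrow> ennreal) \<Rightarrow> 'a \<Rightarrow> ennreal" where
  "resolvent Z \<alpha> f x =
     (\<integral>\<^sup>+t\<in>{0..}. ennreal (exp (- \<alpha> * t)) *
        (\<integral>\<^sup>+\<omega>. ext0 f (state Z (ennreal t) \<omega>) \<partial>law Z (Some x)) \<partial>lborel)"

text \<open>Strong duality: duality of the resolvents, together with their absolute continuity.\<close>

definition strong_duality ::
    "'a::topological_space measure \<Rightarrow> ('a, 'w) process \<Rightarrow> ('a, 'v) process \<Rightarrow> bool" where
  "strong_duality m X Xd \<longleftrightarrow>
     (\<forall>\<alpha>>0. \<forall>f\<in>borel_measurable borel. \<forall>g\<in>borel_measurable borel.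
        (\<integral>\<^sup>+x. f x * resolvent X \<alpha> g x \<partial>m) = (\<integral>\<^sup>+x. resolvent Xd \<alpha> f x * g x \<partial>m)) \<and>
     (\<forall>\<alpha>>0. \<forall>x. \<forall>N\<in>null_sets m.
        resolvent X \<alpha> (indicator N) x = 0 \<and> resolvent Xd \<alpha> (indicator N) x = 0)"

definition polar :: "('a::topological_space, 'w) process \<Rightarrow> 'a set \<Rightarrow> bool" where
  "polar Z A \<longleftrightarrow> (\<exists>B\<in>sets borel. A \<subseteq> B \<and>
     (\<forall>x. AE \<omega> in law Z (Some x). hitting_time Z (Some ` B) \<omega> = \<top>))"

definition thin :: "('a::topological_space, 'w) process \<Rightarrow> 'a set \<Rightarrow> bool" where
  "thin Z A \<longleftrightarrow> (\<exists>B\<in>sets borel. A \<subseteq> B \<and>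
     (\<forall>x. \<not> (AE \<omega> in law Z (Some x). hitting_time Z (Some ` B) \<omega> = 0)))"

definition semipolar :: "('a::topological_space, 'w) process \<Rightarrow> 'a set \<Rightarrow> bool" where
  "semipolar Z A \<longleftrightarrow> (\<exists>N :: nat \<Rightarrow> 'a set. (\<forall>n. thin Z (N n)) \<and> A \<subseteq> (\<Union>n. N n))"

definition killed_semigroup ::
    "('a, 'w) process \<Rightarrow> 'a set \<Rightarrow> real \<Rightarrow> ('a \<Rightarrow> ennreal) \<Rightarrow> 'a \<Rightarrow> ennreal" where
  "killed_semigroup Z D t f x =
     (\<integral>\<^sup>+\<omega>. (if ennreal t < exit_time Z D \<omega> then ext0 f (state Z (ennreal t) \<omega>) else 0)
        \<partial>completion (law Z (Some x)))"

definition killed_excessive :: "('a, 'w) process \<Rightarrow> 'a set \<Rightarrow> ('a \<Rightarrow> ennreal) \<Rightarrow> bool" where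
  "killed_excessive Z D f \<longleftrightarrow> (\<forall>x.
     (\<forall>t>0. killed_semigroup Z D t f x \<le> f x) \<and>
     ((\<lambda>t. killed_semigroup Z D t f x) \<longlongrightarrow> f x) (at_right 0))"

definition killed_potential ::
    "('a, 'w) process \<Rightarrow> 'a set \<Rightarrow> ('a \<Rightarrow> ennreal) \<Rightarrow> 'a \<Rightarrow> ennreal" where
  "killed_potential Z D f x =
     (\<integral>\<^sup>+\<omega>. (\<integral>\<^sup>+t\<in>{t. 0 \<le> t \<and> ennreal t < exit_time Z D \<omega>}.
        ext0 f (state Z (ennreal t) \<omega>) \<partial>lborel) \<partial>completion (law Z (Some x)))"

text \<open>
  The occupation-time identities alone determine the Green function only up to null sets.
  The version that is unique as a function, and hence may be evaluated pointwise, is the one that is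
  excessive in the first and coexcessive in the second variable for the killed processes.
  The Green function of the dual process is \<open>\<lambda>x y. g y x\<close>.
\<close>

definition green_function ::
    "'a::topological_space measure \<Rightarrow> ('a, 'w) process \<Rightarrow> ('a, 'v) process \<Rightarrow> 'a set \<Rightarrow>
      ('a \<Rightarrow> 'a \<Rightarrow> ennreal) \<Rightarrow> bool" where
  "green_function m X Xd D g \<longleftrightarrow>
     case_prod g \<in> borel_measurable (borel \<Otimes>\<^sub>M borel) \<and>
     (\<forall>f\<in>borel_measurable borel. \<forall>x.
        killed_potential X D f x = (\<integral>\<^sup>+y\<in>D. f y * g x y \<partial>m) \<and>
        killed_potential Xd D f x = (\<integral>\<^sup>+y\<in>D. f y * g y x \<partial>m)) \<and>
     (\<forall>y. killed_excessive X D (\<lambda>x. g x y)) \<and>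
     (\<forall>x. killed_excessive Xd D (g x))"

section \<open>Standing assumptions\<close>

definition reference_measure :: "'a::topological_space measure \<Rightarrow> bool" where
  "reference_measure m \<longleftrightarrow> sigma_finite_measure m \<and> sets m = sets borel \<and>
     (\<forall>U. open U \<and> U \<noteq> {} \<longrightarrow> 0 < emeasure m U)"

definition localization_radius :: "'a::metric_space itself \<Rightarrow> ereal \<Rightarrow> bool" where
  "localization_radius _ R\<^sub>0 \<longleftrightarrow> 0 < R\<^sub>0 \<and>
     (\<forall>(x::'a) r. 0 < r \<and> ereal r < R\<^sub>0 \<longrightarrow> - ball x (2 * r) \<noteq> {})"

definition assumption_A ::
    "'a::topological_space measure \<Rightarrow> ('a, 'w) process \<Rightarrow> ('a, 'v) process \<Rightarrow> bool" where
  "assumption_A m X Xd \<longleftrightarrow>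
     hunt_process X \<and> hunt_process Xd \<and> strong_duality m X Xd \<and>
     feller X \<and> feller Xd \<and> strongly_feller X \<and> strongly_feller Xd \<and>
     (\<forall>A. semipolar X A \<longrightarrow> polar X A)"

definition test_functions ::
    "'a::topological_space measure \<Rightarrow> ('a \<Rightarrow> real) set \<Rightarrow> 'a set \<Rightarrow> 'a set \<Rightarrow> ('a \<Rightarrow> real) set" where
  "test_functions m \<D> K D = {f\<in>\<D>. (\<forall>x\<in>K. f x = 1) \<and> (\<forall>x\<in>-D. f x = 0) \<and>
     (\<forall>x. 0 \<le> f x \<and> f x \<le> 1) \<and> emeasure m (frontier {x. 0 < f x}) = 0}"

definition linear_subspace :: "('a \<Rightarrow> real) set \<Rightarrow> bool" where
  "linear_subspace S \<longleftrightarrow> (\<lambda>_. 0) \<in> S \<and> (\<forall>f\<in>S. \<forall>g\<in>S. (\<lambda>x. f x + g x) \<in> S) \<and>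
     (\<forall>f\<in>S. \<forall>c. (\<lambda>x. c * f x) \<in> S)"

definition assumption_B ::
    "'a::topological_space measure \<Rightarrow> ('a, 'w) process \<Rightarrow> ('a, 'v) process \<Rightarrow>
      ('a \<Rightarrow> real) set \<Rightarrow> bool" where
  "assumption_B m X Xd \<D> \<longleftrightarrow>
     linear_subspace \<D> \<and> \<D> \<subseteq> gen_domain X \<inter> gen_domain Xd \<and>
     (\<forall>K D. compact K \<and> open D \<and> K \<subseteq> D \<longrightarrow> test_functions m \<D> K D \<noteq> {})"

definition assumption_C ::
    "'a::topological_space measure \<Rightarrow> ('a, 'w) process \<Rightarrow> ('a, 'v) process \<Rightarrow>
      ('a \<Rightarrow> 'a \<Rightarrow> real) \<Rightarrow> ('a \<Rightarrow> 'a \<Rightarrow> real) \<Rightarrow> bool" where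
  "assumption_C m X Xd j jd \<longleftrightarrow>
     (\<forall>x. j x \<in> borel_measurable borel \<and> jd x \<in> borel_measurable borel) \<and>
     levy_kernel X (\<lambda>x. density m (\<lambda>y. ennreal (j x y))) \<and>
     levy_kernel Xd (\<lambda>x. density m (\<lambda>y. ennreal (jd x y))) \<and>
     (\<forall>x y. x \<noteq> y \<longrightarrow> j x y = jd y x \<and> 0 < j x y)"

section \<open>Assumptions at a point\<close>

text \<open>
  All bounds are in \<^typ>\<open>ereal\<close> or \<^typ>\<open>ennreal\<close>, so that the volume of a ball may a priori be
  infinite, and the quotient of a positive number by \<open>0\<close> is \<open>\<infinity>\<close>.
\<close>

definition vol :: "'a::metric_space measure \<Rightarrow> 'a \<Rightarrow> real \<Rightarrow> ennreal" where
  "vol m z r = emeasure m (ball z r)"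

definition assumption_V1 :: "'a::metric_space measure \<Rightarrow> 'a \<Rightarrow> bool" where
  "assumption_V1 m z \<longleftrightarrow> (\<exists>c>1. \<forall>r>0. vol m z (2 * r) \<le> ennreal c * vol m z r)"

definition assumption_V2' :: "'a::metric_space measure \<Rightarrow> 'a \<Rightarrow> ereal \<Rightarrow> nat \<Rightarrow> bool" where
  "assumption_V2' m z r\<^sub>0 n\<^sub>0 \<longleftrightarrow> 2 \<le> n\<^sub>0 \<and>
     (\<exists>c>1. \<forall>r>0. ereal r \<le> r\<^sub>0 \<longrightarrow> ennreal c * vol m z r \<le> vol m z (real n\<^sub>0 * r))"

definition assumption_Phi' :: "(real \<Rightarrow> real) \<Rightarrow> bool" where
  "assumption_Phi' \<Phi> \<longleftrightarrow> mono_on {0..} \<Phi> \<and> (\<forall>r\<ge>0. 0 \<le> \<Phi> r) \<and>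
     (\<exists>c>1. \<forall>r>0. \<Phi> (2 * r) \<le> c * \<Phi> r)"

definition assumption_B1a ::
    "'a::metric_space measure \<Rightarrow> ('a, 'w) process \<Rightarrow> ('a, 'v) process \<Rightarrow> ('a \<Rightarrow> real) set \<Rightarrow>
      (real \<Rightarrow> real) \<Rightarrow> 'a \<Rightarrow> ereal \<Rightarrow> bool" where
  "assumption_B1a m X Xd \<D> \<Phi> z r\<^sub>0 \<longleftrightarrow>
     (\<forall>a\<in>{1/2<..<1}. \<exists>c>0. \<forall>r>0. ereal r < r\<^sub>0 \<longrightarrow>
        (INF f\<in>test_functions m \<D> (closure (ball z (a * r))) (ball z r).
           SUP x. ereal (max (gen X f x) (gen Xd f x))) \<le> ereal c / ereal (\<Phi> r))"

definition assumption_B1b ::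
    "'a::metric_space measure \<Rightarrow> ('a, 'w) process \<Rightarrow> ('a, 'v) process \<Rightarrow> ('a \<Rightarrow> real) set \<Rightarrow>
      ('a \<Rightarrow> 'a \<Rightarrow> real) \<Rightarrow> 'a \<Rightarrow> ereal \<Rightarrow> bool" where
  "assumption_B1b m X Xd \<D> j z r\<^sub>0 \<longleftrightarrow>
     (\<forall>a\<in>{1/2<..<1}. \<exists>c>0. \<forall>r>0. ereal r < r\<^sub>0 \<longrightarrow>
        (\<forall>f\<in>test_functions m \<D> (closure (ball z (a * r))) (ball z r).
         \<forall>x\<in>closure (annulus z (a * r) ((a + 1) * r)).
           ereal (max (gen X f x) (gen Xd f x))
             \<le> ereal c * enn2ereal (vol m z r) * ereal (j x z)))"

definition assumption_B1c ::
    "'a::metric_space measure \<Rightarrow> ('a, 'w) process \<Rightarrow> ('a, 'v) process \<Rightarrow> ('a \<Rightarrow> real) set \<Rightarrow>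
      (real \<Rightarrow> real) \<Rightarrow> 'a \<Rightarrow> ereal \<Rightarrow> bool" where
  "assumption_B1c m X Xd \<D> \<Phi> z r\<^sub>0 \<longleftrightarrow>
     (\<forall>a b. 1/2 < b \<and> b < a \<and> a < 1 \<longrightarrow> (\<exists>c>0. \<forall>r>0. ereal r < r\<^sub>0 \<longrightarrow>
        (INF f\<in>test_functions m \<D> (closure (annulus z (b * r) (a * r))) (annulus z (r / 2) r).
           SUP x. ereal (max (gen X f x) (gen Xd f x))) \<le> ereal c / ereal (\<Phi> r)))"

definition assumption_C1 ::
    "'a::metric_space measure \<Rightarrow> ('a \<Rightarrow> 'a \<Rightarrow> real) \<Rightarrow> ('a \<Rightarrow> 'a \<Rightarrow> real) \<Rightarrow>
      (real \<Rightarrow> real) \<Rightarrow> 'a \<Rightarrow> ereal \<Rightarrow> bool" where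
  "assumption_C1 m j jd \<Phi> z r\<^sub>0 \<longleftrightarrow>
     (\<forall>a\<in>{1/2<..<1}. \<exists>c\<ge>1. \<exists>c'>0. \<forall>r>0. ereal r < r\<^sub>0 \<longrightarrow>
        (\<forall>x\<in>ball z (a * r). \<forall>y\<in>- ball z r.
           inverse c * j z y \<le> j x y \<and> j x y \<le> c * j z y \<and>
           inverse c * jd z y \<le> jd x y \<and> jd x y \<le> c * jd z y) \<and>
        ennreal c' / (vol m z r * ennreal (\<Phi> r))
          \<le> (INF y\<in>closure (annulus z (a * r) r). ennreal (min (j z y) (jd z y))))"

definition assumption_D1 ::
    "'a::metric_space measure \<Rightarrow> ('a set \<Rightarrow> 'a \<Rightarrow> 'a \<Rightarrow> ennreal) \<Rightarrow>
      (real \<Rightarrow> real) \<Rightarrow> 'a \<Rightarrow> ereal \<Rightarrow> bool" where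
  "assumption_D1 m G \<Phi> z r\<^sub>0 \<longleftrightarrow>
     (\<forall>a\<in>{1/2<..<1}. \<exists>c>0. \<forall>r>0. ereal r < r\<^sub>0 \<longrightarrow>
        (SUP x\<in>closure (annulus z (a * r) r). SUP y\<in>ball z (r / 2).
           max (G (ball z r) x y) (G (ball z r) y x))
          \<le> ennreal c * (ennreal (\<Phi> r) / vol m z r))"

section \<open>Harmonicity\<close>

definition regular_harmonic ::
    "('a::topological_space, 'w) process \<Rightarrow> 'a set \<Rightarrow> ('a \<Rightarrow> real) \<Rightarrow> bool" where
  "regular_harmonic Z D u \<longleftrightarrow> u \<in> borel_measurable borel \<and> (\<forall>x. 0 \<le> u x) \<and>
     (\<forall>x\<in>D. ennreal (u x) =
        (\<integral>\<^sup>+\<omega>. ennreal (ext0 u (state Z (exit_time Z D \<omega>) \<omega>)) \<partial>completion (law Z (Some x))))"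

definition regular_points ::
    "('a::topological_space, 'w) process \<Rightarrow> 'a set \<Rightarrow> 'a set" where
  "regular_points Z D = {x\<in>frontier D. AE \<omega> in law Z (Some x). exit_time Z D \<omega> = 0}"

end

(* A regular harmonic function u on D inside B(z0,r) that vanishes on the rest of the ball is, on
   B(z0,r/8), comparable to the product of the mean exit time from U = D \<inter> B(z0,3r/10) and the
   tail \<integral> j(z0,y) u(y) m(dy) over the complement of B(z0,r/2); the ratio of two such functions is
   then controlled since the exit time does not depend on u. Jumps out of U beyond B(z0,r/2) give
   the product by the Levy system and (C1). Exits of U into the annulus inside B(z0,r/2) have
   probability at most a multiple of the mean exit time over \<Phi>(r) by Dynkin's formula for a cutoff
   from (B1-c), and on B(z0,r/2) one needs u \<le> C \<Phi>(r) tail.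

   For this sup bound, kill the processes in addition at rate (A^ \<phi>)^+ / (\<phi> + \<epsilon>), where A^ is the
   dual generator and \<phi> a cutoff from (B1-a). Then \<phi> + \<epsilon> is a supersolution for the dual process,
   so the perturbed dual potential of a weight k on B(z0,r/2) is dominated away from the centre by a
   multiple of \<phi> + \<epsilon>, the multiple coming from (D1) and (C1). Integrating u against k, the extra
   killing contributes the integral of u over an annulus, which (C1) bounds by the tail. The exit
   law contributes the tail as \<epsilon> tends to 0: this is tested with functions of \<D> supported off the
   ball and extended to Borel functions by inner regularity.

   Irregular boundary points form a semi-polar, hence polar set, so u may be replaced by 0 there. *)

theory Submission imports Defs begin

text \<open>The obstacle sits near the sphere of radius r: (C1) compares j(x, .) with j(z0, .) only
  when x keeps a distance from the target, so exits that start just inside the sphere, or pass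
  through it continuously, cannot be compared with the tail. The extra killing removes them. Where
  \<phi> vanishes, the rate is of order 1/\<epsilon> and the dual potential of order \<epsilon>, so
  that exits from this region disappear in the limit. The price is the integral of u against
  potential times rate; there the factor \<open>\<phi> + \<epsilon>\<close> of the potential cancels
  the denominator of the rate, which leaves the supremum of the generator from (B1-a), uniformly in
  \<epsilon>. A second constraint shapes all formulas. A harmonic function is not known to be
  bounded or integrable, so potentials take extended non-negative values and are not subtracted
  unless finite. Identities are therefore written as sums, Dynkin's formula keeps the two parts of
  the generator on opposite sides, and differences of potentials are replaced by minimality among
  supersolutions.\<close>

abbreviation (input) borel_fun :: "('a::topological_space \<Rightarrow> 'b::topological_space) set" where
 "borel_fun \<equiv> borel_measurable borel"

section \<open>The one-point compactification\<close>

text \<open>Vanishing at infinity is continuity at the added point: the preimage of a neighbourhood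
  of 0 misses only a closed subset of some compact set
  \<open>{x. e \<le> \<bar>f x\<bar>}\<close>.\<close>

lemma continuous_map_ext0:
 fixes f :: "'a::t2_space \<Rightarrow> real"
 assumes "f \<in> C0"
 shows "continuous_map cemetery_topology euclideanreal (ext0 f)"
proof -
 have cf: "continuous_on UNIV f" and K: "\<And>e. e > 0 \<Longrightarrow> compact {x. e \<le> \<bar>f x\<bar>}"
  using assms by (auto simp: C0_def)
 have "openin cemetery_topology {z. ext0 f z \<in> V}" if V: "open V" for V
 proof (cases "0 \<in> V")
  case False
  then have eq: "{z. ext0 f z \<in> V} = Some ` (f -` V)"
   by (auto simp: ext0_def image_iff split: option.splits)
  have "open (f -` V)" using cf V by (simp add: continuous_on_open_vimage)
  then show ?thesis by (simp add: eq)
 next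
  case True
  then obtain e where e: "e > 0" "ball 0 e \<subseteq> V" using V open_contains_ball by blast
  let ?C = "f -` (-V)"
  have cl: "closed ?C" using cf V by (metis closed_vimage closed_Compl)
  have "?C = ?C \<inter> {x. e \<le> \<bar>f x\<bar>}" using e by (force simp: dist_real_def subset_iff)
  then have "compact ?C" using K[OF e(1)] cl by (metis closed_Int_compact)
  moreover have "{z. ext0 f z \<in> V} = insert None (Some ` (UNIV - ?C))"
  proof -
   have "z \<in> insert None (Some ` (UNIV - ?C))" if "ext0 f z \<in> V" for z
    using that by (cases z) (auto simp: ext0_def)
   then show ?thesis using True by (auto simp: ext0_def)
  qed
  ultimately show ?thesis using cl by (auto simp: openin_Alexandroff_compactification)
 qed
 moreover have "{z \<in> topspace cemetery_topology. ext0 f z \<in> V} = {z. ext0 f z \<in> V}" for V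
  by auto (metis not_None_eq rangeI)
 ultimately show ?thesis by (simp only: continuous_map_def) auto
qed

text \<open>Tent functions belong to \<open>C0\<close> and are positive exactly on balls, so they
  reduce both right-continuity of paths and measurability into the space with cemetery to statements
  on real functions.\<close>

definition bump :: "'a::metric_space \<Rightarrow> real \<Rightarrow> 'a \<Rightarrow> real" where
 "bump c \<rho> x = max 0 (\<rho> - dist c x)"

lemma continuous_on_bump: "continuous_on A (bump c \<rho>)"
 unfolding bump_def by (intro continuous_on_max continuous_on_const continuous_on_diff continuous_on_dist continuous_on_id)

lemma bump_C0: "bump c \<rho> \<in> (C0 :: ('a::heine_borel \<Rightarrow> real) set)"
proof -
 have "compact {x. e \<le> \<bar>bump c \<rho> x\<bar>}" if "e > 0" for e
 proof -
  have "{x. e \<le> \<bar>bump c \<rho> x\<bar>} \<subseteq> cball c \<rho>" using that by (auto simp: bump_def)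
  then have "bounded {x. e \<le> \<bar>bump c \<rho> x\<bar>}" using bounded_cball bounded_subset by blast
  moreover have "closed {x. e \<le> \<bar>bump c \<rho> x\<bar>}"
   by (intro closed_Collect_le continuous_intros continuous_on_bump)
  ultimately show ?thesis by (simp add: compact_eq_bounded_closed)
 qed
 then show ?thesis by (auto simp: C0_def continuous_on_bump)
qed

lemma ext0_bump_pos: "0 < ext0 (bump c \<rho>) z \<longleftrightarrow> z \<in> Some ` ball c \<rho>"
 by (cases z) (auto simp: ext0_def bump_def)

text \<open>Closed balls of integer radius are compact, hence have finite nets of every mesh
  1/(m+1); the balls around the points of all these nets form a countable base. The Lindelof
  argument below rests on this.\<close>

instance heine_borel \<subseteq> second_countable_topology
proof
 fix x0 :: 'a
 have "\<exists>k. finite k \<and> cball x0 (real n) \<subseteq> (\<Union>x\<in>k. ball x (1 / real (Suc m)))" for n m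
 proof -
  have "\<forall>e>0. \<exists>k. finite k \<and> k \<subseteq> cball x0 (real n) \<and> cball x0 (real n) \<subseteq> (\<Union>x\<in>k. ball x e)"
   by (rule seq_compact_imp_totally_bounded) (simp add: compact_eq_seq_compact_metric[symmetric])
  then obtain k where "finite k" "cball x0 (real n) \<subseteq> (\<Union>x\<in>k. ball x (1 / real (Suc m)))"
   by (metis of_nat_0_less_iff zero_less_Suc zero_less_divide_1_iff)
  then show ?thesis by blast
 qed
 then obtain k where k: "\<And>n m. finite (k n m)" "\<And>n m. cball x0 (real n) \<subseteq> (\<Union>x\<in>k n m. ball x (1 / real (Suc m)))"
  by metis
 define B where "B = (\<lambda>(x, m). ball x (1 / real (Suc m))) ` (SIGMA x:(\<Union>n m. k n m). (UNIV :: nat set))"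
 have "countable B" unfolding B_def using k(1) by (intro countable_image countable_SIGMA countable_UN) (auto intro: countable_finite)
 moreover have "topological_basis B"
 proof (rule topological_basisI)
  fix U :: "'a set" and x assume U: "open U" "x \<in> U"
  obtain e where e: "0 < e" "ball x e \<subseteq> U" using U openE by blast
  obtain m where m: "1 / real (Suc m) < e / 2" using nat_approx_posE[of "e/2"] e(1) by auto
  obtain n where "dist x0 x \<le> real n" using real_arch_simple by blast
  then obtain y where y: "y \<in> k n m" "dist y x < 1 / real (Suc m)" using k(2)[of n m] by (force simp: subset_eq)
  have "ball y (1 / real (Suc m)) \<subseteq> ball x e"
  proof
   fix z assume "z \<in> ball y (1 / real (Suc m))"
   then show "z \<in> ball x e" using y(2) m dist_triangle[of x z y] by (simp add: dist_commute)
  qed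
  then show "\<exists>B'\<in>B. x \<in> B' \<and> B' \<subseteq> U" using y e(2) by (intro bexI[of _ "ball y (1 / real (Suc m))"]) (auto simp: B_def)
 qed (auto simp: B_def)
 ultimately show "\<exists>B::'a set set. countable B \<and> open = generate_topology B"
  unfolding topological_basis_def[symmetric] using topological_basis_imp_subbasis by blast
qed

section \<open>Borel structure of the space with cemetery\<close>

lemma space_cemetery_borel [simp]: "space cemetery_borel = UNIV" by (simp add: cemetery_borel_def)

lemma openin_cemetery_measurable: "openin cemetery_topology U \<Longrightarrow> U \<in> sets cemetery_borel"
 by (simp add: cemetery_borel_def)

text \<open>\<open>Some\<close> is an open embedding, so images of open sets are open; complements
  are taken inside the image of the whole space.\<close>

lemma Some_image_measurable:
 fixes B :: "'a::heine_borel set"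
 assumes "B \<in> sets borel" shows "Some ` B \<in> sets cemetery_borel"
proof -
 have UN: "Some ` (UNIV::'a set) \<in> sets cemetery_borel" by (intro openin_cemetery_measurable) simp
 from assms have "B \<in> sigma_sets UNIV {S. open S}" by (simp add: borel_def)
 then show ?thesis
 proof (induction rule: sigma_sets.induct)
  case (Basic a)
  then show ?case by (intro openin_cemetery_measurable) simp
 next
  case Empty then show ?case by simp
 next
  case (Compl a)
  have "Some ` (UNIV - a) = Some ` UNIV - Some ` a" by auto
  with Compl UN show ?case by simp
 next
  case (Union a)
  then show ?case by (simp add: image_UN sets.countable_UN)
 qed
qed

lemma None_measurable: "{None} \<in> sets (cemetery_borel :: 'a::heine_borel option measure)"
proof -
 have "{None} = (UNIV - Some ` UNIV :: 'a option set)" by (auto simp: notin_range_Some)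
 moreover have "(UNIV - Some ` UNIV :: 'a option set) \<in> sets cemetery_borel"
  using sets.compl_sets[OF Some_image_measurable[of UNIV]] by simp
 ultimately show ?thesis by simp
qed

lemma ext0_measurable [measurable]:
 fixes f :: "'a::heine_borel \<Rightarrow> 'b::{topological_space,zero}"
 assumes "f \<in> borel_fun"
 shows "ext0 f \<in> borel_measurable cemetery_borel"
proof (rule measurableI)
 fix A :: "'b set" assume A: "A \<in> sets borel"
 have *: "ext0 f -` A = Some ` (f -` A) \<union> (if 0 \<in> A then {None} else {})"
 proof -
  have "(z \<in> ext0 f -` A) = (z \<in> Some ` (f -` A) \<union> (if 0 \<in> A then {None} else {}))" for z
   by (cases z) (auto simp: ext0_def)
  then show ?thesis by blast
 qed
 have "f -` A \<in> sets borel" using measurable_sets[OF assms A] by simp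
 then show "ext0 f -` A \<inter> space cemetery_borel \<in> sets cemetery_borel"
  unfolding * using Some_image_measurable[of "f -` A"] None_measurable by (auto intro!: sets.Un simp del: Un_insert_right)
qed simp

text \<open>Limits of measurable maps can be taken after composition with real functions. Balls are
  positivity sets of bumps, open sets are countable unions of balls, and \<open>None\<close> is
  caught as the complement of the image of \<open>Some\<close>.\<close>

lemma measurable_cemeteryI:
 fixes h :: "'b \<Rightarrow> 'a::heine_borel option"
 assumes "\<And>c \<rho>. (\<lambda>x. ext0 (bump c \<rho>) (h x)) \<in> borel_measurable M"
 shows "h \<in> measurable M cemetery_borel"
proof -
 have ball: "h -` (Some ` ball c \<rho>) \<inter> space M \<in> sets M" for c \<rho>
 proof -
  have "h -` (Some ` ball c \<rho>) \<inter> space M = {x\<in>space M. 0 < ext0 (bump c \<rho>) (h x)}"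
   by (auto simp: ext0_bump_pos)
  also have "\<dots> \<in> sets M" using assms[of c \<rho>] by measurable
  finally show ?thesis .
 qed
 have op: "h -` (Some ` U) \<inter> space M \<in> sets M" if "open U" for U
 proof -
  let ?F = "{ball c \<rho> | c \<rho>. ball c \<rho> \<subseteq> U}"
  obtain F where F: "F \<subseteq> ?F" "countable F" "\<Union>F = \<Union>?F" by (rule Lindelof[of ?F]) auto
  have "U = \<Union>?F"
  proof (intro equalityI subsetI)
   fix x assume "x \<in> U"
   then obtain e where "e > 0" "ball x e \<subseteq> U" using \<open>open U\<close> open_contains_ball by blast
   then show "x \<in> \<Union>?F" by (intro UnionI[of "ball x e"]) auto
  qed blast
  then have "h -` (Some ` U) \<inter> space M = (\<Union>B\<in>F. h -` (Some ` B) \<inter> space M)" unfolding F(3)[symmetric] by blast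
  also have "\<dots> \<in> sets M" using ball F(1) by (intro sets.countable_UN' F(2)) auto
  finally show ?thesis .
 qed
 show ?thesis unfolding cemetery_borel_def
 proof (rule measurable_measure_of)
  fix V :: "'a option set" assume "V \<in> {U. openin cemetery_topology U}"
  then consider U where "open U" "V = Some ` U" | C where "closed C" "V = insert None (Some ` (UNIV - C))"
   by (auto simp: openin_Alexandroff_compactification)
  then show "h -` V \<inter> space M \<in> sets M"
  proof cases
   case 1 then show ?thesis using op by simp
  next
   case 2
   have "h -` V \<inter> space M = (space M - h -` (Some ` UNIV) \<inter> space M) \<union> (h -` (Some ` (- C)) \<inter> space M)"
    unfolding 2(2) by (auto simp: image_iff)
   also have "\<dots> \<in> sets M" using 2(1) op[of UNIV] op[of "-C"] by auto
   finally show ?thesis .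
  qed
 qed auto
qed

lemma Some_measurable [measurable]: "Some \<in> measurable borel (cemetery_borel :: 'a::heine_borel option measure)"
proof (rule measurable_cemeteryI)
 fix c :: 'a and \<rho>
 have "(\<lambda>x. ext0 (bump c \<rho>) (Some x)) = bump c \<rho>" by (simp add: ext0_def)
 then show "(\<lambda>x. ext0 (bump c \<rho>) (Some x)) \<in> borel_fun"
  using continuous_on_bump[of UNIV c \<rho>] borel_measurable_continuous_onI by auto
qed

section \<open>Hunt processes and the strong Markov property for path functionals\<close>

locale hunt =
 fixes Z :: "('a::heine_borel, 'w) process"
 assumes hunt: "hunt_process Z"
begin

abbreviation Om where "Om \<equiv> sample_space Z"
abbreviation Pr where "Pr \<equiv> law Z"
abbreviation St where "St \<equiv> state Z"
abbreviation NF where "NF \<equiv> natural_filtration Z \<top>"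

lemmas hunt_parts = hunt[unfolded hunt_process_def]

lemma prob_space_Pr: "prob_space (Pr z)" and space_Pr [simp]: "space (Pr z) = Om"
 and sets_Pr [measurable_cong]: "sets (Pr z) = sets NF"
 by (simp_all add: conjunct1[OF hunt_parts, rule_format, of z])

lemma path_properties:
 assumes "w \<in> Om"
 shows state_top: "St \<top> w = None"
  and absorbed: "s \<le> t \<Longrightarrow> St s w = None \<Longrightarrow> St t w = None"
  and right_cont: "t < \<top> \<Longrightarrow> limitin cemetery_topology (\<lambda>s. St s w) (St t w) (at_right t)"
  and shift_exists: "\<exists>w'\<in>Om. \<forall>t. St t w' = St (s + t) w"
 by (simp_all add: conjunct1[OF conjunct2[OF conjunct2[OF conjunct2[OF hunt_parts]]], rule_format, OF assms])

lemma AE_start: "AE w in Pr z. St 0 w = z" using conjunct1[OF conjunct2[OF conjunct2[OF hunt_parts]]] ..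

lemma strong_markov_Z: "strong_markov Z"
 by (rule conjunct1[OF conjunct2[OF conjunct2[OF conjunct2[OF conjunct2[OF hunt_parts]]]]])

lemma qlc_Z: "quasi_left_continuous Z"
 by (rule conjunct2[OF conjunct2[OF conjunct2[OF conjunct2[OF conjunct2[OF hunt_parts]]]]])

lemma state_kernel: "B \<in> sets cemetery_borel \<Longrightarrow>
  (\<lambda>z. emeasure (Pr z) {w\<in>Om. St t w \<in> B}) \<in> borel_measurable cemetery_borel"
 by (rule conjunct1[OF conjunct2[OF hunt_parts], rule_format])

lemma space_natural [simp]: "space (natural_filtration Z t) = Om"
 unfolding natural_filtration_def by (rule space_measure_of) auto

lemma sets_natural: "sets (natural_filtration Z t) =
  sigma_sets Om {St s -` B \<inter> Om | s B. s \<le> t \<and> B \<in> sets cemetery_borel}"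
 unfolding natural_filtration_def by (rule sets_measure_of) auto

lemma state_measurable_le:
 assumes "s \<le> t" shows "St s \<in> measurable (natural_filtration Z t) cemetery_borel"
proof (rule measurableI)
 fix B :: "'a option set" assume "B \<in> sets cemetery_borel"
 then show "St s -` B \<inter> space (natural_filtration Z t) \<in> sets (natural_filtration Z t)"
  using assms unfolding sets_natural by (auto intro!: sigma_sets.Basic)
qed simp

lemma state_measurable [measurable]: "St s \<in> measurable NF cemetery_borel"
 by (rule state_measurable_le) simp

lemma measurable_naturalI:
 assumes "h \<in> space M \<rightarrow> Om" and "\<And>s. s \<le> t \<Longrightarrow> (\<lambda>x. St s (h x)) \<in> measurable M cemetery_borel"
 shows "h \<in> measurable M (natural_filtration Z t)" unfolding natural_filtration_def
proof (rule measurable_measure_of)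
 fix A assume "A \<in> {St s -` B \<inter> Om | s B. s \<le> t \<and> B \<in> sets cemetery_borel}"
 then obtain s B where A: "A = St s -` B \<inter> Om" "s \<le> t" "B \<in> sets cemetery_borel" by blast
 have "h -` A \<inter> space M = (\<lambda>x. St s (h x)) -` B \<inter> space M" using A(1) assms(1) by auto
 then show "h -` A \<inter> space M \<in> sets M" using measurable_sets[OF assms(2)[OF A(2)] A(3)] by simp
qed (use assms(1) in auto)

lemma sets_natural_mono: "s \<le> t \<Longrightarrow> sets (natural_filtration Z s) \<subseteq> sets (natural_filtration Z t)"
 unfolding sets_natural by (intro sigma_sets_mono') (auto intro: order_trans)

lemma space_right [simp]: "space (right_filtration Z t) = Om" unfolding right_filtration_def
 by (rule space_measure_of) (use sets.sets_into_space[of _ NF] in auto)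

text \<open>The generators already form a sigma-algebra, being an intersection of
  sigma-algebras.\<close>

lemma sets_right: "sets (right_filtration Z t) =
  {A \<in> sets NF. \<forall>s>t. A \<in> sets (natural_filtration Z s)}" (is "_ = ?S")
proof -
 have "sigma_algebra Om ?S" unfolding sigma_algebra_iff2
  using sets.sets_into_space[of _ NF] sets.compl_sets[of _ NF] sets.compl_sets[of _ "natural_filtration Z _"]
  by (auto intro!: sets.countable_UN)
 then show ?thesis unfolding right_filtration_def by (simp add: sigma_algebra.sets_measure_of_eq)
qed

sublocale filtration Om "right_filtration Z"
proof
 fix s t :: ennreal assume "s \<le> t"
 then show "sets (right_filtration Z s) \<subseteq> sets (right_filtration Z t)" unfolding sets_right by auto
qed simp

abbreviation stop where "stop \<equiv> stopping_time (right_filtration Z)"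

lemma right_sub_NF: "A \<in> sets (right_filtration Z t) \<Longrightarrow> A \<in> sets NF"
 by (simp add: sets_right)

lemma stop_measurable: "stop T \<Longrightarrow> T \<in> borel_measurable NF"
 by (rule measurable_stopping_time) (auto simp: sets_right)

lemma pre_sigma_sub_NF: assumes "stop T" "A \<in> sets (pre_sigma T)" shows "A \<in> sets NF"
proof -
 have "{w\<in>A. T w \<le> \<top>} \<in> sets (right_filtration Z \<top>)" using sets_pre_sigmaD[OF assms] .
 then show ?thesis using right_sub_NF by simp
qed

lemma ext0_right_cont:
 assumes "w \<in> Om" "t < \<top>" "f \<in> C0"
 shows "((\<lambda>s. ext0 f (St s w)) \<longlongrightarrow> ext0 f (St t w)) (at_right t)"
proof -
 have "limitin euclideanreal (ext0 f \<circ> (\<lambda>s. St s w)) (ext0 f (St t w)) (at_right t)"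
  by (rule continuous_map_limit[OF continuous_map_ext0[OF assms(3)] right_cont[OF assms(1,2)]])
 then show ?thesis by (simp add: o_def)
qed

end

text \<open>Rounds strictly upwards, since 1 is added to the floor: the approximations approach t
  from the right, the side on which paths are continuous, and take countably many values.\<close>

definition dyadic_ceil :: "nat \<Rightarrow> ennreal \<Rightarrow> ennreal" where
 "dyadic_ceil n t = (if t = \<top> then \<top> else ennreal ((of_int \<lfloor>2 ^ n * enn2real t\<rfloor> + 1) / 2 ^ n))"

lemma dyadic_ceil_gt: "t < \<top> \<Longrightarrow> t < dyadic_ceil n t"
proof -
 assume t: "t < \<top>"
 then obtain r where r: "t = ennreal r" "r \<ge> 0" by (cases t) auto
 have "2 ^ n * r < of_int \<lfloor>2 ^ n * r\<rfloor> + 1" by linarith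
 then have "r < (of_int \<lfloor>2 ^ n * r\<rfloor> + 1) / 2 ^ n" by (simp add: field_simps)
 then show ?thesis using r by (simp add: dyadic_ceil_def ennreal_lessI)
qed

lemma dyadic_ceil_tendsto: assumes t: "t < \<top>" shows "(\<lambda>n. dyadic_ceil n t) \<longlonglongrightarrow> t"
proof -
 obtain r where r: "t = ennreal r" "r \<ge> 0" using t by (cases t) auto
 have "(\<lambda>n. (of_int \<lfloor>2 ^ n * r\<rfloor> + 1) / 2 ^ n) \<longlonglongrightarrow> r"
 proof (rule tendsto_sandwich[where f = "\<lambda>_. r" and h = "\<lambda>n. r + (1/2) ^ n"])
  show "(\<lambda>n. r + (1/2) ^ n) \<longlonglongrightarrow> r"
   using tendsto_add[OF tendsto_const[of r] LIMSEQ_power_zero[of "1/2::real"]] by simp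
  have "(of_int \<lfloor>2 ^ n * r\<rfloor> + 1) / 2 ^ n \<le> r + (1/2) ^ n" for n
  proof -
   have "of_int \<lfloor>2 ^ n * r\<rfloor> + 1 \<le> 2 ^ n * r + 1" by linarith
   then have "(of_int \<lfloor>2 ^ n * r\<rfloor> + 1) / 2 ^ n \<le> (2 ^ n * r + 1) / 2 ^ n"
    by (intro divide_right_mono) auto
   then show ?thesis by (simp add: field_simps power_divide)
  qed
  then show "\<forall>\<^sub>F n in sequentially. (of_int \<lfloor>2 ^ n * r\<rfloor> + 1) / 2 ^ n \<le> r + (1/2) ^ n" by simp
  have "r \<le> (of_int \<lfloor>2 ^ n * r\<rfloor> + 1) / 2 ^ n" for n
  proof -
   have "2 ^ n * r \<le> of_int \<lfloor>2 ^ n * r\<rfloor> + 1" by linarith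
   then show ?thesis by (simp add: field_simps)
  qed
  then show "\<forall>\<^sub>F n in sequentially. r \<le> (of_int \<lfloor>2 ^ n * r\<rfloor> + 1) / 2 ^ n" by simp
 qed auto
 then have "(\<lambda>n. ennreal ((of_int \<lfloor>2 ^ n * r\<rfloor> + 1) / 2 ^ n)) \<longlonglongrightarrow> ennreal r" by (rule tendsto_ennrealI)
 then show ?thesis using r by (simp add: dyadic_ceil_def)
qed

lemma dyadic_ceil_measurable [measurable]: "dyadic_ceil n \<in> borel_fun"
 unfolding dyadic_ceil_def by measurable

lemma dyadic_ceil_countable: "countable (range (dyadic_ceil n))"
proof -
 have "range (dyadic_ceil n) \<subseteq> insert \<top> (range (\<lambda>k::int. ennreal ((of_int k + 1) / 2 ^ n)))"
  by (auto simp: dyadic_ceil_def)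
 then show ?thesis by (rule countable_subset) auto
qed

context hunt begin

text \<open>The time runs along a measurable \<open>\<tau>\<close> while the path is chosen by \<open>h\<close>: this covers
 progressive measurability as well as joint measurability in time and path.\<close>

lemma state_at_measurable:
 assumes h: "h \<in> space M \<rightarrow> Om"
  and st: "\<And>r. r \<le> s \<Longrightarrow> (\<lambda>x. St r (h x)) \<in> measurable M cemetery_borel"
  and \<tau> [measurable]: "\<tau> \<in> borel_measurable M"
  and less: "\<And>x. x \<in> space M \<Longrightarrow> \<tau> x < s \<or> s = \<top>"
 shows "(\<lambda>x. St (\<tau> x) (h x)) \<in> measurable M cemetery_borel"
proof (rule measurable_cemeteryI)
 fix c :: 'a and \<rho>
 let ?f = "ext0 (bump c \<rho>)"
 have bm: "bump c \<rho> \<in> borel_fun"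
  using continuous_on_bump[of UNIV c \<rho>] borel_measurable_continuous_onI by auto
 \<comment> \<open>The cap at s keeps all sampled times at most s, so only states assumed measurable
   are used; as \<open>\<tau> x < s\<close>, the capped times still lie strictly to the right of
   \<open>\<tau> x\<close>. The exception \<open>s = \<top>\<close> admits an infinite time, where
   all approximations are \<open>\<top>\<close>.\<close>
 define e where "e n x = min (dyadic_ceil n (\<tau> x)) s" for n x
 have cn: "countable (range (e n))" for n
 proof -
  have "range (e n) \<subseteq> (\<lambda>t. min t s) ` range (dyadic_ceil n)" by (auto simp: e_def)
  then show ?thesis using dyadic_ceil_countable countable_subset by blast
 qed
 show "(\<lambda>x. ?f (St (\<tau> x) (h x))) \<in> borel_measurable M"
 proof (rule borel_measurable_LIMSEQ_real)
  fix n
  have em: "e n \<in> borel_measurable M" unfolding e_def by measurable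
  have "e n \<in> measurable M (count_space (range (e n)))"
  proof (rule measurable_count_space_eq_countable[THEN iffD2, rule_format])
   show "countable (range (e n))" by (rule cn)
   show "e n \<in> space M \<rightarrow> range (e n) \<and> (\<forall>a\<in>range (e n). e n -` {a} \<inter> space M \<in> sets M)"
    using em by (auto intro!: measurable_sets)
  qed
  then have "(\<lambda>x. St (e n x) (h x)) \<in> measurable M cemetery_borel"
   by (rule measurable_compose_countable'[rotated]) (use cn st in \<open>auto simp: e_def\<close>)
  then show "(\<lambda>x. ?f (St (e n x) (h x))) \<in> borel_measurable M"
   using measurable_compose[OF _ ext0_measurable[OF bm]] by blast
 next
  fix x assume x: "x \<in> space M"
  then have hx: "h x \<in> Om" using h by auto
  show "(\<lambda>n. ?f (St (e n x) (h x))) \<longlonglongrightarrow> ?f (St (\<tau> x) (h x))"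
  proof (cases "\<tau> x < s")
   case False
   then have "s = \<top>" "\<tau> x = \<top>" using less[OF x] by (auto simp: less_top[symmetric])
   then show ?thesis by (simp add: e_def dyadic_ceil_def)
  next
   case True
   then have t: "\<tau> x < \<top>" using top.not_eq_extremum by fastforce
   have "filterlim (\<lambda>n. e n x) (at_right (\<tau> x)) sequentially" unfolding filterlim_at
   proof
    show "\<forall>\<^sub>F n in sequentially. e n x \<in> {\<tau> x<..} \<and> e n x \<noteq> \<tau> x"
     using dyadic_ceil_gt[OF t] True by (auto simp: e_def min_def order_less_imp_not_eq2 intro!: always_eventually)
    have "(\<lambda>n. min (dyadic_ceil n (\<tau> x)) s) \<longlonglongrightarrow> min (\<tau> x) s"
     by (intro tendsto_min dyadic_ceil_tendsto t tendsto_const)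
    then show "(\<lambda>n. e n x) \<longlonglongrightarrow> \<tau> x" using True by (simp add: e_def min_absorb1)
   qed
   then show ?thesis by (rule filterlim_compose[OF ext0_right_cont[OF hx t bump_C0[of c \<rho>]]])
  qed
 qed
qed

lemma state_random_time [measurable]:
 assumes [measurable]: "T \<in> borel_measurable NF"
 shows "(\<lambda>w. St (T w) w) \<in> measurable NF cemetery_borel"
 by (rule state_at_measurable[where s = \<top> and h = "\<lambda>w. w"]) auto

text \<open>On the event that T is at most t, T may be replaced by \<open>min (T w) t\<close>. This
  time is measurable for the sigma-algebra of every later s and lies strictly below s, which is what
  \<open>state_at_measurable\<close> asks for.\<close>

lemma state_pre_sigma:
 assumes T: "stop T" and B: "B \<in> sets cemetery_borel" and A: "A \<in> sets (pre_sigma T)"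
 shows "{w\<in>A. St (T w) w \<in> B} \<in> sets (pre_sigma T)"
proof (rule sets_pre_sigmaI[OF T])
 fix t
 note [measurable] = stop_measurable[OF T] pre_sigma_sub_NF[OF T A] B
 have AO: "A \<subseteq> Om" using sets.sets_into_space[OF A] by (simp add: space_pre_sigma)
 have eq: "{w \<in> {w \<in> A. St (T w) w \<in> B}. T w \<le> t} = {w\<in>A. T w \<le> t} \<inter> {w\<in>Om. St (min (T w) t) w \<in> B}"
  using AO by (auto simp: min_def)
 have "{w\<in>A. T w \<le> t} \<inter> {w\<in>Om. St (min (T w) t) w \<in> B} \<in> sets (natural_filtration Z s)"
  if s: "t < s \<or> s = \<top>" for s
 proof -
  let ?N = "natural_filtration Z s"
  have Tm: "(\<lambda>w. min (T w) t) \<in> borel_measurable ?N"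
  proof (rule borel_measurableI_le)
   fix r
   show "{w \<in> space ?N. min (T w) t \<le> r} \<in> sets ?N"
   proof (cases "t \<le> r")
    case True then show ?thesis using sets.top[of ?N] by (simp add: min_le_iff_disj)
   next
    case False
    have "{w \<in> Om. T w \<le> r} \<in> sets (right_filtration Z r)"
     using stopping_timeD[OF T, of r] by (simp add: pred_def)
    moreover have "r < s \<or> s = \<top>" using False s by auto
    ultimately have "{w \<in> Om. T w \<le> r} \<in> sets ?N" by (auto simp: sets_right)
    then show ?thesis using False by (simp add: min_le_iff_disj)
   qed
  qed
  have "(\<lambda>w. St (min (T w) t) w) \<in> measurable ?N cemetery_borel"
   by (rule state_at_measurable[where s = s and h = "\<lambda>w. w", OF _ _ Tm])
    (use s in \<open>auto intro: state_measurable_le simp: min_less_iff_disj\<close>)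
  then have "{w\<in>Om. St (min (T w) t) w \<in> B} \<in> sets ?N"
   using measurable_sets[OF _ B, of "\<lambda>w. St (min (T w) t) w" ?N]
   by (simp add: vimage_def Int_def conj_commute)
  moreover have "{w\<in>A. T w \<le> t} \<in> sets ?N"
   using sets_pre_sigmaD[OF T A, of t] s by (auto simp: sets_right)
  ultimately show ?thesis by auto
 qed
 then show "{w \<in> {w \<in> A. St (T w) w \<in> B}. T w \<le> t} \<in> sets (right_filtration Z t)"
  unfolding eq by (simp add: sets_right)
qed

declare sets_Pr [simp]

text \<open>A path with the shifted states need not be unique. Any choice is measurable, because the
  sigma-algebra is generated by the states.\<close>

definition shift :: "ennreal \<Rightarrow> 'w \<Rightarrow> 'w" where
 "shift s w = (SOME w'. w' \<in> Om \<and> (\<forall>t. St t w' = St (s + t) w))"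

lemma shift: assumes "w \<in> Om"
 shows shift_in [simp]: "shift s w \<in> Om" and state_shift [simp]: "St t (shift s w) = St (s + t) w"
proof -
 have "\<exists>w'. w' \<in> Om \<and> (\<forall>t. St t w' = St (s + t) w)" using shift_exists[OF assms] by blast
 from someI_ex[OF this] show "shift s w \<in> Om" "St t (shift s w) = St (s + t) w"
  unfolding shift_def by auto
qed

lemma shift_measurable [measurable]:
 assumes [measurable]: "T \<in> borel_measurable NF"
 shows "(\<lambda>w. shift (T w) w) \<in> measurable NF NF"
proof (rule measurable_naturalI)
 fix s
 have "(\<lambda>w. St (T w + s) w) \<in> measurable NF cemetery_borel" by measurable
 then show "(\<lambda>w. St s (shift (T w) w)) \<in> measurable NF cemetery_borel"
  by (rule measurable_cong[THEN iffD1, rotated]) simp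
qed simp

lemma emeasure_Pr_le_1: "emeasure (Pr z) A \<le> 1"
 using prob_space_Pr by (simp add: prob_space.emeasure_le_1)

lemma subprob_Pr: "subprob_space (Pr z)" by (rule prob_space_imp_subprob_space[OF prob_space_Pr])

lemma state_distr_kernel:
 "(\<lambda>z. distr (Pr z) cemetery_borel (St s)) \<in> measurable cemetery_borel (subprob_algebra cemetery_borel)"
proof (rule measurable_subprob_algebra)
 fix z :: "'a option"
 show "subprob_space (distr (Pr z) cemetery_borel (St s))"
  by (intro subprob_space.subprob_space_distr subprob_Pr) auto
next
 fix B :: "'a option set" assume B [measurable]: "B \<in> sets cemetery_borel"
 have "emeasure (distr (Pr z) cemetery_borel (St s)) B = emeasure (Pr z) {w\<in>Om. St s w \<in> B}" for z
  by (subst emeasure_distr) (auto simp: vimage_def Int_def conj_commute)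
 then show "(\<lambda>z. emeasure (distr (Pr z) cemetery_borel (St s)) B) \<in> borel_measurable cemetery_borel"
  using state_kernel[OF B] by simp
qed simp

section \<open>Image and mixture of a restricted law\<close>

context
 fixes z :: "'a option" and C :: "'w set" and N :: "'b measure" and S :: "'w \<Rightarrow> 'b" and K :: "'w \<Rightarrow> 'b measure"
 assumes C [measurable]: "C \<in> sets NF" and S [measurable]: "S \<in> measurable NF N"
  and K [measurable]: "K \<in> measurable NF (subprob_algebra N)"
begin

abbreviation (input) "Prz \<equiv> density (Pr z) (indicator C)"

lemma restricted_nonempty: "space Prz \<noteq> {}" using prob_space.not_empty[OF prob_space_Pr] by simp

lemma restricted_kernel: "K \<in> measurable Prz (subprob_algebra N)" by measurable

lemma sets_restricted_bind: "sets (Prz \<bind> K) = sets N"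
 using sets_bind[OF _ restricted_nonempty, of K N] sets_kernel[OF K] by simp

lemma emeasure_restricted_distr:
 assumes B: "B \<in> sets N"
 shows "emeasure (distr Prz N S) B = emeasure (Pr z) (C \<inter> (S -` B \<inter> Om))"
proof -
 have SB: "S -` B \<inter> Om \<in> sets NF" using measurable_sets[OF S B] by simp
 have "emeasure (distr Prz N S) B = emeasure Prz (S -` B \<inter> Om)" by (subst emeasure_distr) (use B in auto)
 also have "\<dots> = (\<integral>\<^sup>+w. indicator (C \<inter> (S -` B \<inter> Om)) w \<partial>Pr z)"
  using SB by (subst emeasure_density) (simp_all add: indicator_inter_arith[symmetric])
 also have "\<dots> = emeasure (Pr z) (C \<inter> (S -` B \<inter> Om))" using SB C by (intro nn_integral_indicator) auto
 finally show ?thesis .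
qed

lemma emeasure_restricted_bind:
 assumes B: "B \<in> sets N"
 shows "emeasure (Prz \<bind> K) B = (\<integral>\<^sup>+w\<in>C. emeasure (K w) B \<partial>Pr z)"
 unfolding emeasure_bind[OF restricted_nonempty restricted_kernel B]
 using B by (subst nn_integral_density) (auto simp: mult.commute intro!: measurable_emeasure_kernel[OF K])

text \<open>An identity for events becomes one for functions once both sides are read as measures:
  the image of the restricted law under S, and its mixture through the kernel K.\<close>

lemma restricted_integral:
 assumes eq: "distr Prz N S = Prz \<bind> K" and F [measurable]: "F \<in> borel_measurable N"
 shows "(\<integral>\<^sup>+w\<in>C. F (S w) \<partial>Pr z) = (\<integral>\<^sup>+w\<in>C. (\<integral>\<^sup>+y. F y \<partial>K w) \<partial>Pr z)"
proof -
 have "(\<integral>\<^sup>+y. F y \<partial>distr Prz N S) = (\<integral>\<^sup>+w. \<integral>\<^sup>+y. F y \<partial>K w \<partial>Prz)"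
  unfolding eq by (rule nn_integral_bind[OF F restricted_kernel])
 also have "\<dots> = (\<integral>\<^sup>+w\<in>C. (\<integral>\<^sup>+y. F y \<partial>K w) \<partial>Pr z)"
  by (subst nn_integral_density)
   (auto simp: mult.commute intro!: measurable_compose[OF K nn_integral_measurable_subprob_algebra])
 finally show ?thesis
  by (subst (asm) nn_integral_distr, simp, simp, subst (asm) nn_integral_density) (auto simp: mult.commute)
qed

end

lemma finite_before_measurable:
 assumes T: "stop T" and A: "A \<in> sets (pre_sigma T)" shows "{w\<in>A. T w < \<top>} \<in> sets NF"
proof -
 note [measurable] = stop_measurable[OF T] pre_sigma_sub_NF[OF T A]
 have "{w\<in>A. T w < \<top>} = A \<inter> {w\<in>space NF. T w < \<top>}"
  using sets.sets_into_space[OF A] by (auto simp: space_pre_sigma)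
 also have "\<dots> \<in> sets NF" by measurable
 finally show ?thesis .
qed

lemma strong_markov_state:
 assumes T: "stop T" and A: "A \<in> sets (pre_sigma T)" and h [measurable]: "h \<in> borel_measurable cemetery_borel"
 shows "(\<integral>\<^sup>+w\<in>{w\<in>A. T w < \<top>}. h (St (T w + s) w) \<partial>Pr z) =
  (\<integral>\<^sup>+w\<in>{w\<in>A. T w < \<top>}. (\<integral>\<^sup>+w'. h (St s w') \<partial>Pr (St (T w) w)) \<partial>Pr z)"
proof -
 note [measurable] = stop_measurable[OF T]
 let ?C = "{w\<in>A. T w < \<top>}" and ?S = "\<lambda>w. St (T w + s) w" and ?K = "\<lambda>w. distr (Pr (St (T w) w)) cemetery_borel (St s)"
 note C = finite_before_measurable[OF T A]
 have S: "?S \<in> measurable NF cemetery_borel" by measurable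
 have K: "?K \<in> measurable NF (subprob_algebra cemetery_borel)"
  by (rule measurable_compose[OF _ state_distr_kernel]) measurable
 have "distr (density (Pr z) (indicator ?C)) cemetery_borel ?S = density (Pr z) (indicator ?C) \<bind> ?K"
 proof (rule measure_eqI)
  fix B assume "B \<in> sets (distr (density (Pr z) (indicator ?C)) cemetery_borel ?S)"
  then have B: "B \<in> sets cemetery_borel" by simp
  have "?C \<inter> (?S -` B \<inter> Om) = {w\<in>A. T w < \<top> \<and> St (T w + s) w \<in> B}"
   using sets.sets_into_space[OF A] by (auto simp: space_pre_sigma)
  moreover have "emeasure (?K w) B = emeasure (Pr (St (T w) w)) {w'\<in>Om. St s w' \<in> B}" for w
   using B by (subst emeasure_distr) (auto simp: vimage_def Int_def conj_commute)
  ultimately show "emeasure (distr (density (Pr z) (indicator ?C)) cemetery_borel ?S) B =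
    emeasure (density (Pr z) (indicator ?C) \<bind> ?K) B"
   unfolding emeasure_restricted_distr[OF C S K B] emeasure_restricted_bind[OF C S K B]
   using strong_markov_Z[unfolded strong_markov_def, rule_format, OF T B A] by simp
 qed (simp add: sets_restricted_bind[OF C S K])
 from restricted_integral[OF C S K this h] show ?thesis by (simp add: nn_integral_distr)
qed

lemma ennreal_add_le_iff:
 fixes a t0 t :: ennreal
 assumes "t0 < \<top>" shows "a + t0 \<le> t \<longleftrightarrow> t0 \<le> t \<and> a \<le> t - t0"
proof
 assume *: "a + t0 \<le> t"
 moreover have "t0 \<le> a + t0" by (simp add: add_increasing)
 ultimately have "t0 \<le> t" by (rule order_trans[rotated])
 moreover have "a \<le> t - t0" using * assms by (simp add: ennreal_le_minus_iff)
 ultimately show "t0 \<le> t \<and> a \<le> t - t0" ..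
next
 assume "t0 \<le> t \<and> a \<le> t - t0"
 then have "a + t0 \<le> t - t0 + t0" "t0 \<le> t" by (auto intro: add_right_mono)
 then show "a + t0 \<le> t" using assms by (simp add: diff_add_cancel_ennreal)
qed

lemma stop_add_const:
 assumes "stop T" "t0 < \<top>" shows "stop (\<lambda>w. T w + t0)"
proof
 fix t
 have "Measurable.pred (right_filtration Z t) (\<lambda>w. T w \<le> t - t0)"
  by (rule stopping_time_le_const[OF assms(1)]) (rule diff_le_self_ennreal)
 then show "Measurable.pred (right_filtration Z t) (\<lambda>w. T w + t0 \<le> t)"
  unfolding ennreal_add_le_iff[OF assms(2)] by measurable
qed

section \<open>Finite-dimensional cylinders and the law of the whole path\<close>

definition cyl :: "ennreal set \<Rightarrow> (ennreal \<Rightarrow> 'a option set) \<Rightarrow> 'w set" where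
 "cyl I B = {w\<in>Om. \<forall>t\<in>I. St t w \<in> B t}"

lemma cyl_measurable:
 assumes "finite I" "\<And>t. B t \<in> sets cemetery_borel" shows "cyl I B \<in> sets NF"
proof -
 have "cyl I B = Om \<inter> (\<Inter>t\<in>I. {w\<in>Om. St t w \<in> B t})" by (auto simp: cyl_def)
 moreover have "{w\<in>Om. St t w \<in> B t} \<in> sets NF" for t
  using measurable_sets[OF state_measurable assms(2)] by (simp add: vimage_def Int_def conj_commute)
 ultimately show ?thesis
  using assms(1) sets.top[of NF] by (cases "I = {}") (auto intro!: sets.Int sets.finite_INT)
qed

text \<open>Measurability in the starting point is part of the predicate because the induction needs
  it: the probability of the later conditions becomes a function of the state at the earliest time,
  to which the Markov property is applied again.\<close>

definition markov_cyl :: "ennreal set \<Rightarrow> (ennreal \<Rightarrow> 'a option set) \<Rightarrow> bool" where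
 "markov_cyl I B \<longleftrightarrow> (\<lambda>y. emeasure (Pr y) (cyl I B)) \<in> borel_measurable cemetery_borel \<and>
  (\<forall>T A z. stop T \<longrightarrow> A \<in> sets (pre_sigma T) \<longrightarrow>
   emeasure (Pr z) {w\<in>A. T w < \<top> \<and> (\<forall>t\<in>I. St (T w + t) w \<in> B t)} =
   (\<integral>\<^sup>+w\<in>{w\<in>A. T w < \<top>}. emeasure (Pr (St (T w) w)) (cyl I B) \<partial>Pr z))"

lemma stop_const: "stop (\<lambda>_. c)" by (rule stopping_time_const)

lemma top_pre_sigma: "stop T \<Longrightarrow> Om \<in> sets (pre_sigma T)"
 using sets.top[of "pre_sigma T"] by (simp add: space_pre_sigma)

text \<open>Induction on the number of times, splitting off the least one: the condition at
  \<open>T + t0\<close> belongs to the past of the stopping time \<open>T + t0\<close>, and the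
  others are a cylinder with fewer times for the path restarted there.\<close>

lemma markov_cyl:
 assumes "finite I" "\<And>t. B t \<in> sets cemetery_borel"
 shows "markov_cyl I B" using assms
proof (induction "card I" arbitrary: I B)
 case 0
 then have I: "I = {}" by simp
 have e1: "emeasure (Pr y) (cyl I B) = 1" for y
  using prob_space.emeasure_space_1[OF prob_space_Pr, of y] by (simp add: I cyl_def)
 show ?case unfolding markov_cyl_def e1
 proof (intro conjI allI impI)
  fix T A z assume T: "stop T" and A: "A \<in> sets (pre_sigma T)"
  show "emeasure (Pr z) {w\<in>A. T w < \<top> \<and> (\<forall>t\<in>I. St (T w + t) w \<in> B t)} =
   (\<integral>\<^sup>+w\<in>{w\<in>A. T w < \<top>}. 1 \<partial>Pr z)" using finite_before_measurable[OF T A] by (simp add: I)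
 qed simp
next
 case (Suc n)
 note B = Suc.prems(2)
 have ne: "I \<noteq> {}" "finite I" using Suc.hyps(2) Suc.prems(1) by auto
 define t0 where "t0 = Min I"
 have t0: "t0 \<in> I" "\<And>t. t \<in> I \<Longrightarrow> t0 \<le> t" using ne by (auto simp: t0_def)
 show ?case
 \<comment> \<open>A single time may be infinite. With a second, larger time in I the least one is
   finite, so that it can be subtracted from the others.\<close>
 proof (cases "I = {t0}")
  case True
  have c: "cyl I B = {w\<in>Om. St t0 w \<in> B t0}" unfolding cyl_def by (subst True) simp
  show ?thesis unfolding markov_cyl_def c
  proof (intro conjI allI impI)
   fix T A z assume T: "stop T" and A: "A \<in> sets (pre_sigma T)"
   show "emeasure (Pr z) {w\<in>A. T w < \<top> \<and> (\<forall>t\<in>I. St (T w + t) w \<in> B t)} =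
     (\<integral>\<^sup>+w\<in>{w\<in>A. T w < \<top>}. emeasure (Pr (St (T w) w)) {w\<in>Om. St t0 w \<in> B t0} \<partial>Pr z)"
    using strong_markov_Z[unfolded strong_markov_def, rule_format, OF T B A] by (subst True) simp
  qed (rule state_kernel[OF B])
 next
  case False
  define J where "J = I - {t0}"
  have J: "J \<noteq> {}" "finite J" "card J = n" "I = insert t0 J" "t0 \<notin> J"
   using False t0 ne Suc.hyps(2) by (auto simp: J_def)
  have Jlt: "t0 < t" if "t \<in> J" for t using that t0 J(5) J(4) by (metis insertCI order_le_less)
  then have fin: "t0 < \<top>" using J(1) by (metis equals0I less_top_ennreal top.extremum_strict top.not_eq_extremum)
  define I' where "I' = (\<lambda>t. t - t0) ` J"
  define B' where "B' = (\<lambda>s. B (t0 + s))"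
  have inv_sub: "t0 + (t - t0) = t" if "t \<in> J" for t
   using Jlt[OF that] fin by (simp add: add_diff_inverse_ennreal less_imp_le)
  have inj: "inj_on (\<lambda>t. t - t0) J" by (rule inj_on_inverseI[of _ "\<lambda>s. t0 + s"]) (rule inv_sub)
  have "markov_cyl I' B'"
   by (rule Suc.hyps(1)) (use J inj B in \<open>auto simp: I'_def B'_def card_image\<close>)
  then have Gm [measurable]: "(\<lambda>y. emeasure (Pr y) (cyl I' B')) \<in> borel_measurable cemetery_borel"
   and IH: "\<And>T A z. stop T \<Longrightarrow> A \<in> sets (pre_sigma T) \<Longrightarrow>
   emeasure (Pr z) {w\<in>A. T w < \<top> \<and> (\<forall>t\<in>I'. St (T w + t) w \<in> B' t)} =
   (\<integral>\<^sup>+w\<in>{w\<in>A. T w < \<top>}. emeasure (Pr (St (T w) w)) (cyl I' B') \<partial>Pr z)"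
   unfolding markov_cyl_def by blast+
  define h where "h = (\<lambda>y. indicator (B t0) y * emeasure (Pr y) (cyl I' B'))"
  note [measurable] = B
  have hm [measurable]: "h \<in> borel_measurable cemetery_borel" unfolding h_def by measurable
  have mid: "emeasure (Pr z) {w\<in>A. T w < \<top> \<and> (\<forall>t\<in>I. St (T w + t) w \<in> B t)} =
    (\<integral>\<^sup>+w\<in>{w\<in>A. T w < \<top>}. h (St (T w + t0) w) \<partial>Pr z)"
   if T: "stop T" and A: "A \<in> sets (pre_sigma T)" for T A z
  proof -
   let ?T = "\<lambda>w. T w + t0"
   have T1: "stop ?T" by (rule stop_add_const[OF T fin])
   have A1: "A \<in> sets (pre_sigma ?T)" using mono_pre_sigma[OF T T1] A by auto
   let ?A = "{w\<in>A. St (?T w) w \<in> B t0}"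
   have A2: "?A \<in> sets (pre_sigma ?T)" by (rule state_pre_sigma[OF T1 B A1])
   have eq: "{w\<in>A. T w < \<top> \<and> (\<forall>t\<in>I. St (T w + t) w \<in> B t)} =
    {w\<in>?A. ?T w < \<top> \<and> (\<forall>t\<in>I'. St (?T w + t) w \<in> B' t)}"
   proof -
    have "(\<forall>t\<in>I'. St (?T w + t) w \<in> B' t) \<longleftrightarrow> (\<forall>t\<in>J. St (T w + t) w \<in> B t)" for w
    proof -
     have "(\<forall>t\<in>I'. St (?T w + t) w \<in> B' t) \<longleftrightarrow>
       (\<forall>t\<in>J. St (?T w + (t - t0)) w \<in> B' (t - t0))" unfolding I'_def by blast
     also have "\<dots> \<longleftrightarrow> (\<forall>t\<in>J. St (T w + t) w \<in> B t)"
      by (intro ball_cong refl) (simp only: add.assoc inv_sub B'_def)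
     finally show ?thesis .
    qed
    then show ?thesis using fin by (auto simp: J(4))
   qed
   show ?thesis unfolding eq IH[OF T1 A2]
    using fin by (intro nn_integral_cong) (auto simp: h_def indicator_def)
  qed
  \<comment> \<open>The unconditional law is the case of the stopping time 0.\<close>
  have c: "emeasure (Pr y) (cyl I B) = (\<integral>\<^sup>+w. h (St t0 w) \<partial>Pr y)" for y
   using mid[OF stop_const[of 0] top_pre_sigma[OF stop_const], of y]
   by (simp add: cyl_def) (auto intro!: nn_integral_cong)
  show ?thesis unfolding markov_cyl_def
  proof (intro conjI allI impI)
   have "(\<integral>\<^sup>+w. h (St t0 w) \<partial>Pr y) = (\<integral>\<^sup>+v. h v \<partial>distr (Pr y) cemetery_borel (St t0))" for y
    by (subst nn_integral_distr) auto
   then show "(\<lambda>y. emeasure (Pr y) (cyl I B)) \<in> borel_measurable cemetery_borel"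
    unfolding c using measurable_compose[OF state_distr_kernel nn_integral_measurable_subprob_algebra[OF hm]]
    by simp
   fix T A z assume T: "stop T" and A: "A \<in> sets (pre_sigma T)"
   show "emeasure (Pr z) {w\<in>A. T w < \<top> \<and> (\<forall>t\<in>I. St (T w + t) w \<in> B t)} =
    (\<integral>\<^sup>+w\<in>{w\<in>A. T w < \<top>}. emeasure (Pr (St (T w) w)) (cyl I B) \<partial>Pr z)"
    unfolding mid[OF T A] c by (rule strong_markov_state[OF T A hm])
  qed
 qed
qed

definition cylinders :: "'w set set" where
 "cylinders = {cyl I B | I B. finite I \<and> (\<forall>t. B t \<in> sets cemetery_borel)}"

lemma Int_stable_cylinders: "Int_stable cylinders"
proof (rule Int_stableI)
 fix a b assume "a \<in> cylinders" "b \<in> cylinders"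
 then obtain I B J C where a: "a = cyl I B" "finite I" "\<forall>t. B t \<in> sets cemetery_borel"
  and b: "b = cyl J C" "finite J" "\<forall>t. C t \<in> sets cemetery_borel" unfolding cylinders_def by blast
 define E where "E t = (if t \<in> I then B t else UNIV) \<inter> (if t \<in> J then C t else UNIV)" for t
 have U: "UNIV \<in> sets (cemetery_borel :: 'a option measure)" using sets.top[of cemetery_borel] by simp
 have "a \<inter> b = cyl (I \<union> J) E" by (auto simp: a b cyl_def E_def)
 moreover have "\<forall>t. E t \<in> sets cemetery_borel" using a b U by (auto simp: E_def)
 ultimately show "a \<inter> b \<in> cylinders" using a b by (auto simp: cylinders_def)
qed

lemma sets_NF_cylinders: "sets NF = sigma_sets Om cylinders"
proof
 show "sets NF \<subseteq> sigma_sets Om cylinders" unfolding sets_natural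
 proof (rule sigma_sets_mono)
  show "{St s -` B \<inter> Om |s B. s \<le> \<top> \<and> B \<in> sets cemetery_borel} \<subseteq> sigma_sets Om cylinders"
  proof safe
   fix s :: ennreal and B :: "'a option set" assume "B \<in> sets cemetery_borel"
   then have "cyl {s} (\<lambda>_. B) \<in> cylinders" by (auto simp: cylinders_def)
   moreover have "cyl {s} (\<lambda>_. B) = St s -` B \<inter> Om" by (auto simp: cyl_def)
   ultimately show "St s -` B \<inter> Om \<in> sigma_sets Om cylinders" by auto
  qed
 qed
 have "cylinders \<subseteq> sets NF" by (auto simp: cylinders_def intro: cyl_measurable)
 then show "sigma_sets Om cylinders \<subseteq> sets NF" using sets.sigma_sets_subset[of cylinders NF] by simp
qed

lemma cylinders_Pow: "cylinders \<subseteq> Pow Om" by (auto simp: cylinders_def cyl_def)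

text \<open>The definition of a Hunt process provides measurability in the starting point for one
  time only; cylinders are stable under intersection and generate, which extends it to all path
  events.\<close>

lemma Pr_kernel [measurable]: "Pr \<in> measurable cemetery_borel (subprob_algebra NF)"
proof (rule measurable_subprob_algebra_generated[OF sets_NF_cylinders Int_stable_cylinders cylinders_Pow])
 fix A assume "A \<in> cylinders"
 then show "(\<lambda>a. emeasure (Pr a) A) \<in> borel_measurable cemetery_borel"
  using markov_cyl by (auto simp: cylinders_def markov_cyl_def)
next
 show "(\<lambda>a. emeasure (Pr a) Om) \<in> borel_measurable cemetery_borel"
  using prob_space.emeasure_space_1[OF prob_space_Pr] by simp
qed (auto simp: sets_Pr intro: subprob_Pr)

lemma expectation_measurable [measurable]:
 "F \<in> borel_measurable NF \<Longrightarrow> (\<lambda>z. \<integral>\<^sup>+w. F w \<partial>Pr z) \<in> borel_measurable cemetery_borel"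
 by (rule measurable_compose[OF Pr_kernel nn_integral_measurable_subprob_algebra])

text \<open>Both sides integrate F against finite measures on path space that agree on cylinders.
  The whole future path is needed because exit times and occupation integrals of the shifted path
  occur later.\<close>

theorem strong_markov_path:
 assumes T: "stop T" and A: "A \<in> sets (pre_sigma T)" and F: "F \<in> borel_measurable NF"
 shows "(\<integral>\<^sup>+w\<in>{w\<in>A. T w < \<top>}. F (shift (T w) w) \<partial>Pr z) =
  (\<integral>\<^sup>+w\<in>{w\<in>A. T w < \<top>}. (\<integral>\<^sup>+w'. F w' \<partial>Pr (St (T w) w)) \<partial>Pr z)"
proof -
 note [measurable] = stop_measurable[OF T]
 let ?C = "{w\<in>A. T w < \<top>}" and ?S = "\<lambda>w. shift (T w) w" and ?K = "\<lambda>w. Pr (St (T w) w)"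
 let ?Prz = "density (Pr z) (indicator ?C)"
 note C = finite_before_measurable[OF T A]
 have S: "?S \<in> measurable NF NF" by measurable
 have K: "?K \<in> measurable NF (subprob_algebra NF)" by (rule measurable_compose[OF _ Pr_kernel]) measurable
 note emeasure = emeasure_restricted_distr[OF C S K] emeasure_restricted_bind[OF C S K]
 have cylinder: "emeasure (distr ?Prz NF ?S) D = emeasure (?Prz \<bind> ?K) D" if Dc: "D \<in> cylinders" for D
 proof -
  obtain I B where D: "D = cyl I B" and "finite I \<and> (\<forall>t. B t \<in> sets cemetery_borel)"
   using Dc unfolding cylinders_def by blast
  then have IB: "finite I" "\<And>t. B t \<in> sets cemetery_borel" by auto
  have Dm: "D \<in> sets NF" using cyl_measurable[OF IB] D by simp
  have "?C \<inter> (?S -` D \<inter> Om) = {w\<in>A. T w < \<top> \<and> (\<forall>t\<in>I. St (T w + t) w \<in> B t)}"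
   using sets.sets_into_space[OF A] by (auto simp: D cyl_def space_pre_sigma)
  then show ?thesis unfolding emeasure[OF Dm] using markov_cyl[OF IB] T A by (simp add: markov_cyl_def D)
 qed
 have "distr ?Prz NF ?S = ?Prz \<bind> ?K"
 proof (rule measure_eqI_generator_eq[OF Int_stable_cylinders cylinders_Pow cylinder, where A = "\<lambda>_. Om"])
  have "Om = cyl {} (\<lambda>_. {})" by (simp add: cyl_def)
  then show "range (\<lambda>_::nat. Om) \<subseteq> cylinders" by (auto simp: cylinders_def)
  show "emeasure (distr ?Prz NF ?S) Om \<noteq> \<infinity>" for i :: nat
   using emeasure_Pr_le_1[of z "?C \<inter> (?S -` Om \<inter> Om)"] emeasure(1)[of Om] sets.top[of NF] by (auto simp: top_unique)
 qed (auto simp: sets_restricted_bind[OF C S K] sets_NF_cylinders)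
 from restricted_integral[OF C S K this F] show ?thesis .
qed

end

section \<open>Exit times from open sets\<close>

text \<open>A compact exhaustion of D around the arbitrary base point \<open>undefined\<close>.
  Distances to single points outside D are used, so that \<open>D = UNIV\<close> needs no convention
  on the distance to an empty set.\<close>

definition core :: "'a::metric_space set \<Rightarrow> nat \<Rightarrow> 'a set" where
 "core D n = {x. dist undefined x \<le> real n \<and> (\<forall>y. y \<notin> D \<longrightarrow> 1 / real (Suc n) \<le> dist x y)}"

lemma compact_core: "compact (core D n :: 'a::heine_borel set)"
proof -
 have "core D n = cball undefined (real n) \<inter> (\<Inter>y\<in>-D. {x. 1 / real (Suc n) \<le> dist x y})"
  by (auto simp: core_def)
 moreover have "closed {x. 1 / real (Suc n) \<le> dist x y}" for y :: 'a
  by (intro closed_Collect_le continuous_intros)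
 ultimately have "closed (core D n)" by (metis closed_INT closed_Int closed_cball)
 moreover have "bounded (core D n)"
  by (rule bounded_subset[OF bounded_cball[of undefined "real n"]]) (auto simp: core_def)
 ultimately show ?thesis by (simp add: compact_eq_bounded_closed)
qed

lemma core_subset: "core D n \<subseteq> D"
proof
 fix x assume "x \<in> core D n"
 then have *: "\<And>y. y \<notin> D \<Longrightarrow> 1 / real (Suc n) \<le> dist x y" by (simp add: core_def)
 show "x \<in> D"
 proof (rule ccontr)
  assume "x \<notin> D"
  from *[OF this] show False by (simp add: field_simps)
 qed
qed

lemma core_mono: "m \<le> n \<Longrightarrow> core D m \<subseteq> core D n"
proof -
 assume "m \<le> n"
 then have "1 / real (Suc n) \<le> 1 / real (Suc m)" by (simp add: frac_le)
 then show ?thesis using \<open>m \<le> n\<close> by (force simp: core_def)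
qed

lemma core_exhausts:
 assumes "open D" "x \<in> D" shows "\<exists>n. x \<in> interior (core D n)"
proof -
 obtain e where e: "e > 0" "ball x e \<subseteq> D" using assms open_contains_ball by blast
 obtain n1 where n1: "1 / real (Suc n1) < e / 2" using nat_approx_posE[of "e/2"] e by auto
 obtain n2 where n2: "dist undefined x + e \<le> real n2" using real_arch_simple[of "dist undefined x + e"] by blast
 let ?n = "max n1 n2"
 have "1 / real (Suc ?n) \<le> 1 / real (Suc n1)" by (simp add: frac_le)
 then have n: "1 / real (Suc ?n) < e / 2" using n1 by linarith
 have "ball x (e/2) \<subseteq> core D ?n"
 proof
  fix y assume y: "y \<in> ball x (e/2)"
  have "dist undefined y \<le> real ?n"
   using dist_triangle[of undefined y x] y n2 e(1) by (simp add: dist_commute)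
  moreover have "1 / real (Suc ?n) \<le> dist y v" if "v \<notin> D" for v
  proof -
   have "e \<le> dist x v" using e(2) that by (meson in_mono mem_ball not_le)
   then show ?thesis using dist_triangle[of x v y] y n by (simp add: dist_commute)
  qed
  ultimately show "y \<in> core D ?n" by (auto simp: core_def)
 qed
 then have "x \<in> interior (core D ?n)" using e(1) by (meson centre_in_ball half_gt_zero interiorI open_ball)
 then show ?thesis ..
qed

context hunt begin

text \<open>Time 0 counts, in contrast to \<open>hitting_time\<close>: a path starting in G has
  debut 0, and the debut is additive under every finite shift up to it.\<close>

definition debut :: "'a option set \<Rightarrow> 'w \<Rightarrow> ennreal" where
 "debut G w = Inf {t. St t w \<in> G}"

lemma right_cont_open:
 assumes w: "w \<in> Om" and t: "t < u" and G: "openin cemetery_topology G" "St t w \<in> G"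
 shows "\<exists>b>t. b \<le> u \<and> (\<forall>s. t \<le> s \<and> s < b \<longrightarrow> St s w \<in> G)"
proof -
 have "t < \<top>" using t top.not_eq_extremum by fastforce
 then have "\<forall>\<^sub>F s in at_right t. St s w \<in> G"
  using right_cont[OF w] G by (auto simp: limitin_def)
 then obtain b where b: "b > t" "\<forall>s>t. s < b \<longrightarrow> St s w \<in> G"
  unfolding eventually_at_right[OF t] by (elim exE conjE) simp
 then have "\<forall>s. t \<le> s \<and> s < min b u \<longrightarrow> St s w \<in> G" using G(2) by (auto simp: order_le_less)
 then show ?thesis using b(1) t by (intro exI[of _ "min b u"]) auto
qed

lemma right_cont_Some:
 assumes "w \<in> Om" "t < \<top>" "open U" "St t w \<in> Some ` U"
 shows "\<exists>b>t. \<forall>s. t \<le> s \<longrightarrow> s < b \<longrightarrow> St s w \<in> Some ` U"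
proof -
 have "openin cemetery_topology (Some ` U)" using assms(3) by simp
 from right_cont_open[OF assms(1,2) this assms(4)]
 obtain b where "b > t" "\<forall>s. t \<le> s \<and> s < b \<longrightarrow> St s w \<in> Some ` U" by (elim exE conjE)
 then show ?thesis by (intro exI[of _ b]) simp_all
qed

text \<open>Membership in the right-continuous filtration at t means membership at all later s, and
  there \<open>min s (T w)\<close> is measurable.\<close>

lemma stop_from_less:
 assumes "\<And>r. {w\<in>Om. T w < r} \<in> sets (natural_filtration Z r)"
 shows "stop T"
proof
 fix t
 have *: "{w\<in>Om. T w \<le> t} \<in> sets (natural_filtration Z s)" if s: "t < s" for s
 proof -
  have "(\<lambda>w. min s (T w)) \<in> borel_measurable (natural_filtration Z s)"
  proof (rule borel_measurableI_less)
   fix y show "{w \<in> space (natural_filtration Z s). min s (T w) < y} \<in> sets (natural_filtration Z s)"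
   proof (cases "s < y")
    case True
    then show ?thesis using sets.top[of "natural_filtration Z s"] by (simp add: min_less_iff_disj)
   next
    case False
    then have "sets (natural_filtration Z y) \<subseteq> sets (natural_filtration Z s)"
     by (intro sets_natural_mono) auto
    then have "{w\<in>Om. T w < y} \<in> sets (natural_filtration Z s)" using assms[of y] by (rule subsetD)
    then show ?thesis using False by (simp add: min_less_iff_disj)
   qed
  qed
  from measurable_sets[OF this atMost_borel]
  have "(\<lambda>w. min s (T w)) -` {..t} \<inter> Om \<in> sets (natural_filtration Z s)" by simp
  moreover have "min s (T w) \<le> t \<longleftrightarrow> T w \<le> t" for w
   unfolding min_le_iff_disj using s not_le by blast
  then have "(\<lambda>w. min s (T w)) -` {..t} \<inter> Om = {w\<in>Om. T w \<le> t}" by auto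
  ultimately show ?thesis by (rule back_subst)
 qed
 have "{w\<in>Om. T w \<le> t} \<in> sets (right_filtration Z t)"
 proof (cases "t = \<top>")
  case True
  have "{w\<in>Om. T w \<le> t} = space (right_filtration Z t)" using True by simp
  then show ?thesis using sets.top by metis
 next
  case False
  then show ?thesis using * by (auto simp: sets_right less_top)
 qed
 then show "Measurable.pred (right_filtration Z t) (\<lambda>x. T x \<le> t)" by (simp add: pred_def)
qed

text \<open>By right continuity a path that meets an open set before r is in it at some time before
  r from a countable dense set.\<close>

lemma debut_stop:
 assumes G: "openin cemetery_topology G" shows "stop (debut G)"
proof (rule stop_from_less)
 fix r
 obtain Q :: "ennreal set" where Q: "countable Q" "\<And>X. open X \<Longrightarrow> X \<noteq> {} \<Longrightarrow> \<exists>d\<in>Q. d \<in> X"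
  using countable_dense_setE by auto
 have "{w\<in>Om. debut G w < r} = (\<Union>q\<in>Q \<inter> {..<r}. {w\<in>Om. St q w \<in> G})"
 proof safe
  fix w assume w: "w \<in> Om" "debut G w < r"
  then obtain t where t: "St t w \<in> G" "t < r" by (auto simp: debut_def Inf_less_iff)
  then obtain b where b: "b > t" "b \<le> r" "\<forall>s. t \<le> s \<and> s < b \<longrightarrow> St s w \<in> G"
   using right_cont_open[OF w(1) t(2) G t(1)] by blast
  then have "{t<..<b} \<noteq> {}" using dense[OF b(1)] by auto
  then obtain q where "q \<in> Q" "t < q" "q < b" using Q(2)[OF open_greaterThanLessThan] by auto
  then have "St q w \<in> G" "q < r" using b by auto
  then show "w \<in> (\<Union>q\<in>Q \<inter> {..<r}. {w\<in>Om. St q w \<in> G})" using \<open>q \<in> Q\<close> w(1) by blast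
 next
  fix w q assume "St q w \<in> G" "q < r"
  then show "debut G w < r" by (auto simp: debut_def Inf_less_iff)
 qed
 also have "\<dots> \<in> sets (natural_filtration Z r)"
 proof (intro sets.countable_UN'' countable_Int1 Q(1))
  fix q assume "q \<in> Q \<inter> {..<r}"
  then show "{w \<in> Om. St q w \<in> G} \<in> sets (natural_filtration Z r)"
   using measurable_sets[OF state_measurable_le[of q r] openin_cemetery_measurable[OF G]]
   by (auto simp: vimage_def Int_def conj_commute)
 qed
 finally show "{w\<in>Om. debut G w < r} \<in> sets (natural_filtration Z r)" .
qed

abbreviation Gn :: "'a set \<Rightarrow> nat \<Rightarrow> 'a option set" where
 "Gn D n \<equiv> - Some ` core D n"

text \<open>Since the core is compact, its complement is a neighbourhood of the cemetery; being
  killed therefore counts as leaving the core.\<close>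

lemma openin_Gn: "openin cemetery_topology (Gn D n)"
proof -
 have "closed (core D n)" by (rule compact_imp_closed[OF compact_core])
 moreover have "Gn D n = insert None (Some ` (UNIV - core D n))"
 proof (rule set_eqI)
  fix z show "z \<in> Gn D n \<longleftrightarrow> z \<in> insert None (Some ` (UNIV - core D n))" by (cases z) auto
 qed
 ultimately show ?thesis unfolding openin_Alexandroff_compactification
  by (intro disjI2 exI[of _ "core D n"] conjI) (use compact_core[of D n] in simp_all)
qed

text \<open>In contrast to the exit time, \<open>leave D\<close> vanishes for paths that start outside \<open>D\<close>, and it is
 a stopping time without completion. Quasi-left-continuity makes both agree almost surely for a start
 in \<open>D\<close>.\<close>

definition leave :: "'a set \<Rightarrow> 'w \<Rightarrow> ennreal" where
 "leave D w = (SUP n. debut (Gn D n) w)"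

lemma debut_Gn_mono: "m \<le> n \<Longrightarrow> debut (Gn D m) w \<le> debut (Gn D n) w"
 unfolding debut_def using core_mono[of m n D] by (intro Inf_superset_mono) auto

lemma leave_stop: "stop (leave D)"
proof
 fix t
 have "Measurable.pred (right_filtration Z t) (\<lambda>w. \<forall>n. debut (Gn D n) w \<le> t)"
  using stopping_timeD[OF debut_stop[OF openin_Gn]] by (intro pred_intros_countable) auto
 then show "Measurable.pred (right_filtration Z t) (\<lambda>w. leave D w \<le> t)"
  by (simp add: leave_def SUP_le_iff)
qed

lemma leave_measurable [measurable]: "leave D \<in> borel_measurable NF"
 by (rule stop_measurable[OF leave_stop])

lemma before_leave: "t < leave D w \<Longrightarrow> St t w \<in> Some ` D"
proof -
 assume "t < leave D w"
 then obtain n where "t < debut (Gn D n) w" unfolding leave_def less_SUP_iff by blast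
 have "St t w \<notin> Gn D n"
 proof
  assume "St t w \<in> Gn D n"
  then have "debut (Gn D n) w \<le> t" unfolding debut_def by (intro Inf_lower) simp
  then show False using \<open>t < debut (Gn D n) w\<close> by order
 qed
 then show ?thesis using core_subset[of D n] by blast
qed

lemma leave_le: "St t w \<notin> Some ` D \<Longrightarrow> leave D w \<le> t"
 using before_leave[of t D w] not_less by blast

text \<open>From an interior point of the core the path would stay in the core for a while, whereas
  the debut is an infimum of times spent outside.\<close>

lemma state_debut_Gn:
 assumes w: "w \<in> Om" and fin: "debut (Gn D n) w < \<top>"
 shows "St (debut (Gn D n) w) w \<notin> Some ` interior (core D n)"
proof
 let ?T = "debut (Gn D n) w"
 assume a: "St ?T w \<in> Some ` interior (core D n)"
 obtain b where b: "b > ?T" "\<forall>s. ?T \<le> s \<longrightarrow> s < b \<longrightarrow> St s w \<in> Some ` interior (core D n)"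
  using right_cont_Some[OF w fin open_interior a] by (elim exE conjE)
 obtain t where t: "St t w \<in> Gn D n" "t < b" using b(1) by (auto simp: debut_def Inf_less_iff)
 have "?T \<le> t" unfolding debut_def by (rule Inf_lower) (use t in simp)
 then have "St t w \<in> Some ` interior (core D n)" using b(2) t(2) by blast
 then show False using t(1) interior_subset[of "core D n"] by blast
qed

text \<open>Quasi-left-continuity along the increasing debuts of the complements of the cores. If
  the limit state were in D, it would be interior to some core k; then the states at all late debuts
  would be interior to core k, contrary to \<open>state_debut_Gn\<close>.\<close>

lemma AE_state_leave:
 assumes D: "open D" shows "AE w in Pr z. St (leave D w) w \<notin> Some ` D"
proof -
 let ?T = "\<lambda>n. debut (Gn D n)"
 have "AE w in Pr z. (SUP n. ?T n w) < \<top> \<longrightarrow>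
   limitin cemetery_topology (\<lambda>n. St (?T n w) w) (St (SUP n. ?T n w) w) sequentially"
  using qlc_Z[unfolded quasi_left_continuous_def, rule_format, of ?T z]
   debut_stop[OF openin_Gn] debut_Gn_mono by (auto simp: incseq_def)
 then show ?thesis
 proof (rule AE_mp, intro AE_I2 impI)
  fix w assume "w \<in> space (Pr z)"
  then have w: "w \<in> Om" by simp
  assume lim: "(SUP n. ?T n w) < \<top> \<longrightarrow>
   limitin cemetery_topology (\<lambda>n. St (?T n w) w) (St (SUP n. ?T n w) w) sequentially"
  show "St (leave D w) w \<notin> Some ` D"
  proof
   assume a: "St (leave D w) w \<in> Some ` D"
   then have fin: "leave D w < \<top>" using state_top[OF w] by (cases "leave D w = \<top>") (auto simp: less_top)
   obtain k where k: "St (leave D w) w \<in> Some ` interior (core D k)" using a core_exhausts[OF D] by blast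
   have "limitin cemetery_topology (\<lambda>n. St (?T n w) w) (St (leave D w) w) sequentially"
    using lim fin by (simp add: leave_def)
   then have "\<forall>\<^sub>F n in sequentially. St (?T n w) w \<in> Some ` interior (core D k)"
    using k by (auto simp: limitin_def)
   then obtain N where N: "\<And>n. n \<ge> N \<Longrightarrow> St (?T n w) w \<in> Some ` interior (core D k)"
    by (auto simp: eventually_sequentially)
   let ?n = "max N k"
   have "St (?T ?n w) w \<in> Some ` interior (core D ?n)"
    using N[of ?n] interior_mono[OF core_mono[of k ?n D]] by auto
   moreover have "?T ?n w < \<top>"
    using fin SUP_upper[of ?n UNIV "\<lambda>n. ?T n w"] by (auto simp: leave_def)
   ultimately show False using state_debut_Gn[OF w] by blast
  qed
 qed
qed

lemma leave_eq_0: assumes "St 0 w \<notin> Some ` D" shows "leave D w = 0" using leave_le[OF assms] by simp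

lemma leave_pos:
 assumes "open D" "w \<in> Om" "St 0 w \<in> Some ` D" shows "0 < leave D w"
proof -
 obtain k where k: "St 0 w \<in> Some ` interior (core D k)"
  using assms(3) core_exhausts[OF assms(1)] by blast
 obtain b where b: "b > 0" "\<forall>s. 0 \<le> s \<longrightarrow> s < b \<longrightarrow> St s w \<in> Some ` interior (core D k)"
  using right_cont_Some[OF assms(2) ennreal_zero_less_top open_interior k] by (elim exE conjE)
 have "b \<le> debut (Gn D k) w" unfolding debut_def
 proof (rule Inf_greatest)
  fix t assume t: "t \<in> {t. St t w \<in> Gn D k}"
  show "b \<le> t"
  proof (rule ccontr)
   assume "\<not> b \<le> t"
   then have "St t w \<in> Some ` interior (core D k)" using b(2) by (auto simp: not_le)
   then show False using t interior_subset[of "core D k"] by blast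
  qed
 qed
 also have "\<dots> \<le> leave D w" unfolding leave_def by (rule SUP_upper) simp
 finally show ?thesis using b(1) by order
qed

text \<open>Exit times are integrated with respect to completed laws. For a start in D they agree
  almost surely with a measurable stopping time, which allows the completions to be dropped.\<close>

lemma AE_exit_time:
 assumes D: "open D" and x: "x \<in> D"
 shows "AE w in Pr (Some x). exit_time Z D w = leave D w \<and> 0 < leave D w"
 using AE_state_leave[OF D] AE_start AE_space
proof eventually_elim
 case (elim w)
 then have w: "w \<in> Om" by simp
 have pos: "0 < leave D w" using leave_pos[OF D w] elim x by auto
 have "exit_time Z D w \<le> leave D w"
  unfolding exit_time_def hitting_time_def by (rule Inf_lower) (use elim pos in auto)
 moreover have "leave D w \<le> exit_time Z D w" unfolding exit_time_def hitting_time_def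
 proof (rule Inf_greatest)
  fix t assume "t \<in> {t. 0 < t \<and> St t w \<in> - Some ` D}"
  then show "leave D w \<le> t" using leave_le by simp
 qed
 ultimately show ?case using pos by auto
qed

lemma debut_shift:
 assumes w: "w \<in> Om" and t: "t \<le> debut G w" "t < \<top>"
 shows "debut G w = t + debut G (shift t w)"
proof (rule antisym)
 have "debut G w - t \<le> debut G (shift t w)" unfolding debut_def[of G "shift t w"]
 proof (rule Inf_greatest)
  fix s assume "s \<in> {s. St s (shift t w) \<in> G}"
  then have "St (t + s) w \<in> G" using w by simp
  then have "debut G w \<le> t + s" unfolding debut_def by (intro Inf_lower) simp
  then show "debut G w - t \<le> s" using t(2) by (auto simp: ennreal_minus_le_iff)
 qed
 then show "debut G w \<le> t + debut G (shift t w)" using t(2) by (auto simp: ennreal_minus_le_iff)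
 show "t + debut G (shift t w) \<le> debut G w" unfolding debut_def[of G w]
 proof (rule Inf_greatest)
  fix r assume r: "r \<in> {r. St r w \<in> G}"
  have "debut G w \<le> r" unfolding debut_def by (rule Inf_lower) (rule r)
  then have tr: "t \<le> r" using t(1) by order
  then have eq: "t + (r - t) = r" by (simp add: add_diff_inverse_ennreal)
  have "St (r - t) (shift t w) \<in> G" unfolding state_shift[OF w] eq using r by simp
  then have "debut G (shift t w) \<le> r - t" unfolding debut_def by (intro Inf_lower) simp
  then have "t + debut G (shift t w) \<le> t + (r - t)" by (rule add_left_mono)
  then show "t + debut G (shift t w) \<le> r" using eq by simp
 qed
qed

text \<open>In the supremum only indices from N on matter, as debuts increase with the core; for
  those, t precedes the debut and \<open>debut_shift\<close> applies.\<close>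

lemma leave_shift:
 assumes w: "w \<in> Om" and t: "t < leave D w"
 shows "leave D w = t + leave D (shift t w)"
proof -
 obtain N where N: "t < debut (Gn D N) w" using t by (auto simp: leave_def less_SUP_iff)
 have fin: "t < \<top>" using t top.not_eq_extremum by fastforce
 have eq: "debut (Gn D (max n N)) w = t + debut (Gn D (max n N)) (shift t w)" for n
  by (rule debut_shift[OF w _ fin]) (use N debut_Gn_mono[of N "max n N" D w] in auto)
 show ?thesis
 proof (rule antisym)
  show "leave D w \<le> t + leave D (shift t w)" unfolding leave_def[of D w]
  proof (rule SUP_least)
   fix n
   have "debut (Gn D n) w \<le> debut (Gn D (max n N)) w" by (rule debut_Gn_mono) simp
   also have "\<dots> \<le> t + leave D (shift t w)"
    unfolding eq leave_def by (intro add_left_mono SUP_upper) simp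
   finally show "debut (Gn D n) w \<le> t + leave D (shift t w)" .
  qed
  have "t + debut (Gn D n) (shift t w) \<le> leave D w" for n
  proof -
   have "t + debut (Gn D n) (shift t w) \<le> t + debut (Gn D (max n N)) (shift t w)"
    by (intro add_left_mono debut_Gn_mono) simp
   also have "\<dots> \<le> leave D w" unfolding eq[symmetric] leave_def by (rule SUP_upper) simp
   finally show ?thesis .
  qed
  then have "debut (Gn D n) (shift t w) \<le> leave D w - t" for n
   using fin t by (simp add: ennreal_le_minus_iff less_imp_le add.commute)
  then have "leave D (shift t w) \<le> leave D w - t" unfolding leave_def[of D "shift t w"] by (rule SUP_least)
  then have "t + leave D (shift t w) \<le> t + (leave D w - t)" by (rule add_left_mono)
  then show "t + leave D (shift t w) \<le> leave D w" using t by (simp add: add_diff_inverse_ennreal less_imp_le)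
 qed
qed

text \<open>The dichotomy behind the decompositions below: at the exit from D' the path is either
  still in D, and D is left strictly later, or both sets are left together.\<close>

lemma AE_leave_mono:
 assumes D: "open D" and D': "open D'" "D' \<subseteq> D"
 shows "AE w in Pr z. leave D' w \<le> leave D w \<and> (leave D' w < leave D w \<longleftrightarrow> St (leave D' w) w \<in> Some ` D)"
 using AE_state_leave[OF D]
proof eventually_elim
 case (elim w)
 have le: "leave D' w \<le> leave D w" using elim D'(2) by (intro leave_le) blast
 then show ?case using before_leave[of "leave D' w" D w] elim by (auto simp: order_le_less)
qed

end

section \<open>Killed resolvents and exit operators\<close>

context hunt begin

text \<open>\<open>enn2real \<top>\<close> is 0, so an infinite time is not discounted at all. In
  \<open>exit_path\<close> this is harmless: the state at time \<open>\<top>\<close> is the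
  cemetery, where \<open>ext0\<close> vanishes.\<close>

definition decay :: "real \<Rightarrow> ennreal \<Rightarrow> ennreal" where
 "decay l t = ennreal (exp (- l * enn2real t))"

lemma decay_measurable [measurable]: "decay l \<in> borel_fun" unfolding decay_def by measurable

definition exit_path :: "real \<Rightarrow> 'a set \<Rightarrow> ('a \<Rightarrow> ennreal) \<Rightarrow> 'w \<Rightarrow> ennreal" where
 "exit_path l D g w = decay l (leave D w) * ext0 g (St (leave D w) w)"

definition res_density :: "real \<Rightarrow> 'a set \<Rightarrow> ('a \<Rightarrow> ennreal) \<Rightarrow> 'w \<Rightarrow> real \<Rightarrow> ennreal" where
 "res_density l D f w t =
   (if 0 \<le> t \<and> ennreal t < leave D w then ennreal (exp (- l * t)) * ext0 f (St (ennreal t) w) else 0)"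

definition res_path :: "real \<Rightarrow> 'a set \<Rightarrow> ('a \<Rightarrow> ennreal) \<Rightarrow> 'w \<Rightarrow> ennreal" where
 "res_path l D f w = (\<integral>\<^sup>+t. res_density l D f w t \<partial>lborel)"

definition H :: "real \<Rightarrow> 'a set \<Rightarrow> ('a \<Rightarrow> ennreal) \<Rightarrow> 'a \<Rightarrow> ennreal" where
 "H l D g x = (\<integral>\<^sup>+w. exit_path l D g w \<partial>Pr (Some x))"

text \<open>\<open>R l D\<close> is the \<open>l\<close>-resolvent of the process killed on leaving \<open>D\<close>, and \<open>H l D\<close> its discounted
 exit kernel.\<close>

definition R :: "real \<Rightarrow> 'a set \<Rightarrow> ('a \<Rightarrow> ennreal) \<Rightarrow> 'a \<Rightarrow> ennreal" where
 "R l D f x = (\<integral>\<^sup>+w. res_path l D f w \<partial>Pr (Some x))"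

section \<open>Joint measurability in time and path\<close>

lemma state_joint_NF [measurable]:
 "(\<lambda>p. St (ennreal (snd p)) (fst p)) \<in> measurable (NF \<Otimes>\<^sub>M lborel) cemetery_borel"
proof (rule state_at_measurable[where s = \<top> and h = fst and \<tau> = "\<lambda>p. ennreal (snd p)"])
 show "fst \<in> space (NF \<Otimes>\<^sub>M lborel) \<rightarrow> Om" by (auto simp: space_pair_measure)
 show "(\<lambda>x. St r (fst x)) \<in> measurable (NF \<Otimes>\<^sub>M lborel) cemetery_borel" for r
  by (rule measurable_compose[OF measurable_fst]) simp
qed auto

lemma shift_joint_measurable [measurable]:
 "(\<lambda>p. shift (ennreal (snd p)) (fst p)) \<in> measurable (NF \<Otimes>\<^sub>M lborel) NF"
proof (rule measurable_naturalI)
 show "(\<lambda>p. shift (ennreal (snd p)) (fst p)) \<in> space (NF \<Otimes>\<^sub>M lborel) \<rightarrow> Om"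
  by (auto simp: space_pair_measure)
 fix s
 have "(\<lambda>p. St (ennreal (snd p) + s) (fst p)) \<in> measurable (NF \<Otimes>\<^sub>M lborel) cemetery_borel"
 proof (rule state_at_measurable[where s = \<top> and h = fst and \<tau> = "\<lambda>p. ennreal (snd p) + s"])
  show "fst \<in> space (NF \<Otimes>\<^sub>M lborel) \<rightarrow> Om" by (auto simp: space_pair_measure)
  show "(\<lambda>x. St r (fst x)) \<in> measurable (NF \<Otimes>\<^sub>M lborel) cemetery_borel" for r
   by (rule measurable_compose[OF measurable_fst]) simp
 qed auto
 then show "(\<lambda>p. St s (shift (ennreal (snd p)) (fst p))) \<in> measurable (NF \<Otimes>\<^sub>M lborel) cemetery_borel"
  by (rule measurable_cong[THEN iffD1, rotated]) (auto simp: space_pair_measure)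
qed

lemma exit_path_measurable [measurable]:
 assumes [measurable]: "g \<in> borel_fun"
 shows "exit_path l D g \<in> borel_measurable NF" unfolding exit_path_def by measurable

lemma res_density_measurable [measurable]:
 assumes f: "f \<in> borel_fun"
 shows "(\<lambda>p. res_density l D f (fst p) (snd p)) \<in> borel_measurable (NF \<Otimes>\<^sub>M lborel)"
proof -
 have [measurable]: "(\<lambda>p. ext0 f (St (ennreal (snd p)) (fst p))) \<in> borel_measurable (NF \<Otimes>\<^sub>M lborel)"
  by (rule measurable_compose[OF state_joint_NF ext0_measurable[OF f]])
 show ?thesis unfolding res_density_def by measurable
qed

lemma res_density_path_measurable [measurable]:
 assumes f: "f \<in> borel_fun" and w: "w \<in> Om"
 shows "res_density l D f w \<in> borel_measurable lborel"
 using measurable_compose[OF measurable_Pair1' res_density_measurable[OF f, of l D]] w by simp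

lemma res_path_measurable [measurable]:
 assumes f: "f \<in> borel_fun"
 shows "res_path l D f \<in> borel_measurable NF" unfolding res_path_def
 by (rule lborel.borel_measurable_nn_integral)
  (use res_density_measurable[OF f, of l D] in \<open>simp add: case_prod_unfold\<close>)

lemma H_measurable [measurable]:
 assumes g: "g \<in> borel_fun" shows "H l D g \<in> borel_fun" unfolding H_def
 by (rule measurable_compose[OF Some_measurable expectation_measurable[OF exit_path_measurable[OF g]]])

lemma R_measurable [measurable]:
 assumes f: "f \<in> borel_fun" shows "R l D f \<in> borel_fun" unfolding R_def
 by (rule measurable_compose[OF Some_measurable expectation_measurable[OF res_path_measurable[OF f]]])

lemma res_path_zero:
 assumes "St 0 w \<notin> Some ` D" shows "res_path l D f w = 0"
proof -
 have "res_density l D f w = (\<lambda>_. 0)" using leave_eq_0[OF assms] by (auto simp: res_density_def)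
 then show ?thesis by (simp add: res_path_def)
qed

lemma exit_path_outside:
 assumes "St 0 w \<notin> Some ` D" shows "exit_path l D g w = ext0 g (St 0 w)"
 using leave_eq_0[OF assms] by (simp add: exit_path_def decay_def)

text \<open>Kernels act on functions on the space without cemetery. A functional that vanishes on
  paths starting in the cemetery loses nothing when its expectation is extended there by 0.\<close>

lemma ext0_expectation:
 assumes "\<And>w. w \<in> Om \<Longrightarrow> St 0 w = None \<Longrightarrow> F w = 0"
 shows "ext0 (\<lambda>x. \<integral>\<^sup>+w. F w \<partial>Pr (Some x)) z = (\<integral>\<^sup>+w. F w \<partial>Pr z)"
proof (cases z)
 case None
 have "AE w in Pr None. F w = 0" using AE_start[of None] AE_space by eventually_elim (use assms in auto)
 then have "(\<integral>\<^sup>+w. F w \<partial>Pr None) = (\<integral>\<^sup>+w. 0 \<partial>Pr None)" by (rule nn_integral_cong_AE)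
 then show ?thesis using None by (simp add: ext0_def)
qed (simp add: ext0_def)

text \<open>Carries a discount known at time T through the strong Markov property. The restriction
  to finite T disappears because for \<open>T w = \<top>\<close> the shifted path starts in the
  cemetery and both integrands vanish.\<close>

lemma strong_markov_weighted:
 assumes T: "stop T" and W: "W \<in> borel_measurable (pre_sigma T)" and F [measurable]: "F \<in> borel_measurable NF"
  and F0: "\<And>w. w \<in> Om \<Longrightarrow> St 0 w = None \<Longrightarrow> F w = 0"
 shows "(\<integral>\<^sup>+w. W w * F (shift (T w) w) \<partial>Pr z) =
  (\<integral>\<^sup>+w. W w * ext0 (\<lambda>x. \<integral>\<^sup>+w. F w \<partial>Pr (Some x)) (St (T w) w) \<partial>Pr z)"
proof -
 have [measurable]: "T \<in> borel_measurable NF" by (rule stop_measurable[OF T])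
 let ?E = "ext0 (\<lambda>x. \<integral>\<^sup>+w. F w \<partial>Pr (Some x))"
 have E [measurable]: "?E \<in> borel_measurable cemetery_borel"
  by (rule ext0_measurable, rule measurable_compose[OF Some_measurable expectation_measurable[OF F]])
 have Fs [measurable]: "(\<lambda>w. F (shift (T w) w)) \<in> borel_measurable NF"
  by (rule measurable_compose[OF _ F]) measurable
 have Es [measurable]: "(\<lambda>w. ?E (St (T w) w)) \<in> borel_measurable NF"
  by (rule measurable_compose[OF _ E]) measurable
 have sub: "V \<in> borel_measurable NF" if "V \<in> borel_measurable (pre_sigma T)" for V :: "'w \<Rightarrow> ennreal"
 proof (rule measurableI)
  fix A :: "ennreal set" assume "A \<in> sets borel"
  then have "V -` A \<inter> Om \<in> sets (pre_sigma T)" using measurable_sets[OF that] by (simp add: space_pre_sigma)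
  then show "V -` A \<inter> space NF \<in> sets NF" using pre_sigma_sub_NF[OF T] by simp
 qed simp
 have top: "F (shift (T w) w) = 0 \<and> ?E (St (T w) w) = 0" if "w \<in> Om" "\<not> T w < \<top>" for w
 proof -
  have "T w = \<top>" using that(2) by (simp add: less_top[symmetric])
  then show ?thesis using F0[of "shift (T w) w"] state_top[OF that(1)] that(1) by (simp add: ext0_def)
 qed
 show ?thesis using W
 proof (induction rule: borel_measurable_induct)
  case (cong f g)
  have fg: "\<And>w. w \<in> Om \<Longrightarrow> f w = g w" using cong(3) by (simp add: space_pre_sigma)
  have "(\<integral>\<^sup>+w. f w * K w \<partial>Pr z) = (\<integral>\<^sup>+w. g w * K w \<partial>Pr z)" for K
   by (intro nn_integral_cong) (simp add: fg)
  with cong(4) show ?case by simp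
 next
  case (set A)
  have "(\<integral>\<^sup>+w. indicator A w * F (shift (T w) w) \<partial>Pr z) =
    (\<integral>\<^sup>+w\<in>{w\<in>A. T w < \<top>}. F (shift (T w) w) \<partial>Pr z)"
   by (intro nn_integral_cong) (use top in \<open>auto simp: indicator_def\<close>)
  also have "\<dots> = (\<integral>\<^sup>+w\<in>{w\<in>A. T w < \<top>}. (\<integral>\<^sup>+w'. F w' \<partial>Pr (St (T w) w)) \<partial>Pr z)"
   by (rule strong_markov_path[OF T set F])
  also have "\<dots> = (\<integral>\<^sup>+w. indicator A w * ?E (St (T w) w) \<partial>Pr z)"
   using ext0_expectation[of F, OF F0]
   by (intro nn_integral_cong) (use top in \<open>auto simp: indicator_def\<close>)
  finally show ?case .
 next
  case (mult u c)
  note [measurable] = sub[OF \<open>u \<in> borel_measurable (pre_sigma T)\<close>]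
  show ?case using mult.IH by (simp add: mult.assoc nn_integral_cmult)
 next
  case (add u v)
  note [measurable] = sub[OF \<open>u \<in> borel_measurable (pre_sigma T)\<close>] sub[OF \<open>v \<in> borel_measurable (pre_sigma T)\<close>]
  show ?case using add.IH by (simp add: distrib_right nn_integral_add)
 next
  case (seq U)
  note [measurable] = sub[OF \<open>\<And>i. U i \<in> borel_measurable (pre_sigma T)\<close>]
  have mono: "incseq (\<lambda>i w. U i w * K w)" for K :: "'w \<Rightarrow> ennreal"
   using \<open>incseq U\<close> by (auto simp: incseq_def le_fun_def intro!: mult_right_mono)
  have "(\<integral>\<^sup>+w. (SUP i. U i w * F (shift (T w) w)) \<partial>Pr z) =
    (\<integral>\<^sup>+w. (SUP i. U i w * ?E (St (T w) w)) \<partial>Pr z)"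
   using seq.IH by (simp add: nn_integral_monotone_convergence_SUP[OF mono])
  then show ?case using seq.hyps by (simp add: SUP_mult_right_ennreal image_comp)
 qed
qed

section \<open>Decomposition at the exit from a smaller set\<close>

lemma leave_pre_sigma: "(\<lambda>w. decay l (leave D w)) \<in> borel_measurable (pre_sigma (leave D))"
 by (rule measurable_compose[OF measurable_stopping_time_pre_sigma[OF leave_stop] decay_measurable])

lemma exit_path_shift:
 assumes w: "w \<in> Om" and s: "s < leave D w"
 shows "decay l s * exit_path l D g (shift s w) = exit_path l D g w"
proof -
 have eq: "leave D w = s + leave D (shift s w)" by (rule leave_shift[OF w s])
 show ?thesis
 proof (cases "leave D w = \<top>")
  case True
  have "St (leave D (shift s w)) (shift s w) = None"
   unfolding state_shift[OF w] eq[symmetric] using state_top[OF w] True by simp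
  then show ?thesis using state_top[OF w] True by (simp add: exit_path_def ext0_def)
 next
  case False
  then have "s < \<top>" "leave D (shift s w) < \<top>" using eq by (auto simp: less_top[symmetric])
  then have "enn2real (leave D w) = enn2real s + enn2real (leave D (shift s w))"
   using eq by (simp add: enn2real_plus)
  then have "decay l (leave D w) = decay l s * decay l (leave D (shift s w))"
   by (simp add: decay_def ennreal_mult[symmetric] exp_add[symmetric] algebra_simps)
  then show ?thesis unfolding exit_path_def state_shift[OF w] eq[symmetric] by (simp add: mult.assoc)
 qed
qed

text \<open>Strong Markov property at the exit from D'. If D is left at the same moment, the shifted
  path starts outside D, and \<open>exit_path\<close> then returns the value at its starting point
  without discount.\<close>

lemma H_decompose:
 assumes D: "open D" and D': "open D'" "D' \<subseteq> D" and g [measurable]: "g \<in> borel_fun"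
 shows "H l D g x = H l D' (H l D g) x"
proof -
 have "H l D g x = (\<integral>\<^sup>+w. decay l (leave D' w) * exit_path l D g (shift (leave D' w) w) \<partial>Pr (Some x))"
  unfolding H_def
 proof (rule nn_integral_cong_AE)
  show "AE w in Pr (Some x). exit_path l D g w =
    decay l (leave D' w) * exit_path l D g (shift (leave D' w) w)" using AE_leave_mono[OF D D'] AE_space
  proof eventually_elim
   case (elim w)
   then have w: "w \<in> Om" by simp
   show ?case
   proof (cases "leave D' w < leave D w")
    case True
    then show ?thesis using exit_path_shift[OF w True, of l g] by simp
   next
    case False
    then have eq: "leave D' w = leave D w" using elim by auto
    then have "St 0 (shift (leave D' w) w) \<notin> Some ` D" using elim w by simp
    from exit_path_outside[OF this] show ?thesis using w eq by (simp add: exit_path_def)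
   qed
  qed
 qed
 also have "\<dots> = (\<integral>\<^sup>+w. decay l (leave D' w) *
   ext0 (\<lambda>x. \<integral>\<^sup>+w. exit_path l D g w \<partial>Pr (Some x)) (St (leave D' w) w) \<partial>Pr (Some x))"
  by (rule strong_markov_weighted[OF leave_stop leave_pre_sigma])
   (auto simp: exit_path_outside ext0_def)
 moreover have "H l D g = (\<lambda>x. \<integral>\<^sup>+w. exit_path l D g w \<partial>Pr (Some x))" by (rule ext) (rule H_def)
 ultimately show ?thesis by (simp only: H_def[of l D'] exit_path_def[of l D'])
qed

lemma res_path_shift:
 assumes w: "w \<in> Om" and s: "s < leave D w" and f: "f \<in> borel_fun" and r: "s = ennreal r" "0 \<le> r"
 shows "decay l s * res_path l D f (shift s w) = (\<integral>\<^sup>+t. indicator {r..} t * res_density l D f w t \<partial>lborel)"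
proof -
 have eq: "leave D w = s + leave D (shift s w)" by (rule leave_shift[OF w s])
 have fm: "(\<lambda>t. indicator {r..} t * res_density l D f w t) \<in> borel_fun"
  using res_density_path_measurable[OF f w] by simp
 have "(\<integral>\<^sup>+t. indicator {r..} t * res_density l D f w t \<partial>lborel) =
   (\<integral>\<^sup>+t. indicator {r..} (r + t) * res_density l D f w (r + t) \<partial>lborel)"
  using nn_integral_real_affine[OF fm, of 1 r] by simp
 also have "\<dots> = (\<integral>\<^sup>+t. decay l s * res_density l D f (shift s w) t \<partial>lborel)"
 proof (rule nn_integral_cong)
  fix t :: real
  show "indicator {r..} (r + t) * res_density l D f w (r + t) = decay l s * res_density l D f (shift s w) t"
  proof (cases "0 \<le> t")
   case False
   then show ?thesis by (simp add: res_density_def)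
  next
   case True
   then have rt: "ennreal (r + t) = s + ennreal t" using r by simp
   have "ennreal (r + t) < leave D w \<longleftrightarrow> ennreal t < leave D (shift s w)"
    unfolding rt eq using r by (simp add: ennreal_add_left_cancel_less)
   moreover have "ennreal (exp (- l * (r + t))) = decay l s * ennreal (exp (- l * t))"
    using r by (simp add: decay_def ennreal_mult[symmetric] exp_add[symmetric] algebra_simps)
   ultimately show ?thesis
    unfolding res_density_def state_shift[OF w] rt[symmetric] using True r by (simp add: mult.assoc)
  qed
 qed
 also have "\<dots> = decay l s * res_path l D f (shift s w)" unfolding res_path_def
  by (rule nn_integral_cmult) (use res_density_path_measurable[OF f shift_in[OF w]] in simp)
 finally show ?thesis by simp
qed

text \<open>Occupation splits into the parts before and after the exit from D'; the later part
  vanishes when D is left at the same moment.\<close>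

lemma R_decompose:
 assumes D: "open D" and D': "open D'" "D' \<subseteq> D" and f [measurable]: "f \<in> borel_fun"
 shows "R l D f x = R l D' f x + H l D' (R l D f) x"
proof -
 have "R l D f x = (\<integral>\<^sup>+w. res_path l D' f w +
   decay l (leave D' w) * res_path l D f (shift (leave D' w) w) \<partial>Pr (Some x))" unfolding R_def
 proof (rule nn_integral_cong_AE)
  show "AE w in Pr (Some x). res_path l D f w = res_path l D' f w +
    decay l (leave D' w) * res_path l D f (shift (leave D' w) w)" using AE_leave_mono[OF D D'] AE_space
  proof eventually_elim
   case (elim w)
   then have w: "w \<in> Om" by simp
   show ?case
   proof (cases "leave D' w < leave D w")
    case True
    then obtain r where r: "leave D' w = ennreal r" "0 \<le> r" by (cases "leave D' w") auto
    have "res_path l D f w = (\<integral>\<^sup>+t. res_density l D' f w t + indicator {r..} t * res_density l D f w t \<partial>lborel)"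
     unfolding res_path_def
    proof (rule nn_integral_cong)
     fix t :: real
     show "res_density l D f w t = res_density l D' f w t + indicator {r..} t * res_density l D f w t"
     proof (cases "0 \<le> t \<and> t < r")
      case True
      then have "ennreal t < leave D' w" unfolding r(1) by (simp add: ennreal_less_iff)
      moreover from this have "ennreal t < leave D w" using elim by (auto intro: less_le_trans)
      ultimately show ?thesis using True by (simp add: res_density_def)
     next
      case False
      then have "\<not> (0 \<le> t \<and> ennreal t < leave D' w)" unfolding r(1) using r(2) by (auto simp: ennreal_less_iff)
      then show ?thesis using False by (auto simp: res_density_def indicator_def)
     qed
    qed
    also have "\<dots> = res_path l D' f w + (\<integral>\<^sup>+t. indicator {r..} t * res_density l D f w t \<partial>lborel)"
     unfolding res_path_def by (rule nn_integral_add) (use res_density_path_measurable[OF f w] in simp_all)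
    finally show ?thesis using res_path_shift[OF w True f r] by simp
   next
    case False
    then have eq: "leave D' w = leave D w" using elim by auto
    then have "St 0 (shift (leave D' w) w) \<notin> Some ` D" using elim w by simp
    from res_path_zero[OF this] have "res_path l D f (shift (leave D' w) w) = 0" .
    moreover have "res_path l D f w = res_path l D' f w" unfolding res_path_def res_density_def eq ..
    ultimately show ?thesis by simp
   qed
  qed
 qed
 also have "\<dots> = R l D' f x + (\<integral>\<^sup>+w. decay l (leave D' w) * res_path l D f (shift (leave D' w) w) \<partial>Pr (Some x))"
  unfolding R_def
 proof (rule nn_integral_add)
  have "(\<lambda>w. res_path l D f (shift (leave D' w) w)) \<in> borel_measurable NF"
   by (rule measurable_compose[OF _ res_path_measurable[OF f]]) measurable
  then show "(\<lambda>w. decay l (leave D' w) * res_path l D f (shift (leave D' w) w)) \<in> borel_measurable (Pr (Some x))"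
   by measurable
 qed measurable
 also have "(\<integral>\<^sup>+w. decay l (leave D' w) * res_path l D f (shift (leave D' w) w) \<partial>Pr (Some x)) =
   (\<integral>\<^sup>+w. decay l (leave D' w) *
   ext0 (\<lambda>x. \<integral>\<^sup>+w. res_path l D f w \<partial>Pr (Some x)) (St (leave D' w) w) \<partial>Pr (Some x))"
  by (rule strong_markov_weighted[OF leave_stop leave_pre_sigma]) (auto intro!: res_path_zero)
 finally show ?thesis by (simp add: H_def exit_path_def R_def[abs_def])
qed

lemma R_outside: assumes "x \<notin> D" shows "R l D f x = 0"
proof -
 have "AE w in Pr (Some x). res_path l D f w = 0"
  using AE_start by eventually_elim (use assms in \<open>auto intro!: res_path_zero\<close>)
 then have "R l D f x = (\<integral>\<^sup>+w. 0 \<partial>Pr (Some x))" unfolding R_def by (rule nn_integral_cong_AE)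
 then show ?thesis by simp
qed

lemma H_outside: assumes "x \<notin> D" shows "H l D g x = g x"
proof -
 have "AE w in Pr (Some x). exit_path l D g w = g x" using AE_start
 proof eventually_elim
  case (elim w)
  then show ?case using assms exit_path_outside[of w D l g] by (auto simp: ext0_def)
 qed
 then have "H l D g x = (\<integral>\<^sup>+w. g x \<partial>Pr (Some x))" unfolding H_def by (rule nn_integral_cong_AE)
 then show ?thesis using prob_space.emeasure_space_1[OF prob_space_Pr, of "Some x"] by simp
qed

end

section \<open>Resolvent equations\<close>

lemma nn_integral_exp_Icc:
 fixes c s :: real
 assumes "c \<noteq> 0" "0 \<le> s"
 shows "ennreal \<bar>c\<bar> * (\<integral>\<^sup>+t. indicator {0..s} t * ennreal (exp (c * t)) \<partial>lborel) = ennreal \<bar>exp (c * s) - 1\<bar>"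
proof -
 have "(\<integral>\<^sup>+t. ennreal (\<bar>c\<bar> * exp (c * t)) * indicator {0..s} t \<partial>lborel) =
   ennreal (sgn c * exp (c * s) - sgn c * exp (c * 0))"
 proof (rule nn_integral_FTC_Icc)
  show "((\<lambda>t. sgn c * exp (c * t)) has_real_derivative \<bar>c\<bar> * exp (c * t)) (at t)" for t
   by (auto intro!: derivative_eq_intros simp: abs_sgn mult_ac)
 qed (use assms in auto)
 also have "sgn c * exp (c * s) - sgn c * exp (c * 0) = \<bar>exp (c * s) - 1\<bar>"
  using assms by (cases "c > 0") (auto simp: sgn_if not_less mult_nonpos_nonneg)
 finally have 1: "(\<integral>\<^sup>+t. ennreal (\<bar>c\<bar> * exp (c * t)) * indicator {0..s} t \<partial>lborel) = ennreal \<bar>exp (c * s) - 1\<bar>" .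
 have "ennreal \<bar>c\<bar> * (\<integral>\<^sup>+t. indicator {0..s} t * ennreal (exp (c * t)) \<partial>lborel) =
   (\<integral>\<^sup>+t. ennreal \<bar>c\<bar> * (indicator {0..s} t * ennreal (exp (c * t))) \<partial>lborel)"
  by (rule nn_integral_cmult[symmetric]) simp
 also have "\<dots> = (\<integral>\<^sup>+t. ennreal (\<bar>c\<bar> * exp (c * t)) * indicator {0..s} t \<partial>lborel)"
  by (intro nn_integral_cong) (simp add: ennreal_mult mult_ac)
 finally show ?thesis using 1 by simp
qed

definition time_below :: "ennreal \<Rightarrow> real \<Rightarrow> ennreal" where
 "time_below S t = (if 0 \<le> t \<and> ennreal t < S then 1 else 0)"

lemma time_below_measurable [measurable]: "time_below S \<in> borel_fun"
 unfolding time_below_def by measurable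

lemma nn_integral_exp_below:
 assumes c: "0 < c"
 shows "ennreal c * (\<integral>\<^sup>+t. time_below (ennreal s) t * ennreal (exp (- c * t)) \<partial>lborel) = ennreal (1 - exp (- c * max 0 s))"
proof -
 define s' where "s' = max 0 s"
 have s': "0 \<le> s'" "ennreal s = ennreal s'" by (auto simp: s'_def max_def ennreal_neg)
 have "(\<integral>\<^sup>+t. time_below (ennreal s) t * ennreal (exp (- c * t)) \<partial>lborel) =
   (\<integral>\<^sup>+t. indicator {0..s'} t * ennreal (exp (- c * t)) \<partial>lborel)"
 proof (rule nn_integral_cong_AE)
  have "AE t in lborel. t \<noteq> s'" by (rule AE_lborel_singleton)
  then show "AE t in lborel. time_below (ennreal s) t * ennreal (exp (- c * t)) =
    indicator {0..s'} t * ennreal (exp (- c * t))"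
   by eventually_elim (auto simp: time_below_def s'(2) ennreal_less_iff indicator_def)
 qed
 moreover have "ennreal c * (\<integral>\<^sup>+t. indicator {0..s'} t * ennreal (exp (- c * t)) \<partial>lborel) = ennreal \<bar>exp (- c * s') - 1\<bar>"
  using nn_integral_exp_Icc[of "- c" s'] c s'(1) by simp
 moreover have "\<bar>exp (- c * s') - 1\<bar> = 1 - exp (- c * s')"
 proof -
  have "- c * s' \<le> 0" using c s'(1) by (simp add: mult_nonneg_nonneg)
  then have "exp (- c * s') \<le> 1" by (simp only: exp_le_one_iff)
  then show ?thesis by linarith
 qed
 ultimately show ?thesis unfolding s'_def by (simp only:)
qed

lemma nn_integral_exp_below_top:
 assumes c: "0 < c"
 shows "ennreal c * (\<integral>\<^sup>+t. time_below \<top> t * ennreal (exp (- c * t)) \<partial>lborel) = 1"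
proof -
 have "(\<integral>\<^sup>+t. ennreal (c * exp (- c * t)) * indicator {0..} t \<partial>lborel) = ennreal (0 - - exp (- c * 0))"
 proof (rule nn_integral_FTC_atLeast)
  show "((\<lambda>t. - exp (- c * t)) has_real_derivative c * exp (- c * t)) (at t)" for t
   by (auto intro!: derivative_eq_intros)
  have "((\<lambda>t. exp (- c * t)) \<longlongrightarrow> 0) at_top"
  proof (rule filterlim_compose[OF exp_at_bot])
   have "LIM t at_top. c * t :> at_top"
    by (rule filterlim_tendsto_pos_mult_at_top[OF tendsto_const c filterlim_ident])
   then show "LIM t at_top. - c * t :> at_bot" by (simp add: filterlim_uminus_at_top)
  qed
  from tendsto_minus[OF this] show "((\<lambda>t. - exp (- c * t)) \<longlongrightarrow> 0) at_top" by simp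
 qed (use c in auto)
 then have 1: "(\<integral>\<^sup>+t. ennreal (c * exp (- c * t)) * indicator {0..} t \<partial>lborel) = 1" by simp
 have "ennreal c * (\<integral>\<^sup>+t. time_below \<top> t * ennreal (exp (- c * t)) \<partial>lborel) =
   (\<integral>\<^sup>+t. ennreal c * (time_below \<top> t * ennreal (exp (- c * t))) \<partial>lborel)"
  by (rule nn_integral_cmult[symmetric]) simp
 also have "\<dots> = (\<integral>\<^sup>+t. ennreal (c * exp (- c * t)) * indicator {0..} t \<partial>lborel)"
  using c by (intro nn_integral_cong) (auto simp: ennreal_mult mult_ac time_below_def indicator_def)
 finally show ?thesis using 1 by simp
qed

context hunt begin

lemma res_density_alt:
 "res_density l D f w t = time_below (leave D w) t * (ennreal (exp (- l * t)) * ext0 f (St (ennreal t) w))"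
 by (simp add: res_density_def time_below_def)

lemma time_below_leave_measurable [measurable]:
 "(\<lambda>p. time_below (leave D (fst p)) (snd p)) \<in> borel_measurable (NF \<Otimes>\<^sub>M lborel)"
 unfolding time_below_def by measurable

lemma Fubini_time:
 assumes "(\<lambda>p. k (fst p) (snd p)) \<in> borel_measurable (NF \<Otimes>\<^sub>M lborel)"
 shows "(\<integral>\<^sup>+w. (\<integral>\<^sup>+t. k w t \<partial>lborel) \<partial>Pr z) = (\<integral>\<^sup>+t. (\<integral>\<^sup>+w. k w t \<partial>Pr z) \<partial>lborel)"
proof -
 interpret P: prob_space "Pr z" by (rule prob_space_Pr)
 interpret pair_sigma_finite "Pr z" lborel ..
 have "sets (Pr z \<Otimes>\<^sub>M lborel) = sets (NF \<Otimes>\<^sub>M lborel)" by (intro sets_pair_measure_cong) simp_all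
 then have "(\<lambda>(w, t). k w t) \<in> borel_measurable (Pr z \<Otimes>\<^sub>M lborel)"
  using assms by (simp add: case_prod_unfold cong: measurable_cong_sets)
 from Fubini'[OF this] show ?thesis by simp
qed

text \<open>Path version of \<open>R l D\<close> applied to an expectation: the functional is
  evaluated along the shifted paths. Resolvent equations reduce in this way to integrals of
  exponentials for a fixed path.\<close>

definition pot :: "real \<Rightarrow> 'a set \<Rightarrow> ('w \<Rightarrow> ennreal) \<Rightarrow> 'w \<Rightarrow> ennreal" where
 "pot l D F w = (\<integral>\<^sup>+t. time_below (leave D w) t * (ennreal (exp (- l * t)) * F (shift (ennreal t) w)) \<partial>lborel)"

lemma pot_measurable [measurable]:
 assumes F: "F \<in> borel_measurable NF" shows "pot l D F \<in> borel_measurable NF"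
proof -
 have [measurable]: "(\<lambda>p. F (shift (ennreal (snd p)) (fst p))) \<in> borel_measurable (NF \<Otimes>\<^sub>M lborel)"
  by (rule measurable_compose[OF shift_joint_measurable F])
 have "(\<lambda>p. time_below (leave D (fst p)) (snd p) *
  (ennreal (exp (- l * snd p)) * F (shift (ennreal (snd p)) (fst p)))) \<in> borel_measurable (NF \<Otimes>\<^sub>M lborel)"
  by measurable
 then show ?thesis unfolding pot_def by (intro lborel.borel_measurable_nn_integral) (simp add: case_prod_unfold)
qed

text \<open>Fubini and the Markov property at each fixed t; the event that the exit comes after t is
  known at time t and may serve as weight.\<close>

lemma R_path_expectation:
 assumes F [measurable]: "F \<in> borel_measurable NF"
  and F0: "\<And>w. w \<in> Om \<Longrightarrow> St 0 w = None \<Longrightarrow> F w = 0"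
 shows "R l D (\<lambda>x. \<integral>\<^sup>+w. F w \<partial>Pr (Some x)) x = (\<integral>\<^sup>+w. pot l D F w \<partial>Pr (Some x))"
proof -
 let ?f = "\<lambda>x. \<integral>\<^sup>+w. F w \<partial>Pr (Some x)"
 have f: "?f \<in> borel_fun" by (rule measurable_compose[OF Some_measurable expectation_measurable[OF F]])
 have Fs [measurable]: "(\<lambda>p. F (shift (ennreal (snd p)) (fst p))) \<in> borel_measurable (NF \<Otimes>\<^sub>M lborel)"
  by (rule measurable_compose[OF shift_joint_measurable F])
 have "R l D ?f x = (\<integral>\<^sup>+t. (\<integral>\<^sup>+w. res_density l D ?f w t \<partial>Pr (Some x)) \<partial>lborel)"
  unfolding R_def res_path_def by (rule Fubini_time[OF res_density_measurable[OF f]])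
 also have "\<dots> = (\<integral>\<^sup>+t. (\<integral>\<^sup>+w. time_below (leave D w) t * (ennreal (exp (- l * t)) * F (shift (ennreal t) w)) \<partial>Pr (Some x)) \<partial>lborel)"
 proof (rule nn_integral_cong)
  fix t :: real
  let ?W = "\<lambda>w. time_below (leave D w) t * ennreal (exp (- l * t))"
  have T: "stop (\<lambda>_. ennreal t)" by (rule stop_const)
  have "{w \<in> Om. ennreal t < leave D w} \<in> sets (pre_sigma (\<lambda>_. ennreal t))"
  proof (rule sets_pre_sigmaI[OF T])
   fix s
   have "{w\<in>Om. ennreal t < leave D w} \<in> sets (right_filtration Z (ennreal t))"
    using stopping_timeD2[OF leave_stop, of "ennreal t"] by (simp add: pred_def)
   then show "{w \<in> {w \<in> Om. ennreal t < leave D w}. ennreal t \<le> s} \<in> sets (right_filtration Z s)"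
    using sets_F_mono[of "ennreal t" s] by (cases "ennreal t \<le> s") auto
  qed
  then have [measurable]: "Measurable.pred (pre_sigma (\<lambda>_. ennreal t)) (\<lambda>w. ennreal t < leave D w)"
   by (simp add: pred_def space_pre_sigma)
  have W: "?W \<in> borel_measurable (pre_sigma (\<lambda>_. ennreal t))"
   unfolding time_below_def by measurable
  show "(\<integral>\<^sup>+w. res_density l D ?f w t \<partial>Pr (Some x)) =
    (\<integral>\<^sup>+w. time_below (leave D w) t * (ennreal (exp (- l * t)) * F (shift (ennreal t) w)) \<partial>Pr (Some x))"
   using strong_markov_weighted[OF T W F F0, of "Some x"] by (simp add: res_density_alt mult.assoc)
 qed
 also have "\<dots> = (\<integral>\<^sup>+w. pot l D F w \<partial>Pr (Some x))"
  unfolding pot_def by (rule Fubini_time[symmetric]) measurable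
 finally show ?thesis .
qed

text \<open>For a fixed path with exit time s the two discounts differ by the factor
  \<open>exp (- (b - a) * s)\<close>, and the integral over the times before s supplies its
  complement to 1. Written as a sum, since a difference of infinite values would be
  meaningless.\<close>

lemma H_resolvent:
 assumes g [measurable]: "g \<in> borel_fun" and ab: "a \<le> b"
 shows "H a D g x = H b D g x + ennreal (b - a) * R b D (H a D g) x"
proof (cases "a = b")
 case True then show ?thesis by simp
next
 case False
 then have ab: "0 < b - a" using ab by simp
 let ?p = "pot b D (exit_path a D g)"
 have "H a D g = (\<lambda>x. \<integral>\<^sup>+w. exit_path a D g w \<partial>Pr (Some x))" by (rule ext) (rule H_def)
 then have "R b D (H a D g) x = (\<integral>\<^sup>+w. ?p w \<partial>Pr (Some x))"
  using R_path_expectation[OF exit_path_measurable[OF g], of a D b D x] by (simp add: exit_path_outside ext0_def)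
 then have "H b D g x + ennreal (b - a) * R b D (H a D g) x = (\<integral>\<^sup>+w. exit_path b D g w + ennreal (b - a) * ?p w \<partial>Pr (Some x))"
  unfolding H_def[of b] by (subst nn_integral_add) (simp_all add: nn_integral_cmult)
 also have "\<dots> = H a D g x" unfolding H_def
 proof (rule nn_integral_cong)
  fix w assume "w \<in> space (Pr (Some x))"
  then have w: "w \<in> Om" by simp
  let ?S = "leave D w"
  have "?p w = (\<integral>\<^sup>+t. exit_path a D g w * (time_below ?S t * ennreal (exp (- (b - a) * t))) \<partial>lborel)"
   unfolding pot_def
  proof (rule nn_integral_cong)
   fix t :: real
   show "time_below ?S t * (ennreal (exp (- b * t)) * exit_path a D g (shift (ennreal t) w)) =
    exit_path a D g w * (time_below ?S t * ennreal (exp (- (b - a) * t)))"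
   proof (cases "0 \<le> t \<and> ennreal t < ?S")
    case True
    have "ennreal (exp (- b * t)) = ennreal (exp (- (b - a) * t)) * decay a (ennreal t)"
     using True by (simp add: decay_def ennreal_mult[symmetric] exp_add[symmetric] algebra_simps)
    then have "ennreal (exp (- b * t)) * exit_path a D g (shift (ennreal t) w) =
      ennreal (exp (- (b - a) * t)) * (decay a (ennreal t) * exit_path a D g (shift (ennreal t) w))"
     by (simp only: mult.assoc)
    then show ?thesis using exit_path_shift[OF w, of "ennreal t" D a g] True
     by (simp only: time_below_def if_True simp_thms mult_1_left mult.commute)
   qed (auto simp: time_below_def)
  qed
  also have "\<dots> = exit_path a D g w * (\<integral>\<^sup>+t. time_below ?S t * ennreal (exp (- (b - a) * t)) \<partial>lborel)"
   by (rule nn_integral_cmult) simp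
  finally have eq: "ennreal (b - a) * ?p w =
    exit_path a D g w * (ennreal (b - a) * (\<integral>\<^sup>+t. time_below ?S t * ennreal (exp (- (b - a) * t)) \<partial>lborel))"
   by (simp add: mult_ac)
  show "exit_path b D g w + ennreal (b - a) * ?p w = exit_path a D g w"
  proof (cases "?S")
   case top
   then show ?thesis unfolding eq using state_top[OF w] by (simp add: exit_path_def ext0_def)
  next
   case (real s)
   have 2: "ennreal (b - a) * (\<integral>\<^sup>+t. time_below ?S t * ennreal (exp (- (b - a) * t)) \<partial>lborel) = ennreal (1 - exp (- (b - a) * s))"
    using nn_integral_exp_below[OF ab, of s] real by simp
   have "decay b ?S = decay a ?S * ennreal (exp (- (b - a) * s))"
    using real by (simp add: decay_def ennreal_mult[symmetric] exp_add[symmetric] algebra_simps)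
   then have 1: "exit_path b D g w = exit_path a D g w * ennreal (exp (- (b - a) * s))"
    unfolding exit_path_def by (simp only: mult.assoc mult.commute[of "ext0 g _"])
   have "- (b - a) * s \<le> 0" using ab real by (simp add: mult_nonpos_nonneg)
   then have "ennreal (exp (- (b - a) * s)) + ennreal (1 - exp (- (b - a) * s)) =
     ennreal (exp (- (b - a) * s) + (1 - exp (- (b - a) * s)))" by (intro ennreal_plus[symmetric]) auto
   then have 3: "ennreal (exp (- (b - a) * s)) + ennreal (1 - exp (- (b - a) * s)) = 1" by simp
   show ?thesis unfolding eq 1 2 distrib_left[symmetric] 3 by simp
  qed
 qed
 finally show ?thesis ..
qed

text \<open>Exchanges the two time integrals: in the composed kernels an occupation at time v is
  counted once for every intermediate time t between 0 and v.\<close>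

lemma R_resolvent_aux:
 assumes f [measurable]: "f \<in> borel_fun"
 shows "R a D (R b D f) x = (\<integral>\<^sup>+w. (\<integral>\<^sup>+v. res_density b D f w v *
  (\<integral>\<^sup>+t. indicator {0..v} t * ennreal (exp ((b - a) * t)) \<partial>lborel) \<partial>lborel) \<partial>Pr (Some x))"
proof -
 have "R b D f = (\<lambda>x. \<integral>\<^sup>+w. res_path b D f w \<partial>Pr (Some x))" by (rule ext) (rule R_def)
 then have "R a D (R b D f) x = (\<integral>\<^sup>+w. pot a D (res_path b D f) w \<partial>Pr (Some x))"
  using R_path_expectation[OF res_path_measurable[OF f], of b D a D x] by (auto simp: res_path_zero)
 also have "\<dots> = (\<integral>\<^sup>+w. (\<integral>\<^sup>+v. res_density b D f w v *
  (\<integral>\<^sup>+t. indicator {0..v} t * ennreal (exp ((b - a) * t)) \<partial>lborel) \<partial>lborel) \<partial>Pr (Some x))"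
 proof (rule nn_integral_cong)
  fix w assume "w \<in> space (Pr (Some x))"
  then have w: "w \<in> Om" by simp
  note [measurable] = res_density_path_measurable[OF f w]
  have "pot a D (res_path b D f) w = (\<integral>\<^sup>+t. (\<integral>\<^sup>+v. indicator {0..} t * indicator {t..} v * ennreal (exp ((b - a) * t)) * res_density b D f w v \<partial>lborel) \<partial>lborel)"
   unfolding pot_def
  proof (rule nn_integral_cong)
   fix t :: real
   show "time_below (leave D w) t * (ennreal (exp (- a * t)) * res_path b D f (shift (ennreal t) w)) =
    (\<integral>\<^sup>+v. indicator {0..} t * indicator {t..} v * ennreal (exp ((b - a) * t)) * res_density b D f w v \<partial>lborel)"
   proof (cases "0 \<le> t \<and> ennreal t < leave D w")
    case True
    have "ennreal (exp (- a * t)) = ennreal (exp ((b - a) * t)) * decay b (ennreal t)"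
     using True by (simp add: decay_def ennreal_mult[symmetric] exp_add[symmetric] algebra_simps)
    then have "time_below (leave D w) t * (ennreal (exp (- a * t)) * res_path b D f (shift (ennreal t) w)) =
      ennreal (exp ((b - a) * t)) * (decay b (ennreal t) * res_path b D f (shift (ennreal t) w))"
     using True by (simp add: time_below_def mult.assoc)
    also have "\<dots> = ennreal (exp ((b - a) * t)) * (\<integral>\<^sup>+v. indicator {t..} v * res_density b D f w v \<partial>lborel)"
     using res_path_shift[OF w _ f refl, of t D b] True by simp
    also have "\<dots> = (\<integral>\<^sup>+v. ennreal (exp ((b - a) * t)) * (indicator {t..} v * res_density b D f w v) \<partial>lborel)"
     by (rule nn_integral_cmult[symmetric]) measurable
    also have "\<dots> = (\<integral>\<^sup>+v. indicator {0..} t * indicator {t..} v * ennreal (exp ((b - a) * t)) * res_density b D f w v \<partial>lborel)"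
     using True by (intro nn_integral_cong) (simp add: mult_ac)
    finally show ?thesis .
   next
    case False
    have z: "indicator {0..} t * indicator {t..} v * ennreal (exp ((b - a) * t)) * res_density b D f w v = 0" for v
    proof (cases "0 \<le> t \<and> t \<le> v")
     case True
     then have "\<not> ennreal v < leave D w" using False ennreal_leI[of t v] by (meson order_le_less_trans)
     then show ?thesis by (simp add: res_density_def)
    qed (auto simp: indicator_def)
    show ?thesis unfolding z using False by (auto simp: time_below_def)
   qed
  qed
  also have "\<dots> = (\<integral>\<^sup>+v. (\<integral>\<^sup>+t. indicator {0..} t * indicator {t..} v * ennreal (exp ((b - a) * t)) * res_density b D f w v \<partial>lborel) \<partial>lborel)"
  proof (rule lborel_pair.Fubini')
   have [measurable]: "(\<lambda>p. res_density b D f w (fst p)) \<in> borel_measurable (lborel \<Otimes>\<^sub>M lborel)"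
    by (rule measurable_compose[OF measurable_fst]) measurable
   have *: "indicator {t..} v = (if t \<le> v then 1 else 0 :: ennreal)" for t v :: real by simp
   show "(\<lambda>(v, t). indicator {0..} t * indicator {t..} v * ennreal (exp ((b - a) * t)) * res_density b D f w v)
     \<in> borel_measurable (lborel \<Otimes>\<^sub>M lborel)" unfolding case_prod_unfold * by measurable
  qed
  also have "\<dots> = (\<integral>\<^sup>+v. res_density b D f w v *
    (\<integral>\<^sup>+t. indicator {0..v} t * ennreal (exp ((b - a) * t)) \<partial>lborel) \<partial>lborel)"
  proof (rule nn_integral_cong)
   fix v :: real
   have "(\<integral>\<^sup>+t. indicator {0..} t * indicator {t..} v * ennreal (exp ((b - a) * t)) * res_density b D f w v \<partial>lborel) =
    (\<integral>\<^sup>+t. res_density b D f w v * (indicator {0..v} t * ennreal (exp ((b - a) * t))) \<partial>lborel)"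
    by (intro nn_integral_cong) (auto simp: indicator_def mult_ac)
   also have "\<dots> = res_density b D f w v * (\<integral>\<^sup>+t. indicator {0..v} t * ennreal (exp ((b - a) * t)) \<partial>lborel)"
    by (rule nn_integral_cmult) measurable
   finally show "(\<integral>\<^sup>+t. indicator {0..} t * indicator {t..} v * ennreal (exp ((b - a) * t)) * res_density b D f w v \<partial>lborel) = \<dots>" .
  qed
  finally show "pot a D (res_path b D f) w = \<dots>" .
 qed
 finally show ?thesis .
qed

lemma res_density_change:
 "ennreal (exp (c * v)) * res_density l D f w v = res_density (l - c) D f w v"
proof -
 have "ennreal (exp (- (l - c) * v)) = ennreal (exp (c * v)) * ennreal (exp (- l * v))"
  by (simp add: ennreal_mult[symmetric] exp_add[symmetric] algebra_simps)
 then show ?thesis unfolding res_density_def by (simp add: mult.assoc)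
qed

text \<open>The exponential integral is available for either sign of \<open>b - a\<close>. Thus one
  identity covers both orders of composition in \<open>R_resolvent\<close>.\<close>

lemma R_resolvent_aux2:
 assumes f [measurable]: "f \<in> borel_fun" and ab: "a \<noteq> b"
 shows "R (max a b) D f x + ennreal \<bar>b - a\<bar> * R a D (R b D f) x = R (min a b) D f x"
proof -
 define k where "k v = (\<integral>\<^sup>+t. indicator {0..v} t * ennreal (exp ((b - a) * t)) \<partial>lborel)" for v :: real
 have [measurable]: "k \<in> borel_fun"
 proof -
  have *: "indicator {0..v} t = (if 0 \<le> t \<and> t \<le> v then 1 else 0 :: ennreal)" for t v :: real by simp
  have "(\<lambda>(v, t). (if 0 \<le> t \<and> t \<le> v then 1 else 0) * ennreal (exp ((b - a) * t))) \<in> borel_measurable (borel \<Otimes>\<^sub>M lborel)"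
   unfolding case_prod_unfold by measurable
  then show ?thesis unfolding k_def * by (rule lborel.borel_measurable_nn_integral)
 qed
 have jm: "(\<lambda>p. res_density b D f (fst p) (snd p) * k (snd p)) \<in> borel_measurable (NF \<Otimes>\<^sub>M lborel)"
  using res_density_measurable[OF f] by measurable
 have [measurable]: "(\<lambda>w. \<integral>\<^sup>+v. res_density b D f w v * k v \<partial>lborel) \<in> borel_measurable NF"
  by (rule lborel.borel_measurable_nn_integral) (use jm in \<open>simp add: case_prod_unfold\<close>)
 note [measurable] = res_path_measurable[OF f]
 have "R (max a b) D f x + ennreal \<bar>b - a\<bar> * R a D (R b D f) x =
   (\<integral>\<^sup>+w. res_path (max a b) D f w + ennreal \<bar>b - a\<bar> * (\<integral>\<^sup>+v. res_density b D f w v * k v \<partial>lborel) \<partial>Pr (Some x))"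
  unfolding R_resolvent_aux[OF f] k_def[symmetric] R_def[of "max a b"]
  by (subst nn_integral_add) (auto simp: nn_integral_cmult)
 also have "\<dots> = (\<integral>\<^sup>+w. res_path (min a b) D f w \<partial>Pr (Some x))"
 proof (rule nn_integral_cong)
  fix w assume "w \<in> space (Pr (Some x))"
  then have w: "w \<in> Om" by simp
  note [measurable] = res_density_path_measurable[OF f w]
  have "res_path (max a b) D f w + ennreal \<bar>b - a\<bar> * (\<integral>\<^sup>+v. res_density b D f w v * k v \<partial>lborel) =
   (\<integral>\<^sup>+v. res_density (max a b) D f w v + ennreal \<bar>b - a\<bar> * (res_density b D f w v * k v) \<partial>lborel)"
   unfolding res_path_def by (subst nn_integral_add) (auto simp: nn_integral_cmult)
  also have "\<dots> = (\<integral>\<^sup>+v. res_density (min a b) D f w v \<partial>lborel)"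
  proof (rule nn_integral_cong)
   fix v :: real
   show "res_density (max a b) D f w v + ennreal \<bar>b - a\<bar> * (res_density b D f w v * k v) = res_density (min a b) D f w v"
   proof (cases "0 \<le> v")
    case False then show ?thesis by (simp add: res_density_def)
   next
    case True
    have k: "ennreal \<bar>b - a\<bar> * k v = ennreal \<bar>exp ((b - a) * v) - 1\<bar>"
     unfolding k_def by (rule nn_integral_exp_Icc) (use ab True in auto)
    have "res_density (max a b) D f w v = ennreal (exp ((b - max a b) * v)) * res_density b D f w v"
     by (simp add: res_density_change)
    then have "res_density (max a b) D f w v + ennreal \<bar>b - a\<bar> * (res_density b D f w v * k v) =
     (ennreal (exp ((b - max a b) * v)) + ennreal \<bar>exp ((b - a) * v) - 1\<bar>) * res_density b D f w v"
     unfolding k[symmetric] by (simp only: distrib_right mult.assoc mult.commute[of _ "k v"] mult.left_commute[of _ "k v"])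
    also have "ennreal (exp ((b - max a b) * v)) + ennreal \<bar>exp ((b - a) * v) - 1\<bar> = ennreal (exp ((b - min a b) * v))"
    proof (cases "a < b")
     case True
     then have "exp ((b - a) * v) \<ge> 1" using \<open>0 \<le> v\<close> by simp
     then have "ennreal 1 + ennreal (exp ((b - a) * v) - 1) = ennreal (1 + (exp ((b - a) * v) - 1))"
      by (intro ennreal_plus[symmetric]) auto
     then show ?thesis using True \<open>exp ((b - a) * v) \<ge> 1\<close> by simp
    next
     case False
     then have "(b - a) * v \<le> 0" using \<open>0 \<le> v\<close> by (simp add: mult_nonpos_nonneg)
     then have "exp ((b - a) * v) \<le> 1" by simp
     then have "ennreal (exp ((b - a) * v)) + ennreal (1 - exp ((b - a) * v)) = ennreal (exp ((b - a) * v) + (1 - exp ((b - a) * v)))"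
      by (intro ennreal_plus[symmetric]) auto
     then show ?thesis using False \<open>exp ((b - a) * v) \<le> 1\<close> by simp
    qed
    finally show ?thesis by (simp add: res_density_change)
   qed
  qed
  finally show "res_path (max a b) D f w + ennreal \<bar>b - a\<bar> * (\<integral>\<^sup>+v. res_density b D f w v * k v \<partial>lborel) =
   res_path (min a b) D f w" by (simp add: res_path_def)
 qed
 finally show ?thesis by (simp add: R_def)
qed

lemma R_resolvent:
 assumes f: "f \<in> borel_fun" and ab: "a \<le> b"
 shows "R a D f x = R b D f x + ennreal (b - a) * R b D (R a D f) x"
  and "R a D f x = R b D f x + ennreal (b - a) * R a D (R b D f) x"
proof -
 have "R a D f x = R b D f x + ennreal (b - a) * R b D (R a D f) x \<and>
   R a D f x = R b D f x + ennreal (b - a) * R a D (R b D f) x"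
 proof (cases "a = b")
  case False
  have "max a b = b" "max b a = b" "min a b = a" "min b a = a" "\<bar>b - a\<bar> = b - a" "\<bar>a - b\<bar> = b - a"
   using ab by auto
  then show ?thesis
   using R_resolvent_aux2[OF f False, of D x] R_resolvent_aux2[OF f not_sym[OF False], of D x] by simp
 qed simp
 then show "R a D f x = R b D f x + ennreal (b - a) * R b D (R a D f) x"
  "R a D f x = R b D f x + ennreal (b - a) * R a D (R b D f) x" by blast+
qed

section \<open>Order, linearity and monotone limits of the kernels\<close>

lemma res_density_mono:
 assumes "\<And>y. y \<in> D \<Longrightarrow> f y \<le> g y"
 shows "res_density l D f w t \<le> res_density l D g w t" using before_leave[of "ennreal t" D w] assms
 by (auto simp: res_density_def ext0_def intro!: mult_left_mono)

lemma R_mono: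
 assumes "\<And>y. y \<in> D \<Longrightarrow> f y \<le> g y" shows "R l D f x \<le> R l D g x"
 unfolding R_def res_path_def by (intro nn_integral_mono res_density_mono assms)

lemma R_cong:
 assumes "\<And>y. y \<in> D \<Longrightarrow> f y = g y" shows "R l D f x = R l D g x"
 by (intro antisym R_mono) (simp_all add: assms)

lemma R_add:
 assumes f [measurable]: "f \<in> borel_fun" and g [measurable]: "g \<in> borel_fun"
 shows "R l D (\<lambda>y. f y + g y) x = R l D f x + R l D g x"
proof -
 have "res_path l D (\<lambda>y. f y + g y) w = res_path l D f w + res_path l D g w" if w: "w \<in> Om" for w
 proof -
  have "res_density l D (\<lambda>y. f y + g y) w t = res_density l D f w t + res_density l D g w t" for t
   by (auto simp: res_density_def ext0_def distrib_left split: option.split)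
  then have "res_density l D (\<lambda>y. f y + g y) w = (\<lambda>t. res_density l D f w t + res_density l D g w t)"
   by (rule ext)
  then show ?thesis unfolding res_path_def
   using res_density_path_measurable[OF f w] res_density_path_measurable[OF g w]
   by (simp add: nn_integral_add)
 qed
 then have "R l D (\<lambda>y. f y + g y) x = (\<integral>\<^sup>+w. res_path l D f w + res_path l D g w \<partial>Pr (Some x))"
  unfolding R_def by (intro nn_integral_cong) simp
 also have "\<dots> = R l D f x + R l D g x" unfolding R_def by (rule nn_integral_add) measurable
 finally show ?thesis .
qed

lemma R_cmult:
 assumes f [measurable]: "f \<in> borel_fun"
 shows "R l D (\<lambda>y. c * f y) x = c * R l D f x"
proof -
 have "res_path l D (\<lambda>y. c * f y) w = c * res_path l D f w" if w: "w \<in> Om" for w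
 proof -
  have "res_density l D (\<lambda>y. c * f y) w t = c * res_density l D f w t" for t
   by (auto simp: res_density_def ext0_def mult_ac split: option.split)
  then have "res_density l D (\<lambda>y. c * f y) w = (\<lambda>t. c * res_density l D f w t)" by (rule ext)
  then show ?thesis unfolding res_path_def
   using res_density_path_measurable[OF f w] by (simp add: nn_integral_cmult)
 qed
 then have "R l D (\<lambda>y. c * f y) x = (\<integral>\<^sup>+w. c * res_path l D f w \<partial>Pr (Some x))"
  unfolding R_def by (intro nn_integral_cong) simp
 also have "\<dots> = c * R l D f x" unfolding R_def by (rule nn_integral_cmult) measurable
 finally show ?thesis .
qed

lemma R_zero [simp]: "R l D (\<lambda>y. 0) x = 0" using R_cmult[of "\<lambda>_. 0" l D 0 x] by simp

lemma R_SUP: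
 assumes f [measurable]: "\<And>i. F i \<in> borel_fun" and inc: "incseq F"
 shows "R l D (\<lambda>y. SUP i. F i y) x = (SUP i. R l D (F i) x)"
proof -
 have incd: "incseq (\<lambda>i. res_density l D (F i) w)" for w
  using inc by (auto simp: incseq_def le_fun_def intro!: res_density_mono)
 have 1: "res_path l D (\<lambda>y. SUP i. F i y) w = (SUP i. res_path l D (F i) w)" if w: "w \<in> Om" for w
 proof -
  have "res_density l D (\<lambda>y. SUP i. F i y) w t = (SUP i. res_density l D (F i) w t)" for t
   by (auto simp: res_density_def ext0_def SUP_mult_left_ennreal split: option.split)
  then have "res_path l D (\<lambda>y. SUP i. F i y) w = (\<integral>\<^sup>+t. (SUP i. res_density l D (F i) w t) \<partial>lborel)"
   by (simp add: res_path_def)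
  also have "\<dots> = (SUP i. res_path l D (F i) w)" unfolding res_path_def
   by (rule nn_integral_monotone_convergence_SUP[OF incd res_density_path_measurable[OF f w]])
  finally show ?thesis .
 qed
 have incp: "incseq (\<lambda>i. res_path l D (F i))"
  using incd by (auto simp: incseq_def le_fun_def res_path_def intro!: nn_integral_mono)
 have "R l D (\<lambda>y. SUP i. F i y) x = (\<integral>\<^sup>+w. (SUP i. res_path l D (F i) w) \<partial>Pr (Some x))"
  unfolding R_def using 1 by (intro nn_integral_cong) simp
 also have "\<dots> = (SUP i. R l D (F i) x)" unfolding R_def
  by (rule nn_integral_monotone_convergence_SUP[OF incp]) measurable
 finally show ?thesis .
qed

lemma H_mono:
 assumes "open D" "\<And>y. y \<notin> D \<Longrightarrow> f y \<le> g y" shows "H l D f x \<le> H l D g x"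
 unfolding H_def exit_path_def
proof (rule nn_integral_mono_AE)
 show "AE w in Pr (Some x). decay l (leave D w) * ext0 f (St (leave D w) w) \<le>
   decay l (leave D w) * ext0 g (St (leave D w) w)" using AE_state_leave[OF assms(1)]
 proof eventually_elim
  case (elim w)
  then show ?case using assms(2) by (cases "St (leave D w) w") (auto simp: ext0_def intro!: mult_left_mono)
 qed
qed

lemma H_cong:
 assumes "open D" "\<And>y. y \<notin> D \<Longrightarrow> f y = g y" shows "H l D f x = H l D g x"
 by (intro antisym H_mono assms(1)) (simp_all add: assms(2))

lemma H_add:
 assumes f [measurable]: "f \<in> borel_fun" and g [measurable]: "g \<in> borel_fun"
 shows "H l D (\<lambda>y. f y + g y) x = H l D f x + H l D g x"
proof -
 have "exit_path l D (\<lambda>y. f y + g y) w = exit_path l D f w + exit_path l D g w" for w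
  by (auto simp: exit_path_def ext0_def distrib_left split: option.split)
 then have "H l D (\<lambda>y. f y + g y) x = (\<integral>\<^sup>+w. exit_path l D f w + exit_path l D g w \<partial>Pr (Some x))"
  unfolding H_def by (auto intro!: nn_integral_cong simp del: of_nat_Suc)
 also have "\<dots> = H l D f x + H l D g x" unfolding H_def by (rule nn_integral_add) measurable
 finally show ?thesis .
qed

lemma H_cmult:
 assumes f [measurable]: "f \<in> borel_fun"
 shows "H l D (\<lambda>y. c * f y) x = c * H l D f x"
proof -
 have "exit_path l D (\<lambda>y. c * f y) w = c * exit_path l D f w" for w
  by (auto simp: exit_path_def ext0_def mult_ac split: option.split)
 then have "H l D (\<lambda>y. c * f y) x = (\<integral>\<^sup>+w. c * exit_path l D f w \<partial>Pr (Some x))"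
  unfolding H_def by (auto intro!: nn_integral_cong simp del: of_nat_Suc)
 also have "\<dots> = c * H l D f x" unfolding H_def by (rule nn_integral_cmult) measurable
 finally show ?thesis .
qed

lemma H_SUP:
 assumes f [measurable]: "\<And>i. F i \<in> borel_fun" and inc: "incseq F"
 shows "H l D (\<lambda>y. SUP i. F i y) x = (SUP i. H l D (F i) x)"
proof -
 have incp: "incseq (\<lambda>i. exit_path l D (F i))"
  using inc by (auto simp: incseq_def le_fun_def exit_path_def ext0_def intro!: mult_left_mono split: option.split)
 have "exit_path l D (\<lambda>y. SUP i. F i y) w = (SUP i. exit_path l D (F i) w)" for w
  by (auto simp: exit_path_def ext0_def SUP_mult_left_ennreal split: option.split)
 then have "H l D (\<lambda>y. SUP i. F i y) x = (\<integral>\<^sup>+w. (SUP i. exit_path l D (F i) w) \<partial>Pr (Some x))"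
  unfolding H_def by (auto intro!: nn_integral_cong simp del: of_nat_Suc)
 also have "\<dots> = (SUP i. H l D (F i) x)" unfolding H_def
  by (rule nn_integral_monotone_convergence_SUP[OF incp]) measurable
 finally show ?thesis .
qed

lemma R_mono_set:
 assumes "open D" "open D'" "D' \<subseteq> D" "f \<in> borel_fun"
 shows "R l D' f x \<le> R l D f x" unfolding R_decompose[OF assms, of l x] by simp

lemma R_antimono: "f \<in> borel_fun \<Longrightarrow> a \<le> b \<Longrightarrow> R b D f x \<le> R a D f x"
 using R_resolvent(1)[of f a b D x] by simp

lemma decay_le_1: "0 \<le> l \<Longrightarrow> decay l t \<le> 1" by (simp add: decay_def)

lemma H_le_const:
 assumes "open D" "0 \<le> l" "\<And>y. y \<notin> D \<Longrightarrow> f y \<le> c" shows "H l D f x \<le> c"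
proof -
 have "H l D f x \<le> H l D (\<lambda>_. c) x" by (rule H_mono) (use assms in auto)
 also have "\<dots> \<le> (\<integral>\<^sup>+w. c \<partial>Pr (Some x))" unfolding H_def exit_path_def
 proof (rule nn_integral_mono)
  fix w show "decay l (leave D w) * ext0 (\<lambda>_. c) (St (leave D w) w) \<le> c"
   using mult_mono[OF decay_le_1[OF assms(2), of "leave D w"], of "ext0 (\<lambda>_. c) (St (leave D w) w)" c]
   by (simp add: ext0_def split: option.split)
 qed
 also have "\<dots> = c" using prob_space.emeasure_space_1[OF prob_space_Pr, of "Some x"] by simp
 finally show ?thesis .
qed

text \<open>An independent clock of rate l rings either before or after the exit. Equality may fail
  because the exit can lead to the cemetery, where the function 1 is extended by 0.\<close>

lemma R_H_one:
 assumes D: "open D" and l: "0 < l"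
 shows "ennreal l * R l D (\<lambda>_. 1) x + H l D (\<lambda>_. 1) x \<le> 1"
proof -
 have "ennreal l * R l D (\<lambda>_. 1) x + H l D (\<lambda>_. 1) x =
   (\<integral>\<^sup>+w. ennreal l * res_path l D (\<lambda>_. 1) w + exit_path l D (\<lambda>_. 1) w \<partial>Pr (Some x))"
  unfolding R_def H_def by (subst nn_integral_add) (auto simp: nn_integral_cmult)
 also have "\<dots> \<le> (\<integral>\<^sup>+w. 1 \<partial>Pr (Some x))"
 proof (rule nn_integral_mono)
  fix w assume "w \<in> space (Pr (Some x))"
  then have w: "w \<in> Om" by simp
  have 1: "res_path l D (\<lambda>_. 1) w = (\<integral>\<^sup>+t. time_below (leave D w) t * ennreal (exp (- l * t)) \<partial>lborel)"
   unfolding res_path_def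
  proof (rule nn_integral_cong)
   fix t show "res_density l D (\<lambda>_. 1) w t = time_below (leave D w) t * ennreal (exp (- l * t))"
    using before_leave[of "ennreal t" D w] by (auto simp: res_density_def time_below_def ext0_def)
  qed
  show "ennreal l * res_path l D (\<lambda>_. 1) w + exit_path l D (\<lambda>_. 1) w \<le> 1"
  proof (cases "leave D w")
   case top
   then show ?thesis using nn_integral_exp_below_top[OF l] state_top[OF w]
    by (simp add: 1 exit_path_def ext0_def)
  next
   case (real s)
   have "ennreal l * res_path l D (\<lambda>_. 1) w = ennreal (1 - exp (- l * s))"
    using nn_integral_exp_below[OF l, of s] real by (simp add: 1)
   moreover have "exit_path l D (\<lambda>_. 1) w \<le> ennreal (exp (- l * s))"
    using real by (simp add: exit_path_def decay_def ext0_def split: option.split)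
   ultimately have "ennreal l * res_path l D (\<lambda>_. 1) w + exit_path l D (\<lambda>_. 1) w \<le>
     ennreal (1 - exp (- l * s)) + ennreal (exp (- l * s))" by (simp add: add_left_mono)
   also have "\<dots> = ennreal (1 - exp (- l * s) + exp (- l * s))"
   proof (rule ennreal_plus[symmetric])
    have "- l * s \<le> 0" using l real by (simp add: mult_nonpos_nonneg)
    then show "0 \<le> 1 - exp (- l * s)" by (simp only: diff_ge_0_iff_ge exp_le_one_iff)
   qed simp
   finally show ?thesis by simp
  qed
 qed
 also have "\<dots> = 1" using prob_space.emeasure_space_1[OF prob_space_Pr, of "Some x"] by simp
 finally show ?thesis .
qed

lemma SUP_exp: "0 \<le> s \<Longrightarrow> (SUP n. ennreal (exp (- (1 / real (Suc n)) * s))) = 1"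
proof (rule LIMSEQ_unique[OF LIMSEQ_SUP])
 assume s: "0 \<le> s"
 show "incseq (\<lambda>n. ennreal (exp (- (1 / real (Suc n)) * s)))"
 proof (rule incseq_SucI, intro ennreal_leI)
  fix n
  have "1 / real (Suc (Suc n)) \<le> 1 / real (Suc n)" by (simp add: frac_le)
  then have "1 / real (Suc (Suc n)) * s \<le> 1 / real (Suc n) * s" using s by (rule mult_right_mono)
  then show "exp (- (1 / real (Suc n)) * s) \<le> exp (- (1 / real (Suc (Suc n))) * s)" by simp
 qed
 have "(\<lambda>n. exp (- (1 / real (Suc n)) * s)) \<longlonglongrightarrow> exp (- 0 * s)"
  by (intro tendsto_intros LIMSEQ_Suc[OF lim_1_over_n])
 then show "(\<lambda>n. ennreal (exp (- (1 / real (Suc n)) * s))) \<longlonglongrightarrow> 1"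
  using tendsto_ennrealI by fastforce
qed

text \<open>Identities are proved for positive l, where potentials of bounded functions are finite,
  and reach \<open>l = 0\<close> through this monotone limit.\<close>

lemma H_0_SUP:
 assumes f [measurable]: "f \<in> borel_fun"
 shows "H 0 D f x = (SUP n. H (1 / real (Suc n)) D f x)"
proof -
 have inc: "incseq (\<lambda>n. exit_path (1 / real (Suc n)) D f)"
  unfolding incseq_def le_fun_def exit_path_def decay_def
  by (auto intro!: mult_right_mono ennreal_leI simp: frac_le)
 have "exit_path 0 D f w = (SUP n. exit_path (1 / real (Suc n)) D f w)" for w
  unfolding exit_path_def decay_def
  by (simp only: SUP_mult_right_ennreal[symmetric] SUP_exp[OF enn2real_nonneg]) simp
 then have "H 0 D f x = (\<integral>\<^sup>+w. (SUP n. exit_path (1 / real (Suc n)) D f w) \<partial>Pr (Some x))"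
  unfolding H_def by (auto intro!: nn_integral_cong simp del: of_nat_Suc)
 also have "\<dots> = (SUP n. H (1 / real (Suc n)) D f x)" unfolding H_def
  by (rule nn_integral_monotone_convergence_SUP[OF inc]) measurable
 finally show ?thesis .
qed

lemma R_0_SUP:
 assumes f [measurable]: "f \<in> borel_fun"
 shows "R 0 D f x = (SUP n. R (1 / real (Suc n)) D f x)"
proof -
 have incd: "incseq (\<lambda>n. res_density (1 / real (Suc n)) D f w)" for w
  unfolding incseq_def le_fun_def res_density_def by (auto intro!: mult_right_mono ennreal_leI simp: frac_le)
 have 1: "res_path 0 D f w = (SUP n. res_path (1 / real (Suc n)) D f w)" if w: "w \<in> Om" for w
 proof -
  have "res_density 0 D f w t = (SUP n. res_density (1 / real (Suc n)) D f w t)" for t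
  proof (cases "0 \<le> t \<and> ennreal t < leave D w")
   case True
   then have "(SUP n. res_density (1 / real (Suc n)) D f w t) =
     (SUP n. ennreal (exp (- (1 / real (Suc n)) * t))) * ext0 f (St (ennreal t) w)"
    by (simp only: res_density_def SUP_mult_right_ennreal if_True simp_thms)
   also have "\<dots> = res_density 0 D f w t" using True SUP_exp[of t] by (simp only:) (simp add: res_density_def)
   finally show ?thesis ..
  next
   case False
   then have "res_density l D f w t = 0" for l by (auto simp: res_density_def)
   then show ?thesis by simp
  qed
  then have "res_path 0 D f w = (\<integral>\<^sup>+t. (SUP n. res_density (1 / real (Suc n)) D f w t) \<partial>lborel)"
   by (simp add: res_path_def)
  also have "\<dots> = (SUP n. res_path (1 / real (Suc n)) D f w)" unfolding res_path_def
   by (rule nn_integral_monotone_convergence_SUP[OF incd res_density_path_measurable[OF f w]])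
  finally show ?thesis .
 qed
 have incp: "incseq (\<lambda>n. res_path (1 / real (Suc n)) D f)"
  using incd by (auto simp: incseq_def le_fun_def res_path_def intro!: nn_integral_mono)
 have "R 0 D f x = (\<integral>\<^sup>+w. (SUP n. res_path (1 / real (Suc n)) D f w) \<partial>Pr (Some x))"
  unfolding R_def using 1 by (intro nn_integral_cong) simp
 also have "\<dots> = (SUP n. R (1 / real (Suc n)) D f x)" unfolding R_def
  by (rule nn_integral_monotone_convergence_SUP[OF incp]) measurable
 finally show ?thesis .
qed

section \<open>Harmonic functions and Green potentials in terms of the kernels\<close>

lemma regular_harmonic_H:
 assumes D: "open D" and u: "regular_harmonic Z D u" and x: "x \<in> D"
 shows "ennreal (u x) = H 0 D (\<lambda>y. ennreal (u y)) x"
proof -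
 have e: "ennreal (ext0 u z) = ext0 (\<lambda>y. ennreal (u y)) z" for z by (simp add: ext0_def split: option.split)
 have "ennreal (u x) = (\<integral>\<^sup>+w. ennreal (ext0 u (St (exit_time Z D w) w)) \<partial>completion (Pr (Some x)))"
  using u x by (simp add: regular_harmonic_def)
 also have "\<dots> = (\<integral>\<^sup>+w. exit_path 0 D (\<lambda>y. ennreal (u y)) w \<partial>completion (Pr (Some x)))"
 proof (rule nn_integral_cong_AE, rule AE_completion)
  show "AE w in Pr (Some x). ennreal (ext0 u (St (exit_time Z D w) w)) = exit_path 0 D (\<lambda>y. ennreal (u y)) w"
   using AE_exit_time[OF D x] by eventually_elim (simp add: exit_path_def decay_def e)
 qed
 also have "\<dots> = H 0 D (\<lambda>y. ennreal (u y)) x" unfolding H_def by (rule nn_integral_completion)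
 finally show ?thesis .
qed

lemma killed_potential_R:
 assumes D: "open D" and x: "x \<in> D"
 shows "killed_potential Z D f x = R 0 D f x"
proof -
 have "killed_potential Z D f x = (\<integral>\<^sup>+w. res_path 0 D f w \<partial>completion (Pr (Some x)))"
  unfolding killed_potential_def
 proof (rule nn_integral_cong_AE, rule AE_completion)
  show "AE w in Pr (Some x). (\<integral>\<^sup>+t\<in>{t. 0 \<le> t \<and> ennreal t < exit_time Z D w}. ext0 f (St (ennreal t) w) \<partial>lborel)
    = res_path 0 D f w" using AE_exit_time[OF D x]
  proof eventually_elim
   case (elim w)
   show ?case unfolding res_path_def
    by (rule nn_integral_cong) (use elim in \<open>auto simp: res_density_def indicator_def\<close>)
  qed
 qed
 also have "\<dots> = R 0 D f x" unfolding R_def by (rule nn_integral_completion)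
 finally show ?thesis .
qed

end

section \<open>Dynkin's formula\<close>

lemma C0_bounded:
 assumes "f \<in> C0" obtains B where "0 < B" "\<And>x. \<bar>f x\<bar> \<le> B"
proof -
 have "continuous_on UNIV f" "compact {x. 1 \<le> \<bar>f x\<bar>}" using assms by (auto simp: C0_def)
 then have "compact (f ` {x. 1 \<le> \<bar>f x\<bar>})"
  using compact_continuous_image continuous_on_subset subset_UNIV by blast
 then have "bounded (f ` {x. 1 \<le> \<bar>f x\<bar>})" by (rule compact_imp_bounded)
 then obtain B where B: "\<forall>y \<in> f ` {x. 1 \<le> \<bar>f x\<bar>}. norm y \<le> B" unfolding bounded_iff by blast
 have "\<bar>f x\<bar> \<le> max B 1" for x
  using B by (cases "1 \<le> \<bar>f x\<bar>") (auto simp: le_max_iff_disj)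
 then show thesis by (intro that[of "max B 1"]) auto
qed

lemma C0_measurable: "f \<in> C0 \<Longrightarrow> f \<in> borel_fun"
 by (auto simp: C0_def intro: borel_measurable_continuous_onI)

lemma generates_unique:
 assumes "generates Z f g" "generates Z f g'" shows "g = g'"
proof
 fix x
 have "((\<lambda>t. (semigroup_op Z t f x - f x) / t) \<longlongrightarrow> g x) (at_right 0)"
  "((\<lambda>t. (semigroup_op Z t f x - f x) / t) \<longlongrightarrow> g' x) (at_right 0)"
  using assms by (auto simp: generates_def dest!: tendsto_uniform_limitI[where x = x])
 then show "g x = g' x" by (intro tendsto_unique[of "at_right (0::real)"]) auto
qed

lemma generates_gen: assumes "f \<in> gen_domain Z" shows "generates Z f (gen Z f)"
proof -
 obtain g where g: "generates Z f g" using assms by (auto simp: gen_domain_def)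
 then have "gen Z f = g" unfolding gen_def using generates_unique by (intro the_equality) auto
 with g show ?thesis by simp
qed

context hunt begin

section \<open>The semigroup and its Laplace transform\<close>

definition Q :: "real \<Rightarrow> ('a \<Rightarrow> ennreal) \<Rightarrow> 'a \<Rightarrow> ennreal" where
 "Q t f x = (\<integral>\<^sup>+w. ext0 f (St (ennreal t) w) \<partial>Pr (Some x))"

lemma semigroup_op_Q:
 assumes f [measurable]: "f \<in> borel_fun" and b: "\<And>x. 0 \<le> f x" "\<And>x. f x \<le> B"
 shows "Q t (\<lambda>y. ennreal (f y)) x = ennreal (semigroup_op Z t f x)" "0 \<le> semigroup_op Z t f x"
proof -
 interpret P: prob_space "Pr (Some x)" by (rule prob_space_Pr)
 have B: "0 \<le> B" using b[of x] by linarith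
 have bb: "0 \<le> ext0 f z \<and> ext0 f z \<le> B" for z using b B by (auto simp: ext0_def split: option.split)
 have m: "(\<lambda>w. ext0 f (St (ennreal t) w)) \<in> borel_measurable NF"
  by (rule measurable_compose[OF _ ext0_measurable[OF f]]) simp
 then have "integrable (Pr (Some x)) (\<lambda>w. ext0 f (St (ennreal t) w))"
  by (intro P.integrable_const_bound[where B = B]) (use bb in auto)
 from nn_integral_eq_integral[OF this]
 have "(\<integral>\<^sup>+w. ennreal (ext0 f (St (ennreal t) w)) \<partial>Pr (Some x)) = ennreal (semigroup_op Z t f x)"
  using bb by (simp add: semigroup_op_def)
 moreover have "ext0 (\<lambda>y. ennreal (f y)) z = ennreal (ext0 f z)" for z by (simp add: ext0_def split: option.split)
 ultimately show "Q t (\<lambda>y. ennreal (f y)) x = ennreal (semigroup_op Z t f x)" by (simp add: Q_def)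
 show "0 \<le> semigroup_op Z t f x" unfolding semigroup_op_def using bb by (intro integral_nonneg_AE) auto
qed

lemma state_ext0_measurable [measurable]:
 "f \<in> borel_fun \<Longrightarrow> (\<lambda>w. ext0 f (St s w)) \<in> borel_measurable NF"
 by (rule measurable_compose[OF _ ext0_measurable]) simp_all

lemma Q_measurable [measurable]: "f \<in> borel_fun \<Longrightarrow> Q t f \<in> borel_fun"
 unfolding Q_def by (rule measurable_compose[OF Some_measurable expectation_measurable[OF state_ext0_measurable]])

lemma Q_semigroup:
 assumes f: "f \<in> borel_fun" and t: "0 \<le> t" "0 \<le> h"
 shows "Q t (Q h f) x = Q (t + h) f x"
proof -
 have F0: "ext0 f (St (ennreal h) w) = 0" if "w \<in> Om" "St 0 w = None" for w
  using absorbed[OF that(1) _ that(2), of "ennreal h"] by (simp add: ext0_def)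
 have "Q t (Q h f) x = (\<integral>\<^sup>+w. ext0 f (St (ennreal h) (shift (ennreal t) w)) \<partial>Pr (Some x))"
  unfolding Q_def[of t] using strong_markov_weighted[OF stop_const[of "ennreal t"] borel_measurable_const[of 1] state_ext0_measurable[OF f] F0]
  by (simp add: Q_def[abs_def])
 also have "\<dots> = Q (t + h) f x" unfolding Q_def ennreal_plus[OF t] by (intro nn_integral_cong) simp
 finally show ?thesis .
qed

context
 fixes f :: "'a \<Rightarrow> ennreal"
 assumes f [measurable]: "f \<in> borel_fun"
begin

lemma state_ext0_joint [measurable]: "(\<lambda>p. ext0 f (St (ennreal (snd p)) (fst p))) \<in> borel_measurable (NF \<Otimes>\<^sub>M lborel)"
 by (rule measurable_compose[OF state_joint_NF ext0_measurable[OF f]])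

lemma Q_time_measurable [measurable]: "(\<lambda>t. Q t f x) \<in> borel_measurable lborel"
proof -
 interpret P: prob_space "Pr (Some x)" by (rule prob_space_Pr)
 have "sets (lborel \<Otimes>\<^sub>M Pr (Some x)) = sets (lborel \<Otimes>\<^sub>M NF)" by (intro sets_pair_measure_cong) simp_all
 moreover have "(\<lambda>p. ext0 f (St (ennreal (fst p)) (snd p))) \<in> borel_measurable (lborel \<Otimes>\<^sub>M NF)"
  using measurable_compose[OF measurable_pair_swap' state_ext0_joint] by (simp add: case_prod_unfold)
 ultimately show ?thesis unfolding Q_def
  by (intro P.borel_measurable_nn_integral) (simp add: case_prod_unfold cong: measurable_cong_sets)
qed

lemma U_alt: "R l UNIV f x = (\<integral>\<^sup>+t. time_below \<top> t * (ennreal (exp (- l * t)) * Q t f x) \<partial>lborel)"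
proof -
 have tb: "time_below \<top> t = (if 0 \<le> t then 1 else 0)" for t by (simp add: time_below_def)
 have "R l UNIV f x = (\<integral>\<^sup>+w. (\<integral>\<^sup>+t. time_below \<top> t * (ennreal (exp (- l * t)) * ext0 f (St (ennreal t) w)) \<partial>lborel) \<partial>Pr (Some x))"
  unfolding R_def res_path_def
 proof (rule nn_integral_cong_AE)
  show "AE w in Pr (Some x). (\<integral>\<^sup>+t. res_density l UNIV f w t \<partial>lborel) =
    (\<integral>\<^sup>+t. time_below \<top> t * (ennreal (exp (- l * t)) * ext0 f (St (ennreal t) w)) \<partial>lborel)"
   using AE_state_leave[OF open_UNIV] AE_space
  proof eventually_elim
   case (elim w)
   then have "St (leave UNIV w) w = None" by (cases "St (leave UNIV w) w") auto
   then have None: "St t w = None" if "leave UNIV w \<le> t" for t using absorbed that elim by simp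
   show ?case
   proof (rule nn_integral_cong)
    fix t :: real
    show "res_density l UNIV f w t = time_below \<top> t * (ennreal (exp (- l * t)) * ext0 f (St (ennreal t) w))"
     using None[of "ennreal t"] by (cases "ennreal t < leave UNIV w") (auto simp: res_density_def time_below_def ext0_def)
   qed
  qed
 qed
 also have "\<dots> = (\<integral>\<^sup>+t. (\<integral>\<^sup>+w. time_below \<top> t * (ennreal (exp (- l * t)) * ext0 f (St (ennreal t) w)) \<partial>Pr (Some x)) \<partial>lborel)"
  unfolding tb by (rule Fubini_time) measurable
 also have "\<dots> = (\<integral>\<^sup>+t. time_below \<top> t * (ennreal (exp (- l * t)) * Q t f x) \<partial>lborel)"
  unfolding Q_def mult.assoc[symmetric] by (intro nn_integral_cong nn_integral_cmult) simp
 finally show ?thesis .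
qed

end

text \<open>Splitting at time h produces the transform of \<open>Q h f\<close>, and with it the
  difference quotient of the semigroup.\<close>

lemma U_split:
 assumes f: "f \<in> borel_fun" and h: "0 < h"
 shows "R l UNIV f x = ennreal (exp (- l * h)) * R l UNIV (Q h f) x +
  (\<integral>\<^sup>+t. indicator {0<..<h} t * (ennreal (exp (- l * t)) * Q t f x) \<partial>lborel)"
proof -
 define \<phi> where "\<phi> t = ennreal (exp (- l * t)) * Q t f x" for t
 note [measurable] = Q_time_measurable[OF f] Q_time_measurable[OF Q_measurable[OF f]]
 have \<phi>m [measurable]: "\<phi> \<in> borel_fun" unfolding \<phi>_def by measurable
 have tb: "time_below \<top> t = (if 0 \<le> t then 1 else 0)" for t by (simp add: time_below_def)
 have "R l UNIV f x = (\<integral>\<^sup>+t. indicator {h..} t * \<phi> t + indicator {0<..<h} t * \<phi> t \<partial>lborel)"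
  unfolding U_alt[OF f] \<phi>_def[symmetric]
 proof (rule nn_integral_cong_AE)
  have "AE t in lborel. t \<noteq> (0::real)" by (rule AE_lborel_singleton)
  then show "AE t in lborel. time_below \<top> t * \<phi> t = indicator {h..} t * \<phi> t + indicator {0<..<h} t * \<phi> t"
   by eventually_elim (use h in \<open>auto simp: tb indicator_def\<close>)
 qed
 also have "\<dots> = (\<integral>\<^sup>+t. indicator {h..} t * \<phi> t \<partial>lborel) + (\<integral>\<^sup>+t. indicator {0<..<h} t * \<phi> t \<partial>lborel)"
  by (rule nn_integral_add) measurable
 also have "(\<integral>\<^sup>+t. indicator {h..} t * \<phi> t \<partial>lborel) = (\<integral>\<^sup>+t. indicator {h..} (h + t) * \<phi> (h + t) \<partial>lborel)"
  using nn_integral_real_affine[of "\<lambda>t. indicator {h..} t * \<phi> t" 1 h] by simp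
 also have "\<dots> = (\<integral>\<^sup>+t. ennreal (exp (- l * h)) * (time_below \<top> t * (ennreal (exp (- l * t)) * Q t (Q h f) x)) \<partial>lborel)"
 proof (rule nn_integral_cong)
  fix t :: real
  have "ennreal (exp (- l * (h + t))) = ennreal (exp (- l * h)) * ennreal (exp (- l * t))"
   by (simp add: ennreal_mult[symmetric] exp_add[symmetric] algebra_simps)
  then show "indicator {h..} (h + t) * \<phi> (h + t) =
    ennreal (exp (- l * h)) * (time_below \<top> t * (ennreal (exp (- l * t)) * Q t (Q h f) x))"
   using Q_semigroup[OF f, of t h x] h by (cases "0 \<le> t") (simp_all add: tb \<phi>_def mult.assoc add.commute[of h])
 qed
 also have "\<dots> = ennreal (exp (- l * h)) * R l UNIV (Q h f) x"
  unfolding U_alt[OF Q_measurable[OF f]] by (rule nn_integral_cmult) measurable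
 finally show ?thesis unfolding \<phi>_def .
qed

lemma U_bounded:
 assumes "0 < l" "\<And>y. f y \<le> ennreal B" shows "R l UNIV f x \<le> ennreal (B / l)"
proof -
 have "ennreal l * R l UNIV (\<lambda>_. 1) x \<le> 1"
  using R_H_one[OF open_UNIV assms(1), of x] by (meson add_increasing2 order_refl order_trans zero_le le_add1 dual_order.trans le_iff_add)
 then have one: "R l UNIV (\<lambda>_. 1) x \<le> ennreal (1 / l)"
  using assms(1) by (cases "R l UNIV (\<lambda>_. 1) x")
   (auto simp: ennreal_mult[symmetric] ennreal_mult_top top_unique field_simps ennreal_1[symmetric] simp del: ennreal_1)
 have "R l UNIV f x \<le> R l UNIV (\<lambda>y. ennreal B * 1) x" by (rule R_mono) (use assms in simp)
 also have "\<dots> = ennreal B * R l UNIV (\<lambda>_. 1) x" by (rule R_cmult) simp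
 also have "\<dots> \<le> ennreal B * ennreal (1 / l)" by (intro mult_left_mono one) simp
 also have "\<dots> \<le> ennreal (B / l)"
 proof (cases "0 \<le> B")
  case True then show ?thesis using assms(1) by (simp add: ennreal_mult[symmetric])
 qed (simp add: ennreal_neg)
 finally show ?thesis .
qed

text \<open>The resolvent equation for the generator is obtained from difference quotients of the
 Laplace transform, which avoids differentiating the semigroup.\<close>

lemma U_generator:
 assumes gen: "generates Z f g" and f0: "\<And>y. 0 \<le> f y" and fel: "feller Z" and l: "0 < l"
 shows "ennreal (f x) + R l UNIV (\<lambda>y. ennreal (g y)) x =
  R l UNIV (\<lambda>y. ennreal (l * f y) + ennreal (- g y)) x"
proof -
 have fC: "f \<in> C0" and gC: "g \<in> C0"
  and ul: "uniform_limit UNIV (\<lambda>t x. (semigroup_op Z t f x - f x) / t) g (at_right 0)"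
  using gen by (auto simp: generates_def)
 obtain B where B: "0 < B" "\<And>x. \<bar>f x\<bar> \<le> B" using C0_bounded[OF fC] by blast
 obtain C where C: "0 < C" "\<And>x. \<bar>g x\<bar> \<le> C" using C0_bounded[OF gC] by blast
 note [measurable] = C0_measurable[OF fC] C0_measurable[OF gC]
 define F where "F = (\<lambda>y. ennreal (f y))"
 define Gp where "Gp = (\<lambda>y. ennreal (g y))"
 define Gm where "Gm = (\<lambda>y. ennreal (- g y))"
 have [measurable]: "F \<in> borel_fun" "Gp \<in> borel_fun" "Gm \<in> borel_fun"
  unfolding F_def Gp_def Gm_def by measurable
 let ?U = "\<lambda>f. R l UNIV f x"
 have fB: "f y \<le> B" for y using B(2)[of y] by linarith
 have PB: "semigroup_op Z h f y \<le> B" "0 \<le> semigroup_op Z h f y" for h y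
 proof -
  show "0 \<le> semigroup_op Z h f y" by (rule semigroup_op_Q(2)[OF C0_measurable[OF fC] f0 fB])
  have "ennreal (semigroup_op Z h f y) = Q h F y"
   unfolding F_def by (rule semigroup_op_Q(1)[OF C0_measurable[OF fC] f0 fB, symmetric])
  also have "\<dots> \<le> (\<integral>\<^sup>+w. ennreal B \<partial>Pr (Some y))"
   unfolding Q_def by (intro nn_integral_mono) (use fB B in \<open>auto simp: F_def ext0_def intro!: ennreal_leI split: option.split\<close>)
  also have "\<dots> = ennreal B" using prob_space.emeasure_space_1[OF prob_space_Pr, of "Some y"] by simp
  finally show "semigroup_op Z h f y \<le> B" using B(1) by (simp add: ennreal_le_iff)
 qed
 have QF: "Q h F y = ennreal (semigroup_op Z h f y)" for h y
  unfolding F_def by (rule semigroup_op_Q(1)[OF C0_measurable[OF fC] f0 fB])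
 have fin: "\<exists>r\<ge>0. ?U k = ennreal r" if "\<And>y. k y \<le> ennreal K" for k K
 proof -
  have "?U k \<le> ennreal (K / l)" by (rule U_bounded[OF l that])
  then have "?U k < \<top>" using ennreal_less_top le_less_trans by blast
  then show ?thesis by (cases "?U k") auto
 qed
 have Fy: "F y = ennreal (f y)" for y by (simp add: F_def)
 obtain a where a: "0 \<le> a" "?U F = ennreal a" using fin[of F B] fB by (auto simp: F_def intro!: ennreal_leI)
 obtain p where p: "0 \<le> p" "?U Gp = ennreal p"
  using fin[of Gp C] C(2) by (auto simp: Gp_def abs_le_iff intro!: ennreal_leI)
 obtain q where q: "0 \<le> q" "?U Gm = ennreal q"
  using fin[of Gm C] C(2) by (auto simp: Gm_def abs_le_iff intro!: ennreal_leI)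
 have "\<exists>b\<ge>0. ?U (Q h F) = ennreal b" for h using fin[of "Q h F" B] PB by (auto simp: QF intro!: ennreal_leI)
 then obtain b where b: "\<And>h. 0 \<le> b h" "\<And>h. ?U (Q h F) = ennreal (b h)" by metis
 \<comment> \<open>By \<open>U_split\<close> this is the part of the integral over the times below
   h. Both transforms are finite, so real subtraction is legitimate.\<close>
 define I where "I h = (a - exp (- l * h) * b h)" for h
 have I: "ennreal (I h) = (\<integral>\<^sup>+t. indicator {0<..<h} t * (ennreal (exp (- l * t)) * Q t F x) \<partial>lborel)" "0 \<le> I h"
  if h: "0 < h" for h
 proof -
  define j where "j = (\<integral>\<^sup>+t. indicator {0<..<h} t * (ennreal (exp (- l * t)) * Q t F x) \<partial>lborel)"
  have "ennreal a = ennreal (exp (- l * h) * b h) + j"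
   using U_split[OF \<open>F \<in> _\<close> h, of l x] by (simp add: a b j_def ennreal_mult b(1))
  then have "j < \<top>" using ennreal_less_top[of a] by (auto simp: less_top)
  then obtain j' where j': "j = ennreal j'" "0 \<le> j'" by (cases j) auto
  have "ennreal a = ennreal (exp (- l * h) * b h + j')"
   using \<open>ennreal a = _\<close> j' b(1)[of h] by (simp add: ennreal_plus)
  then have "a = exp (- l * h) * b h + j'" using a b(1)[of h] j' by (subst (asm) ennreal_inj) auto
  then have "I h = j'" by (simp add: I_def)
  then show "ennreal (I h) = (\<integral>\<^sup>+t. indicator {0<..<h} t * (ennreal (exp (- l * t)) * Q t F x) \<partial>lborel)" "0 \<le> I h"
   using j' by (auto simp: j_def)
 qed
 have "((\<lambda>v. semigroup_op Z v f x) \<longlongrightarrow> f x) (at_right 0)"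
  using fel fC by (auto simp: feller_def dest!: bspec[where x = f] tendsto_uniform_limitI[where x = x])
 moreover have "((\<lambda>v. exp (- l * v)) \<longlongrightarrow> exp (- l * 0)) (at_right 0)" by (intro tendsto_intros)
 ultimately have lim: "((\<lambda>v. exp (- l * v) * semigroup_op Z v f x) \<longlongrightarrow> f x) (at_right 0)"
  using tendsto_mult by fastforce
 \<comment> \<open>The mean over (0, h) of a function that tends to \<open>f x\<close> at 0.\<close>
 have limI: "((\<lambda>h. I h / h) \<longlongrightarrow> f x) (at_right 0)"
 proof (rule tendstoI)
  fix e :: real assume "e > 0"
  then have "\<forall>\<^sub>F v in at_right 0. dist (exp (- l * v) * semigroup_op Z v f x) (f x) < e / 2"
   using tendstoD[OF lim, of "e/2"] by simp
  then obtain d where d: "d > 0" "\<And>v. 0 < v \<Longrightarrow> v < d \<Longrightarrow> \<bar>exp (- l * v) * semigroup_op Z v f x - f x\<bar> < e / 2"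
   unfolding eventually_at_right_field dist_real_def by auto
  have "\<bar>I h / h - f x\<bar> < e" if h: "0 < h" "h < d" for h
  proof -
   have val: "ennreal (exp (- l * t)) * Q t F x = ennreal (exp (- l * t) * semigroup_op Z t f x)" for t
    using PB(2)[of t x] by (simp add: QF ennreal_mult)
   have near: "exp (- l * t) * semigroup_op Z t f x \<le> f x + e / 2"
     "f x - e / 2 \<le> exp (- l * t) * semigroup_op Z t f x" if "0 < t" "t < h" for t
    using d(2)[of t] that h by linarith+
   have "ennreal (I h) \<le> (\<integral>\<^sup>+t. ennreal (f x + e / 2) * indicator {0<..<h} t \<partial>lborel)"
    unfolding I(1)[OF h(1)] val
   proof (rule nn_integral_mono)
    fix t show "indicator {0<..<h} t * ennreal (exp (- l * t) * semigroup_op Z t f x) \<le> ennreal (f x + e / 2) * indicator {0<..<h} t"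
     using near[of t] by (auto simp: indicator_def intro!: ennreal_leI)
   qed
   also have "\<dots> = ennreal ((f x + e / 2) * h)"
    using h f0[of x] \<open>e > 0\<close> by (subst nn_integral_cmult_indicator) (auto simp: ennreal_mult)
   finally have up: "I h \<le> (f x + e / 2) * h"
    using h f0[of x] \<open>e > 0\<close> by (subst (asm) ennreal_le_iff) auto
   have "ennreal ((f x - e / 2) * h) \<le> (\<integral>\<^sup>+t. ennreal (f x - e / 2) * indicator {0<..<h} t \<partial>lborel)"
   proof (cases "0 \<le> f x - e / 2")
    case True then show ?thesis using h by (subst nn_integral_cmult_indicator) (auto simp: ennreal_mult)
   next
    case False
    then have "(f x - e / 2) * h \<le> 0" using h by (simp add: mult_nonpos_nonneg)
    then show ?thesis by (simp add: ennreal_neg)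
   qed
   also have "\<dots> \<le> ennreal (I h)" unfolding I(1)[OF h(1)] val
   proof (rule nn_integral_mono)
    fix t show "ennreal (f x - e / 2) * indicator {0<..<h} t \<le> indicator {0<..<h} t * ennreal (exp (- l * t) * semigroup_op Z t f x)"
     using near[of t] by (auto simp: indicator_def intro!: ennreal_leI)
   qed
   finally have lo: "(f x - e / 2) * h \<le> I h" using I(2)[OF h(1)] by (subst (asm) ennreal_le_iff) auto
   have "I h / h \<le> f x + e / 2" "f x - e / 2 \<le> I h / h" using up lo h by (auto simp: field_simps)
   then show ?thesis using \<open>e > 0\<close> by linarith
  qed
  then show "\<forall>\<^sub>F h in at_right 0. dist (I h / h) (f x) < e"
   unfolding eventually_at_right_field dist_real_def using d(1) by blast
 qed
 \<comment> \<open>Uniform convergence of the difference quotients passes through the resolvent,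
   whose total mass is at most 1/l.\<close>
 have lim1: "((\<lambda>h. (b h - a) / h) \<longlongrightarrow> p - q) (at_right 0)"
 proof (rule tendstoI)
  fix e :: real assume e: "e > 0"
  define e' where "e' = e * l / 2"
  have e': "e' > 0" using e l by (simp add: e'_def)
  have "\<forall>\<^sub>F h in at_right 0. \<forall>y. dist ((semigroup_op Z h f y - f y) / h) (g y) < e'"
   using uniform_limitD[OF ul e'] by simp
  then obtain d where d: "d > 0" "\<And>h y. 0 < h \<Longrightarrow> h < d \<Longrightarrow> \<bar>(semigroup_op Z h f y - f y) / h - g y\<bar> < e'"
   unfolding eventually_at_right_field dist_real_def by auto
  have "\<bar>(b h - a) / h - (p - q)\<bar> < e" if h: "0 < h" "h < d" for h
  proof -
   have near: "semigroup_op Z h f y \<le> f y + h * g y + h * e' \<and> f y + h * g y \<le> semigroup_op Z h f y + h * e'" for y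
   proof -
    define r where "r = (semigroup_op Z h f y - f y) / h"
    have "semigroup_op Z h f y = f y + h * r" using h by (simp add: r_def)
    moreover have "\<bar>r - g y\<bar> < e'" using d(2)[OF h, of y] by (simp add: r_def)
    then have "h * r \<le> h * (g y + e')" "h * g y \<le> h * (r + e')"
     using h by (auto intro!: mult_left_mono)
    ultimately show ?thesis by (simp add: distrib_left)
   qed
   \<comment> \<open>\<open>ennreal\<close> cuts off negative numbers, so g enters through its
     positive and negative parts on opposite sides; this is the real inequality in that
     form.\<close>
   have pm: "ennreal u + ennreal h * ennreal (- v) \<le> ennreal u' + ennreal h * ennreal v + ennreal (h * e') * 1"
    if u: "0 \<le> u" "0 \<le> u'" "u \<le> u' + h * v + h * e'" for u u' v
   proof (cases "0 \<le> v")
    case True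
    then show ?thesis using u h e'
     by (simp add: ennreal_neg ennreal_mult[symmetric] ennreal_plus[symmetric] ennreal_leI del: ennreal_plus)
   next
    case False
    then have "h * v \<le> 0" using h by (simp add: mult_nonneg_nonpos)
    then show ?thesis using False u h e'
     by (simp add: ennreal_neg ennreal_mult[symmetric] ennreal_plus[symmetric] ennreal_leI mult_nonneg_nonpos del: ennreal_plus)
   qed
   have up: "Q h F y + ennreal h * Gm y \<le> F y + ennreal h * Gp y + ennreal (h * e') * 1" for y
    unfolding QF Fy Gp_def Gm_def by (rule pm) (use near[of y] f0[of y] PB(2)[of h y] in auto)
   have lo: "F y + ennreal h * Gp y \<le> Q h F y + ennreal h * Gm y + ennreal (h * e') * 1" for y
    using pm[of "f y" "semigroup_op Z h f y" "- g y"] near[of y] f0[of y] PB(2)[of h y]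
    by (simp add: QF Fy Gp_def Gm_def)
   have one: "?U (\<lambda>_. 1) \<le> ennreal (1 / l)" using U_bounded[OF l, of "\<lambda>_. 1" 1 x] by simp
   have e1: "ennreal (h * e') * ?U (\<lambda>_. 1) \<le> ennreal (h * e' / l)"
   proof -
    have "ennreal (h * e') * ?U (\<lambda>_. 1) \<le> ennreal (h * e') * ennreal (1 / l)" by (intro mult_left_mono one) simp
    also have "\<dots> = ennreal (h * e' / l)" using h e' l by (simp add: ennreal_mult[symmetric])
    finally show ?thesis .
   qed
   have "?U (Q h F) + ennreal h * ?U Gm \<le> ?U F + ennreal h * ?U Gp + ennreal (h * e') * ?U (\<lambda>_. 1)"
    using R_mono[of UNIV "\<lambda>y. Q h F y + ennreal h * Gm y" "\<lambda>y. F y + ennreal h * Gp y + ennreal (h * e') * 1" l x, OF up]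
    by (simp add: R_add R_cmult del: mult_1_right)
   also have "\<dots> \<le> ?U F + ennreal h * ?U Gp + ennreal (h * e' / l)" by (intro add_left_mono e1)
   finally have 1: "b h + h * q \<le> a + h * p + h * e' / l"
    using a p q b(1)[of h] h e' l by (simp add: b(2) ennreal_mult[symmetric] ennreal_plus[symmetric] ennreal_le_iff del: ennreal_plus)
   have "?U F + ennreal h * ?U Gp \<le> ?U (Q h F) + ennreal h * ?U Gm + ennreal (h * e') * ?U (\<lambda>_. 1)"
    using R_mono[of UNIV "\<lambda>y. F y + ennreal h * Gp y" "\<lambda>y. Q h F y + ennreal h * Gm y + ennreal (h * e') * 1" l x, OF lo]
    by (simp add: R_add R_cmult del: mult_1_right)
   also have "\<dots> \<le> ?U (Q h F) + ennreal h * ?U Gm + ennreal (h * e' / l)" by (intro add_left_mono e1)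
   finally have 2: "a + h * p \<le> b h + h * q + h * e' / l"
    using a p q b(1)[of h] h e' l by (simp add: b(2) ennreal_mult[symmetric] ennreal_plus[symmetric] ennreal_le_iff del: ennreal_plus)
   have el: "h * e' / l = h * (e / 2)" using l by (simp add: e'_def)
   have "b h - a \<le> ((p - q) + e / 2) * h" "((p - q) - e / 2) * h \<le> b h - a"
    using 1 2 unfolding el by (simp_all add: algebra_simps)
   then have "(b h - a) / h \<le> (p - q) + e / 2" "(p - q) - e / 2 \<le> (b h - a) / h"
    using h(1) by (simp_all only: pos_divide_le_eq pos_le_divide_eq)
   then show ?thesis using e by linarith
  qed
  then show "\<forall>\<^sub>F h in at_right 0. dist ((b h - a) / h) (p - q) < e"
   unfolding eventually_at_right_field dist_real_def using d(1) by blast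
 qed
 \<comment> \<open>Solving the definition of I for \<open>b h\<close> expresses the quotient of
   \<open>lim1\<close> through \<open>I h / h\<close> and a derivative of the exponential; equality
   of the two limits is the resolvent equation.\<close>
 have "((\<lambda>h. exp (l * h)) has_real_derivative l * exp (l * 0)) (at 0)"
  by (auto intro!: derivative_eq_intros)
 then have "((\<lambda>h. (exp (l * h) - 1) / h) \<longlongrightarrow> l) (at 0)" by (simp add: has_field_derivative_iff)
 then have "((\<lambda>h. (exp (l * h) - 1) / h) \<longlongrightarrow> l) (at_right 0)"
  by (rule filterlim_mono) (simp_all add: at_le)
 moreover have "((\<lambda>h. exp (l * h)) \<longlongrightarrow> exp (l * 0)) (at_right 0)" by (intro tendsto_intros)
 ultimately have "((\<lambda>h. (exp (l * h) - 1) / h * a - exp (l * h) * (I h / h)) \<longlongrightarrow> l * a - exp (l * 0) * f x) (at_right 0)"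
  using limI by (intro tendsto_intros)
 moreover have "(exp (l * h) - 1) / h * a - exp (l * h) * (I h / h) = (b h - a) / h" for h
 proof -
  have "exp (l * h) * exp (- l * h) = 1" by (simp add: exp_add[symmetric])
  then have "exp (l * h) * I h = exp (l * h) * a - b h"
   unfolding I_def by (simp add: right_diff_distrib mult.assoc[symmetric])
  then show ?thesis by (simp add: diff_divide_distrib[symmetric] left_diff_distrib)
 qed
 ultimately have "((\<lambda>h. (b h - a) / h) \<longlongrightarrow> l * a - f x) (at_right 0)" by simp
 from tendsto_unique[OF _ this lim1] have "l * a - f x = p - q" by simp
 then have eq: "f x + p = l * a + q" by simp
 have "?U (\<lambda>y. ennreal (l * f y) + ennreal (- g y)) = ?U (\<lambda>y. ennreal l * F y + Gm y)"
  using l f0 by (simp add: F_def Gm_def ennreal_mult)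
 also have "\<dots> = ennreal l * ?U F + ?U Gm" by (simp add: R_add R_cmult)
 also have "\<dots> = ennreal (f x) + ?U Gp"
  using eq a p q l f0[of x] by (simp add: ennreal_mult[symmetric] ennreal_plus[symmetric] del: ennreal_plus)
 finally show ?thesis by (simp add: Gp_def)
qed

text \<open>Both sides of the resolvent equation on the whole space are decomposed at the exit from
  D; the common term is finite, since the generator is bounded, and cancels. The negative part of
  the generator stands on the right, so that no subtraction occurs.\<close>

theorem dynkin:
 assumes D: "open D" and f: "f \<in> gen_domain Z" and f0: "\<And>y. 0 \<le> f y" and fel: "feller Z" and l: "0 < l"
 shows "ennreal (f x) + R l D (\<lambda>y. ennreal (gen Z f y)) x =
  R l D (\<lambda>y. ennreal (l * f y) + ennreal (- gen Z f y)) x + H l D (\<lambda>y. ennreal (f y)) x"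
proof -
 define g where "g = gen Z f"
 have gen: "generates Z f g" unfolding g_def by (rule generates_gen[OF f])
 then have gC: "g \<in> C0" and fC: "f \<in> C0" by (auto simp: generates_def)
 obtain C where C: "0 < C" "\<And>x. \<bar>g x\<bar> \<le> C" using C0_bounded[OF gC] by blast
 note [measurable] = C0_measurable[OF fC] C0_measurable[OF gC]
 let ?G = "\<lambda>y. ennreal (g y)" and ?K = "\<lambda>y. ennreal (l * f y) + ennreal (- g y)"
 have dec: "R l UNIV k y = R l D k y + H l D (R l UNIV k) y" if "k \<in> borel_fun" for k y
  by (rule R_decompose[OF open_UNIV D subset_UNIV that])
 have U: "ennreal (f y) + R l UNIV ?G y = R l UNIV ?K y" for y by (rule U_generator[OF gen f0 fel l])
 have "H l D (R l UNIV ?K) x = H l D (\<lambda>y. ennreal (f y) + R l UNIV ?G y) x" by (simp add: U)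
 also have "\<dots> = H l D (\<lambda>y. ennreal (f y)) x + H l D (R l UNIV ?G) x" by (rule H_add) measurable
 finally have HK: "H l D (R l UNIV ?K) x = H l D (\<lambda>y. ennreal (f y)) x + H l D (R l UNIV ?G) x" .
 have fin: "H l D (R l UNIV ?G) x < \<top>"
 proof -
  have "R l UNIV ?G y \<le> ennreal (C / l)" for y
   by (rule U_bounded[OF l]) (use C in \<open>auto simp: abs_le_iff intro!: ennreal_leI\<close>)
  then have "H l D (R l UNIV ?G) x \<le> ennreal (C / l)" by (intro H_le_const[OF D]) (use l in auto)
  then show ?thesis using ennreal_less_top le_less_trans by blast
 qed
 have "(ennreal (f x) + R l D ?G x) + H l D (R l UNIV ?G) x = ennreal (f x) + R l UNIV ?G x"
  using dec[of ?G x] by (simp add: add.assoc)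
 also have "\<dots> = R l D ?K x + H l D (R l UNIV ?K) x" unfolding U by (rule dec) measurable
 also have "\<dots> = (R l D ?K x + H l D (\<lambda>y. ennreal (f y)) x) + H l D (R l UNIV ?G) x"
  unfolding HK by (simp add: add.assoc)
 finally have "ennreal (f x) + R l D ?G x = R l D ?K x + H l D (\<lambda>y. ennreal (f y)) x"
  using fin by (auto simp: add.commute[of _ "H l D (R l UNIV ?G) x"] ennreal_add_left_cancel)
 then show ?thesis by (simp add: g_def)
qed

end

section \<open>The law of the jump out of an open set\<close>

text \<open>Turns exit laws and their counterparts from the Levy kernel into genuine measures, for
  which inner regularity and uniqueness on a generating family are available.\<close>

lemma functional_measure:
 fixes T :: "('a::topological_space \<Rightarrow> ennreal) \<Rightarrow> ennreal"
 assumes add: "\<And>f g. f \<in> borel_fun \<Longrightarrow> g \<in> borel_fun \<Longrightarrow> T (\<lambda>x. f x + g x) = T f + T g"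
  and cmult: "\<And>f c. f \<in> borel_fun \<Longrightarrow> T (\<lambda>x. c * f x) = c * T f"
  and SUP: "\<And>F. (\<And>i::nat. F i \<in> borel_measurable borel) \<Longrightarrow> incseq F \<Longrightarrow> T (\<lambda>x. SUP i. F i x) = (SUP i. T (F i))"
 shows "\<exists>\<mu>. sets \<mu> = sets borel \<and> (\<forall>f\<in>borel_measurable borel. T f = (\<integral>\<^sup>+x. f x \<partial>\<mu>))"
proof -
 define \<mu> where "\<mu> = measure_of UNIV (sets borel) (\<lambda>A. T (indicator A))"
 have T0: "T (\<lambda>_. 0) = 0" using cmult[of "\<lambda>_. 0" 0] by simp
 have sm: "sets \<mu> = sets borel"
  unfolding \<mu>_def using sets.sigma_sets_eq[of "borel :: 'a measure"] by (simp add: sets_measure_of)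
 have fin: "T (\<lambda>x. \<Sum>i<n. F i x) = (\<Sum>i<n. T (F i))" if "\<And>i. F i \<in> borel_fun" for F and n :: nat
  using that by (induction n) (simp_all add: T0 add)
 have em: "emeasure \<mu> A = T (indicator A)" if A: "A \<in> sets borel" for A unfolding \<mu>_def
 proof (rule emeasure_measure_of_sigma)
  show "sigma_algebra UNIV (sets (borel :: 'a measure))"
   using sets.sigma_algebra_axioms[of "borel :: 'a measure"] by simp
  show "positive (sets borel) (\<lambda>A. T (indicator A))"
  proof -
   have "(indicator {} :: 'a \<Rightarrow> ennreal) = (\<lambda>_. 0)" by auto
   then show ?thesis using T0 by (simp add: positive_def)
  qed
  show "countably_additive (sets borel) (\<lambda>A. T (indicator A))"
  proof (rule countably_additiveI)
   fix A :: "nat \<Rightarrow> 'a set" assume A: "range A \<subseteq> sets borel" "disjoint_family A" "(\<Union>i. A i) \<in> sets borel"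
   have Am: "indicator (A i) \<in> borel_fun" for i :: nat
    using A(1) by (intro borel_measurable_indicator) auto
   have inc: "incseq (\<lambda>n x. \<Sum>i<n. indicator (A i) x :: ennreal)"
    by (auto simp: incseq_def le_fun_def intro!: sum_mono2)
   have "indicator (\<Union>i. A i) = (\<lambda>x. SUP n. \<Sum>i<n. indicator (A i) x :: ennreal)"
    using suminf_indicator[OF A(2)] by (intro ext) (simp add: suminf_eq_SUP)
   then have "T (indicator (\<Union>i. A i)) = (SUP n. T (\<lambda>x. \<Sum>i<n. indicator (A i) x))"
    by (simp only: SUP[OF borel_measurable_sum[OF Am] inc])
   also have "\<dots> = (\<Sum>i. T (indicator (A i)))" by (simp add: fin[OF Am] suminf_eq_SUP)
   finally show "(\<Sum>i. T (indicator (A i))) = T (indicator (\<Union>i. A i))" ..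
  qed
 qed (rule A)
 have "T f = (\<integral>\<^sup>+x. f x \<partial>\<mu>)" if f: "f \<in> borel_fun" for f using f
 proof (induction rule: borel_measurable_induct)
  case (cong f g) then have "f = g" by auto
  with cong show ?case by simp
 next
  case (set A) then show ?case using em[of A] by (simp add: sm)
 next
  case (mult u c)
  have "u \<in> borel_measurable \<mu>" using mult.hyps by (simp cong: measurable_cong_sets add: sm)
  then show ?case using mult by (simp add: cmult nn_integral_cmult)
 next
  case (add u v)
  have "u \<in> borel_measurable \<mu>" "v \<in> borel_measurable \<mu>"
   using add.hyps by (simp_all cong: measurable_cong_sets add: sm)
  then show ?case using add.IH add.hyps by (simp add: assms(1) nn_integral_add)
 next
  case (seq U)
  have m: "\<And>i. U i \<in> borel_measurable \<mu>" using seq.hyps by (simp cong: measurable_cong_sets add: sm)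
  have "T (\<lambda>x. SUP i. U i x) = (\<integral>\<^sup>+x. (SUP i. U i x) \<partial>\<mu>)"
   using seq.IH seq.hyps by (simp add: SUP nn_integral_monotone_convergence_SUP[OF _ m])
  then show ?case by (simp add: image_comp)
 qed
 then show ?thesis using sm by blast
qed

lemma measurable_kernel_integral:
 assumes "\<And>x. sets (J x) = sets borel" "\<And>B. B \<in> sets borel \<Longrightarrow> (\<lambda>x. emeasure (J x) B) \<in> borel_fun"
  and "f \<in> borel_fun"
 shows "(\<lambda>x. \<integral>\<^sup>+y. f y \<partial>J x) \<in> borel_measurable (borel :: 'a::topological_space measure)"
 using assms(3)
proof (induction rule: borel_measurable_induct)
 case (cong f g) then have "f = g" by auto
 with cong show ?case by simp
next
 case (set A) then show ?case using assms by simp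
next
 case (mult u c)
 have "u \<in> borel_measurable (J x)" for x using mult.hyps by (simp cong: measurable_cong_sets add: assms(1))
 then show ?case using mult.IH by (simp add: nn_integral_cmult)
next
 case (add u v)
 have "u \<in> borel_measurable (J x)" "v \<in> borel_measurable (J x)" for x
  using add.hyps by (simp_all cong: measurable_cong_sets add: assms(1))
 then show ?case using add.IH by (simp add: nn_integral_add)
next
 case (seq U)
 have m: "\<And>i. U i \<in> borel_measurable (J x)" for x using seq.hyps by (simp cong: measurable_cong_sets add: assms(1))
 have "(\<lambda>x. \<integral>\<^sup>+y. (SUP i. U i y) \<partial>J x) = (\<lambda>x. SUP i. \<integral>\<^sup>+y. U i y \<partial>J x)"
  using seq.hyps by (intro ext) (simp add: nn_integral_monotone_convergence_SUP[OF _ m])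
 then show ?case using seq.IH by (simp add: image_comp)
qed

section \<open>Compact sets and their thickenings\<close>

lemma UN_core:
 fixes D :: "'a::heine_borel set"
 assumes "open D" shows "(\<Union>n. core D n) = D"
proof
 show "D \<subseteq> (\<Union>n. core D n)"
 proof
  fix y assume "y \<in> D"
  then obtain n where "y \<in> interior (core D n)" using core_exhausts[OF assms] by blast
  then show "y \<in> (\<Union>n. core D n)" using interior_subset[of "core D n"] by blast
 qed
qed (use core_subset[of D] in blast)

lemma compact_thickening:
 fixes K :: "'a::heine_borel set"
 assumes "compact K" "K \<noteq> {}" shows "compact {z. infdist z K \<le> r}"
proof -
 obtain x0 B where B: "\<And>y. y \<in> K \<Longrightarrow> dist x0 y \<le> B"
  using compact_imp_bounded[OF assms(1)] unfolding bounded_def by blast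
 have "{z. infdist z K \<le> r} \<subseteq> cball x0 (B + r)"
 proof
  fix z assume "z \<in> {z. infdist z K \<le> r}"
  moreover obtain k where "k \<in> K" "infdist z K = dist z k"
   using infdist_attains_inf[OF compact_imp_closed[OF assms(1)] assms(2)] by metis
  ultimately show "z \<in> cball x0 (B + r)" using B[of k] dist_triangle[of x0 z k] by (auto simp: dist_commute)
 qed
 then have "bounded {z. infdist z K \<le> r}" by (rule bounded_subset[OF bounded_cball])
 moreover have "closed {z. infdist z K \<le> r}" by (intro closed_Collect_le continuous_intros)
 ultimately show ?thesis by (simp add: compact_eq_bounded_closed)
qed

text \<open>Continuity from above along the shrinking thickenings; it needs one of them to have
  finite measure.\<close>

lemma emeasure_thickening:
 fixes K :: "'a::heine_borel set"
 assumes K: "compact K" "K \<noteq> {}" and s: "sets \<mu> = sets borel" and d: "0 < d"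
  and fin: "emeasure \<mu> {y. infdist y K \<le> d} < \<top>"
 shows "(\<lambda>i. emeasure \<mu> {y. infdist y K \<le> d / (1 + real i)}) \<longlonglongrightarrow> emeasure \<mu> K"
proof -
 define W where "W i = {y. infdist y K \<le> d / (1 + real i)}" for i :: nat
 have W: "compact (W i)" for i unfolding W_def by (rule compact_thickening[OF K])
 have "(\<lambda>i. emeasure \<mu> (W i)) \<longlonglongrightarrow> emeasure \<mu> (\<Inter>i. W i)"
 proof (rule Lim_emeasure_decseq)
  show "range W \<subseteq> sets \<mu>" using borel_compact[OF W] by (auto simp: s)
  show "decseq W"
  proof (rule decseq_SucI)
   fix i
   have "d / (1 + real (Suc i)) \<le> d / (1 + real i)" using d by (intro divide_left_mono) auto
   then show "W (Suc i) \<subseteq> W i" by (auto simp: W_def)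
  qed
  fix i
  have "d / (1 + real i) \<le> d" using d by (simp add: divide_le_eq)
  then have "emeasure \<mu> (W i) \<le> emeasure \<mu> {y. infdist y K \<le> d}"
   using borel_compact[OF compact_thickening[OF K, of d]] by (intro emeasure_mono) (auto simp: W_def s)
  then show "emeasure \<mu> (W i) \<noteq> \<infinity>" using fin by (auto simp: top_unique)
 qed
 also have "(\<Inter>i. W i) = K"
 proof (intro equalityI subsetI)
  fix y assume y: "y \<in> (\<Inter>i. W i)"
  have "(\<lambda>i. d / (1 + real i)) \<longlonglongrightarrow> 0" by real_asymp
  then have "infdist y K \<le> 0" using y by (intro LIMSEQ_le_const) (auto simp: W_def)
  then show "y \<in> K" using in_closed_iff_infdist_zero[OF compact_imp_closed[OF K(1)] K(2)] infdist_nonneg[of y K] by simp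
 qed (use d in \<open>auto simp: W_def\<close>)
 finally show ?thesis unfolding W_def .
qed

section \<open>Exits by a jump and the Levy kernel\<close>

locale hunt_levy = hunt Z for Z :: "('a::heine_borel, 'w) process" +
 fixes J :: "'a \<Rightarrow> 'a measure" and \<D> :: "('a \<Rightarrow> real) set"
 assumes feller_Z: "feller Z" and levy: "levy_kernel Z J" and dom: "\<D> \<subseteq> gen_domain Z"
  and test_ex: "\<And>K U. compact K \<Longrightarrow> open U \<Longrightarrow> K \<subseteq> U \<Longrightarrow>
   \<exists>f\<in>\<D>. (\<forall>x\<in>K. f x = 1) \<and> (\<forall>x\<in>-U. f x = 0) \<and> (\<forall>x. 0 \<le> f x \<and> f x \<le> 1)"
begin

lemma sets_J [simp]: "sets (J x) = sets borel" using levy by (simp add: levy_kernel_def)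

lemma J_measurable: "f \<in> borel_fun \<Longrightarrow> (\<lambda>x. \<integral>\<^sup>+y. f y \<partial>J x) \<in> borel_fun"
 using levy by (intro measurable_kernel_integral) (auto simp: levy_kernel_def)

lemma test_C0: "f \<in> \<D> \<Longrightarrow> f \<in> C0"
 using dom generates_gen[of f Z] by (auto simp: generates_def)

lemma test_measurable: "f \<in> \<D> \<Longrightarrow> f \<in> borel_fun" by (rule C0_measurable[OF test_C0])

lemma gen_measurable: "f \<in> \<D> \<Longrightarrow> gen Z f \<in> borel_fun"
 using dom generates_gen[of f Z] by (auto simp: generates_def intro: C0_measurable)

text \<open>Off the support f vanishes at y, so the difference quotient of the generator is the
  semigroup divided by time, whose limit defines the Levy kernel.\<close>

lemma gen_off_support:
 assumes f: "f \<in> \<D>" "\<And>x. 0 \<le> f x" and y: "y \<notin> closure {x. f x \<noteq> 0}"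
 shows "ennreal (gen Z f y) = (\<integral>\<^sup>+z. ennreal (f z) \<partial>J y)" "0 \<le> gen Z f y"
proof -
 have fC: "f \<in> C0" by (rule test_C0[OF f(1)])
 obtain B where "\<And>x. \<bar>f x\<bar> \<le> B" using C0_bounded[OF fC] by blast
 then have "bounded (range f)" by (auto simp: bounded_iff)
 moreover have "continuous_on UNIV f" using fC by (simp add: C0_def)
 ultimately have int: "integrable (J y) f"
  and lim: "((\<lambda>t. semigroup_op Z t f y / t) \<longlongrightarrow> (\<integral>z. f z \<partial>J y)) (at_right 0)"
  using levy y unfolding levy_kernel_def by blast+
 have "generates Z f (gen Z f)" using f(1) dom by (intro generates_gen) auto
 then have "((\<lambda>t. (semigroup_op Z t f y - f y) / t) \<longlongrightarrow> gen Z f y) (at_right 0)"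
  by (auto simp: generates_def dest!: tendsto_uniform_limitI[where x = y])
 moreover have "f y = 0" using y closure_subset[of "{x. f x \<noteq> 0}"] by blast
 ultimately have "gen Z f y = (\<integral>z. f z \<partial>J y)" using tendsto_unique[OF _ _ lim] by simp
 moreover have "(\<integral>\<^sup>+z. ennreal (f z) \<partial>J y) = ennreal (\<integral>z. f z \<partial>J y)"
  by (rule nn_integral_eq_integral[OF int]) (simp add: f(2))
 moreover have "0 \<le> (\<integral>z. f z \<partial>J y)" by (rule integral_nonneg_AE) (simp add: f(2))
 ultimately show "ennreal (gen Z f y) = (\<integral>\<^sup>+z. ennreal (f z) \<partial>J y)" "0 \<le> gen Z f y" by simp_all
qed

text \<open>On D the test function vanishes and its generator is the non-negative jump integral;
  Dynkin's formula loses all other terms.\<close>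

lemma jump_law_test:
 assumes D: "open D" and x: "x \<in> D" and f: "f \<in> \<D>" "\<And>x. 0 \<le> f x"
  and sup: "closure {z. f z \<noteq> 0} \<inter> D = {}" and l: "0 < l"
 shows "H l D (\<lambda>y. ennreal (f y)) x = R l D (\<lambda>y. \<integral>\<^sup>+z. ennreal (f z) \<partial>J y) x"
proof -
 have z: "y \<in> D \<Longrightarrow> f y = 0" for y using sup closure_subset[of "{z. f z \<noteq> 0}"] by blast
 have g: "y \<in> D \<Longrightarrow> ennreal (gen Z f y) = (\<integral>\<^sup>+z. ennreal (f z) \<partial>J y)"
  "y \<in> D \<Longrightarrow> ennreal (- gen Z f y) = 0" for y
 proof -
  assume "y \<in> D"
  then have "y \<notin> closure {z. f z \<noteq> 0}" using sup by blast
  from gen_off_support[OF f this] show "ennreal (gen Z f y) = (\<integral>\<^sup>+z. ennreal (f z) \<partial>J y)"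
   "ennreal (- gen Z f y) = 0" by (simp_all add: ennreal_neg)
 qed
 have "R l D (\<lambda>y. ennreal (l * f y) + ennreal (- gen Z f y)) x = R l D (\<lambda>_. 0) x"
  by (rule R_cong) (simp add: z g)
 moreover have "R l D (\<lambda>y. ennreal (gen Z f y)) x = R l D (\<lambda>y. \<integral>\<^sup>+z. ennreal (f z) \<partial>J y) x"
  by (rule R_cong) (simp add: g)
 moreover have fg: "f \<in> gen_domain Z" using f(1) dom by blast
 ultimately show ?thesis using dynkin[OF D fg f(2) feller_Z l, of x] z[OF x] by simp
qed

text \<open>Each cutoff lies between the indicators of two consecutive thickenings of K; d is half
  the distance to F, which keeps the closed supports away from F.\<close>

lemma compact_cutoffs:
 assumes K: "compact K" "K \<noteq> {}" and F: "closed F" "K \<inter> F = {}"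
 shows "\<exists>d>0. {y. infdist y K \<le> d} \<inter> F = {} \<and> (\<forall>i. \<exists>f\<in>\<D>. (\<forall>y. 0 \<le> f y \<and> f y \<le> 1) \<and>
  (\<forall>y. infdist y K \<le> d / (1 + real (Suc i)) \<longrightarrow> f y = 1) \<and> (\<forall>y. d / (1 + real i) < infdist y K \<longrightarrow> f y = 0) \<and>
  closure {y. f y \<noteq> 0} \<inter> F = {})"
proof -
 obtain e where e: "0 < e" "\<And>x y. x \<in> K \<Longrightarrow> y \<in> F \<Longrightarrow> e \<le> dist x y"
  using separate_compact_closed[OF K(1) F] by blast
 define d where "d = e / 2"
 have d: "0 < d" using e by (simp add: d_def)
 have sep: "{y. infdist y K \<le> d} \<inter> F = {}"
 proof (intro equalityI subsetI)
  fix y assume y: "y \<in> {y. infdist y K \<le> d} \<inter> F"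
  obtain k where k: "k \<in> K" "infdist y K = dist y k"
   using infdist_attains_inf[OF compact_imp_closed[OF K(1)] K(2)] by metis
  then show "y \<in> {}" using e(2)[OF k(1), of y] y e(1) by (auto simp: d_def dist_commute)
 qed simp
 have "\<exists>f\<in>\<D>. (\<forall>y. 0 \<le> f y \<and> f y \<le> 1) \<and>
  (\<forall>y. infdist y K \<le> d / (1 + real (Suc i)) \<longrightarrow> f y = 1) \<and> (\<forall>y. d / (1 + real i) < infdist y K \<longrightarrow> f y = 0) \<and>
  closure {y. f y \<noteq> 0} \<inter> F = {}" for i
 proof -
  let ?L = "{y. infdist y K \<le> d / (1 + real (Suc i))}" and ?U = "{y. infdist y K < d / (1 + real i)}"
  have lt: "d / (1 + real (Suc i)) < d / (1 + real i)" using d by (intro divide_strict_left_mono) auto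
  have "open ?U" by (intro open_Collect_less continuous_intros)
  moreover have "?L \<subseteq> ?U" using lt by auto
  ultimately obtain f where f: "f \<in> \<D>" "\<forall>x\<in>?L. f x = 1" "\<forall>x\<in>-?U. f x = 0" "\<forall>x. 0 \<le> f x \<and> f x \<le> 1"
   using test_ex[OF compact_thickening[OF K]] by blast
  have "d / (1 + real i) \<le> d" using d by (simp add: divide_le_eq)
  then have "closure {y. f y \<noteq> 0} \<subseteq> {y. infdist y K \<le> d}"
   using f(3) by (intro closure_minimal closed_Collect_le continuous_intros) force
  then have "closure {y. f y \<noteq> 0} \<inter> F = {}" using sep by blast
  then show ?thesis using f by (intro bexI[of _ f]) auto
 qed
 then show ?thesis using d sep by blast
qed

text \<open>Compares the exit law \<alpha> with the measure \<beta> built from the Levy kernel, off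
  the closure of D: test functions squeezed between thickenings settle compact sets, exhaustion
  settles closed sets, and these generate.\<close>

lemma jump_law_pos:
 assumes D: "open D" and x: "x \<in> D" and l: "0 < l" and g: "g \<in> borel_fun"
  and g0: "\<And>z. z \<in> closure D \<Longrightarrow> g z = 0"
 shows "H l D g x = R l D (\<lambda>y. \<integral>\<^sup>+z. g z \<partial>J y) x"
proof -
 define O' where "O' = - closure D"
 have O': "open O'" "O' \<in> sets borel" unfolding O'_def by (auto simp: open_Compl)
 obtain \<alpha> where \<alpha>: "sets \<alpha> = sets borel" "\<And>f. f \<in> borel_fun \<Longrightarrow> H l D f x = (\<integral>\<^sup>+x. f x \<partial>\<alpha>)"
  using functional_measure[of "\<lambda>f. H l D f x"] H_add H_cmult H_SUP by (auto simp: Ball_def)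
 have "\<exists>\<mu>. sets \<mu> = sets borel \<and> (\<forall>f\<in>borel_measurable borel. R l D (\<lambda>y. \<integral>\<^sup>+z. f z \<partial>J y) x = (\<integral>\<^sup>+x. f x \<partial>\<mu>))"
 proof (rule functional_measure)
  fix f h :: "'a \<Rightarrow> ennreal" assume fh: "f \<in> borel_fun" "h \<in> borel_fun"
  then have "f \<in> borel_measurable (J y)" "h \<in> borel_measurable (J y)" for y by (simp_all cong: measurable_cong_sets)
  then show "R l D (\<lambda>y. \<integral>\<^sup>+z. f z + h z \<partial>J y) x = R l D (\<lambda>y. \<integral>\<^sup>+z. f z \<partial>J y) x + R l D (\<lambda>y. \<integral>\<^sup>+z. h z \<partial>J y) x"
   using R_add[OF J_measurable[OF fh(1)] J_measurable[OF fh(2)]] by (simp add: nn_integral_add)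
 next
  fix f :: "'a \<Rightarrow> ennreal" and c assume f: "f \<in> borel_fun"
  then have "f \<in> borel_measurable (J y)" for y by (simp cong: measurable_cong_sets)
  then show "R l D (\<lambda>y. \<integral>\<^sup>+z. c * f z \<partial>J y) x = c * R l D (\<lambda>y. \<integral>\<^sup>+z. f z \<partial>J y) x"
   using R_cmult[OF J_measurable[OF f]] by (simp add: nn_integral_cmult)
 next
  fix F :: "nat \<Rightarrow> 'a \<Rightarrow> ennreal" assume F: "\<And>i. F i \<in> borel_fun" "incseq F"
  then have m: "F i \<in> borel_measurable (J y)" for i y by (simp cong: measurable_cong_sets)
  have inc: "incseq (\<lambda>i y. \<integral>\<^sup>+z. F i z \<partial>J y)"
   using F(2) by (auto simp: incseq_def le_fun_def intro!: nn_integral_mono)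
  show "R l D (\<lambda>y. \<integral>\<^sup>+z. (SUP i. F i z) \<partial>J y) x = (SUP i. R l D (\<lambda>y. \<integral>\<^sup>+z. F i z \<partial>J y) x)"
   using R_SUP[OF J_measurable[OF F(1)] inc] by (simp add: nn_integral_monotone_convergence_SUP[OF F(2) m])
 qed
 then obtain \<beta> where \<beta>: "sets \<beta> = sets borel"
  "\<And>f. f \<in> borel_fun \<Longrightarrow> R l D (\<lambda>y. \<integral>\<^sup>+z. f z \<partial>J y) x = (\<integral>\<^sup>+x. f x \<partial>\<beta>)" by auto
 have \<alpha>1: "emeasure \<alpha> B \<le> 1" if "B \<in> sets borel" for B
 proof -
  have "emeasure \<alpha> B = H l D (indicator B) x" using \<alpha> that by simp
  also have "\<dots> \<le> 1" by (rule H_le_const[OF D]) (use l in \<open>auto simp: indicator_def\<close>)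
  finally show ?thesis .
 qed
 have compact: "emeasure \<alpha> K = emeasure \<beta> K" if K: "compact K" "K \<subseteq> O'" for K
 proof (cases "K = {}")
  case False
  obtain d where d: "0 < d" "\<And>i. \<exists>f\<in>\<D>. (\<forall>y. 0 \<le> f y \<and> f y \<le> 1) \<and>
    (\<forall>y. infdist y K \<le> d / (1 + real (Suc i)) \<longrightarrow> f y = 1) \<and> (\<forall>y. d / (1 + real i) < infdist y K \<longrightarrow> f y = 0) \<and>
    closure {y. f y \<noteq> 0} \<inter> closure D = {}"
   using compact_cutoffs[OF K(1) False closed_closure, of D] K(2) unfolding O'_def by blast
  define W where "W i = {y. infdist y K \<le> d / (1 + real i)}" for i :: nat
  have Wb: "W i \<in> sets borel" for i unfolding W_def by (rule borel_compact[OF compact_thickening[OF K(1) False]])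
  have sandwich: "emeasure \<alpha> (W (Suc i)) \<le> emeasure \<beta> (W i) \<and> emeasure \<beta> (W (Suc i)) \<le> emeasure \<alpha> (W i)" for i
  proof -
   obtain f where f: "f \<in> \<D>" "\<And>y. 0 \<le> f y \<and> f y \<le> 1" "\<And>y. y \<in> W (Suc i) \<Longrightarrow> f y = 1" "\<And>y. y \<notin> W i \<Longrightarrow> f y = 0"
     "closure {y. f y \<noteq> 0} \<inter> closure D = {}"
    using d(2)[of i] unfolding W_def not_le mem_Collect_eq by blast
   have lo: "emeasure \<mu> (W (Suc i)) \<le> (\<integral>\<^sup>+x. ennreal (f x) \<partial>\<mu>)"
    and hi: "(\<integral>\<^sup>+x. ennreal (f x) \<partial>\<mu>) \<le> emeasure \<mu> (W i)" if "sets \<mu> = sets borel" for \<mu>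
    using nn_integral_mono[of \<mu> "indicator (W (Suc i))" "\<lambda>x. ennreal (f x)"]
     nn_integral_mono[of \<mu> "\<lambda>x. ennreal (f x)" "indicator (W i)"] Wb f(2-4) that
    by (auto simp: indicator_def)
   have "H l D (\<lambda>y. ennreal (f y)) x = R l D (\<lambda>y. \<integral>\<^sup>+z. ennreal (f z) \<partial>J y) x"
    using f(2,5) closure_subset[of D] by (intro jump_law_test[OF D x f(1) _ _ l]) auto
   then have "(\<integral>\<^sup>+x. ennreal (f x) \<partial>\<alpha>) = (\<integral>\<^sup>+x. ennreal (f x) \<partial>\<beta>)"
    using \<alpha>(2) \<beta>(2) test_measurable[OF f(1)] by simp
   then show ?thesis using lo[OF \<alpha>(1)] hi[OF \<alpha>(1)] lo[OF \<beta>(1)] hi[OF \<beta>(1)] by (metis order_trans)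
  qed
  have lim: "(\<lambda>i. emeasure \<alpha> (W i)) \<longlonglongrightarrow> emeasure \<alpha> K" unfolding W_def
   by (rule emeasure_thickening[OF K(1) False \<alpha>(1) d(1)])
    (rule le_less_trans[OF \<alpha>1[OF borel_compact[OF compact_thickening[OF K(1) False]]]], simp)
  \<comment> \<open>Finiteness of \<beta> near K is not known in advance; it is borrowed from
    \<alpha> at the cost of one index, which is why the thickenings for \<beta> start at
    \<open>d / 2\<close>.\<close>
  have "emeasure \<beta> {y. infdist y K \<le> d / 2} < \<top>"
   using sandwich[of 0] \<alpha>1[OF Wb, of 0] by (auto simp: W_def intro: le_less_trans[of _ 1] order_trans)
  from emeasure_thickening[OF K(1) False \<beta>(1) _ this] d(1)
  have "(\<lambda>i. emeasure \<beta> {y. infdist y K \<le> d / 2 / (1 + real i)}) \<longlonglongrightarrow> emeasure \<beta> K" by simp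
  \<comment> \<open>The denominators match because \<open>1 + (2 * i + 1)\<close> is twice
    \<open>1 + i\<close>.\<close>
  moreover have "(\<lambda>i. emeasure \<beta> (W (2 * i + 1))) = (\<lambda>i. emeasure \<beta> {y. infdist y K \<le> d / 2 / (1 + real i)})"
   by (simp add: W_def add.commute distrib_left mult.commute[of 2])
  ultimately have lim': "(\<lambda>i. emeasure \<beta> (W (2 * i + 1))) \<longlonglongrightarrow> emeasure \<beta> K" by simp
  have KW: "emeasure \<mu> K \<le> emeasure \<mu> (W i)" if "sets \<mu> = sets borel" for \<mu> i
   by (rule emeasure_mono) (use Wb d(1) that in \<open>auto simp: W_def\<close>)
  show ?thesis
  proof (rule antisym)
   show "emeasure \<beta> K \<le> emeasure \<alpha> K"
    by (rule LIMSEQ_le_const[OF lim]) (use sandwich KW[OF \<beta>(1)] order_trans in blast)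
   show "emeasure \<alpha> K \<le> emeasure \<beta> K"
    by (rule LIMSEQ_le_const[OF lim']) (use sandwich KW[OF \<alpha>(1)] order_trans in blast)
  qed
 qed simp
 have closed: "emeasure \<alpha> (B \<inter> O') = emeasure \<beta> (B \<inter> O')" if B: "closed B" for B
 proof -
  have eq: "B \<inter> O' = (\<Union>n. B \<inter> core O' n)" using UN_core[OF O'(1)] by blast
  have c: "compact (B \<inter> core O' n)" for n by (rule closed_Int_compact[OF B compact_core])
  have inc: "incseq (\<lambda>n. B \<inter> core O' n)" using core_mono[of _ _ O'] by (auto simp: incseq_def)
  have "emeasure \<alpha> (B \<inter> core O' n) = emeasure \<beta> (B \<inter> core O' n)" for n
   using core_subset[of O' n] by (intro compact c) auto
  then show ?thesis unfolding eq
   using SUP_emeasure_incseq[OF _ inc, of \<alpha>] SUP_emeasure_incseq[OF _ inc, of \<beta>] borel_compact[OF c] \<alpha>(1) \<beta>(1)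
   by (auto simp: image_subset_iff)
 qed
 have em: "emeasure (density \<mu> (indicator O')) B = emeasure \<mu> (B \<inter> O')" if "sets \<mu> = sets borel" "B \<in> sets borel" for \<mu> B
  using that O'(2) by (simp add: emeasure_density indicator_inter_arith[symmetric] Int_commute)
 have eqm: "density \<alpha> (indicator O') = density \<beta> (indicator O')"
 proof (rule measure_eqI_generator_eq[where E = "Collect closed" and \<Omega> = UNIV and A = "\<lambda>_. UNIV"])
  show "emeasure (density \<alpha> (indicator O')) UNIV \<noteq> \<infinity>" for i :: nat
   using \<alpha>1[OF O'(2)] by (auto simp: em \<alpha>(1) top_unique)
 qed (auto simp: Int_stable_def \<alpha>(1) \<beta>(1) borel_eq_closed em closed)
 have g': "g z = indicator O' z * g z" for z using g0[of z] by (auto simp: O'_def indicator_def)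
 have "(\<integral>\<^sup>+z. g z \<partial>\<alpha>) = (\<integral>\<^sup>+z. g z \<partial>density \<alpha> (indicator O'))"
  using g O'(2) by (subst nn_integral_density) (auto cong: measurable_cong_sets simp: \<alpha>(1) g'[symmetric])
 also have "\<dots> = (\<integral>\<^sup>+z. g z \<partial>\<beta>)" unfolding eqm
  using g O'(2) by (subst nn_integral_density) (auto cong: measurable_cong_sets simp: \<beta>(1) g'[symmetric])
 finally show ?thesis using \<alpha>(2)[OF g] \<beta>(2)[OF g] by simp
qed

text \<open>The Ikeda-Watanabe formula at the exit time. Requiring g to vanish on the closure of D
  leaves only exits that jump over the boundary.\<close>

theorem jump_law:
 assumes D: "open D" and x: "x \<in> D" and l: "0 \<le> l" and g: "g \<in> borel_fun"
  and g0: "\<And>z. z \<in> closure D \<Longrightarrow> g z = 0"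
 shows "H l D g x = R l D (\<lambda>y. \<integral>\<^sup>+z. g z \<partial>J y) x"
proof (cases "l = 0")
 case True
 show ?thesis unfolding True H_0_SUP[OF g] R_0_SUP[OF J_measurable[OF g]]
  by (intro SUP_cong refl jump_law_pos[OF D x _ g g0]) auto
qed (use jump_law_pos[OF D x _ g g0] l in simp)

end

section \<open>Irregular boundary points\<close>

context hunt begin

lemma hitting_time_le: "0 < t \<Longrightarrow> St t w \<in> S \<Longrightarrow> hitting_time Z S w \<le> t"
 unfolding hitting_time_def by (rule Inf_lower) simp

text \<open>An infinite exit time needs the explicit value 0: \<open>decay\<close> would return 1
  there, and no factor \<open>ext0\<close> corrects it.\<close>

definition exit_weight :: "'a set \<Rightarrow> 'w \<Rightarrow> ennreal" where
 "exit_weight D w = (if leave D w = \<top> then 0 else decay 1 (leave D w))"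

lemma exit_weight_measurable [measurable]: "exit_weight D \<in> borel_measurable NF"
 unfolding exit_weight_def by measurable

lemma exit_weight_le_1: "exit_weight D w \<le> 1" by (simp add: exit_weight_def decay_le_1)

definition restart :: "nat \<Rightarrow> real" where "restart n = 1 / real (Suc n)"

lemma restart_pos: "0 < restart n" by (simp add: restart_def)

text \<open>Expected discount at the first exit after a small positive time; its value is \<open>1\<close> exactly at
 the points where the exit is immediate, and strong continuity of the semigroup makes it lower
 semicontinuous.\<close>

definition restarted_weight :: "'a set \<Rightarrow> nat \<Rightarrow> 'w \<Rightarrow> ennreal" where
 "restarted_weight D n w = ennreal (exp (- restart n)) * exit_weight D (shift (ennreal (restart n)) w)"

definition exit_potential :: "'a set \<Rightarrow> nat \<Rightarrow> 'a \<Rightarrow> ennreal" where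
 "exit_potential D n x = (\<integral>\<^sup>+w. restarted_weight D n w \<partial>Pr (Some x))"

lemma shift_const_measurable [measurable]: "shift s \<in> measurable NF NF"
 using shift_measurable[of "\<lambda>_. s"] by simp

lemma restarted_weight_measurable [measurable]: "restarted_weight D n \<in> borel_measurable NF"
 unfolding restarted_weight_def by measurable

lemma restarted_weight_le_1: "restarted_weight D n w \<le> 1"
proof -
 have "ennreal (exp (- restart n)) \<le> 1" using restart_pos[of n] by simp
 then show ?thesis
  unfolding restarted_weight_def using mult_mono[OF _ exit_weight_le_1[of D "shift (ennreal (restart n)) w"]] by fastforce
qed

lemma strong_markov_const:
 assumes F: "F \<in> borel_measurable NF"
 shows "s < \<top> \<Longrightarrow> (\<integral>\<^sup>+w. F (shift s w) \<partial>Pr z) = (\<integral>\<^sup>+w. (\<integral>\<^sup>+w'. F w' \<partial>Pr (St s w)) \<partial>Pr z)"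
proof -
 assume s: "s < \<top>"
 have "(\<integral>\<^sup>+w\<in>{w\<in>Om. s < \<top>}. F (shift s w) \<partial>Pr z) =
   (\<integral>\<^sup>+w\<in>{w\<in>Om. s < \<top>}. (\<integral>\<^sup>+w'. F w' \<partial>Pr (St s w)) \<partial>Pr z)"
  by (rule strong_markov_path[OF stop_const top_pre_sigma[OF stop_const] F])
 moreover have "(\<integral>\<^sup>+w\<in>{w\<in>Om. s < \<top>}. K w \<partial>Pr z) = (\<integral>\<^sup>+w. K w \<partial>Pr z)" for K
  by (intro nn_integral_cong) (use s in auto)
 ultimately show ?thesis by simp
qed

text \<open>The law of the shifted path is a mixture of the laws, so an event that is null for all
  of them stays null.\<close>

lemma AE_shift:
 assumes "\<And>z. AE w in Pr z. P w" and [measurable]: "Measurable.pred NF P" and s: "s < \<top>"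
 shows "AE w in Pr z. P (shift s w)"
proof -
 define F where "F w = (if P w then 0 else 1 :: ennreal)" for w
 have Fm [measurable]: "F \<in> borel_measurable NF" unfolding F_def by measurable
 have "(\<integral>\<^sup>+w'. F w' \<partial>Pr y) = 0" for y
 proof -
  have "AE w in Pr y. F w = 0" using assms(1)[of y] by eventually_elim (simp add: F_def)
  then have "(\<integral>\<^sup>+w'. F w' \<partial>Pr y) = (\<integral>\<^sup>+w'. 0 \<partial>Pr y)" by (rule nn_integral_cong_AE)
  then show ?thesis by simp
 qed
 then have "(\<integral>\<^sup>+w. F (shift s w) \<partial>Pr z) = 0" using strong_markov_const[OF Fm s, of z] by simp
 moreover have "(\<lambda>w. F (shift s w)) \<in> borel_measurable (Pr z)"
  using measurable_compose[OF shift_const_measurable Fm] by simp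
 ultimately have "AE w in Pr z. F (shift s w) = 0" by (simp add: nn_integral_0_iff_AE)
 then show ?thesis by eventually_elim (simp add: F_def split: if_splits)
qed

text \<open>An exit of the restarted path happens at a positive time of the original one, so it
  counts for \<open>exit_time\<close>, which ignores time 0.\<close>

lemma AE_exit_after:
 assumes D: "open D" and s: "0 < s" "s < \<top>"
 shows "AE w in Pr z. leave D (shift s w) < \<top> \<longrightarrow> exit_time Z D w \<le> s + leave D (shift s w)"
proof -
 have [measurable]: "Measurable.pred NF (\<lambda>w. St (leave D w) w \<notin> Some ` D)"
 proof -
  have "Some ` D \<in> sets cemetery_borel" using D by (intro Some_image_measurable) simp
  then show ?thesis by measurable
 qed
 have "AE w in Pr z. St (leave D (shift s w)) (shift s w) \<notin> Some ` D"
  by (rule AE_shift[OF AE_state_leave[OF D] _ s(2)]) measurable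
 then show ?thesis using AE_space
 proof eventually_elim
  case (elim w)
  then have "St (s + leave D (shift s w)) w \<in> - Some ` D" by simp
  then show ?case unfolding exit_time_def using s(1) by (intro impI hitting_time_le) auto
 qed
qed

text \<open>Fatou's lemma. An immediate exit entails times t outside D arbitrarily near 0; a path
  restarted before such a t has left D by then, so its weight is at least exp (- t).\<close>

lemma SUP_exit_potential_regular:
 assumes D: "open D" and reg: "AE w in Pr (Some x). exit_time Z D w = 0"
 shows "(SUP n. exit_potential D n x) = 1"
proof (rule antisym)
 have "exit_potential D n x \<le> (\<integral>\<^sup>+w. 1 \<partial>Pr (Some x))" for n
  unfolding exit_potential_def by (intro nn_integral_mono restarted_weight_le_1)
 then show "(SUP n. exit_potential D n x) \<le> 1"
  using prob_space.emeasure_space_1[OF prob_space_Pr, of "Some x"] by (intro SUP_least) simp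
 let ?u = "restarted_weight D"
 have "AE w in Pr (Some x). 1 \<le> liminf (\<lambda>n. ?u n w)" using reg AE_space
 proof eventually_elim
  case (elim w)
  then have w: "w \<in> Om" by simp
  show ?case
  proof (rule ccontr)
   assume "\<not> 1 \<le> liminf (\<lambda>n. ?u n w)"
   then have lt: "liminf (\<lambda>n. ?u n w) < 1" by simp
   then obtain c where c: "0 \<le> c" "liminf (\<lambda>n. ?u n w) = ennreal c" "c < 1"
    by (cases "liminf (\<lambda>n. ?u n w)") (auto simp: ennreal_less_iff ennreal_1[symmetric] simp del: ennreal_1)
   define e where "e = (1 - c) / 2"
   have e: "0 < e" "c < 1 - e" using c by (auto simp: e_def field_simps)
   obtain t where t: "0 < t" "ennreal t < ennreal e" "ennreal t \<in> {t. 0 < t \<and> St t w \<in> - Some ` D}"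
   proof -
    have "exit_time Z D w < ennreal e" using elim e(1) by simp
    then obtain t where t: "t < ennreal e" "0 < t" "St t w \<in> - Some ` D"
     unfolding exit_time_def hitting_time_def Inf_less_iff by blast
    then obtain r where "t = ennreal r" "0 \<le> r" using ennreal_less_top[of e] by (cases t) auto
    then show thesis using that[of r] t by simp
   qed
   have te: "t < e" using t(1,2) by (simp add: ennreal_less_iff)
   have "ennreal (1 - e) \<le> ?u n w" if n: "restart n < t" for n
   proof -
    have eq: "ennreal (restart n) + ennreal (t - restart n) = ennreal t"
     using n restart_pos[of n] by (simp add: ennreal_plus[symmetric] del: ennreal_plus)
    have "St (ennreal (t - restart n)) (shift (ennreal (restart n)) w) \<notin> Some ` D"
     unfolding state_shift[OF w] eq using t(3) by simp
    then have le: "leave D (shift (ennreal (restart n)) w) \<le> ennreal (t - restart n)" by (rule leave_le)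
    then have nt: "leave D (shift (ennreal (restart n)) w) \<noteq> \<top>" by (auto simp: top_unique)
    then obtain v where v: "leave D (shift (ennreal (restart n)) w) = ennreal v" "0 \<le> v"
     by (cases "leave D (shift (ennreal (restart n)) w)") auto
    then have "v \<le> t - restart n" using le n by (simp add: ennreal_le_iff)
    then have "1 - e \<le> 1 + (- restart n - v)" using te by simp
    also have "\<dots> \<le> exp (- restart n - v)" by (rule exp_ge_add_one_self)
    finally have "ennreal (1 - e) \<le> ennreal (exp (- restart n - v))" by (rule ennreal_leI)
    also have "\<dots> = ?u n w" using v
     by (simp add: restarted_weight_def exit_weight_def decay_def ennreal_mult[symmetric] exp_diff exp_minus field_simps)
    finally show ?thesis .
   qed
   moreover obtain N where "restart N < t" using nat_approx_posE[OF t(1)] unfolding restart_def by blast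
   moreover have "restart n \<le> restart m" if "m \<le> n" for m n using that by (simp add: restart_def frac_le)
   ultimately have "\<forall>\<^sub>F n in sequentially. ennreal (1 - e) \<le> ?u n w"
    unfolding eventually_sequentially by (meson order_le_less_trans)
   then have "ennreal (1 - e) \<le> liminf (\<lambda>n. ?u n w)" by (rule Liminf_bounded)
   then show False using c e by (simp add: ennreal_le_iff)
  qed
 qed
 then have "(\<integral>\<^sup>+w. 1 \<partial>Pr (Some x)) \<le> (\<integral>\<^sup>+w. liminf (\<lambda>n. ?u n w) \<partial>Pr (Some x))" by (rule nn_integral_mono_AE)
 also have "\<dots> \<le> liminf (\<lambda>n. \<integral>\<^sup>+w. ?u n w \<partial>Pr (Some x))" by (rule nn_integral_liminf) simp
 also have "\<dots> = liminf (\<lambda>n. exit_potential D n x)" by (simp add: exit_potential_def)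
 also have "\<dots> \<le> (SUP n. exit_potential D n x)" unfolding liminf_SUP_INF
 proof (rule SUP_least)
  fix n
  have "Inf ((\<lambda>n. exit_potential D n x) ` {n..}) \<le> exit_potential D n x" by (rule INF_lower) simp
  also have "\<dots> \<le> (SUP n. exit_potential D n x)" by (rule SUP_upper) simp
  finally show "Inf ((\<lambda>n. exit_potential D n x) ` {n..}) \<le> (SUP n. exit_potential D n x)" .
 qed
 finally show "1 \<le> (SUP n. exit_potential D n x)"
  using prob_space.emeasure_space_1[OF prob_space_Pr, of "Some x"] by simp
qed

text \<open>The converse: weights bounded by 1 whose supremum has mean at least 1 have supremum 1
  almost surely, and a weight above exp (- e) forces an exit before time e.\<close>

lemma SUP_exit_potential_irregular:
 assumes D: "open D" and one: "1 \<le> (SUP n. exit_potential D n x)"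
 shows "AE w in Pr (Some x). exit_time Z D w = 0"
proof -
 interpret P: prob_space "Pr (Some x)" by (rule prob_space_Pr)
 let ?u = "restarted_weight D"
 define v where "v w = (SUP n. ?u n w)" for w
 have vm [measurable]: "v \<in> borel_measurable NF" unfolding v_def by measurable
 have v1: "v w \<le> 1" for w unfolding v_def by (intro SUP_least restarted_weight_le_1)
 have "(SUP n. exit_potential D n x) \<le> (\<integral>\<^sup>+w. v w \<partial>Pr (Some x))"
  unfolding exit_potential_def by (intro SUP_least nn_integral_mono) (auto simp: v_def intro: SUP_upper)
 then have ge: "1 \<le> (\<integral>\<^sup>+w. v w \<partial>Pr (Some x))" using one by (rule order_trans[rotated])
 have le1: "(\<integral>\<^sup>+w. v w \<partial>Pr (Some x)) \<le> 1"
  using nn_integral_mono[of "Pr (Some x)" v "\<lambda>_. 1"] v1 P.emeasure_space_1 by simp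
 have "(\<integral>\<^sup>+w. 1 - v w \<partial>Pr (Some x)) = (\<integral>\<^sup>+w. 1 \<partial>Pr (Some x)) - (\<integral>\<^sup>+w. v w \<partial>Pr (Some x))"
  by (rule nn_integral_diff) (use le1 v1 in \<open>auto simp: top_unique\<close>)
 also have "\<dots> = 0" using ge P.emeasure_space_1 by (simp add: diff_eq_0_ennreal)
 finally have "AE w in Pr (Some x). 1 - v w = 0" by (subst (asm) nn_integral_0_iff_AE) auto
 moreover have "AE w in Pr (Some x). \<forall>n. leave D (shift (ennreal (restart n)) w) < \<top> \<longrightarrow>
   exit_time Z D w \<le> ennreal (restart n) + leave D (shift (ennreal (restart n)) w)"
  unfolding AE_all_countable using AE_exit_after[OF D, of "ennreal (restart _)"] restart_pos by simp
 ultimately show ?thesis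
 proof eventually_elim
  case (elim w)
  then have v: "1 \<le> v w" using v1[of w] by (simp add: ennreal_minus_eq_0)
  have "exit_time Z D w \<le> ennreal e" if e: "0 < e" for e :: real
  proof -
   have "ennreal (exp (- e)) < 1" using e by (simp add: ennreal_less_iff ennreal_1[symmetric] del: ennreal_1)
   then have "ennreal (exp (- e)) < v w" using v by (rule less_le_trans)
   then obtain n where n: "ennreal (exp (- e)) < ?u n w" unfolding v_def less_SUP_iff by blast
   have fin: "leave D (shift (ennreal (restart n)) w) \<noteq> \<top>"
    using n by (auto simp: restarted_weight_def exit_weight_def)
   then obtain r where r: "leave D (shift (ennreal (restart n)) w) = ennreal r" "0 \<le> r"
    by (cases "leave D (shift (ennreal (restart n)) w)") auto
   have "?u n w = ennreal (exp (- (restart n + r)))"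
    using r by (simp add: restarted_weight_def exit_weight_def decay_def ennreal_mult[symmetric] exp_diff exp_minus exp_add field_simps)
   then have "restart n + r < e" using n by (simp add: ennreal_less_iff)
   moreover have "exit_time Z D w \<le> ennreal (restart n) + ennreal r" using spec[OF elim(2), of n] r by simp
   ultimately show ?thesis
    using r restart_pos[of n] by (metis ennreal_leI ennreal_plus less_imp_le order_trans)
  qed
  then show ?case by (metis ennreal_le_epsilon add_0 le_zero_eq)
 qed
qed

text \<open>By the Markov property the potential is obtained from the semigroup at time s applied to
  a bounded Borel function, which the strong Feller property makes continuous.\<close>

lemma exit_potential_continuous:
 assumes D: "open D" and sf: "strongly_feller Z"
 shows "\<exists>h. continuous_on UNIV h \<and> (\<forall>x. exit_potential D n x = ennreal (h x))"
proof -
 define s where "s = restart n"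
 have s: "0 < s" by (simp add: s_def restart_pos)
 define \<phi> where "\<phi> z = (\<integral>\<^sup>+w. exit_weight D w \<partial>Pr z)" for z
 have \<phi>m [measurable]: "\<phi> \<in> borel_measurable cemetery_borel" unfolding \<phi>_def by measurable
 have \<phi>1: "\<phi> z \<le> 1" for z
 proof -
  have "\<phi> z \<le> (\<integral>\<^sup>+w. 1 \<partial>Pr z)" unfolding \<phi>_def by (intro nn_integral_mono exit_weight_le_1)
  then show ?thesis using prob_space.emeasure_space_1[OF prob_space_Pr, of z] by simp
 qed
 have \<phi>N: "\<phi> None = 1"
 proof -
  have "AE w in Pr None. exit_weight D w = 1" using AE_start[of None]
  proof eventually_elim
   case (elim w)
   then have "leave D w = 0" by (intro leave_eq_0) auto
   then show ?case by (simp add: exit_weight_def decay_def)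
  qed
  then have "\<phi> None = (\<integral>\<^sup>+w. 1 \<partial>Pr None)" unfolding \<phi>_def by (rule nn_integral_cong_AE)
  then show ?thesis using prob_space.emeasure_space_1[OF prob_space_Pr, of None] by simp
 qed
 \<comment> \<open>The expected weight is 1 at the cemetery, while functions are extended there by
   0; passing to the complement to 1 reconciles the two.\<close>
 define \<psi> where "\<psi> x = 1 - enn2real (\<phi> (Some x))" for x
 have fin: "\<phi> z = ennreal (enn2real (\<phi> z))" for z
  using le_less_trans[OF \<phi>1[of z] ennreal_one_less_top] by simp
 have en1: "enn2real (\<phi> z) \<le> 1" for z using \<phi>1[of z] by (intro enn2real_leI) auto
 have \<psi>m [measurable]: "\<psi> \<in> borel_fun"
 proof -
  have "(\<lambda>x. \<phi> (Some x)) \<in> borel_fun" by (rule measurable_compose[OF Some_measurable \<phi>m])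
  then show ?thesis unfolding \<psi>_def by measurable
 qed
 have \<psi>b: "0 \<le> \<psi> x" "\<psi> x \<le> 1" for x using en1[of "Some x"] by (auto simp: \<psi>_def)
 have "continuous_on UNIV (semigroup_op Z s \<psi>)"
  using sf s \<psi>m \<psi>b unfolding strongly_feller_def bounded_iff by (metis (no_types, lifting) abs_of_nonneg rangeE real_norm_def)
 then have c: "continuous_on UNIV (\<lambda>x. exp (- s) * (1 - semigroup_op Z s \<psi> x))" by (intro continuous_intros)
 have "exit_potential D n x = ennreal (exp (- s) * (1 - semigroup_op Z s \<psi> x))" for x
 proof -
  interpret P: prob_space "Pr (Some x)" by (rule prob_space_Pr)
  have rel: "\<phi> z = ennreal (1 - ext0 \<psi> z)" for z
   using fin[of z] \<phi>N by (cases z) (simp_all add: ext0_def \<psi>_def)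
  have eb: "0 \<le> ext0 \<psi> z \<and> ext0 \<psi> z \<le> 1" for z using \<psi>b by (auto simp: ext0_def split: option.split)
  have m [measurable]: "(\<lambda>w. ext0 \<psi> (St (ennreal s) w)) \<in> borel_measurable NF"
   by (rule measurable_compose[OF _ ext0_measurable[OF \<psi>m]]) simp
  have int: "integrable (Pr (Some x)) (\<lambda>w. ext0 \<psi> (St (ennreal s) w))"
   by (intro P.integrable_const_bound[where B = 1]) (use eb in auto)
  have "exit_potential D n x = ennreal (exp (- s)) * (\<integral>\<^sup>+w. exit_weight D (shift (ennreal s) w) \<partial>Pr (Some x))"
   unfolding exit_potential_def restarted_weight_def s_def[symmetric] by (rule nn_integral_cmult) simp
  also have "(\<integral>\<^sup>+w. exit_weight D (shift (ennreal s) w) \<partial>Pr (Some x)) = (\<integral>\<^sup>+w. \<phi> (St (ennreal s) w) \<partial>Pr (Some x))"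
   unfolding \<phi>_def by (rule strong_markov_const) auto
  also have "\<dots> = (\<integral>\<^sup>+w. ennreal (1 - ext0 \<psi> (St (ennreal s) w)) \<partial>Pr (Some x))" by (simp add: rel)
  also have "\<dots> = ennreal (\<integral>w. 1 - ext0 \<psi> (St (ennreal s) w) \<partial>Pr (Some x))"
   by (rule nn_integral_eq_integral) (use int eb in auto)
  also have "(\<integral>w. 1 - ext0 \<psi> (St (ennreal s) w) \<partial>Pr (Some x)) = 1 - semigroup_op Z s \<psi> x"
   unfolding semigroup_op_def using int P.prob_space by (subst Bochner_Integration.integral_diff) auto
  finally show ?thesis by (simp add: ennreal_mult'[symmetric])
 qed
 with c show ?thesis by blast
qed

text \<open>Each \<open>N k\<close> is closed, because the potentials are continuous. A point from
  which \<open>N k\<close> is hit at once also exits D at once, so its supremum of potentials is 1;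
  but it lies in \<open>N k\<close> by closedness, where the supremum is at most
  \<open>1 - restart k\<close>. Hence \<open>N k\<close> is thin.\<close>

theorem irregular_points_polar:
 assumes D: "open D" and sf: "strongly_feller Z" and hyp: "\<And>A. semipolar Z A \<Longrightarrow> polar Z A"
 shows "polar Z (frontier D - regular_points Z D)"
proof (rule hyp)
 let ?a = "\<lambda>x. SUP n. exit_potential D n x"
 define N where "N k = {x. x \<notin> D \<and> ?a x \<le> ennreal (1 - restart k)}" for k
 have closed: "closed (N k)" for k
 proof -
  have "closed {x. exit_potential D n x \<le> ennreal (1 - restart k)}" for n
  proof -
   obtain h where h: "continuous_on UNIV h" "\<forall>x. exit_potential D n x = ennreal (h x)"
    using exit_potential_continuous[OF D sf, of n] by (elim exE conjE)
   have "restart k \<le> 1" by (simp add: restart_def)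
   then have "{x. exit_potential D n x \<le> ennreal (1 - restart k)} = {x. h x \<le> 1 - restart k}"
    by (auto simp: h(2) ennreal_le_iff)
   then show ?thesis using closed_Collect_le[OF h(1) continuous_on_const] by simp
  qed
  then have "closed (- D \<inter> (\<Inter>n. {x. exit_potential D n x \<le> ennreal (1 - restart k)}))"
   using D by (intro closed_Int closed_INT) auto
  moreover have "N k = - D \<inter> (\<Inter>n. {x. exit_potential D n x \<le> ennreal (1 - restart k)})"
   by (auto simp: N_def SUP_le_iff)
  ultimately show ?thesis by simp
 qed
 have "thin Z (N k)" for k unfolding thin_def
 proof (intro bexI[of _ "N k"] conjI allI notI)
  fix x assume hit: "AE w in law Z (Some x). hitting_time Z (Some ` N k) w = 0"
  have "AE w in Pr (Some x). exit_time Z D w = 0" using hit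
  proof eventually_elim
   case (elim w)
   have "exit_time Z D w \<le> hitting_time Z (Some ` N k) w"
    unfolding exit_time_def hitting_time_def by (intro Inf_superset_mono) (auto simp: N_def)
   then show ?case using elim by simp
  qed
  then have one: "?a x = 1" by (rule SUP_exit_potential_regular[OF D])
  have "AE w in Pr (Some x). w \<in> Om \<and> St 0 w = Some x \<and> hitting_time Z (Some ` N k) w = 0"
   using hit AE_start AE_space by eventually_elim simp
  from eventually_happens'[OF prob_space.ae_filter_bot[OF prob_space_Pr] this]
  obtain w where w: "w \<in> Om" "St 0 w = Some x" "hitting_time Z (Some ` N k) w = 0" by (elim exE conjE)
  have "x \<in> N k"
  proof (rule ccontr)
   assume "x \<notin> N k"
   then have "St 0 w \<in> Some ` (- N k)" using w(2) by simp
   moreover have "open (- N k)" by (rule open_Compl[OF closed])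
   ultimately have "\<exists>b>0. \<forall>s. 0 \<le> s \<longrightarrow> s < b \<longrightarrow> St s w \<in> Some ` (- N k)"
    by (intro right_cont_Some[OF w(1) ennreal_zero_less_top])
   then obtain b where b: "b > 0" "\<forall>s. 0 \<le> s \<longrightarrow> s < b \<longrightarrow> St s w \<in> Some ` (- N k)"
    by (elim exE conjE)
   have "b \<le> hitting_time Z (Some ` N k) w" unfolding hitting_time_def
   proof (rule Inf_greatest)
    fix t assume "t \<in> {t. 0 < t \<and> St t w \<in> Some ` N k}"
    then have "St t w \<notin> Some ` (- N k)" by auto
    then have "\<not> t < b" using b(2) by auto
    then show "b \<le> t" by simp
   qed
   then show False using b(1) w(3) by simp
  qed
  then have "1 \<le> ennreal (1 - restart k)" using one by (simp add: N_def)
  then show False using restart_pos[of k] by (simp add: ennreal_1[symmetric] ennreal_le_iff restart_def del: ennreal_1)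
 qed (use borel_closed[OF closed] in auto)
 moreover have "frontier D - regular_points Z D \<subseteq> (\<Union>k. N k)"
 proof
  fix x assume x: "x \<in> frontier D - regular_points Z D"
  then have nD: "x \<notin> D" using D by (simp add: frontier_def interior_open)
  have "\<not> 1 \<le> ?a x" using SUP_exit_potential_irregular[OF D, of x] x by (auto simp: regular_points_def)
  then obtain c where c: "0 \<le> c" "?a x = ennreal c" "c < 1"
   by (cases "?a x") (auto simp: ennreal_1[symmetric] ennreal_le_iff simp del: ennreal_1)
  obtain k where "1 / real (Suc k) < 1 - c" using nat_approx_posE[of "1 - c"] c by auto
  then have "c \<le> 1 - restart k" by (simp add: restart_def)
  then have "x \<in> N k" using nD c by (simp add: N_def ennreal_leI)
  then show "x \<in> (\<Union>k. N k)" by blast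
 qed
 ultimately show "semipolar Z (frontier D - regular_points Z D)" unfolding semipolar_def by blast
qed

lemma AE_exit_avoids_polar:
 assumes pol: "polar Z A" and U: "open U" and x: "x \<in> U"
 shows "AE w in Pr (Some x). St (leave U w) w \<notin> Some ` A"
proof -
 obtain B where B: "A \<subseteq> B" "AE w in Pr (Some x). hitting_time Z (Some ` B) w = \<top>"
  using pol unfolding polar_def by blast
 from B(2) AE_exit_time[OF U x] AE_space show ?thesis
 proof eventually_elim
  case (elim w)
  show ?case
  proof
   assume "St (leave U w) w \<in> Some ` A"
   then have *: "St (leave U w) w \<in> Some ` B" using B(1) by auto
   then have "leave U w \<noteq> \<top>" using state_top elim by auto
   moreover have "hitting_time Z (Some ` B) w \<le> leave U w" using elim * by (intro hitting_time_le) auto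
   ultimately show False using elim by (simp add: top_unique)
  qed
 qed
qed

text \<open>A point outside D lies off the closure, is regular, or belongs to the polar set of
  irregular points, which the exit from U avoids. So u may be set to 0 on all of V outside
  D.\<close>

lemma H_vanishing_boundary:
 assumes pol: "polar Z (frontier D - regular_points Z D)" and U: "open U" and x: "x \<in> U"
  and u: "\<And>y. y \<in> V \<Longrightarrow> y \<in> - closure D \<union> regular_points Z D \<Longrightarrow> u y = 0" and D: "open D"
 shows "H l U u x = H l U (\<lambda>y. if y \<in> V \<and> y \<notin> D then 0 else u y) x"
 unfolding H_def exit_path_def
proof (rule nn_integral_cong_AE)
 show "AE w in Pr (Some x). decay l (leave U w) * ext0 u (St (leave U w) w) =
   decay l (leave U w) * ext0 (\<lambda>y. if y \<in> V \<and> y \<notin> D then 0 else u y) (St (leave U w) w)"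
  using AE_exit_avoids_polar[OF pol U x]
 proof eventually_elim
  case (elim w)
  show ?case
  proof (cases "St (leave U w) w")
   case (Some y)
   have "u y = 0" if "y \<in> V" "y \<notin> D"
   proof (rule u[OF that(1)])
    show "y \<in> - closure D \<union> regular_points Z D"
     using elim that(2) D Some by (auto simp: frontier_def interior_open)
   qed
   then show ?thesis using Some by (simp add: ext0_def)
  qed (simp add: ext0_def)
 qed
qed

end

section \<open>Perturbation by a bounded killing rate\<close>

lemma SUP_min_of_nat: "(SUP n. min x (of_nat n)) = (x :: ennreal)"
proof (cases "x = \<top>")
 case True
 then show ?thesis by (simp add: ennreal_SUP_of_nat_eq_top)
next
 case False
 then obtain r where r: "x = ennreal r" "0 \<le> r" by (cases x) auto
 obtain n :: nat where "r \<le> real n" using real_arch_simple ..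
 then have n: "x \<le> of_nat n" unfolding r ennreal_of_nat_eq_real_of_nat by (rule ennreal_leI)
 show ?thesis
 proof (rule antisym)
  show "(SUP n. min x (of_nat n)) \<le> x" by (rule SUP_least) simp
  show "x \<le> (SUP n. min x (of_nat n))" using n by (intro SUP_upper2[of n]) auto
 qed
qed

text \<open>The Green operator of the process killed in addition at rate \<open>c \<le> M\<close> is
 \<open>\<Sum>n. (R\<^sub>M (M - c))^n R\<^sub>M\<close>, with \<open>R\<^sub>M\<close> the \<open>M\<close>-resolvent: ring a clock at rate \<open>M\<close> and survive each
 ring with probability \<open>1 - c / M\<close>. All terms are positive kernels.\<close>

context hunt begin

definition FK :: "real \<Rightarrow> ('a \<Rightarrow> real) \<Rightarrow> 'a set \<Rightarrow> ('a \<Rightarrow> ennreal) \<Rightarrow> 'a \<Rightarrow> ennreal" where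
 "FK M c D f x = R M D (\<lambda>y. ennreal (M - c y) * f y) x"

definition FKsum :: "real \<Rightarrow> ('a \<Rightarrow> real) \<Rightarrow> 'a set \<Rightarrow> ('a \<Rightarrow> ennreal) \<Rightarrow> 'a \<Rightarrow> ennreal" where
 "FKsum M c D a x = (\<Sum>n. (FK M c D ^^ n) a x)"

context
 fixes M :: real and c :: "'a \<Rightarrow> real" and D :: "'a set"
 assumes cm [measurable]: "c \<in> borel_fun"
begin

lemma FK_measurable [measurable]:
 assumes [measurable]: "f \<in> borel_fun" shows "FK M c D f \<in> borel_fun" unfolding FK_def by measurable

lemma FK_pow_measurable [measurable]:
 "f \<in> borel_fun \<Longrightarrow> (FK M c D ^^ n) f \<in> borel_fun"
 by (induction n) (auto intro: FK_measurable)

lemma FKsum_measurable [measurable]: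
 assumes [measurable]: "f \<in> borel_fun" shows "FKsum M c D f \<in> borel_fun"
 unfolding FKsum_def by measurable

lemma FK_mono: "(\<And>y. y \<in> D \<Longrightarrow> f y \<le> g y) \<Longrightarrow> FK M c D f x \<le> FK M c D g x"
 unfolding FK_def by (intro R_mono mult_left_mono) auto

lemma FK_add:
 assumes [measurable]: "f \<in> borel_fun" "g \<in> borel_fun"
 shows "FK M c D (\<lambda>y. f y + g y) x = FK M c D f x + FK M c D g x"
 unfolding FK_def distrib_left by (rule R_add) measurable

lemma FK_cmult:
 assumes [measurable]: "f \<in> borel_fun"
 shows "FK M c D (\<lambda>y. k * f y) x = k * FK M c D f x"
 unfolding FK_def mult.left_commute[of _ k] by (rule R_cmult) measurable

lemma FK_zero [simp]: "FK M c D (\<lambda>_. 0) x = 0" by (simp add: FK_def)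

lemma FK_sum:
 fixes n :: nat
 assumes "\<And>i. F i \<in> borel_fun"
 shows "FK M c D (\<lambda>y. \<Sum>i<n. F i y) x = (\<Sum>i<n. FK M c D (F i) x)"
proof (induction n)
 case (Suc n)
 have "(\<lambda>y. \<Sum>i<n. F i y) \<in> borel_fun" using assms by (intro borel_measurable_sum)
 then show ?case using Suc assms by (simp add: FK_add)
qed simp

lemma FK_SUP:
 assumes [measurable]: "\<And>i. F i \<in> borel_fun" and inc: "incseq F"
 shows "FK M c D (\<lambda>y. SUP i. F i y) x = (SUP i. FK M c D (F i) x)"
 unfolding FK_def SUP_mult_left_ennreal
proof (rule R_SUP)
 show "incseq (\<lambda>i y. ennreal (M - c y) * F i y)"
  using inc by (auto simp: incseq_def le_fun_def intro!: mult_left_mono)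
qed measurable

lemma FK_partial_sum:
 assumes a: "a \<in> borel_fun"
 shows "(\<Sum>i<Suc n. (FK M c D ^^ i) a x) = a x + FK M c D (\<lambda>y. \<Sum>i<n. (FK M c D ^^ i) a y) x"
 unfolding sum.lessThan_Suc_shift FK_sum[OF FK_pow_measurable[OF a]] by simp

lemma FKsum_SUP: "FKsum M c D a x = (SUP n. \<Sum>i<n. (FK M c D ^^ i) a x)"
 unfolding FKsum_def by (rule suminf_eq_SUP)

lemma FKsum_unfold:
 assumes a: "a \<in> borel_fun"
 shows "FKsum M c D a x = a x + FK M c D (FKsum M c D a) x"
proof -
 have inc: "incseq (\<lambda>n x. \<Sum>i<n. (FK M c D ^^ i) a x)"
  by (auto simp: incseq_def le_fun_def intro!: sum_mono2)
 have inc': "incseq (\<lambda>n. \<Sum>i<n. (FK M c D ^^ i) a x)" by (auto simp: incseq_def intro!: sum_mono2)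
 have "FKsum M c D a x = (SUP n. \<Sum>i<Suc n. (FK M c D ^^ i) a x)" unfolding FKsum_SUP
 proof (intro antisym SUP_least)
  fix n
  have "(\<Sum>i<n. (FK M c D ^^ i) a x) \<le> (\<Sum>i<Suc n. (FK M c D ^^ i) a x)"
   using incseqD[OF inc', of n "Suc n"] by simp
  also have "\<dots> \<le> (SUP n. \<Sum>i<Suc n. (FK M c D ^^ i) a x)" by (rule SUP_upper) simp
  finally show "(\<Sum>i<n. (FK M c D ^^ i) a x) \<le> (SUP n. \<Sum>i<Suc n. (FK M c D ^^ i) a x)" .
 next
  fix n
  show "(\<Sum>i<Suc n. (FK M c D ^^ i) a x) \<le> (SUP n. \<Sum>i<n. (FK M c D ^^ i) a x)"
   by (rule SUP_upper) simp
 qed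
 also have "\<dots> = a x + (SUP n. FK M c D (\<lambda>y. \<Sum>i<n. (FK M c D ^^ i) a y) x)"
  unfolding FK_partial_sum[OF a] by (simp add: ennreal_SUP_add_right)
 also have "(SUP n. FK M c D (\<lambda>y. \<Sum>i<n. (FK M c D ^^ i) a y) x) = FK M c D (\<lambda>y. SUP n. \<Sum>i<n. (FK M c D ^^ i) a y) x"
  by (rule FK_SUP[symmetric, OF borel_measurable_sum[OF FK_pow_measurable[OF a]] inc])
 finally show ?thesis by (simp add: FKsum_SUP[abs_def])
qed

text \<open>The partial sums stay below every supersolution, by induction through
  \<open>FK_partial_sum\<close>. This minimality is the substitute for subtracting
  potentials.\<close>

lemma FKsum_least:
 assumes a: "a \<in> borel_fun"
  and s: "\<And>x. x \<in> D \<Longrightarrow> a x + FK M c D s x \<le> s x" and x: "x \<in> D"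
 shows "FKsum M c D a x \<le> s x" unfolding FKsum_SUP
proof (rule SUP_least)
 fix n
 show "(\<Sum>i<n. (FK M c D ^^ i) a x) \<le> s x" using x
 proof (induction n arbitrary: x)
  case (Suc n)
  have "(\<Sum>i<Suc n. (FK M c D ^^ i) a x) \<le> a x + FK M c D s x"
   unfolding FK_partial_sum[OF a] by (intro add_left_mono FK_mono Suc.IH)
  also have "\<dots> \<le> s x" by (rule s[OF Suc.prems])
  finally show ?case .
 qed simp
qed

text \<open>Iterating the subsolution inequality leaves a remainder, the n-th power applied to w,
  which has to be shown to vanish separately.\<close>

lemma FK_iter_upper:
 assumes a: "a \<in> borel_fun" and w: "w \<in> borel_fun"
  and le: "\<And>x. x \<in> D \<Longrightarrow> w x \<le> a x + FK M c D w x" and x: "x \<in> D"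
 shows "w x \<le> (\<Sum>i<n. (FK M c D ^^ i) a x) + (FK M c D ^^ n) w x" using x
proof (induction n arbitrary: x)
 case (Suc n)
 have sm: "(\<lambda>y. \<Sum>i<n. (FK M c D ^^ i) a y) \<in> borel_fun"
  by (intro borel_measurable_sum FK_pow_measurable[OF a])
 have "w x \<le> a x + FK M c D w x" by (rule le[OF Suc.prems])
 also have "\<dots> \<le> a x + FK M c D (\<lambda>y. (\<Sum>i<n. (FK M c D ^^ i) a y) + (FK M c D ^^ n) w y) x"
  by (intro add_left_mono FK_mono Suc.IH)
 also have "\<dots> = (\<Sum>i<Suc n. (FK M c D ^^ i) a x) + (FK M c D ^^ Suc n) w x"
  unfolding FK_partial_sum[OF a] FK_add[OF sm FK_pow_measurable[OF w]] by (simp add: add.assoc)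
 finally show ?case .
qed simp

lemma FKsum_add:
 assumes a: "a \<in> borel_fun" and b: "b \<in> borel_fun"
 shows "FKsum M c D (\<lambda>x. a x + b x) x = FKsum M c D a x + FKsum M c D b x"
proof -
 have "(FK M c D ^^ n) (\<lambda>x. a x + b x) = (\<lambda>x. (FK M c D ^^ n) a x + (FK M c D ^^ n) b x)" for n
 proof (induction n)
  case (Suc n)
  then show ?case by (auto simp: FK_add[OF FK_pow_measurable[OF a] FK_pow_measurable[OF b]])
 qed simp
 then show ?thesis unfolding FKsum_def by (simp add: suminf_add[symmetric])
qed

lemma FKsum_cmult:
 assumes a: "a \<in> borel_fun"
 shows "FKsum M c D (\<lambda>x. k * a x) x = k * FKsum M c D a x"
proof -
 have "(FK M c D ^^ n) (\<lambda>x. k * a x) = (\<lambda>x. k * (FK M c D ^^ n) a x)" for n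
 proof (induction n)
  case (Suc n)
  then show ?case by (auto simp: FK_cmult[OF FK_pow_measurable[OF a]])
 qed simp
 then show ?thesis unfolding FKsum_def by simp
qed

lemma FKsum_mono:
 assumes "\<And>x. x \<in> D \<Longrightarrow> a x \<le> b x" "x \<in> D"
 shows "FKsum M c D a x \<le> FKsum M c D b x"
proof -
 have "(FK M c D ^^ n) a y \<le> (FK M c D ^^ n) b y" if "y \<in> D" for n y
  using that by (induction n arbitrary: y) (auto intro!: FK_mono assms(1))
 then show ?thesis unfolding FKsum_def using assms(2) by (intro suminf_le) auto
qed

end

section \<open>Comparison principle for the process with extra killing\<close>

lemma FK_pow_le_clock:
 assumes M: "0 \<le> M" and c: "\<And>y. 0 \<le> c y"
 shows "(FK M c D ^^ n) f x \<le> (FK M (\<lambda>_. 0) D ^^ n) f x"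
proof (induction n arbitrary: x)
 case (Suc n)
 have "FK M c D h x \<le> FK M (\<lambda>_. 0) D h' x" if "\<And>y. h y \<le> h' y" for h h' unfolding FK_def
 proof (rule R_mono)
  fix y
  have "ennreal (M - c y) \<le> ennreal (M - 0)" using c[of y] by (intro ennreal_leI) simp
  then show "ennreal (M - c y) * h y \<le> ennreal (M - 0) * h' y" using that by (rule mult_mono) auto
 qed
 then show ?case using Suc.IH by simp
qed simp

text \<open>The n-th power is the chance of n rings before the exit. Applied to the M-resolvent of
  1, the powers are the terms of a series bounded by the mean exit time, so they tend to 0.\<close>

lemma clock_pow_tendsto_0:
 assumes M: "0 \<le> M" and x: "x \<in> D" and fin: "R 0 D (\<lambda>_. 1) x < \<top>"
 shows "(\<lambda>n. (FK M (\<lambda>_. 0) D ^^ n) (\<lambda>_. 1) x) \<longlonglongrightarrow> 0"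
proof -
 let ?T = "FK M (\<lambda>_. 0) D"
 have z: "(\<lambda>_. 0::real) \<in> borel_fun" by simp
 have one: "(\<lambda>_. 1::ennreal) \<in> borel_fun" by simp
 note R1 = R_measurable[OF one]
 have "FKsum M (\<lambda>_. 0) D (R M D (\<lambda>_. 1)) x \<le> R 0 D (\<lambda>_. 1) x"
 proof (rule FKsum_least[OF z R1 _ x, where s = "R 0 D (\<lambda>_. 1)"])
  fix y
  have "FK M (\<lambda>_. 0) D (R 0 D (\<lambda>_. 1)) y = ennreal M * R M D (R 0 D (\<lambda>_. 1)) y"
   unfolding FK_def using R_cmult[OF R1, of M D "ennreal M" 0 D y] by simp
  then show "R M D (\<lambda>_. 1) y + ?T (R 0 D (\<lambda>_. 1)) y \<le> R 0 D (\<lambda>_. 1) y"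
   using R_resolvent(1)[OF one M, of D y] by simp
 qed
 then have *: "(\<Sum>n. (?T ^^ n) (R M D (\<lambda>_. 1)) x) < \<top>" unfolding FKsum_def using fin by (rule le_less_trans)
 have "(\<lambda>n. (?T ^^ n) (R M D (\<lambda>_. 1)) x) \<longlonglongrightarrow> 0"
 proof -
  define r where "r n = enn2real ((?T ^^ n) (R M D (\<lambda>_. 1)) x)" for n
  have lt: "(?T ^^ n) (R M D (\<lambda>_. 1)) x < \<top>" for n
   using sum_le_suminf[OF summableI, of "{n}" "\<lambda>n. (?T ^^ n) (R M D (\<lambda>_. 1)) x"] * by (auto intro: le_less_trans)
  then have e: "(?T ^^ n) (R M D (\<lambda>_. 1)) x = ennreal (r n)" for n by (simp add: r_def)
  have "(\<Sum>n. ennreal (r n)) \<noteq> \<top>" using * by (simp add: e)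
  then have "summable r" by (rule summable_suminf_not_top[rotated]) (simp add: r_def)
  then have "r \<longlonglongrightarrow> 0" by (rule summable_LIMSEQ_zero)
  then have "(\<lambda>n. ennreal (r n)) \<longlonglongrightarrow> ennreal 0" by (rule tendsto_ennrealI)
  then show ?thesis by (simp add: e)
 qed
 then have lim: "(\<lambda>n. ennreal M * (?T ^^ n) (R M D (\<lambda>_. 1)) x) \<longlonglongrightarrow> ennreal M * 0"
  by (intro tendsto_mult_ennreal tendsto_const) auto
 have "(?T ^^ Suc n) (\<lambda>_. 1) x = ennreal M * (?T ^^ n) (R M D (\<lambda>_. 1)) x" for n
 proof -
  have "?T (\<lambda>_. 1) = (\<lambda>y. ennreal M * R M D (\<lambda>_. 1) y)"
   unfolding FK_def using R_cmult[OF one, of M D "ennreal M"] by auto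
  then have "(?T ^^ Suc n) (\<lambda>_. 1) x = (?T ^^ n) (\<lambda>y. ennreal M * R M D (\<lambda>_. 1) y) x"
   by (simp only: funpow_Suc_right o_def)
  also have "(?T ^^ n) (\<lambda>y. ennreal M * R M D (\<lambda>_. 1) y) = (\<lambda>y. ennreal M * (?T ^^ n) (R M D (\<lambda>_. 1)) y)"
  proof (induction n)
   case (Suc n)
   then show ?case by (auto simp: FK_cmult[OF z FK_pow_measurable[OF z R1]])
  qed simp
  finally show ?thesis .
 qed
 then have "(\<lambda>n. (?T ^^ Suc n) (\<lambda>_. 1) x) \<longlonglongrightarrow> 0" using lim by simp
 then show ?thesis by (rule LIMSEQ_imp_Suc)
qed

lemma FK_pow_tendsto_0:
 assumes M: "0 \<le> M" and c: "\<And>y. 0 \<le> c y" and x: "x \<in> D" and fin: "R 0 D (\<lambda>_. 1) x < \<top>"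
  and w: "\<And>y. y \<in> D \<Longrightarrow> w y \<le> ennreal B"
 shows "(\<lambda>n. (FK M c D ^^ n) w x) \<longlonglongrightarrow> 0"
proof -
 have z: "(\<lambda>_. 0::real) \<in> borel_fun" by simp
 have one: "(\<lambda>_. 1::ennreal) \<in> borel_fun" by simp
 have up: "(FK M (\<lambda>_. 0) D ^^ n) w y \<le> ennreal B * (FK M (\<lambda>_. 0) D ^^ n) (\<lambda>_. 1) y" if "y \<in> D" for n y
  using that
 proof (induction n arbitrary: y)
  case 0 then show ?case using w by simp
 next
  case (Suc n)
  have FK_pow_Suc: "(FK M (\<lambda>_. 0) D ^^ Suc n) f = FK M (\<lambda>_. 0) D ((FK M (\<lambda>_. 0) D ^^ n) f)" for f
   by simp
  have "(FK M (\<lambda>_. 0) D ^^ Suc n) w y \<le> FK M (\<lambda>_. 0) D (\<lambda>y. ennreal B * (FK M (\<lambda>_. 0) D ^^ n) (\<lambda>_. 1) y) y"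
   unfolding FK_pow_Suc by (rule FK_mono[OF z Suc.IH])
  also have "\<dots> = ennreal B * (FK M (\<lambda>_. 0) D ^^ Suc n) (\<lambda>_. 1) y"
   unfolding FK_pow_Suc by (rule FK_cmult[OF z FK_pow_measurable[OF z one]])
  finally show ?case .
 qed
 have lim: "(\<lambda>n. ennreal B * (FK M (\<lambda>_. 0) D ^^ n) (\<lambda>_. 1) x) \<longlonglongrightarrow> ennreal B * 0"
  by (intro tendsto_mult_ennreal tendsto_const clock_pow_tendsto_0[OF M x fin]) auto
 show ?thesis
 proof (rule tendsto_sandwich[OF _ _ tendsto_const])
  show "\<forall>\<^sub>F n in sequentially. (FK M c D ^^ n) w x \<le> ennreal B * (FK M (\<lambda>_. 0) D ^^ n) (\<lambda>_. 1) x"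
  proof (intro always_eventually allI)
   fix n
   have "(FK M c D ^^ n) w x \<le> (FK M (\<lambda>_. 0) D ^^ n) w x" by (rule FK_pow_le_clock[OF M c])
   also have "\<dots> \<le> ennreal B * (FK M (\<lambda>_. 0) D ^^ n) (\<lambda>_. 1) x" by (rule up[OF x])
   finally show "(FK M c D ^^ n) w x \<le> \<dots>" .
  qed
 qed (use lim in auto)
qed

text \<open>Boundedness of w and the finite mean exit time make the remainder of the iterated
  subsolution inequality vanish; the series left over is minimal among supersolutions.\<close>

lemma FK_comparison:
 assumes M: "0 \<le> M" and c [measurable]: "c \<in> borel_fun" "\<And>y. 0 \<le> c y"
  and a: "a \<in> borel_fun" and w: "w \<in> borel_fun"
  and wB: "\<And>y. y \<in> D \<Longrightarrow> w y \<le> ennreal B"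
  and sub: "\<And>x. x \<in> D \<Longrightarrow> w x \<le> a x + FK M c D w x"
  and super: "\<And>x. x \<in> D \<Longrightarrow> a x + FK M c D s x \<le> s x"
  and x: "x \<in> D" and fin: "R 0 D (\<lambda>_. 1) x < \<top>"
 shows "w x \<le> s x"
proof (rule LIMSEQ_le_const)
 have "(\<lambda>n. s x + (FK M c D ^^ n) w x) \<longlonglongrightarrow> s x + 0"
  by (intro tendsto_add tendsto_const FK_pow_tendsto_0[OF M c(2) x fin wB])
 then show "(\<lambda>n. s x + (FK M c D ^^ n) w x) \<longlonglongrightarrow> s x" by simp
 have "w x \<le> s x + (FK M c D ^^ n) w x" for n
 proof -
  have "w x \<le> (\<Sum>i<n. (FK M c D ^^ i) a x) + (FK M c D ^^ n) w x"
   by (rule FK_iter_upper[OF c(1) a w sub x])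
  also have "(\<Sum>i<n. (FK M c D ^^ i) a x) \<le> FKsum M c D a x"
   unfolding FKsum_def by (rule sum_le_suminf) auto
  also have "\<dots> \<le> s x" by (rule FKsum_least[OF c(1) a super x])
  finally show ?thesis by (simp add: add_right_mono)
 qed
 then show "\<exists>N. \<forall>n\<ge>N. w x \<le> s x + (FK M c D ^^ n) w x" by blast
qed

text \<open>Extra killing can only diminish the exit law: by the resolvent equation the undiscounted
  exit kernel is a supersolution.\<close>

lemma FKsum_H_le:
 assumes M: "0 \<le> M" and c [measurable]: "c \<in> borel_fun" "\<And>y. 0 \<le> c y"
  and g: "g \<in> borel_fun" and x: "x \<in> D"
 shows "FKsum M c D (H M D g) x \<le> H 0 D g x"
proof (rule FKsum_least[OF c(1) H_measurable[OF g] _ x])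
 fix y
 have "FK M c D (H 0 D g) y \<le> R M D (\<lambda>y. ennreal M * H 0 D g y) y"
  unfolding FK_def by (intro R_mono mult_right_mono ennreal_leI) (use c in auto)
 also have "\<dots> = ennreal M * R M D (H 0 D g) y" by (rule R_cmult[OF H_measurable[OF g]])
 finally show "H M D g y + FK M c D (H 0 D g) y \<le> H 0 D g y"
  using H_resolvent[OF g M, of D y] by (simp add: add_left_mono)
qed

text \<open>Truncating the exit data makes the comparison of bounded solutions applicable.\<close>

lemma harmonic_FK:
 assumes M: "0 < M" and c [measurable]: "c \<in> borel_fun" and c0: "\<And>y. 0 \<le> c y" and cM: "\<And>y. c y \<le> M"
  and u [measurable]: "u \<in> borel_fun" and D: "open D"
  and harm: "\<And>x. x \<in> D \<Longrightarrow> u x = H 0 D u x" and x: "x \<in> D" and fin: "R 0 D (\<lambda>_. 1) x < \<top>"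
 shows "u x \<le> FKsum M c D (H M D u) x + FKsum M c D (R M D (\<lambda>y. ennreal (c y) * u y)) x"
proof -
 define a where "a y = H M D u y + R M D (\<lambda>y. ennreal (c y) * u y) y" for y
 have am [measurable]: "a \<in> borel_fun" unfolding a_def by measurable
 define v where "v L y = min (u y) (of_nat L)" for L y
 have vm [measurable]: "v L \<in> borel_fun" for L unfolding v_def by measurable
 have inc: "incseq v" by (auto simp: incseq_def le_fun_def v_def intro!: min.coboundedI2 min.mono)
 have "H 0 D (v L) x \<le> FKsum M c D a x" for L
 proof (rule FK_comparison[OF less_imp_le[OF M] c c0 am H_measurable[OF vm], where B = "real L"])
  let ?w = "H 0 D (v L)"
  have wm [measurable]: "?w \<in> borel_fun" by (rule H_measurable[OF vm])
  show "?w y \<le> ennreal (real L)" for y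
   by (rule H_le_const[OF D]) (auto simp: v_def ennreal_of_nat_eq_real_of_nat)
  show "a y + FK M c D (FKsum M c D a) y \<le> FKsum M c D a y" for y
   by (simp add: FKsum_unfold[OF c am, symmetric])
  fix y
  have "?w y = H M D (v L) y + R M D (\<lambda>y. ennreal M * ?w y) y"
   using H_resolvent[OF vm[of L] less_imp_le[OF M], of D y] R_cmult[OF wm] by simp
  \<comment> \<open>A ring of the clock either kills, at rate c, or is survived, at rate M - c. The
    killing part becomes a source term, the surviving part is \<open>FK\<close>.\<close>
  also have "(\<lambda>y. ennreal M * ?w y) = (\<lambda>y. ennreal (c y) * ?w y + ennreal (M - c y) * ?w y)"
  proof
   fix v
   have "ennreal M = ennreal (c v) + ennreal (M - c v)"
    using c0[of v] cM[of v] by (subst ennreal_plus[symmetric]) auto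
   then show "ennreal M * ?w v = ennreal (c v) * ?w v + ennreal (M - c v) * ?w v" by (simp add: distrib_right)
  qed
  also have "R M D (\<lambda>y. ennreal (c y) * ?w y + ennreal (M - c y) * ?w y) y = R M D (\<lambda>y. ennreal (c y) * ?w y) y + FK M c D ?w y"
   unfolding FK_def by (rule R_add) measurable
  also have "H M D (v L) y + (R M D (\<lambda>y. ennreal (c y) * ?w y) y + FK M c D ?w y) \<le> a y + FK M c D ?w y"
   unfolding a_def add.assoc[symmetric]
  proof (intro add_right_mono add_mono H_mono[OF D] R_mono mult_left_mono)
   fix z
   show "v L z \<le> u z" by (simp add: v_def)
   assume "z \<in> D"
   then show "?w z \<le> u z" unfolding harm[OF \<open>z \<in> D\<close>] by (intro H_mono[OF D]) (simp add: v_def)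
  qed simp
  finally show "?w y \<le> a y + FK M c D ?w y" .
 qed (use x fin in auto)
 moreover have "u x = (SUP L. H 0 D (v L) x)"
  using H_SUP[OF vm inc] harm[OF x] by (simp add: v_def SUP_min_of_nat)
 ultimately have "u x \<le> FKsum M c D a x" by (simp add: SUP_least)
 then show ?thesis unfolding a_def[abs_def] by (simp add: FKsum_add[OF c H_measurable[OF u]])
qed

text \<open>f plus the perturbed potential of the positive part of its generator is a supersolution:
  the killing rate and the negative part of the generator have the favourable sign and are
  dropped.\<close>

lemma dynkin_FK:
 assumes M: "0 < M" and c [measurable]: "c \<in> borel_fun" and c0: "\<And>y. 0 \<le> c y"
  and D: "open D" and f: "f \<in> gen_domain Z" and f0: "\<And>y. 0 \<le> f y" and fel: "feller Z" and x: "x \<in> D"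
 shows "FKsum M c D (H M D (\<lambda>y. ennreal (f y))) x \<le>
  ennreal (f x) + FKsum M c D (R M D (\<lambda>y. ennreal (gen Z f y))) x"
proof -
 have fC: "f \<in> C0" and gC: "gen Z f \<in> C0" using generates_gen[OF f] by (auto simp: generates_def)
 note [measurable] = C0_measurable[OF fC] C0_measurable[OF gC]
 let ?F = "\<lambda>y. ennreal (f y)" and ?b = "R M D (\<lambda>y. ennreal (gen Z f y))"
 have bm [measurable]: "?b \<in> borel_fun" by measurable
 have Fm: "?F \<in> borel_fun" by measurable
 have Wm: "FKsum M c D ?b \<in> borel_fun" by (rule FKsum_measurable[OF c bm])
 show ?thesis
 proof (rule FKsum_least[OF c _ _ x, where s = "\<lambda>x. ?F x + FKsum M c D ?b x"])
  show "H M D ?F \<in> borel_fun" by measurable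
  fix y
  have "FK M c D ?F y \<le> R M D (\<lambda>y. ennreal (M * f y) + ennreal (- gen Z f y)) y" unfolding FK_def
  proof (rule R_mono)
   fix v
   have "ennreal (M - c v) * ennreal (f v) \<le> ennreal M * ennreal (f v)"
    using c0[of v] by (intro mult_right_mono ennreal_leI) auto
   also have "\<dots> = ennreal (M * f v)" using M f0 by (simp add: ennreal_mult)
   finally show "ennreal (M - c v) * ennreal (f v) \<le> ennreal (M * f v) + ennreal (- gen Z f v)"
    by (rule add_increasing2[rotated]) simp
  qed
  then have "H M D ?F y + FK M c D ?F y \<le> ?F y + ?b y"
   unfolding dynkin[OF D f f0 fel M, of y] by (simp add: add.commute add_right_mono)
  then have "(H M D ?F y + FK M c D ?F y) + FK M c D (FKsum M c D ?b) y \<le> ?F y + ?b y + FK M c D (FKsum M c D ?b) y"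
   by (rule add_right_mono)
  then show "H M D ?F y + FK M c D (\<lambda>x. ?F x + FKsum M c D ?b x) y \<le> ?F y + FKsum M c D ?b y"
   unfolding FK_add[OF c Fm Wm] FKsum_unfold[OF c bm, of M D y] by (simp add: add.assoc)
 qed
qed

end

section \<open>Limits of functionals dominated by a finite measure\<close>

lemma compact_inner_approx:
 fixes \<mu> :: "'a::heine_borel measure"
 assumes sm: "sets \<mu> = sets borel" and fin: "emeasure \<mu> UNIV < \<top>" and B: "B \<in> sets borel" and e: "0 < e"
 shows "\<exists>K. compact K \<and> K \<subseteq> B \<and> emeasure \<mu> (B - K) \<le> ennreal e"
proof -
 have fin': "emeasure \<mu> A \<noteq> \<infinity>" for A
  using emeasure_space[of \<mu> A] fin sets_eq_imp_space_eq[OF sm] by (auto simp: top_unique)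
 obtain r where r: "emeasure \<mu> B = ennreal r" "0 \<le> r" using fin'[of B] by (cases "emeasure \<mu> B") auto
 have "emeasure \<mu> B \<le> ennreal e \<or> ennreal (r - e) < (SUP K\<in>{K. K \<subseteq> B \<and> compact K}. emeasure \<mu> K)"
  unfolding inner_regular[OF sm fin'[of "space \<mu>"] B, symmetric] r
  by (cases "r \<le> e") (use e in \<open>auto intro: ennreal_leI ennreal_lessI\<close>)
 then consider "emeasure \<mu> (B - {}) \<le> ennreal e" | K where "compact K" "K \<subseteq> B" "ennreal (r - e) < emeasure \<mu> K"
  by (auto simp: less_SUP_iff)
 then show ?thesis
 proof cases
  case (2 K)
  have "emeasure \<mu> (B - K) = emeasure \<mu> B - emeasure \<mu> K"
   by (rule emeasure_Diff) (use 2 borel_compact B sm fin' in auto)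
  also have "\<dots> \<le> ennreal e"
  proof -
   have "ennreal r \<le> ennreal (r - e) + ennreal e" using r(2) e by (cases "r \<le> e") (auto simp: ennreal_neg ennreal_plus[symmetric] intro!: ennreal_leI simp del: ennreal_plus)
   also have "\<dots> \<le> emeasure \<mu> K + ennreal e" using 2(3) by (intro add_right_mono) simp
   finally show ?thesis unfolding r by (simp add: ennreal_minus_le_iff add.commute)
  qed
  finally show ?thesis using 2 by (intro exI[of _ K]) simp
 qed (intro exI[of _ "{}"], simp)
qed

text \<open>The exceptional sets are compared through \<open>\<kappa>\<close>, which dominates every \<open>L n\<close> and is inner
 regular, so the bound on compact sets suffices.\<close>

lemma limit_domination:
 fixes \<kappa> \<Theta> :: "'a::heine_borel measure" and L :: "nat \<Rightarrow> ('a \<Rightarrow> ennreal) \<Rightarrow> ennreal"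
 assumes sk: "sets \<kappa> = sets borel" and st: "sets \<Theta> = sets borel" and fin: "emeasure \<kappa> UNIV < \<top>"
  and add: "\<And>n f g. f \<in> borel_fun \<Longrightarrow> g \<in> borel_fun \<Longrightarrow> L n (\<lambda>x. f x + g x) = L n f + L n g"
  and cmult: "\<And>n f c. f \<in> borel_fun \<Longrightarrow> L n (\<lambda>x. c * f x) = c * L n f"
  and le: "\<And>n f. f \<in> borel_fun \<Longrightarrow> L n f \<le> (\<integral>\<^sup>+x. f x \<partial>\<kappa>)"
  and S [measurable]: "S \<in> sets borel"
  and comp: "\<And>K e. compact K \<Longrightarrow> K \<subseteq> S \<Longrightarrow> 0 < e \<Longrightarrow>
   \<forall>\<^sub>F n in sequentially. L n (indicator K) \<le> emeasure \<Theta> K + ennreal e"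
  and g: "g \<in> borel_fun" and gk: "(\<integral>\<^sup>+x. indicator S x * g x \<partial>\<kappa>) < \<top>" and e: "0 < e"
 shows "\<forall>\<^sub>F n in sequentially. L n (\<lambda>x. indicator S x * g x) \<le> (\<integral>\<^sup>+x. indicator S x * g x \<partial>\<Theta>) + ennreal e"
 using g gk e
proof (induction arbitrary: e rule: borel_measurable_induct)
 case (cong f g) then have "f = g" by auto
 with cong show ?case by simp
next
 case (set A)
 then have A [measurable]: "A \<in> sets borel" by simp
 \<comment> \<open>One half of e goes to the compact part through the assumed bound, the other to
   the remainder through \<kappa>, uniformly in n.\<close>
 have "\<exists>K. compact K \<and> K \<subseteq> S \<inter> A \<and> emeasure \<kappa> (S \<inter> A - K) \<le> ennreal (e/2)"
  by (rule compact_inner_approx[OF sk fin]) (use set in auto)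
 then obtain K where K: "compact K" "K \<subseteq> S \<inter> A" "emeasure \<kappa> (S \<inter> A - K) \<le> ennreal (e/2)" by blast
 have Kb [measurable]: "K \<in> sets borel" by (rule borel_closed[OF compact_imp_closed[OF K(1)]])
 have eq: "(\<lambda>x. indicator S x * indicator A x) = (\<lambda>x. indicator K x + indicator (S \<inter> A - K) x :: ennreal)"
  using K(2) by (auto simp: indicator_def fun_eq_iff)
 have "\<forall>\<^sub>F n in sequentially. L n (indicator K) \<le> emeasure \<Theta> K + ennreal (e/2)"
  by (rule comp) (use K set in auto)
 then show ?case
 proof eventually_elim
  case (elim n)
  have "L n (\<lambda>x. indicator S x * indicator A x) = L n (indicator K) + L n (indicator (S \<inter> A - K))"
   unfolding eq by (rule add) measurable
  also have "\<dots> \<le> (emeasure \<Theta> K + ennreal (e/2)) + ennreal (e/2)"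
  proof (intro add_mono elim)
   have "L n (indicator (S \<inter> A - K)) \<le> (\<integral>\<^sup>+x. indicator (S \<inter> A - K) x \<partial>\<kappa>)" by (rule le) measurable
   also have "\<dots> = emeasure \<kappa> (S \<inter> A - K)" by (simp add: sk)
   finally show "L n (indicator (S \<inter> A - K)) \<le> ennreal (e/2)" using K(3) by (rule order_trans)
  qed
  also have "\<dots> = emeasure \<Theta> K + ennreal e" using set by (simp add: add.assoc ennreal_plus[symmetric] del: ennreal_plus)
  also have "\<dots> \<le> emeasure \<Theta> (S \<inter> A) + ennreal e"
   by (intro add_right_mono emeasure_mono) (use K st in auto)
  also have "emeasure \<Theta> (S \<inter> A) = (\<integral>\<^sup>+x. indicator S x * indicator A x \<partial>\<Theta>)"
   by (simp add: indicator_inter_arith[symmetric] st)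
  finally show ?case .
 qed
next
 case (mult u c)
 have um [measurable]: "u \<in> borel_fun" by fact
 have ms: "(\<lambda>x. indicator S x * u x) \<in> borel_fun" by measurable
 have mk: "(\<integral>\<^sup>+x. indicator S x * (c * u x) \<partial>\<mu>) = c * (\<integral>\<^sup>+x. indicator S x * u x \<partial>\<mu>)" if "sets \<mu> = sets borel" for \<mu>
  using ms that by (simp add: mult.left_commute nn_integral_cmult cong: measurable_cong_sets)
 have Lc: "L n (\<lambda>x. indicator S x * (c * u x)) = c * L n (\<lambda>x. indicator S x * u x)" for n
  using cmult[OF ms] by (simp add: mult.left_commute)
 show ?case
 proof (cases "c = 0")
  case True
  have "L n (\<lambda>x. 0) = 0" for n using cmult[of "\<lambda>_. 0" n 0] by simp
  then show ?thesis using True by simp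
 next
  case False
  obtain c' where c': "c = ennreal c'" "0 < c'"
   using False \<open>c < \<top>\<close> by (cases c) (auto simp: less_le)
  have "(\<integral>\<^sup>+x. indicator S x * u x \<partial>\<kappa>) < \<top>"
   using mult.prems(1) False unfolding mk[OF sk] by (auto simp: ennreal_mult_less_top)
  from mult.IH[OF this, of "e / c'"]
  have "\<forall>\<^sub>F n in sequentially. L n (\<lambda>x. indicator S x * u x) \<le> (\<integral>\<^sup>+x. indicator S x * u x \<partial>\<Theta>) + ennreal (e / c')"
   using mult.prems(2) c' by simp
  then show ?thesis
  proof eventually_elim
   case (elim n)
   have "c * L n (\<lambda>x. indicator S x * u x) \<le> c * ((\<integral>\<^sup>+x. indicator S x * u x \<partial>\<Theta>) + ennreal (e / c'))"
    by (rule mult_left_mono[OF elim]) simp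
   also have "\<dots> = c * (\<integral>\<^sup>+x. indicator S x * u x \<partial>\<Theta>) + ennreal e"
    using c' mult.prems(2) by (simp add: distrib_left ennreal_mult[symmetric])
   finally show ?case by (simp add: Lc mk[OF st])
  qed
 qed
next
 case (add u v)
 have um [measurable]: "u \<in> borel_fun" and vm [measurable]: "v \<in> borel_fun" by fact+
 have mu: "(\<lambda>x. indicator S x * u x) \<in> borel_fun" and mv: "(\<lambda>x. indicator S x * v x) \<in> borel_fun"
  by measurable
 have split: "(\<integral>\<^sup>+x. indicator S x * (v x + u x) \<partial>\<mu>) = (\<integral>\<^sup>+x. indicator S x * v x \<partial>\<mu>) + (\<integral>\<^sup>+x. indicator S x * u x \<partial>\<mu>)"
  if "sets \<mu> = sets borel" for \<mu>
  using mu mv that by (simp add: distrib_left nn_integral_add cong: measurable_cong_sets)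
 have Ls: "L n (\<lambda>x. indicator S x * (v x + u x)) = L n (\<lambda>x. indicator S x * v x) + L n (\<lambda>x. indicator S x * u x)" for n
  using assms(4)[OF mv mu] by (simp add: distrib_left)
 have "(\<integral>\<^sup>+x. indicator S x * u x \<partial>\<kappa>) < \<top>" "(\<integral>\<^sup>+x. indicator S x * v x \<partial>\<kappa>) < \<top>"
  using add.prems(1) unfolding split[OF sk] by auto
 from add.IH(1)[OF this(1), of "e/2"] add.IH(2)[OF this(2), of "e/2"]
 have "\<forall>\<^sub>F n in sequentially. L n (\<lambda>x. indicator S x * u x) \<le> (\<integral>\<^sup>+x. indicator S x * u x \<partial>\<Theta>) + ennreal (e/2)"
  "\<forall>\<^sub>F n in sequentially. L n (\<lambda>x. indicator S x * v x) \<le> (\<integral>\<^sup>+x. indicator S x * v x \<partial>\<Theta>) + ennreal (e/2)"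
  using add.prems(2) by auto
 then show ?case
 proof eventually_elim
  case (elim n)
  have "L n (\<lambda>x. indicator S x * (v x + u x)) \<le> ((\<integral>\<^sup>+x. indicator S x * v x \<partial>\<Theta>) + ennreal (e/2)) +
    ((\<integral>\<^sup>+x. indicator S x * u x \<partial>\<Theta>) + ennreal (e/2))"
   unfolding Ls by (intro add_mono elim)
  also have "\<dots> = (\<integral>\<^sup>+x. indicator S x * v x \<partial>\<Theta>) + (\<integral>\<^sup>+x. indicator S x * u x \<partial>\<Theta>) + (ennreal (e/2) + ennreal (e/2))"
   by (simp only: ac_simps)
  also have "ennreal (e/2) + ennreal (e/2) = ennreal e" using add.prems(2) by (simp add: ennreal_plus[symmetric] del: ennreal_plus)
  finally show ?case unfolding split[OF st] .
 qed
next
 case (seq U)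
 have Um [measurable]: "U i \<in> borel_fun" for i by fact
 have inc: "incseq U" by fact
 define w where "w x = (SUP i. U i x)" for x
 have wm [measurable]: "w \<in> borel_fun" unfolding w_def by measurable
 have fw: "(\<lambda>x. indicator S x * Sup (range U) x) = (\<lambda>x. indicator S x * w x)" by (auto simp: w_def image_comp)
 have mS: "(\<lambda>x. indicator S x * U i x) \<in> borel_fun" for i by measurable
 have incS: "incseq (\<lambda>i x. indicator S x * U i x)"
  using inc by (auto simp: incseq_def le_fun_def intro!: mult_left_mono)
 have fin_w: "(\<integral>\<^sup>+x. indicator S x * w x \<partial>\<kappa>) < \<top>" using seq.prems(1) unfolding fw .
 have "(\<integral>\<^sup>+x. indicator S x * w x \<partial>\<kappa>) = (SUP i. \<integral>\<^sup>+x. indicator S x * U i x \<partial>\<kappa>)"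
  unfolding w_def SUP_mult_left_ennreal
  by (rule nn_integral_monotone_convergence_SUP[OF incS]) (use mS sk in \<open>simp cong: measurable_cong_sets\<close>)
 moreover obtain I where I: "(\<integral>\<^sup>+x. indicator S x * w x \<partial>\<kappa>) = ennreal I" "0 \<le> I"
  using fin_w by (cases "\<integral>\<^sup>+x. indicator S x * w x \<partial>\<kappa>") auto
 ultimately have sup: "(SUP i. \<integral>\<^sup>+x. indicator S x * U i x \<partial>\<kappa>) = ennreal I" by simp
 have "\<exists>i. (\<integral>\<^sup>+x. indicator S x * w x \<partial>\<kappa>) \<le> (\<integral>\<^sup>+x. indicator S x * U i x \<partial>\<kappa>) + ennreal (e/2)"
 proof (cases "I < e/2")
  case True
  then have "ennreal I \<le> ennreal (e/2)" by (simp add: ennreal_leI)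
  then show ?thesis unfolding I by (meson add_increasing order_trans zero_le)
 next
  case False
  have "ennreal (I - e/2) < (SUP i. \<integral>\<^sup>+x. indicator S x * U i x \<partial>\<kappa>)"
   unfolding sup using False seq.prems(2) by (intro ennreal_lessI) auto
  then obtain i where "ennreal (I - e/2) < (\<integral>\<^sup>+x. indicator S x * U i x \<partial>\<kappa>)" unfolding less_SUP_iff by blast
  then have "ennreal (I - e/2) + ennreal (e/2) \<le> (\<integral>\<^sup>+x. indicator S x * U i x \<partial>\<kappa>) + ennreal (e/2)"
   by (intro add_right_mono) simp
  moreover have "ennreal (I - e/2) + ennreal (e/2) = ennreal I"
   using False seq.prems(2) by (subst ennreal_plus[symmetric]) auto
  ultimately show ?thesis unfolding I by auto
 qed
 then obtain i where i: "(\<integral>\<^sup>+x. indicator S x * w x \<partial>\<kappa>) \<le> (\<integral>\<^sup>+x. indicator S x * U i x \<partial>\<kappa>) + ennreal (e/2)" ..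
 have Uw: "U i x \<le> w x" for x unfolding w_def by (rule SUP_upper) simp
 \<comment> \<open>The defect of the monotone approximation has small integral for \<kappa>, hence
   is small for every \<open>L n\<close> at once.\<close>
 define d where "d x = w x - U i x" for x
 have dm [measurable]: "d \<in> borel_fun" unfolding d_def by measurable
 have dU: "w x = U i x + d x" for x using Uw by (simp add: d_def add_diff_inverse_ennreal)
 have mdS: "(\<lambda>x. indicator S x * d x) \<in> borel_fun" by measurable
 have fin_U: "(\<integral>\<^sup>+x. indicator S x * U i x \<partial>\<kappa>) < \<top>"
 proof (rule le_less_trans[OF _ fin_w])
  show "(\<integral>\<^sup>+x. indicator S x * U i x \<partial>\<kappa>) \<le> (\<integral>\<^sup>+x. indicator S x * w x \<partial>\<kappa>)"
   by (intro nn_integral_mono mult_left_mono Uw) simp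
 qed
 have "(\<integral>\<^sup>+x. indicator S x * w x \<partial>\<kappa>) = (\<integral>\<^sup>+x. indicator S x * U i x \<partial>\<kappa>) + (\<integral>\<^sup>+x. indicator S x * d x \<partial>\<kappa>)"
  unfolding dU using mS mdS sk by (simp add: distrib_left nn_integral_add cong: measurable_cong_sets)
 then have dsmall: "(\<integral>\<^sup>+x. indicator S x * d x \<partial>\<kappa>) \<le> ennreal (e/2)"
  using i fin_U by (auto simp: ennreal_add_left_cancel_le)
 from seq.IH[OF fin_U, of "e/2"]
 have "\<forall>\<^sub>F n in sequentially. L n (\<lambda>x. indicator S x * U i x) \<le> (\<integral>\<^sup>+x. indicator S x * U i x \<partial>\<Theta>) + ennreal (e/2)"
  using seq.prems(2) by simp
 then show ?case unfolding fw
 proof eventually_elim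
  case (elim n)
  have "L n (\<lambda>x. indicator S x * w x) = L n (\<lambda>x. indicator S x * U i x) + L n (\<lambda>x. indicator S x * d x)"
   using assms(4)[OF mS mdS] by (simp add: dU distrib_left)
  also have "\<dots> \<le> ((\<integral>\<^sup>+x. indicator S x * U i x \<partial>\<Theta>) + ennreal (e/2)) + ennreal (e/2)"
   by (intro add_mono elim order_trans[OF le[OF mdS] dsmall])
  also have "\<dots> = (\<integral>\<^sup>+x. indicator S x * U i x \<partial>\<Theta>) + ennreal e"
   using seq.prems(2) by (simp add: add.assoc ennreal_plus[symmetric] del: ennreal_plus)
  also have "\<dots> \<le> (\<integral>\<^sup>+x. indicator S x * w x \<partial>\<Theta>) + ennreal e"
   by (intro add_right_mono nn_integral_mono mult_left_mono Uw) simp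
  finally show ?case .
 qed
qed

context hunt begin

section \<open>Further estimates for potentials, the generator and exit kernels\<close>

lemma FKsum_R_le:
 assumes M: "0 \<le> M" and c [measurable]: "c \<in> borel_fun" "\<And>y. 0 \<le> c y"
  and k: "k \<in> borel_fun" and x: "x \<in> D"
 shows "FKsum M c D (R M D k) x \<le> R 0 D k x"
proof (rule FKsum_least[OF c(1) R_measurable[OF k] _ x])
 fix y
 have "FK M c D (R 0 D k) y \<le> R M D (\<lambda>y. ennreal M * R 0 D k y) y"
  unfolding FK_def by (intro R_mono mult_right_mono ennreal_leI) (use c in auto)
 also have "\<dots> = ennreal M * R M D (R 0 D k) y" by (rule R_cmult[OF R_measurable[OF k]])
 finally show "R M D k y + FK M c D (R 0 D k) y \<le> R 0 D k y"
  using R_resolvent(1)[OF k M, of D y] by (simp add: add_left_mono)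
qed

text \<open>The potential for V with the same killing rate is a supersolution on the smaller
  set.\<close>

lemma FKsum_mono_set:
 assumes c [measurable]: "c \<in> borel_fun" and k: "k \<in> borel_fun"
  and D: "open D" "open V" "D \<subseteq> V" and x: "x \<in> D"
 shows "FKsum M c D (R M D k) x \<le> FKsum M c V (R M V k) x"
proof (rule FKsum_least[OF c R_measurable[OF k] _ x])
 fix y
 have W [measurable]: "FKsum M c V (R M V k) \<in> borel_fun"
  by (rule FKsum_measurable[OF c R_measurable[OF k]])
 have "R M D k y + FK M c D (FKsum M c V (R M V k)) y \<le> R M V k y + FK M c V (FKsum M c V (R M V k)) y"
  unfolding FK_def by (intro add_mono R_mono_set D k) measurable
 also have "\<dots> = FKsum M c V (R M V k) y" by (rule FKsum_unfold[OF c R_measurable[OF k], symmetric])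
 finally show "R M D k y + FK M c D (FKsum M c V (R M V k)) y \<le> FKsum M c V (R M V k) y" .
qed

text \<open>The positive maximum principle: f attains its maximum 1 at y, and the semigroup applied
  to f does not exceed 1.\<close>

lemma generator_max_principle:
 assumes f: "f \<in> gen_domain Z" and f1: "\<And>y. 0 \<le> f y" "\<And>y. f y \<le> 1" and y: "f y = 1"
 shows "gen Z f y \<le> 0"
proof (rule tendsto_upperbound)
 have g: "generates Z f (gen Z f)" by (rule generates_gen[OF f])
 then show "((\<lambda>t. (semigroup_op Z t f y - f y) / t) \<longlongrightarrow> gen Z f y) (at_right 0)"
  by (auto simp: generates_def dest!: tendsto_uniform_limitI[where x = y])
 have fm: "f \<in> borel_fun" using g by (auto simp: generates_def intro: C0_measurable)
 have "semigroup_op Z t f y \<le> 1" for t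
 proof -
  have "ennreal (semigroup_op Z t f y) = Q t (\<lambda>y. ennreal (f y)) y"
   by (rule semigroup_op_Q(1)[OF fm f1, symmetric])
  also have "\<dots> \<le> (\<integral>\<^sup>+w. 1 \<partial>Pr (Some y))"
   unfolding Q_def by (intro nn_integral_mono) (use f1 in \<open>auto simp: ext0_def split: option.split\<close>)
  also have "\<dots> = 1" using prob_space.emeasure_space_1[OF prob_space_Pr, of "Some y"] by simp
  finally show ?thesis by (simp add: ennreal_1[symmetric] ennreal_le_iff del: ennreal_1)
 qed
 then show "\<forall>\<^sub>F t in at_right 0. (semigroup_op Z t f y - f y) / t \<le> 0"
  using y by (auto simp: eventually_at_right_field divide_le_0_iff intro!: exI[of _ 1])
qed simp

text \<open>From a point of an open set the exit takes positive time, so high discounts annihilate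
  it; the undiscounted integrand dominates.\<close>

lemma H_tendsto_0:
 assumes D: "open D" and x: "x \<in> D" and u: "u \<in> borel_fun" and fin: "H 0 D u x < \<top>"
 shows "(\<lambda>n. H (real n) D u x) \<longlonglongrightarrow> 0"
proof -
 have "(\<lambda>n. \<integral>\<^sup>+w. exit_path (real n) D u w \<partial>Pr (Some x)) \<longlonglongrightarrow> (\<integral>\<^sup>+w. 0 \<partial>Pr (Some x))"
 proof (rule nn_integral_dominated_convergence[where w = "exit_path 0 D u"])
  show "exit_path (real n) D u \<in> borel_measurable (Pr (Some x))" for n using exit_path_measurable[OF u] by simp
  show "exit_path 0 D u \<in> borel_measurable (Pr (Some x))" using exit_path_measurable[OF u] by simp
  show "(\<integral>\<^sup>+w. exit_path 0 D u w \<partial>Pr (Some x)) < \<infinity>" using fin by (simp add: H_def)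
  show "AE w in Pr (Some x). exit_path (real n) D u w \<le> exit_path 0 D u w" for n
   unfolding exit_path_def decay_def by (intro AE_I2 mult_right_mono ennreal_leI) auto
  have "AE w in Pr (Some x). exit_path 0 D u w < \<top>"
  proof -
   have "(\<integral>\<^sup>+w. exit_path 0 D u w \<partial>Pr (Some x)) \<noteq> \<infinity>" using fin by (simp add: H_def)
   then have "AE w in Pr (Some x). exit_path 0 D u w \<noteq> \<infinity>"
    by (rule nn_integral_PInf_AE[rotated]) (use exit_path_measurable[OF u] in simp)
   then show ?thesis by eventually_elim (simp add: less_top)
  qed
  then show "AE w in Pr (Some x). (\<lambda>n. exit_path (real n) D u w) \<longlonglongrightarrow> 0"
   using AE_exit_time[OF D x] AE_space
  proof eventually_elim
   case (elim w)
   show ?case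
   proof (cases "leave D w")
    case top
    then show ?thesis using state_top elim by (simp add: exit_path_def ext0_def)
   next
    case (real s)
    then have s: "0 < s" using elim by (simp add: less_le)
    obtain v where v: "ext0 u (St (leave D w) w) = ennreal v" "0 \<le> v"
     using elim by (cases "ext0 u (St (leave D w) w)") (auto simp: exit_path_def decay_def)
    have "exp (- s) < 1" using \<open>0 < s\<close> by simp
    then have "norm (exp (- s)) < 1" by (simp only: real_norm_def abs_exp_cancel)
    then have "(\<lambda>n. exp (- s) ^ n) \<longlonglongrightarrow> 0" by (rule LIMSEQ_power_zero)
    then have "(\<lambda>n. exp (- s) ^ n * v) \<longlonglongrightarrow> 0 * v" by (rule tendsto_mult_right)
    then have "(\<lambda>n. ennreal (exp (- s) ^ n * v)) \<longlonglongrightarrow> ennreal 0" using tendsto_ennrealI by fastforce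
    moreover have "exit_path (real n) D u w = ennreal (exp (- s) ^ n * v)" for n
     using real v by (simp add: exit_path_def decay_def ennreal_mult exp_of_nat_mult[symmetric])
    ultimately show ?thesis by simp
   qed
  qed
 qed auto
 then show ?thesis by (simp add: H_def)
qed

end

section \<open>Duality\<close>

locale dual_pair =
 X: hunt_levy X "\<lambda>x. density m (\<lambda>y. ennreal (j x y))" \<D> +
 Y: hunt_levy Xd "\<lambda>x. density m (\<lambda>y. ennreal (jd x y))" \<D>
 for m :: "'a::heine_borel measure" and X :: "('a, 'w) process" and Xd :: "('a, 'v) process"
  and j jd :: "'a \<Rightarrow> 'a \<Rightarrow> real" and \<D> :: "('a \<Rightarrow> real) set" +
 fixes G :: "'a set \<Rightarrow> 'a \<Rightarrow> 'a \<Rightarrow> ennreal"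
 assumes reference: "reference_measure m"
  and green: "\<And>D. open D \<Longrightarrow> green_function m X Xd D (G D)"
  and jump_measurable: "\<And>x. j x \<in> borel_fun" "\<And>x. jd x \<in> borel_fun"
  and jump_dual: "\<And>x y. x \<noteq> y \<Longrightarrow> j x y = jd y x" and jump_pos: "\<And>x y. x \<noteq> y \<Longrightarrow> 0 < j x y"
begin

lemma sets_m [simp, measurable_cong]: "sets m = sets borel"
 using reference by (simp add: reference_measure_def)

lemma space_m [simp]: "space m = UNIV" using sets_eq_imp_space_eq[OF sets_m] by simp

lemma meas_m [simp]: "borel_measurable m = borel_fun" by (rule measurable_cong_sets) simp_all

sublocale m: sigma_finite_measure m using reference by (simp add: reference_measure_def)

sublocale mm: pair_sigma_finite m m ..

lemma green_measurable: "open D \<Longrightarrow> case_prod (G D) \<in> borel_measurable (borel \<Otimes>\<^sub>M borel)"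
 using green by (simp add: green_function_def)

lemma R_green:
 assumes D: "open D" and k: "k \<in> borel_fun"
 shows "x \<in> D \<Longrightarrow> X.R 0 D k x = (\<integral>\<^sup>+y. indicator D y * (k y * G D x y) \<partial>m)"
  and "x \<in> D \<Longrightarrow> Y.R 0 D k x = (\<integral>\<^sup>+y. indicator D y * (k y * G D y x) \<partial>m)"
 using green[OF D] k X.killed_potential_R[OF D, of x k] Y.killed_potential_R[OF D, of x k]
 by (simp_all add: green_function_def mult.commute[of "indicator D _"])

text \<open>Fubini, as one Green function represents both potentials with exchanged
  arguments.\<close>

lemma duality_0:
 assumes D: "open D" and f [measurable]: "f \<in> borel_fun" and k [measurable]: "k \<in> borel_fun"
 shows "(\<integral>\<^sup>+x. f x * X.R 0 D k x \<partial>m) = (\<integral>\<^sup>+x. Y.R 0 D f x * k x \<partial>m)"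
proof -
 have [measurable]: "D \<in> sets borel" using D by simp
 have [measurable]: "(\<lambda>p. G D (fst p) (snd p)) \<in> borel_measurable (m \<Otimes>\<^sub>M m)"
  using green_measurable[OF D]
  unfolding case_prod_unfold measurable_cong_sets[OF sets_pair_measure_cong[OF sets_m sets_m] refl] .
 have GD [measurable]: "(\<lambda>y. G D x y) \<in> borel_fun" "(\<lambda>y. G D y x) \<in> borel_fun" for x
  using measurable_compose[OF measurable_Pair1' green_measurable[OF D]] measurable_compose[OF measurable_Pair2' green_measurable[OF D]]
  by simp_all
 have "(\<integral>\<^sup>+x. f x * X.R 0 D k x \<partial>m) = (\<integral>\<^sup>+x. (\<integral>\<^sup>+y. indicator D x * indicator D y * f x * k y * G D x y \<partial>m) \<partial>m)"
 proof (rule nn_integral_cong)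
  fix x
  show "f x * X.R 0 D k x = (\<integral>\<^sup>+y. indicator D x * indicator D y * f x * k y * G D x y \<partial>m)"
   by (cases "x \<in> D") (simp_all add: R_green[OF D k] X.R_outside nn_integral_cmult[symmetric] mult_ac)
 qed
 also have "\<dots> = (\<integral>\<^sup>+y. (\<integral>\<^sup>+x. indicator D x * indicator D y * f x * k y * G D x y \<partial>m) \<partial>m)"
  by (rule mm.Fubini'[symmetric, where f = "\<lambda>x y. indicator D x * indicator D y * f x * k y * G D x y"])
   (simp only: case_prod_unfold, measurable)
 also have "\<dots> = (\<integral>\<^sup>+x. Y.R 0 D f x * k x \<partial>m)"
 proof (rule nn_integral_cong)
  fix x
  have "(\<integral>\<^sup>+y. indicator D y * indicator D x * f y * k x * G D y x \<partial>m) =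
    (\<integral>\<^sup>+y. (indicator D x * k x) * (indicator D y * (f y * G D y x)) \<partial>m)" by (simp add: mult_ac)
  also have "\<dots> = (indicator D x * k x) * (\<integral>\<^sup>+y. indicator D y * (f y * G D y x) \<partial>m)"
   by (rule nn_integral_cmult) measurable
  also have "\<dots> = Y.R 0 D f x * k x"
   by (cases "x \<in> D") (simp_all add: R_green[OF D f] Y.R_outside mult_ac)
  finally show "(\<integral>\<^sup>+y. indicator D y * indicator D x * f y * k x * G D y x \<partial>m) = Y.R 0 D f x * k x" .
 qed
 finally show ?thesis .
qed

section \<open>Duality of resolvents and of perturbed potentials\<close>

context
 fixes D :: "'a set" and \<tau> :: real
 assumes D: "open D" and volD: "emeasure m D < \<top>" and \<tau>: "\<And>x. X.R 0 D (\<lambda>_. 1) x \<le> ennreal \<tau>"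
begin

text \<open>Pairs the resolvent equations of the two processes and cancels a common term. The
  cancellation needs finite integrals, hence bounded f and k, finite volume and a bounded mean exit
  time.\<close>

lemma duality_bounded:
 assumes M: "0 \<le> M" and f [measurable]: "f \<in> borel_fun" and k [measurable]: "k \<in> borel_fun"
  and fB: "\<And>x. f x \<le> of_nat n" and kB: "\<And>x. k x \<le> of_nat n"
 shows "(\<integral>\<^sup>+x. f x * X.R M D k x \<partial>m) = (\<integral>\<^sup>+x. Y.R M D f x * k x \<partial>m)"
proof -
 have [measurable]: "D \<in> sets borel" using D by simp
 let ?h = "X.R M D k" and ?g = "Y.R M D f"
 have h [measurable]: "?h \<in> borel_fun" and g [measurable]: "?g \<in> borel_fun"
  by (rule X.R_measurable[OF k], rule Y.R_measurable[OF f])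
 have [measurable]: "X.R 0 D k \<in> borel_fun" "X.R 0 D ?h \<in> borel_fun"
   "Y.R 0 D f \<in> borel_fun" "Y.R 0 D ?g \<in> borel_fun"
  by (rule X.R_measurable Y.R_measurable; measurable)+
 have eX: "X.R 0 D k x = ?h x + ennreal M * X.R 0 D ?h x" for x using X.R_resolvent(2)[OF k M, of D x] by simp
 have eY: "Y.R 0 D f x = ?g x + ennreal M * Y.R 0 D ?g x" for x using Y.R_resolvent(2)[OF f M, of D x] by simp
 have fin: "(\<integral>\<^sup>+x. f x * X.R 0 D k x \<partial>m) < \<top>"
 proof -
  have "X.R 0 D k x \<le> of_nat n * ennreal \<tau>" for x
  proof -
   have "X.R 0 D k x \<le> X.R 0 D (\<lambda>_. of_nat n * 1) x" by (rule X.R_mono) (use kB in simp)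
   also have "\<dots> = of_nat n * X.R 0 D (\<lambda>_. 1) x" by (rule X.R_cmult) simp
   also have "\<dots> \<le> of_nat n * ennreal \<tau>" by (intro mult_left_mono \<tau>) simp
   finally show ?thesis .
  qed
  then have "f x * X.R 0 D k x \<le> of_nat n * (of_nat n * ennreal \<tau>) * indicator D x" for x
   using mult_mono[OF fB, of "X.R 0 D k x" "of_nat n * ennreal \<tau>" x] by (cases "x \<in> D") (simp_all add: X.R_outside)
  then have "(\<integral>\<^sup>+x. f x * X.R 0 D k x \<partial>m) \<le> (\<integral>\<^sup>+x. of_nat n * (of_nat n * ennreal \<tau>) * indicator D x \<partial>m)"
   by (intro nn_integral_mono) simp
  also have "\<dots> = of_nat n * (of_nat n * ennreal \<tau>) * emeasure m D" by (rule nn_integral_cmult_indicator) simp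
  also have "\<dots> < \<top>" using volD by (simp add: ennreal_mult_less_top of_nat_less_top)
  finally show ?thesis .
 qed
 have 1: "(\<integral>\<^sup>+x. ?g x * X.R 0 D k x \<partial>m) = (\<integral>\<^sup>+x. ?g x * ?h x \<partial>m) + ennreal M * (\<integral>\<^sup>+x. ?g x * X.R 0 D ?h x \<partial>m)"
  unfolding eX by (simp add: distrib_left nn_integral_add mult.left_commute nn_integral_cmult)
 have 2: "(\<integral>\<^sup>+x. Y.R 0 D f x * ?h x \<partial>m) = (\<integral>\<^sup>+x. ?g x * ?h x \<partial>m) + ennreal M * (\<integral>\<^sup>+x. Y.R 0 D ?g x * ?h x \<partial>m)"
  unfolding eY by (simp add: distrib_right nn_integral_add mult.assoc nn_integral_cmult)
 \<comment> \<open>The right-hand sides of 1 and 2 agree by duality of the 0-potentials, hence so do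
   the left-hand sides.\<close>
 have 3: "(\<integral>\<^sup>+x. Y.R 0 D ?g x * k x \<partial>m) = (\<integral>\<^sup>+x. f x * X.R 0 D ?h x \<partial>m)"
  using 1 2 duality_0[OF D g h] duality_0[OF D g k] duality_0[OF D f h] by simp
 have 4: "(\<integral>\<^sup>+x. f x * X.R 0 D k x \<partial>m) = (\<integral>\<^sup>+x. f x * ?h x \<partial>m) + ennreal M * (\<integral>\<^sup>+x. f x * X.R 0 D ?h x \<partial>m)"
  unfolding eX by (simp add: distrib_left nn_integral_add mult.left_commute nn_integral_cmult)
 have 5: "(\<integral>\<^sup>+x. Y.R 0 D f x * k x \<partial>m) = (\<integral>\<^sup>+x. ?g x * k x \<partial>m) + ennreal M * (\<integral>\<^sup>+x. Y.R 0 D ?g x * k x \<partial>m)"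
  unfolding eY by (simp add: distrib_right nn_integral_add mult.assoc nn_integral_cmult)
 have "(\<integral>\<^sup>+x. f x * ?h x \<partial>m) + ennreal M * (\<integral>\<^sup>+x. f x * X.R 0 D ?h x \<partial>m)
   = (\<integral>\<^sup>+x. ?g x * k x \<partial>m) + ennreal M * (\<integral>\<^sup>+x. f x * X.R 0 D ?h x \<partial>m)"
  unfolding 4[symmetric] 5[unfolded 3, symmetric] by (rule duality_0[OF D f k])
 moreover have "ennreal M * (\<integral>\<^sup>+x. f x * X.R 0 D ?h x \<partial>m) \<noteq> \<top>" using fin unfolding 4 by (auto simp: less_top)
 ultimately show ?thesis unfolding add.commute[of _ "ennreal M * _"] ennreal_add_left_cancel infinity_ennreal_def by blast
qed

text \<open>Truncations fall under the bounded case; both sides are monotone limits, taken first in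
  k and then in f.\<close>

lemma duality_R:
 assumes M: "0 \<le> M" and f [measurable]: "f \<in> borel_fun" and k [measurable]: "k \<in> borel_fun"
 shows "(\<integral>\<^sup>+x. f x * X.R M D k x \<partial>m) = (\<integral>\<^sup>+x. Y.R M D f x * k x \<partial>m)"
proof -
 define F where "F n x = min (f x) (of_nat n)" for n x
 define K where "K n x = min (k x) (of_nat n)" for n x
 have Fm [measurable]: "F n \<in> borel_fun" and Km [measurable]: "K n \<in> borel_fun" for n
  unfolding F_def K_def by measurable
 have incF: "incseq F" and incK: "incseq K" by (auto simp: incseq_def le_fun_def F_def K_def min.coboundedI2)
 have fS: "f x = (SUP n. F n x)" and kS: "k x = (SUP n. K n x)" for x
  unfolding F_def K_def SUP_min_of_nat by rule+
 have RK [measurable]: "X.R M D (K n) \<in> borel_fun" "Y.R M D (F n) \<in> borel_fun"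
   "X.R M D k \<in> borel_fun" "Y.R M D f \<in> borel_fun" for n
  by (rule X.R_measurable Y.R_measurable; measurable)+
 have incR: "incseq (\<lambda>n. X.R M D (K n))" "incseq (\<lambda>n. Y.R M D (F n))"
  using incF incK by (auto simp: incseq_def le_fun_def intro!: X.R_mono Y.R_mono)
 have eq: "(\<integral>\<^sup>+x. F n x * X.R M D (K n') x \<partial>m) = (\<integral>\<^sup>+x. Y.R M D (F n) x * K n' x \<partial>m)" for n n'
 proof (rule duality_bounded[OF M Fm Km, of n "max n n'" n'])
  show "F n x \<le> of_nat (max n n')" "K n' x \<le> of_nat (max n n')" for x
   by (auto simp: F_def K_def min.coboundedI2)
 qed
 have kX: "X.R M D k x = (SUP n. X.R M D (K n) x)" for x
  using X.R_SUP[OF Km incK, of M D x] by (simp add: kS[symmetric])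
 have fY: "Y.R M D f x = (SUP n. Y.R M D (F n) x)" for x
  using Y.R_SUP[OF Fm incF, of M D x] by (simp add: fS[symmetric])
 have 1: "(\<integral>\<^sup>+x. F n x * X.R M D k x \<partial>m) = (\<integral>\<^sup>+x. Y.R M D (F n) x * k x \<partial>m)" for n
 proof -
  have "(\<integral>\<^sup>+x. F n x * X.R M D k x \<partial>m) = (SUP n'. \<integral>\<^sup>+x. F n x * X.R M D (K n') x \<partial>m)"
   unfolding kX SUP_mult_left_ennreal by (rule nn_integral_monotone_convergence_SUP)
    (use incR in \<open>auto simp: incseq_def le_fun_def intro!: mult_left_mono\<close>)
  also have "\<dots> = (SUP n'. \<integral>\<^sup>+x. Y.R M D (F n) x * K n' x \<partial>m)" unfolding eq ..
  also have "\<dots> = (\<integral>\<^sup>+x. Y.R M D (F n) x * k x \<partial>m)"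
   unfolding kS SUP_mult_left_ennreal by (rule nn_integral_monotone_convergence_SUP[symmetric])
    (use incK in \<open>auto simp: incseq_def le_fun_def intro!: mult_left_mono\<close>)
  finally show ?thesis .
 qed
 have "(\<integral>\<^sup>+x. f x * X.R M D k x \<partial>m) = (SUP n. \<integral>\<^sup>+x. F n x * X.R M D k x \<partial>m)"
  unfolding fS SUP_mult_right_ennreal by (rule nn_integral_monotone_convergence_SUP)
   (use incF in \<open>auto simp: incseq_def le_fun_def intro!: mult_right_mono\<close>)
 also have "\<dots> = (SUP n. \<integral>\<^sup>+x. Y.R M D (F n) x * k x \<partial>m)" unfolding 1 ..
 also have "\<dots> = (\<integral>\<^sup>+x. Y.R M D f x * k x \<partial>m)"
  unfolding fY SUP_mult_right_ennreal by (rule nn_integral_monotone_convergence_SUP[symmetric])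
   (use incR in \<open>auto simp: incseq_def le_fun_def intro!: mult_right_mono\<close>)
 finally show ?thesis .
qed

text \<open>Each term of the series alternates resolvents and multiplications, beginning and ending
  with a resolvent; it reads the same in both directions, so its factors move across the pairing one
  by one.\<close>

lemma duality_FKsum:
 assumes M: "0 \<le> M" and c [measurable]: "c \<in> borel_fun"
  and f: "f \<in> borel_fun" and k [measurable]: "k \<in> borel_fun"
 shows "(\<integral>\<^sup>+x. f x * X.FKsum M c D (X.R M D k) x \<partial>m) = (\<integral>\<^sup>+x. Y.FKsum M c D (Y.R M D f) x * k x \<partial>m)"
proof -
 have eq: "(\<integral>\<^sup>+x. f x * (X.FK M c D ^^ n) (X.R M D k) x \<partial>m) = (\<integral>\<^sup>+x. (Y.FK M c D ^^ n) (Y.R M D f) x * k x \<partial>m)" for n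
  using f
 proof (induction n arbitrary: f)
  case 0
  then show ?case using duality_R[OF M _ k, of f] by simp
 next
  case (Suc n)
  have f [measurable]: "f \<in> borel_fun" by fact
  have a [measurable]: "(X.FK M c D ^^ n) (X.R M D k) \<in> borel_fun"
   by (rule X.FK_pow_measurable[OF c X.R_measurable[OF k]])
  have b [measurable]: "Y.R M D f \<in> borel_fun" by (rule Y.R_measurable[OF f])
  let ?e = "\<lambda>x. ennreal (M - c x)"
  have "(\<integral>\<^sup>+x. f x * (X.FK M c D ^^ Suc n) (X.R M D k) x \<partial>m)
    = (\<integral>\<^sup>+x. f x * X.R M D (\<lambda>y. ?e y * (X.FK M c D ^^ n) (X.R M D k) y) x \<partial>m)"
   by (simp add: X.FK_def[abs_def])
  also have "\<dots> = (\<integral>\<^sup>+x. Y.R M D f x * (?e x * (X.FK M c D ^^ n) (X.R M D k) x) \<partial>m)"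
   by (rule duality_R[OF M f]) measurable
  also have "\<dots> = (\<integral>\<^sup>+x. (?e x * Y.R M D f x) * (X.FK M c D ^^ n) (X.R M D k) x \<partial>m)" by (simp add: mult_ac)
  also have "\<dots> = (\<integral>\<^sup>+x. (Y.FK M c D ^^ n) (Y.R M D (\<lambda>x. ?e x * Y.R M D f x)) x * k x \<partial>m)"
   by (rule Suc.IH) measurable
  also have "Y.R M D (\<lambda>x. ?e x * Y.R M D f x) = Y.FK M c D (Y.R M D f)" by (simp add: Y.FK_def[abs_def])
  finally show ?case by (simp add: funpow_swap1)
 qed
 have mX [measurable]: "(X.FK M c D ^^ n) (X.R M D k) \<in> borel_fun" for n
  by (rule X.FK_pow_measurable[OF c X.R_measurable[OF k]])
 have mY [measurable]: "(Y.FK M c D ^^ n) (Y.R M D f) \<in> borel_fun" for n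
  by (rule Y.FK_pow_measurable[OF c Y.R_measurable[OF f]])
 note f [measurable]
 have "(\<integral>\<^sup>+x. f x * X.FKsum M c D (X.R M D k) x \<partial>m) = (\<Sum>n. \<integral>\<^sup>+x. f x * (X.FK M c D ^^ n) (X.R M D k) x \<partial>m)"
  unfolding X.FKsum_def ennreal_suminf_cmult[symmetric] by (rule nn_integral_suminf) measurable
 also have "\<dots> = (\<Sum>n. \<integral>\<^sup>+x. (Y.FK M c D ^^ n) (Y.R M D f) x * k x \<partial>m)" unfolding eq ..
 also have "\<dots> = (\<integral>\<^sup>+x. Y.FKsum M c D (Y.R M D f) x * k x \<partial>m)"
  unfolding Y.FKsum_def ennreal_suminf_multc[symmetric] by (rule nn_integral_suminf[symmetric]) measurable
 finally show ?thesis .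
qed

end

end

section \<open>The barrier estimate\<close>

context hunt begin

text \<open>The perturbing rate \<open>\<psi>\<close> is chosen such that the killing compensates the positive part of
 the generator; \<open>\<epsilon>\<close> keeps it bounded where \<open>f\<close> vanishes.\<close>

lemma generator_supersolution:
 assumes W: "open W" and f: "f \<in> gen_domain Z" "\<And>y. 0 \<le> f y" and fel: "feller Z"
  and \<delta>: "0 < \<delta>" "\<And>y. gen Z f y \<le> \<delta>" and \<epsilon>: "0 < \<epsilon>"
 defines "\<psi> \<equiv> \<lambda>y. max 0 (gen Z f y) / (f y + \<epsilon>)"
 shows "H (\<delta>/\<epsilon>) W (\<lambda>y. ennreal (f y + \<epsilon>)) x + FK (\<delta>/\<epsilon>) \<psi> W (\<lambda>y. ennreal (f y + \<epsilon>)) x \<le> ennreal (f x + \<epsilon>)"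
proof (cases "x \<in> W")
 case False
 then show ?thesis by (simp add: H_outside FK_def R_outside)
next
 case True
 define M where "M = \<delta>/\<epsilon>"
 have M: "0 < M" using \<delta> \<epsilon> by (simp add: M_def)
 have fm [measurable]: "f \<in> borel_fun" and gm [measurable]: "gen Z f \<in> borel_fun"
  using generates_gen[OF f(1)] by (auto simp: generates_def intro: C0_measurable)
 have pm [measurable]: "\<psi> \<in> borel_fun" unfolding \<psi>_def by measurable
 let ?a = "R M W (\<lambda>y. ennreal (gen Z f y)) x"
 have one: "ennreal M * R M W (\<lambda>_. 1) x + H M W (\<lambda>_. 1) x \<le> 1" by (rule R_H_one[OF W M])
 have "?a \<noteq> \<top>"
 proof -
  have "?a \<le> R M W (\<lambda>y. ennreal \<delta> * 1) x" by (rule R_mono) (use \<delta> in \<open>simp add: ennreal_leI\<close>)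
  also have "\<dots> = ennreal \<delta> * R M W (\<lambda>_. 1) x" by (rule R_cmult) simp
  finally have le: "?a \<le> ennreal \<delta> * R M W (\<lambda>_. 1) x" .
  have "ennreal M * R M W (\<lambda>_. 1) x \<le> 1" using one by (rule order_trans[rotated]) simp
  then have "R M W (\<lambda>_. 1) x \<noteq> \<top>" using M by (auto simp: ennreal_mult_top top_unique)
  then show ?thesis using le by (auto simp: top_unique ennreal_mult_eq_top_iff)
 qed
 have pt: "ennreal (M - \<psi> y) * ennreal (f y + \<epsilon>) + ennreal (gen Z f y) = ennreal M * ennreal (f y) + ennreal \<epsilon> * ennreal M" for y
 proof -
  have fe: "0 < f y + \<epsilon>" using f(2)[of y] \<epsilon> by simp
  have Me: "M * \<epsilon> = \<delta>" using \<epsilon> by (simp add: M_def)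
  have "(M - \<psi> y) * (f y + \<epsilon>) = M * (f y + \<epsilon>) - max 0 (gen Z f y)"
   using fe by (simp add: \<psi>_def field_simps)
  moreover have "max 0 (gen Z f y) \<le> M * (f y + \<epsilon>)"
   using \<delta>(1) \<delta>(2)[of y] M f(2)[of y] Me by (simp add: distrib_left add_increasing)
  moreover have "0 \<le> M - \<psi> y"
  proof -
   have "0 \<le> (M - \<psi> y) * (f y + \<epsilon>)" using calculation by simp
   then show ?thesis using fe by (simp add: zero_le_mult_iff)
  qed
  moreover have "ennreal (gen Z f y) = ennreal (max 0 (gen Z f y))" by (simp add: max_def ennreal_neg)
  ultimately have "ennreal (M - \<psi> y) * ennreal (f y + \<epsilon>) = ennreal (M * (f y + \<epsilon>) - max 0 (gen Z f y))"
    "max 0 (gen Z f y) \<le> M * (f y + \<epsilon>)" "ennreal (gen Z f y) = ennreal (max 0 (gen Z f y))"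
   using fe by (simp_all add: ennreal_mult[symmetric])
  then have "ennreal (M - \<psi> y) * ennreal (f y + \<epsilon>) + ennreal (gen Z f y) =
    ennreal ((M * (f y + \<epsilon>) - max 0 (gen Z f y)) + max 0 (gen Z f y))" by (subst ennreal_plus) auto
  also have "\<dots> = ennreal (M * f y + \<epsilon> * M)" by (simp add: algebra_simps)
  also have "\<dots> = ennreal M * ennreal (f y) + ennreal \<epsilon> * ennreal M"
   using M \<epsilon> f(2)[of y] by (simp add: ennreal_mult)
  finally show ?thesis .
 qed
 have 1: "FK M \<psi> W (\<lambda>y. ennreal (f y + \<epsilon>)) x + ?a = R M W (\<lambda>y. ennreal (M * f y)) x + ennreal \<epsilon> * (ennreal M * R M W (\<lambda>_. 1) x)"
 proof -
  have "FK M \<psi> W (\<lambda>y. ennreal (f y + \<epsilon>)) x + ?a =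
    R M W (\<lambda>y. ennreal (M - \<psi> y) * ennreal (f y + \<epsilon>) + ennreal (gen Z f y)) x"
   unfolding FK_def by (rule R_add[symmetric]) measurable
  also have "\<dots> = R M W (\<lambda>y. ennreal M * ennreal (f y) + (ennreal \<epsilon> * ennreal M) * 1) x" unfolding pt by simp
  also have "\<dots> = R M W (\<lambda>y. ennreal M * ennreal (f y)) x + R M W (\<lambda>y. (ennreal \<epsilon> * ennreal M) * 1) x"
   by (rule R_add) measurable
  also have "R M W (\<lambda>y. (ennreal \<epsilon> * ennreal M) * 1) x = (ennreal \<epsilon> * ennreal M) * R M W (\<lambda>_. 1) x"
   by (rule R_cmult) simp
  finally show ?thesis using M f(2) by (simp add: ennreal_mult mult.assoc)
 qed
 have 2: "H M W (\<lambda>y. ennreal (f y + \<epsilon>)) x = H M W (\<lambda>y. ennreal (f y)) x + ennreal \<epsilon> * H M W (\<lambda>_. 1) x"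
 proof -
  have "(\<lambda>y. ennreal (f y + \<epsilon>)) = (\<lambda>y. ennreal (f y) + ennreal \<epsilon> * 1)" using f(2) \<epsilon> by auto
  moreover have "H M W (\<lambda>y. ennreal (f y) + ennreal \<epsilon> * 1) x = H M W (\<lambda>y. ennreal (f y)) x + H M W (\<lambda>y. ennreal \<epsilon> * 1) x"
   by (rule H_add) measurable
  moreover have "H M W (\<lambda>y. ennreal \<epsilon> * 1) x = ennreal \<epsilon> * H M W (\<lambda>_. 1) x" by (rule H_cmult) simp
  ultimately show ?thesis by simp
 qed
 have dyn: "R M W (\<lambda>y. ennreal (M * f y)) x + H M W (\<lambda>y. ennreal (f y)) x \<le> ennreal (f x) + ?a"
 proof -
  have "R M W (\<lambda>y. ennreal (M * f y)) x \<le> R M W (\<lambda>y. ennreal (M * f y) + ennreal (- gen Z f y)) x"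
   by (rule R_mono) simp
  then show ?thesis unfolding dynkin[OF W f fel M] by (rule add_right_mono)
 qed
 have "(H M W (\<lambda>y. ennreal (f y + \<epsilon>)) x + FK M \<psi> W (\<lambda>y. ennreal (f y + \<epsilon>)) x) + ?a
   = (R M W (\<lambda>y. ennreal (M * f y)) x + H M W (\<lambda>y. ennreal (f y)) x)
    + ennreal \<epsilon> * (ennreal M * R M W (\<lambda>_. 1) x + H M W (\<lambda>_. 1) x)"
  unfolding add.assoc 1 2 by (simp add: distrib_left ac_simps)
 also have "\<dots> \<le> (ennreal (f x) + ?a) + ennreal \<epsilon> * 1" by (intro add_mono dyn mult_left_mono one) simp
 also have "\<dots> = ennreal (f x + \<epsilon>) + ?a" using f(2)[of x] \<epsilon> by (simp add: ac_simps)
 finally show ?thesis using \<open>?a \<noteq> \<top>\<close> unfolding M_def[symmetric]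
  by (simp add: add.commute[of _ ?a] ennreal_add_left_cancel_le)
qed

end

context hunt_levy begin

text \<open>A cutoff that is 1 on K and whose closed support avoids x is integrable for the Levy
  kernel.\<close>

lemma J_compact_finite:
 assumes K: "compact K" and x: "x \<notin> K" shows "emeasure (J x) K < \<top>"
proof (cases "K = {}")
 case False
 define d where "d = infdist x K"
 have d: "0 < d" using infdist_pos_not_in_closed[OF compact_imp_closed[OF K] False x] by (simp add: d_def)
 let ?U = "{y. infdist y K < d / 2}"
 have U: "open ?U" by (intro open_Collect_less continuous_intros)
 have "K \<subseteq> ?U" using d by auto
 from test_ex[OF K U this] obtain f where f: "f \<in> \<D>" "\<And>x. x \<in> K \<Longrightarrow> f x = 1" "\<And>x. x \<notin> ?U \<Longrightarrow> f x = 0" "\<And>x. 0 \<le> f x"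
  by auto
 have "closure {y. f y \<noteq> 0} \<subseteq> {y. infdist y K \<le> d / 2}"
 proof (rule closure_minimal)
  show "{y. f y \<noteq> 0} \<subseteq> {y. infdist y K \<le> d / 2}" using f(3) by force
  show "closed {y. infdist y K \<le> d / 2}" by (intro closed_Collect_le continuous_intros)
 qed
 moreover have "x \<notin> {y. infdist y K \<le> d / 2}" using d by (simp add: d_def)
 ultimately have "x \<notin> closure {y. f y \<noteq> 0}" by blast
 moreover have "continuous_on UNIV f" using test_C0[OF f(1)] by (simp add: C0_def)
 moreover have "bounded (range f)"
 proof -
  obtain B where "\<And>y. \<bar>f y\<bar> \<le> B" using C0_bounded[OF test_C0[OF f(1)]] by auto
  then show ?thesis by (auto simp: bounded_iff)
 qed
 ultimately have "integrable (J x) f" using levy by (auto simp: levy_kernel_def)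
 then have "(\<integral>\<^sup>+y. ennreal (f y) \<partial>J x) < \<top>" using f(4) by (simp add: integrable_iff_bounded)
 moreover have "emeasure (J x) K \<le> (\<integral>\<^sup>+y. ennreal (f y) \<partial>J x)"
 proof -
  have "emeasure (J x) K = (\<integral>\<^sup>+y. indicator K y \<partial>J x)" using borel_compact[OF K] by simp
  also have "\<dots> \<le> (\<integral>\<^sup>+y. ennreal (f y) \<partial>J x)" by (intro nn_integral_mono) (auto simp: indicator_def f)
  finally show ?thesis .
 qed
 ultimately show ?thesis by (rule le_less_trans[rotated])
qed simp

end

text \<open>S carries the weight, and N - P is a collar on which the Green function is bounded. The
  gap between P and the complement of N makes kernels comparable for jumps between these sets
  (\<open>deep\<close>), the gap between E and the complement of E' does so for jumps from E
  outwards (\<open>shallow\<close>). The cutoff \<phi> is 1 on N and 0 off E; \<tau> bounds mean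
  exit times, \<delta> the dual generator of \<phi>.\<close>

locale barrier = dual_pair m X Xd j jd \<D> G
 for m :: "'a::heine_borel measure" and X :: "('a, 'w) process" and Xd :: "('a, 'v) process"
  and j jd :: "'a \<Rightarrow> 'a \<Rightarrow> real" and \<D> :: "('a \<Rightarrow> real) set" and G :: "'a set \<Rightarrow> 'a \<Rightarrow> 'a \<Rightarrow> ennreal" +
 fixes z0 :: 'a and V P N S E E' :: "'a set" and \<phi> :: "'a \<Rightarrow> real" and \<gamma> \<tau> \<delta> c :: real
 assumes V: "open V" "emeasure m V < \<top>"
  and \<tau>: "0 \<le> \<tau>" "\<And>x. X.R 0 V (\<lambda>_. 1) x \<le> ennreal \<tau>" "\<And>x. Y.R 0 V (\<lambda>_. 1) x \<le> ennreal \<tau>"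
  and PN: "open P" "closed N" "P \<subseteq> N" "N \<subseteq> V" "z0 \<in> P" and S: "open S" "S \<subseteq> P"
  and collar: "0 \<le> \<gamma>" "\<And>x y. x \<in> S \<Longrightarrow> y \<in> N - P \<Longrightarrow> G V x y \<le> ennreal \<gamma>"
  and \<phi>: "\<phi> \<in> \<D>" "\<And>y. 0 \<le> \<phi> y" "\<And>y. \<phi> y \<le> 1" "\<And>y. y \<in> N \<Longrightarrow> \<phi> y = 1" "\<And>y. y \<notin> E \<Longrightarrow> \<phi> y = 0"
  and \<delta>: "0 < \<delta>" "\<And>y. gen Xd \<phi> y \<le> \<delta>"
  and EE: "closed E" "closed E'" "E \<subseteq> E'" "E' \<subseteq> V"
  and c: "0 < c"
  and deep: "\<And>x y. x \<in> P \<Longrightarrow> y \<notin> N \<Longrightarrow> j x y \<le> c * j z0 y" "\<And>x y. x \<in> P \<Longrightarrow> y \<notin> N \<Longrightarrow> j z0 y \<le> c * j x y"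
  and shallow: "\<And>x z. x \<in> E \<Longrightarrow> z \<notin> E' \<Longrightarrow> j x z \<le> c * j z0 z"
begin

definition "\<mu> = measure m P"

lemma mP: "emeasure m P = ennreal \<mu>" "0 < \<mu>"
proof -
 have "emeasure m P \<le> emeasure m V" using PN V by (intro emeasure_mono) auto
 then have fin: "emeasure m P < \<top>" using V(2) by (rule le_less_trans)
 then show eq: "emeasure m P = ennreal \<mu>" unfolding \<mu>_def by (intro emeasure_eq_ennreal_measure) auto
 have "0 < emeasure m P" using reference PN by (auto simp: reference_measure_def)
 then show "0 < \<mu>" unfolding eq by simp
qed

text \<open>\<gamma> accounts for entering N through the collar, the second term for landing in P:
  there the dual potential has integral at most \<tau> times the mass, and the two comparisons of
  landing densities cost c each.\<close>

definition "C = \<gamma> + c\<^sup>2 * \<tau> / \<mu>"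

lemma C_nonneg: "0 \<le> C" using collar(1) \<tau>(1) mP(2) by (simp add: C_def)

text \<open>The rate of \<open>generator_supersolution\<close>. It vanishes on N by the maximum
  principle and is at most \<delta> / \<epsilon>, the clock rate used below.\<close>

definition "\<psi> \<epsilon> y = max 0 (gen Xd \<phi> y) / (\<phi> y + \<epsilon>)"

lemma N_subset_E: "N \<subseteq> E" using \<phi>(4,5) by force

lemma phi_measurable [measurable]: "\<phi> \<in> borel_fun" by (rule X.test_measurable[OF \<phi>(1)])

lemma phi_gen_domain: "\<phi> \<in> gen_domain Xd" using Y.dom \<phi>(1) by blast

lemma gen_phi_measurable [measurable]: "gen Xd \<phi> \<in> borel_fun"
 by (rule Y.gen_measurable[OF \<phi>(1)])

lemma psi_measurable [measurable]: "\<psi> \<epsilon> \<in> borel_fun" unfolding \<psi>_def by measurable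

lemma psi_nonneg: "0 < \<epsilon> \<Longrightarrow> 0 \<le> \<psi> \<epsilon> y"
 using \<phi>(2)[of y] by (simp add: \<psi>_def)

lemma psi_zero: "y \<in> N \<Longrightarrow> \<psi> \<epsilon> y = 0"
 using Y.generator_max_principle[OF phi_gen_domain \<phi>(2,3) \<phi>(4), of y] by (simp add: \<psi>_def)

lemma psi_phi: "0 < \<epsilon> \<Longrightarrow> \<psi> \<epsilon> y * (\<phi> y + \<epsilon>) \<le> \<delta>"
 using \<phi>(2)[of y] \<delta>(1) \<delta>(2)[of y] by (simp add: \<psi>_def)

lemma psi_le: "0 < \<epsilon> \<Longrightarrow> \<psi> \<epsilon> y \<le> \<delta> / \<epsilon>"
 unfolding \<psi>_def using \<phi>(2)[of y] \<delta>(1) \<delta>(2)[of y] by (intro frac_le) auto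

section \<open>The dual potential of a weight\<close>

context
 fixes k :: "'a \<Rightarrow> ennreal" and B :: real and \<epsilon> :: real
 assumes k [measurable]: "k \<in> borel_fun" and kB: "\<And>x. k x \<le> ennreal B" and kS: "\<forall>x. x \<notin> S \<longrightarrow> k x = 0"
  and \<epsilon>: "0 < \<epsilon>"
begin

text \<open>\<open>w\<close> is the dual potential of the weight \<open>k\<close> under the additional killing.\<close>

definition "w = Y.FKsum (\<delta>/\<epsilon>) (\<psi> \<epsilon>) V (Y.R (\<delta>/\<epsilon>) V k)"

abbreviation (input) "mass \<equiv> \<integral>\<^sup>+x. k x \<partial>m"

lemma M_pos: "0 < \<delta> / \<epsilon>" using \<delta>(1) \<epsilon> by simp

lemma w_measurable [measurable]: "w \<in> borel_fun"
 unfolding w_def by (rule Y.FKsum_measurable[OF psi_measurable Y.R_measurable[OF k]])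

lemma w_outside: "x \<notin> V \<Longrightarrow> w x = 0"
 unfolding w_def using Y.FKsum_unfold[OF psi_measurable Y.R_measurable[OF k], where x = x]
 by (simp add: Y.R_outside Y.FK_def)

lemma w_le_R: "w x \<le> Y.R 0 V k x"
proof (cases "x \<in> V")
 case True
 show ?thesis unfolding w_def
  by (rule Y.FKsum_R_le[OF _ psi_measurable psi_nonneg[OF \<epsilon>] k True]) (use M_pos in simp)
qed (simp add: w_outside)

text \<open>Duality against the constant 1 turns the integral into mean exit times of X, integrated
  against k.\<close>

lemma w_mass: "(\<integral>\<^sup>+x. w x \<partial>m) \<le> ennreal \<tau> * mass"
proof -
 have "(\<integral>\<^sup>+x. w x \<partial>m) \<le> (\<integral>\<^sup>+x. Y.R 0 V k x * 1 \<partial>m)" by (intro nn_integral_mono) (simp add: w_le_R)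
 also have "\<dots> = (\<integral>\<^sup>+x. k x * X.R 0 V (\<lambda>_. 1) x \<partial>m)" by (rule duality_0[OF V(1) k, symmetric]) simp
 also have "\<dots> \<le> (\<integral>\<^sup>+x. k x * ennreal \<tau> \<partial>m)" by (intro nn_integral_mono mult_left_mono \<tau>) simp
 also have "\<dots> = mass * ennreal \<tau>" by (rule nn_integral_multc) simp
 also have "\<dots> = ennreal \<tau> * mass" by (rule mult.commute)
 finally show ?thesis .
qed

lemma w_bounded: "w x \<le> ennreal (B * \<tau>)"
proof -
 have "w x \<le> Y.R 0 V k x" by (rule w_le_R)
 also have "\<dots> \<le> Y.R 0 V (\<lambda>_. ennreal B * 1) x" by (rule Y.R_mono) (simp add: kB)
 also have "\<dots> = ennreal B * Y.R 0 V (\<lambda>_. 1) x" by (rule Y.R_cmult) simp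
 also have "\<dots> \<le> ennreal B * ennreal \<tau>" by (intro mult_left_mono \<tau>) simp
 also have "\<dots> \<le> ennreal (B * \<tau>)" using \<tau>(1) by (cases "0 \<le> B") (simp_all add: ennreal_mult ennreal_neg)
 finally show ?thesis .
qed

lemma w_collar:
 assumes y: "y \<in> N - P" shows "w y \<le> ennreal \<gamma> * mass"
proof -
 have yV: "y \<in> V" using y PN by blast
 have "w y \<le> Y.R 0 V k y" by (rule w_le_R)
 also have "\<dots> = (\<integral>\<^sup>+x. indicator V x * (k x * G V x y) \<partial>m)" by (rule R_green(2)[OF V(1) k yV])
 also have "\<dots> \<le> (\<integral>\<^sup>+x. ennreal \<gamma> * k x \<partial>m)"
 proof (rule nn_integral_mono)
  fix x
  show "indicator V x * (k x * G V x y) \<le> ennreal \<gamma> * k x"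
  proof (cases "x \<in> S")
   case True
   have "k x * G V x y \<le> k x * ennreal \<gamma>" by (intro mult_left_mono collar True y) simp
   then show ?thesis by (auto simp: indicator_def mult.commute)
  qed (simp add: kS)
 qed
 also have "\<dots> = ennreal \<gamma> * mass" by (rule nn_integral_cmult) simp
 finally show ?thesis .
qed

lemma kernel_dual: assumes "x \<in> P" "y \<notin> N"
 shows "ennreal (jd y x) \<le> ennreal c * ennreal (j z0 y)" "ennreal (j z0 y) \<le> ennreal c * ennreal (jd y x)"
proof -
 have "x \<noteq> y" "z0 \<noteq> y" using assms PN by auto
 then have "jd y x = j x y" "0 < j x y" "0 < j z0 y" using jump_dual jump_pos by auto
 with deep[OF assms] c show "ennreal (jd y x) \<le> ennreal c * ennreal (j z0 y)"
  "ennreal (j z0 y) \<le> ennreal c * ennreal (jd y x)" by (simp_all add: ennreal_mult[symmetric] ennreal_leI)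
qed

text \<open>On P the useful bound is the integral of w, not its values. Seen from y outside N, the
  density of landing at a point of P is comparable to j(z0, y) throughout P, so a jump averages w
  over P. The Levy kernel yields both the integral of w after the jump and the probability of
  landing in P.\<close>

lemma w_deep:
 assumes x: "x \<in> V - N"
 shows "Y.H (\<delta>/\<epsilon>) (V - N) (\<lambda>z. w z * indicator P z) x
  \<le> ennreal (c\<^sup>2 * \<tau> / \<mu>) * mass * Y.H (\<delta>/\<epsilon>) (V - N) (indicator P) x"
proof -
 let ?W = "V - N" and ?M = "\<delta>/\<epsilon>"
 have W: "open ?W" using V PN by auto
 have [measurable]: "P \<in> sets borel" "j z0 \<in> borel_fun" using PN jump_measurable by auto
 have M: "0 \<le> ?M" using M_pos by simp
 have cl: "indicator P z = (0 :: ennreal)" if "z \<in> closure ?W" for z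
 proof -
  have "P \<inter> closure ?W = {}" using open_Int_closure_eq_empty[OF PN(1), of ?W] PN(3) by blast
  with that show ?thesis by (auto simp: indicator_def)
 qed
 have int: "(\<integral>\<^sup>+z. g z \<partial>density m (\<lambda>z. ennreal (jd y z))) = (\<integral>\<^sup>+z. ennreal (jd y z) * g z \<partial>m)"
  if "g \<in> borel_fun" for g y using that jump_measurable(2)[of y] by (intro nn_integral_density) auto
 have 1: "Y.H ?M ?W (\<lambda>z. w z * indicator P z) x \<le> ennreal c * (ennreal \<tau> * mass) * Y.R ?M ?W (\<lambda>y. ennreal (j z0 y)) x"
 proof -
  have "Y.H ?M ?W (\<lambda>z. w z * indicator P z) x =
    Y.R ?M ?W (\<lambda>y. \<integral>\<^sup>+z. w z * indicator P z \<partial>density m (\<lambda>z. ennreal (jd y z))) x"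
   by (rule Y.jump_law[OF W x M]) (simp_all add: cl)
  also have "\<dots> \<le> Y.R ?M ?W (\<lambda>y. (ennreal c * (ennreal \<tau> * mass)) * ennreal (j z0 y)) x"
  proof (rule Y.R_mono)
   fix y assume y: "y \<in> ?W"
   have "(\<integral>\<^sup>+z. w z * indicator P z \<partial>density m (\<lambda>z. ennreal (jd y z))) = (\<integral>\<^sup>+z. ennreal (jd y z) * (w z * indicator P z) \<partial>m)"
    by (rule int) measurable
   also have "\<dots> \<le> (\<integral>\<^sup>+z. (ennreal c * ennreal (j z0 y)) * w z \<partial>m)"
   proof (rule nn_integral_mono)
    fix z
    show "ennreal (jd y z) * (w z * indicator P z) \<le> (ennreal c * ennreal (j z0 y)) * w z"
     using kernel_dual(1)[of z y] y by (cases "z \<in> P") (auto intro: mult_right_mono)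
   qed
   also have "\<dots> = (ennreal c * ennreal (j z0 y)) * (\<integral>\<^sup>+z. w z \<partial>m)" by (rule nn_integral_cmult) measurable
   also have "\<dots> \<le> (ennreal c * ennreal (j z0 y)) * (ennreal \<tau> * mass)" by (intro mult_left_mono w_mass) simp
   finally show "(\<integral>\<^sup>+z. w z * indicator P z \<partial>density m (\<lambda>z. ennreal (jd y z))) \<le> (ennreal c * (ennreal \<tau> * mass)) * ennreal (j z0 y)"
    by (simp only: mult_ac)
  qed
  also have "\<dots> = (ennreal c * (ennreal \<tau> * mass)) * Y.R ?M ?W (\<lambda>y. ennreal (j z0 y)) x" by (rule Y.R_cmult) measurable
  finally show ?thesis .
 qed
 have 2: "ennreal (\<mu> / c) * Y.R ?M ?W (\<lambda>y. ennreal (j z0 y)) x \<le> Y.H ?M ?W (indicator P) x"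
 proof -
  have "ennreal (\<mu> / c) * Y.R ?M ?W (\<lambda>y. ennreal (j z0 y)) x = Y.R ?M ?W (\<lambda>y. ennreal (\<mu> / c) * ennreal (j z0 y)) x"
   by (rule Y.R_cmult[symmetric]) measurable
  also have "\<dots> \<le> Y.R ?M ?W (\<lambda>y. \<integral>\<^sup>+z. indicator P z \<partial>density m (\<lambda>z. ennreal (jd y z))) x"
  proof (rule Y.R_mono)
   fix y assume y: "y \<in> ?W"
   have "ennreal (\<mu> / c) * ennreal (j z0 y) = (ennreal (1/c) * ennreal (j z0 y)) * emeasure m P"
    unfolding mP using c mP(2) by (simp add: ennreal_mult'[symmetric] ennreal_mult''[symmetric] ac_simps)
   also have "\<dots> = (\<integral>\<^sup>+z. (ennreal (1/c) * ennreal (j z0 y)) * indicator P z \<partial>m)"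
    by (rule nn_integral_cmult_indicator[symmetric]) simp
   also have "\<dots> \<le> (\<integral>\<^sup>+z. ennreal (jd y z) * indicator P z \<partial>m)"
   proof (rule nn_integral_mono)
    fix z
    show "(ennreal (1/c) * ennreal (j z0 y)) * indicator P z \<le> ennreal (jd y z) * indicator P z"
    proof (cases "z \<in> P")
     case True
     have "ennreal (1/c) * ennreal (j z0 y) \<le> ennreal (1/c) * (ennreal c * ennreal (jd y z))"
      using kernel_dual(2)[OF True] y by (intro mult_left_mono) auto
     also have "\<dots> = ennreal (jd y z)" using c by (simp add: mult.assoc[symmetric] ennreal_mult[symmetric])
     finally show ?thesis using True by simp
    qed simp
   qed
   also have "\<dots> = (\<integral>\<^sup>+z. indicator P z \<partial>density m (\<lambda>z. ennreal (jd y z)))" by (rule int[symmetric]) measurable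
   finally show "ennreal (\<mu> / c) * ennreal (j z0 y) \<le> (\<integral>\<^sup>+z. indicator P z \<partial>density m (\<lambda>z. ennreal (jd y z)))" .
  qed
  also have "\<dots> = Y.H ?M ?W (indicator P) x" by (rule Y.jump_law[OF W x M, symmetric]) (simp_all add: cl)
  finally show ?thesis .
 qed
 have "ennreal c * (ennreal \<tau> * mass) * Y.R ?M ?W (\<lambda>y. ennreal (j z0 y)) x
   = ennreal (c\<^sup>2 * \<tau> / \<mu>) * mass * (ennreal (\<mu> / c) * Y.R ?M ?W (\<lambda>y. ennreal (j z0 y)) x)"
 proof -
  let ?r = "Y.R ?M ?W (\<lambda>y. ennreal (j z0 y)) x"
  have e: "ennreal c * ennreal \<tau> = ennreal (c\<^sup>2 * \<tau> / \<mu>) * ennreal (\<mu> / c)"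
   using c mP(2) \<tau>(1) by (simp add: ennreal_mult[symmetric] power2_eq_square)
  have "ennreal c * (ennreal \<tau> * mass) * ?r = (ennreal c * ennreal \<tau>) * (mass * ?r)" by (simp only: mult_ac)
  also have "\<dots> = ennreal (c\<^sup>2 * \<tau> / \<mu>) * mass * (ennreal (\<mu> / c) * ?r)" unfolding e by (simp only: mult_ac)
  finally show ?thesis .
 qed
 also have "\<dots> \<le> ennreal (c\<^sup>2 * \<tau> / \<mu>) * mass * Y.H ?M ?W (indicator P) x" by (intro mult_left_mono 2) simp
 finally show ?thesis using 1 by (rule order_trans[rotated])
qed

text \<open>On V - N, where the weight vanishes, w solves the perturbed exit problem with its own
  values on N as data: bounded on the collar, averaged on P. A multiple of
  \<open>\<phi> y + \<epsilon>\<close> dominates these data, \<phi> being 1 on N, and is a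
  supersolution.\<close>

lemma w_barrier:
 assumes y: "y \<in> V - P"
 shows "w y \<le> ennreal C * mass * ennreal (\<phi> y + \<epsilon>)"
proof (cases "y \<in> N")
 case True
 have "w y \<le> ennreal \<gamma> * mass" using True y by (intro w_collar) auto
 also have "\<dots> \<le> ennreal C * mass * ennreal (\<phi> y + \<epsilon>)"
 proof -
  have "ennreal \<gamma> * mass * 1 \<le> ennreal C * mass * ennreal (\<phi> y + \<epsilon>)"
  proof (intro mult_mono)
   show "ennreal \<gamma> \<le> ennreal C" using c \<tau>(1) mP(2) by (intro ennreal_leI) (simp add: C_def)
   show "1 \<le> ennreal (\<phi> y + \<epsilon>)" using \<phi>(4)[OF True] \<epsilon> by (simp add: ennreal_1[symmetric] ennreal_leI del: ennreal_1)
  qed auto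
  then show ?thesis by simp
 qed
 finally show ?thesis .
next
 case False
 let ?W = "V - N" and ?M = "\<delta>/\<epsilon>"
 have W: "open ?W" "?W \<subseteq> V" using V PN by auto
 have M: "0 \<le> ?M" using M_pos by simp
 have [measurable]: "P \<in> sets borel" "N \<in> sets borel" using PN by auto
 have yW: "y \<in> ?W" using y False by simp
 show ?thesis
 proof (rule Y.FK_comparison[where s = "\<lambda>y. ennreal C * mass * ennreal (\<phi> y + \<epsilon>)" and a = "Y.H ?M ?W w",
    OF M psi_measurable psi_nonneg[OF \<epsilon>] Y.H_measurable[OF w_measurable] w_measurable w_bounded _ _ yW])
  fix x assume x: "x \<in> ?W"
  let ?f = "\<lambda>z. k z + ennreal (?M - \<psi> \<epsilon> z) * w z"
  have fm: "?f \<in> borel_fun" by measurable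
  have wf: "w z = Y.R ?M V ?f z" for z
  proof -
   have "w z = Y.R ?M V k z + Y.FK ?M (\<psi> \<epsilon>) V w z"
    unfolding w_def by (rule Y.FKsum_unfold[OF psi_measurable Y.R_measurable[OF k]])
   also have "\<dots> = Y.R ?M V ?f z" unfolding Y.FK_def by (rule Y.R_add[symmetric]) measurable
   finally show ?thesis .
  qed
  have "w x = Y.R ?M ?W ?f x + Y.H ?M ?W (Y.R ?M V ?f) x"
   unfolding wf[of x] by (rule Y.R_decompose[OF V(1) W fm])
  also have "Y.R ?M V ?f = w" by (rule ext) (rule wf[symmetric])
  also have "Y.R ?M ?W ?f x = Y.FK ?M (\<psi> \<epsilon>) ?W w x" unfolding Y.FK_def
  proof (rule Y.R_cong)
   fix z assume "z \<in> ?W"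
   then have "z \<notin> S" using S PN by auto
   then show "?f z = ennreal (?M - \<psi> \<epsilon> z) * w z" by (simp add: kS)
  qed
  finally show "w x \<le> Y.H ?M ?W w x + Y.FK ?M (\<psi> \<epsilon>) ?W w x" by (simp add: add.commute)
  have hi: "Y.H ?M ?W w x \<le> ennreal C * mass * Y.H ?M ?W (\<lambda>y. ennreal (\<phi> y + \<epsilon>)) x"
  proof -
   have "Y.H ?M ?W w x \<le> Y.H ?M ?W (\<lambda>z. w z * indicator P z + (ennreal \<gamma> * mass) * indicator N z) x"
   proof (rule Y.H_mono[OF W(1)])
    fix z assume z: "z \<notin> ?W"
    show "w z \<le> w z * indicator P z + (ennreal \<gamma> * mass) * indicator N z"
     using w_collar[of z] w_outside[of z] z by (cases "z \<in> P"; cases "z \<in> N") auto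
   qed
   also have "\<dots> = Y.H ?M ?W (\<lambda>z. w z * indicator P z) x + Y.H ?M ?W (\<lambda>z. (ennreal \<gamma> * mass) * indicator N z) x"
    by (rule Y.H_add) measurable
   also have "Y.H ?M ?W (\<lambda>z. (ennreal \<gamma> * mass) * indicator N z) x = (ennreal \<gamma> * mass) * Y.H ?M ?W (indicator N) x"
    by (rule Y.H_cmult) measurable
   also have "Y.H ?M ?W (\<lambda>z. w z * indicator P z) x + (ennreal \<gamma> * mass) * Y.H ?M ?W (indicator N) x
     \<le> ennreal (c\<^sup>2 * \<tau> / \<mu>) * mass * Y.H ?M ?W (\<lambda>y. ennreal (\<phi> y + \<epsilon>)) x +
      (ennreal \<gamma> * mass) * Y.H ?M ?W (\<lambda>y. ennreal (\<phi> y + \<epsilon>)) x"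
   proof (intro add_mono order_trans[OF w_deep[OF x]] mult_left_mono Y.H_mono[OF W(1)])
    fix z
    show "indicator P z \<le> ennreal (\<phi> z + \<epsilon>)" "indicator N z \<le> ennreal (\<phi> z + \<epsilon>)"
     using \<phi>(4)[of z] PN(3) \<epsilon> by (auto simp: indicator_def ennreal_1[symmetric] ennreal_leI simp del: ennreal_1)
   qed auto
   also have "\<dots> = ennreal C * mass * Y.H ?M ?W (\<lambda>y. ennreal (\<phi> y + \<epsilon>)) x"
   proof -
    have "ennreal C = ennreal \<gamma> + ennreal (c\<^sup>2 * \<tau> / \<mu>)"
     unfolding C_def using collar(1) \<tau>(1) mP(2) by (intro ennreal_plus) auto
    then show ?thesis by (simp add: distrib_right add.commute)
   qed
   finally show ?thesis .
  qed
  have "Y.FK ?M (\<psi> \<epsilon>) ?W (\<lambda>y. ennreal C * mass * ennreal (\<phi> y + \<epsilon>)) x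
    = ennreal C * mass * Y.FK ?M (\<psi> \<epsilon>) ?W (\<lambda>y. ennreal (\<phi> y + \<epsilon>)) x"
   by (rule Y.FK_cmult[OF psi_measurable]) measurable
  then have "Y.H ?M ?W w x + Y.FK ?M (\<psi> \<epsilon>) ?W (\<lambda>y. ennreal C * mass * ennreal (\<phi> y + \<epsilon>)) x
    \<le> ennreal C * mass * (Y.H ?M ?W (\<lambda>y. ennreal (\<phi> y + \<epsilon>)) x + Y.FK ?M (\<psi> \<epsilon>) ?W (\<lambda>y. ennreal (\<phi> y + \<epsilon>)) x)"
   using hi by (simp add: distrib_left add_right_mono)
  also have "\<dots> \<le> ennreal C * mass * ennreal (\<phi> x + \<epsilon>)" unfolding \<psi>_def
   by (intro mult_left_mono Y.generator_supersolution[OF W(1) phi_gen_domain \<phi>(2) Y.feller_Z \<delta> \<epsilon>]) simp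
  finally show "Y.H ?M ?W w x + Y.FK ?M (\<psi> \<epsilon>) ?W (\<lambda>y. ennreal C * mass * ennreal (\<phi> y + \<epsilon>)) x
    \<le> ennreal C * mass * ennreal (\<phi> x + \<epsilon>)" .
 next
  have "Y.R 0 ?W (\<lambda>_. 1) y \<le> Y.R 0 V (\<lambda>_. 1) y" by (rule Y.R_mono_set[OF V(1) W]) simp
  also have "\<dots> \<le> ennreal \<tau>" by (rule \<tau>)
  finally show "Y.R 0 ?W (\<lambda>_. 1) y < \<top>" by (rule le_less_trans) simp
 qed
qed

end

section \<open>Integrating a harmonic function against a weight\<close>

context
 fixes k :: "'a \<Rightarrow> ennreal" and B :: real and D :: "'a set"
 assumes k [measurable]: "k \<in> borel_fun" and kB: "\<And>x. k x \<le> ennreal B"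
  and kSD: "\<And>x. x \<notin> S \<inter> D \<Longrightarrow> k x = 0" and D: "open D" "D \<subseteq> V"
begin

lemma kS: "\<forall>x. x \<notin> S \<longrightarrow> k x = 0" using kSD by blast

lemma mass_finite: "mass k < \<top>"
proof -
 have "mass k \<le> (\<integral>\<^sup>+x. ennreal B * indicator V x \<partial>m)"
 proof (rule nn_integral_mono)
  fix x show "k x \<le> ennreal B * indicator V x" using kB[of x] kS S PN by (cases "x \<in> V") auto
 qed
 also have "\<dots> = ennreal B * emeasure m V" by (rule nn_integral_cmult_indicator) (use V in simp)
 also have "\<dots> < \<top>" using V(2) by (simp add: ennreal_mult_less_top)
 finally show ?thesis .
qed

definition "L \<epsilon> f = (\<integral>\<^sup>+x. k x * X.FKsum (\<delta>/\<epsilon>) (\<psi> \<epsilon>) D (X.H (\<delta>/\<epsilon>) D f) x \<partial>m)"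

text \<open>Replacing D by V gives a dual weight w that does not depend on D; the price is an
  inequality.\<close>

lemma FKsum_dual_le:
 assumes \<epsilon>: "0 < \<epsilon>" and f [measurable]: "f \<in> borel_fun"
 shows "(\<integral>\<^sup>+x. k x * X.FKsum (\<delta>/\<epsilon>) (\<psi> \<epsilon>) D (X.R (\<delta>/\<epsilon>) D f) x \<partial>m) \<le> (\<integral>\<^sup>+x. w k \<epsilon> x * f x \<partial>m)"
proof -
 have "(\<integral>\<^sup>+x. k x * X.FKsum (\<delta>/\<epsilon>) (\<psi> \<epsilon>) D (X.R (\<delta>/\<epsilon>) D f) x \<partial>m)
   \<le> (\<integral>\<^sup>+x. k x * X.FKsum (\<delta>/\<epsilon>) (\<psi> \<epsilon>) V (X.R (\<delta>/\<epsilon>) V f) x \<partial>m)"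
 proof (rule nn_integral_mono)
  fix x
  show "k x * X.FKsum (\<delta>/\<epsilon>) (\<psi> \<epsilon>) D (X.R (\<delta>/\<epsilon>) D f) x \<le> k x * X.FKsum (\<delta>/\<epsilon>) (\<psi> \<epsilon>) V (X.R (\<delta>/\<epsilon>) V f) x"
  proof (cases "x \<in> D")
   case True
   show ?thesis by (intro mult_left_mono X.FKsum_mono_set[OF psi_measurable f D(1) V(1) D(2) True]) simp
  qed (simp add: kSD)
 qed
 also have "\<dots> = (\<integral>\<^sup>+x. w k \<epsilon> x * f x \<partial>m)"
  unfolding w_def[OF k kB kS \<epsilon>]
  by (rule duality_FKsum[OF V \<tau>(2) _ psi_measurable k f]) (use \<delta> \<epsilon> in simp)
 finally show ?thesis .
qed

lemma L_add:
 assumes [measurable]: "f \<in> borel_fun" "g \<in> borel_fun"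
 shows "L \<epsilon> (\<lambda>x. f x + g x) = L \<epsilon> f + L \<epsilon> g"
proof -
 have "X.H (\<delta>/\<epsilon>) D (\<lambda>x. f x + g x) = (\<lambda>x. X.H (\<delta>/\<epsilon>) D f x + X.H (\<delta>/\<epsilon>) D g x)"
  by (rule ext) (rule X.H_add; measurable)
 moreover have "X.FKsum (\<delta>/\<epsilon>) (\<psi> \<epsilon>) D (\<lambda>x. X.H (\<delta>/\<epsilon>) D f x + X.H (\<delta>/\<epsilon>) D g x) x =
   X.FKsum (\<delta>/\<epsilon>) (\<psi> \<epsilon>) D (X.H (\<delta>/\<epsilon>) D f) x + X.FKsum (\<delta>/\<epsilon>) (\<psi> \<epsilon>) D (X.H (\<delta>/\<epsilon>) D g) x" for x
  by (rule X.FKsum_add[OF psi_measurable]) (rule X.H_measurable; measurable)+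
 ultimately show ?thesis unfolding L_def by (simp add: distrib_left nn_integral_add)
qed

lemma L_cmult:
 assumes [measurable]: "f \<in> borel_fun"
 shows "L \<epsilon> (\<lambda>x. a * f x) = a * L \<epsilon> f"
proof -
 have "X.H (\<delta>/\<epsilon>) D (\<lambda>x. a * f x) = (\<lambda>x. a * X.H (\<delta>/\<epsilon>) D f x)"
  by (rule ext) (rule X.H_cmult; measurable)
 moreover have "X.FKsum (\<delta>/\<epsilon>) (\<psi> \<epsilon>) D (\<lambda>x. a * X.H (\<delta>/\<epsilon>) D f x) x = a * X.FKsum (\<delta>/\<epsilon>) (\<psi> \<epsilon>) D (X.H (\<delta>/\<epsilon>) D f) x" for x
  by (rule X.FKsum_cmult[OF psi_measurable]) (rule X.H_measurable; measurable)
 ultimately show ?thesis unfolding L_def by (simp add: mult.left_commute[of _ a] nn_integral_cmult)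
qed

lemma L_mono:
 assumes "\<And>x. x \<notin> D \<Longrightarrow> f x \<le> g x" shows "L \<epsilon> f \<le> L \<epsilon> g"
 unfolding L_def
proof (rule nn_integral_mono)
 fix x
 show "k x * X.FKsum (\<delta>/\<epsilon>) (\<psi> \<epsilon>) D (X.H (\<delta>/\<epsilon>) D f) x \<le> k x * X.FKsum (\<delta>/\<epsilon>) (\<psi> \<epsilon>) D (X.H (\<delta>/\<epsilon>) D g) x"
 proof (cases "x \<in> D")
  case True
  show ?thesis by (intro mult_left_mono X.FKsum_mono[OF psi_measurable _ True] X.H_mono[OF D(1)] assms) simp_all
 qed (simp add: kSD)
qed

lemma L_le:
 assumes \<epsilon>: "0 < \<epsilon>" and f [measurable]: "f \<in> borel_fun"
 shows "L \<epsilon> f \<le> (\<integral>\<^sup>+x. k x * X.H 0 D f x \<partial>m)" unfolding L_def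
proof (rule nn_integral_mono)
 fix x
 have M: "0 \<le> \<delta>/\<epsilon>" using \<delta> \<epsilon> by simp
 show "k x * X.FKsum (\<delta>/\<epsilon>) (\<psi> \<epsilon>) D (X.H (\<delta>/\<epsilon>) D f) x \<le> k x * X.H 0 D f x"
 proof (cases "x \<in> D")
  case True
  show ?thesis by (intro mult_left_mono X.FKsum_H_le[OF M psi_measurable psi_nonneg[OF \<epsilon>] f True]) simp
 qed (simp add: kSD)
qed

text \<open>Dynkin's formula and duality lead to the integral of w against the generator of f. On E
  this generator is a jump integral comparable to the one from z0; on V - E, where \<phi> vanishes,
  the barrier makes w of order \<epsilon>. The bound b may depend on f, so f has to be fixed before
  \<epsilon> tends to 0.\<close>

lemma L_test:
 assumes \<epsilon>: "0 < \<epsilon>" and f: "f \<in> \<D>" "\<And>y. 0 \<le> f y" and sup: "closure {y. f y \<noteq> 0} \<inter> E' = {}"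
  and b: "\<And>y. gen X f y \<le> b"
 shows "L \<epsilon> (\<lambda>y. ennreal (f y)) \<le> ennreal (c * \<tau>) * mass k * (\<integral>\<^sup>+z. ennreal (j z0 z) * ennreal (f z) \<partial>m)
  + ennreal C * mass k * ennreal b * emeasure m V * ennreal \<epsilon>"
proof -
 have [measurable]: "f \<in> borel_fun" "gen X f \<in> borel_fun" "j z0 \<in> borel_fun"
   "V \<in> sets borel" "E \<in> sets borel"
  using X.test_measurable[OF f(1)] X.gen_measurable[OF f(1)] jump_measurable V EE by auto
 have w [measurable]: "w k \<epsilon> \<in> borel_fun" by (rule w_measurable[OF k kB kS \<epsilon>])
 have M: "0 < \<delta>/\<epsilon>" using \<delta> \<epsilon> by simp
 define I where "I = (\<integral>\<^sup>+z. ennreal (j z0 z) * ennreal (f z) \<partial>m)"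
 have "L \<epsilon> (\<lambda>y. ennreal (f y)) \<le> (\<integral>\<^sup>+x. k x * X.FKsum (\<delta>/\<epsilon>) (\<psi> \<epsilon>) D (X.R (\<delta>/\<epsilon>) D (\<lambda>y. ennreal (gen X f y))) x \<partial>m)"
  unfolding L_def
 proof (rule nn_integral_mono)
  fix x
  show "k x * X.FKsum (\<delta>/\<epsilon>) (\<psi> \<epsilon>) D (X.H (\<delta>/\<epsilon>) D (\<lambda>y. ennreal (f y))) x
    \<le> k x * X.FKsum (\<delta>/\<epsilon>) (\<psi> \<epsilon>) D (X.R (\<delta>/\<epsilon>) D (\<lambda>y. ennreal (gen X f y))) x"
  proof (cases "x \<in> S \<inter> D")
   case True
   then have x: "x \<in> E'" using S PN N_subset_E EE by blast
   then have "f x = 0" using sup closure_subset[of "{y. f y \<noteq> 0}"] by blast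
   moreover have "f \<in> gen_domain X" using X.dom f(1) by blast
   ultimately have "X.FKsum (\<delta>/\<epsilon>) (\<psi> \<epsilon>) D (X.H (\<delta>/\<epsilon>) D (\<lambda>y. ennreal (f y))) x
    \<le> X.FKsum (\<delta>/\<epsilon>) (\<psi> \<epsilon>) D (X.R (\<delta>/\<epsilon>) D (\<lambda>y. ennreal (gen X f y))) x"
    using X.dynkin_FK[where f = f, OF M psi_measurable psi_nonneg[OF \<epsilon>] D(1) _ f(2) X.feller_Z, of x] True by simp
   then show ?thesis by (rule mult_left_mono) simp
  qed (simp add: kSD)
 qed
 also have "\<dots> \<le> (\<integral>\<^sup>+x. w k \<epsilon> x * ennreal (gen X f x) \<partial>m)" by (rule FKsum_dual_le[OF \<epsilon>]) measurable
 also have "\<dots> \<le> (\<integral>\<^sup>+x. (ennreal c * I) * w k \<epsilon> x + (ennreal C * mass k * ennreal b * ennreal \<epsilon>) * indicator V x \<partial>m)"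
 proof (rule nn_integral_mono)
  fix x
  consider "x \<notin> V" | "x \<in> E" | "x \<in> V - E" by blast
  then show "w k \<epsilon> x * ennreal (gen X f x) \<le> (ennreal c * I) * w k \<epsilon> x + (ennreal C * mass k * ennreal b * ennreal \<epsilon>) * indicator V x"
  proof cases
   case 1
   then show ?thesis using w_outside[OF k kB kS \<epsilon> 1] by simp
  next
   case 2
   have "x \<notin> closure {y. f y \<noteq> 0}" using 2 sup EE by blast
   then have "ennreal (gen X f x) = (\<integral>\<^sup>+z. ennreal (f z) \<partial>density m (\<lambda>z. ennreal (j x z)))"
    by (rule X.gen_off_support[OF f])
   also have "\<dots> = (\<integral>\<^sup>+z. ennreal (j x z) * ennreal (f z) \<partial>m)"
    by (rule nn_integral_density) (use jump_measurable(1)[of x] in simp_all)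
   also have "\<dots> \<le> (\<integral>\<^sup>+z. ennreal c * (ennreal (j z0 z) * ennreal (f z)) \<partial>m)"
   proof (rule nn_integral_mono)
    fix z
    show "ennreal (j x z) * ennreal (f z) \<le> ennreal c * (ennreal (j z0 z) * ennreal (f z))"
    proof (cases "z \<in> E'")
     case True
     then have "f z = 0" using sup closure_subset[of "{y. f y \<noteq> 0}"] by blast
     then show ?thesis by simp
    next
     case False
     have "z0 \<noteq> z" using False PN N_subset_E EE by blast
     then have "0 < j z0 z" by (rule jump_pos)
     then have "ennreal (j x z) \<le> ennreal c * ennreal (j z0 z)"
      using shallow[OF 2 False] c by (simp add: ennreal_mult[symmetric] ennreal_leI)
     then have "ennreal (j x z) * ennreal (f z) \<le> (ennreal c * ennreal (j z0 z)) * ennreal (f z)"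
      by (rule mult_right_mono) simp
     then show ?thesis by (simp only: mult.assoc)
    qed
   qed
   also have "\<dots> = ennreal c * I" unfolding I_def by (rule nn_integral_cmult) measurable
   finally have "w k \<epsilon> x * ennreal (gen X f x) \<le> w k \<epsilon> x * (ennreal c * I)" by (rule mult_left_mono) simp
   then show ?thesis by (intro add_increasing2) (simp_all add: mult.commute)
  next
   case 3
   then have "x \<in> V - P" using PN N_subset_E by blast
   then have "w k \<epsilon> x \<le> ennreal C * mass k * ennreal (\<phi> x + \<epsilon>)" by (rule w_barrier[OF k kB kS \<epsilon>])
   then have "w k \<epsilon> x \<le> ennreal C * mass k * ennreal \<epsilon>" using \<phi>(5)[of x] 3 by simp
   then have "w k \<epsilon> x * ennreal (gen X f x) \<le> (ennreal C * mass k * ennreal \<epsilon>) * ennreal b"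
    by (rule mult_mono) (use b in \<open>auto intro: ennreal_leI\<close>)
   also have "\<dots> = (ennreal C * mass k * ennreal b * ennreal \<epsilon>) * indicator V x" using 3 by (simp add: mult_ac)
   finally show ?thesis by (intro add_increasing) simp_all
  qed
 qed
 also have "\<dots> = (\<integral>\<^sup>+x. (ennreal c * I) * w k \<epsilon> x \<partial>m) + (\<integral>\<^sup>+x. (ennreal C * mass k * ennreal b * ennreal \<epsilon>) * indicator V x \<partial>m)"
  by (rule nn_integral_add) measurable
 also have "(\<integral>\<^sup>+x. (ennreal c * I) * w k \<epsilon> x \<partial>m) = (ennreal c * I) * (\<integral>\<^sup>+x. w k \<epsilon> x \<partial>m)" by (rule nn_integral_cmult) measurable
 also have "(\<integral>\<^sup>+x. (ennreal C * mass k * ennreal b * ennreal \<epsilon>) * indicator V x \<partial>m) = (ennreal C * mass k * ennreal b * ennreal \<epsilon>) * emeasure m V"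
  by (rule nn_integral_cmult_indicator) simp
 also have "(ennreal c * I) * (\<integral>\<^sup>+x. w k \<epsilon> x \<partial>m) + (ennreal C * mass k * ennreal b * ennreal \<epsilon>) * emeasure m V
   \<le> (ennreal c * I) * (ennreal \<tau> * mass k) + (ennreal C * mass k * ennreal b * ennreal \<epsilon>) * emeasure m V"
  by (intro add_right_mono mult_left_mono w_mass[OF k kB kS \<epsilon>]) simp
 also have "\<dots> = ennreal (c * \<tau>) * mass k * I + ennreal C * mass k * ennreal b * emeasure m V * ennreal \<epsilon>"
  using c \<tau>(1) by (simp add: ennreal_mult mult_ac)
 finally show ?thesis unfolding I_def .
qed

definition "\<Theta> = density m (\<lambda>z. ennreal (c * \<tau>) * mass k * ennreal (j z0 z))"

lemma sets_Theta [simp, measurable_cong]: "sets \<Theta> = sets borel" by (simp add: \<Theta>_def)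

lemma integral_Theta:
 assumes g [measurable]: "g \<in> borel_fun"
 shows "(\<integral>\<^sup>+z. g z \<partial>\<Theta>) = ennreal (c * \<tau>) * mass k * (\<integral>\<^sup>+z. ennreal (j z0 z) * g z \<partial>m)"
proof -
 have [measurable]: "j z0 \<in> borel_fun" by (rule jump_measurable)
 have "(\<integral>\<^sup>+z. g z \<partial>\<Theta>) = (\<integral>\<^sup>+z. ennreal (c * \<tau>) * mass k * ennreal (j z0 z) * g z \<partial>m)"
  unfolding \<Theta>_def by (rule nn_integral_density) measurable
 also have "\<dots> = (\<integral>\<^sup>+z. (ennreal (c * \<tau>) * mass k) * (ennreal (j z0 z) * g z) \<partial>m)" by (simp only: mult.assoc)
 also have "\<dots> = ennreal (c * \<tau>) * mass k * (\<integral>\<^sup>+z. ennreal (j z0 z) * g z \<partial>m)" by (rule nn_integral_cmult) measurable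
 finally show ?thesis .
qed

text \<open>The order of choices matters: a thickening of K with nearly the same measure for
  \<Theta>, a cutoff supported in it, the bound b of its generator, and only then \<epsilon>, small
  against b.\<close>

lemma L_compact:
 assumes K: "compact K" "K \<subseteq> - V" and e: "0 < e"
 shows "\<forall>\<^sub>F n in sequentially. L (1 / real (Suc n)) (indicator K) \<le> emeasure \<Theta> K + ennreal e"
proof (cases "K = {}")
 case True
 have "L \<epsilon> (indicator K) = 0" for \<epsilon>
 proof -
  have "indicator K = (\<lambda>_. 0 :: ennreal)" using True by auto
  then show ?thesis using L_cmult[of "\<lambda>_. 0" \<epsilon> 0] by simp
 qed
 then show ?thesis by simp
next
 case False
 have "K \<inter> E' = {}" using K EE by blast
 from X.compact_cutoffs[OF K(1) False EE(2) this] obtain d where d: "0 < d" "{y. infdist y K \<le> d} \<inter> E' = {}"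
  "\<And>i. \<exists>f\<in>\<D>. (\<forall>y. 0 \<le> f y \<and> f y \<le> 1) \<and> (\<forall>y. infdist y K \<le> d / (1 + real (Suc i)) \<longrightarrow> f y = 1) \<and>
   (\<forall>y. d / (1 + real i) < infdist y K \<longrightarrow> f y = 0) \<and> closure {y. f y \<noteq> 0} \<inter> E' = {}" by blast
 define W where "W i = {y. infdist y K \<le> d / (1 + real i)}" for i :: nat
 have Wb [measurable]: "W i \<in> sets borel" for i
  unfolding W_def by (rule borel_compact[OF compact_thickening[OF K(1) False]])
 let ?J = "density m (\<lambda>z. ennreal (j z0 z))" and ?T = "{y. infdist y K \<le> d}"
 have "emeasure \<Theta> ?T < \<top>"
 proof -
  have T: "compact ?T" by (rule compact_thickening[OF K(1) False])
  note [measurable] = borel_compact[OF T]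
  have "emeasure \<Theta> ?T = (\<integral>\<^sup>+z. indicator ?T z \<partial>\<Theta>)" by simp
  also have "\<dots> = ennreal (c * \<tau>) * mass k * (\<integral>\<^sup>+z. ennreal (j z0 z) * indicator ?T z \<partial>m)" by (rule integral_Theta) measurable
  also have "(\<integral>\<^sup>+z. ennreal (j z0 z) * indicator ?T z \<partial>m) = emeasure ?J ?T"
   by (rule emeasure_density[symmetric]) (use jump_measurable in simp_all)
  finally have eq: "emeasure \<Theta> ?T = ennreal (c * \<tau>) * mass k * emeasure ?J ?T" .
  have "emeasure ?J ?T < \<top>" by (rule X.J_compact_finite[OF T]) (use d(2) PN N_subset_E EE in blast)
  then show ?thesis unfolding eq using mass_finite by (simp only: ennreal_mult_less_top) simp
 qed
 from emeasure_thickening[OF K(1) False sets_Theta d(1) this]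
 have lim: "(\<lambda>i. emeasure \<Theta> (W i)) \<longlonglongrightarrow> emeasure \<Theta> K" unfolding W_def .
 have "\<exists>i. emeasure \<Theta> (W i) \<le> emeasure \<Theta> K + ennreal (e/2)"
 proof (cases "emeasure \<Theta> K = \<top>")
  case False
  then have "emeasure \<Theta> K < emeasure \<Theta> K + ennreal (e/2)" using e by (simp add: less_top[symmetric] ennreal_add_left_cancel_less)
  from order_tendstoD(2)[OF lim this] have "\<exists>i. emeasure \<Theta> (W i) < emeasure \<Theta> K + ennreal (e/2)"
   by (auto dest: eventually_happens)
  then show ?thesis by (auto intro: less_imp_le)
 qed simp
 then obtain i where i: "emeasure \<Theta> (W i) \<le> emeasure \<Theta> K + ennreal (e/2)" ..
 obtain f where f: "f \<in> \<D>" "\<And>y. 0 \<le> f y" "\<And>y. f y \<le> 1" "\<And>y. y \<in> K \<Longrightarrow> f y = 1" and fW: "\<And>y. y \<notin> W i \<Longrightarrow> f y = 0"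
   and sup: "closure {y. f y \<noteq> 0} \<inter> E' = {}" using d(3)[of i] d(1) by (auto simp: W_def not_le)
 have "generates X f (gen X f)" using X.dom f(1) by (intro generates_gen) blast
 then have "gen X f \<in> C0" by (simp add: generates_def)
 then obtain b where b: "0 < b" "\<And>y. \<bar>gen X f y\<bar> \<le> b" using C0_bounded by blast
 have gb: "gen X f y \<le> b" for y using b(2)[of y] by simp
 let ?A = "ennreal C * mass k * ennreal b * emeasure m V"
 have "?A < \<top>" using mass_finite V(2) by (simp add: ennreal_mult_less_top)
 then obtain a where a: "?A = ennreal a" "0 \<le> a" by (cases ?A) auto
 have "(\<lambda>n. a * (1 / real (Suc n))) \<longlonglongrightarrow> 0" by real_asymp
 then have "\<forall>\<^sub>F n in sequentially. a * (1 / real (Suc n)) < e/2" using e by (intro order_tendstoD(2)) auto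
 then show ?thesis
 proof eventually_elim
  case (elim n)
  let ?e = "1 / real (Suc n)"
  have fm [measurable]: "f \<in> borel_fun" by (rule X.test_measurable[OF f(1)])
  have "L ?e (indicator K) \<le> L ?e (\<lambda>y. ennreal (f y))"
   by (rule L_mono) (use f in \<open>auto simp: indicator_def\<close>)
  also have "\<dots> \<le> ennreal (c * \<tau>) * mass k * (\<integral>\<^sup>+z. ennreal (j z0 z) * ennreal (f z) \<partial>m) + ?A * ennreal ?e"
   by (rule L_test[OF _ f(1,2) sup gb]) simp
  also have "ennreal (c * \<tau>) * mass k * (\<integral>\<^sup>+z. ennreal (j z0 z) * ennreal (f z) \<partial>m) = (\<integral>\<^sup>+z. ennreal (f z) \<partial>\<Theta>)"
   by (rule integral_Theta[symmetric]) measurable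
  also have "(\<integral>\<^sup>+z. ennreal (f z) \<partial>\<Theta>) + ?A * ennreal ?e \<le> (emeasure \<Theta> K + ennreal (e/2)) + ennreal (e/2)"
  proof (rule add_mono)
   have "(\<integral>\<^sup>+z. ennreal (f z) \<partial>\<Theta>) \<le> (\<integral>\<^sup>+z. indicator (W i) z \<partial>\<Theta>)"
    by (intro nn_integral_mono) (use f fW in \<open>auto simp: indicator_def\<close>)
   also have "\<dots> = emeasure \<Theta> (W i)" by simp
   finally show "(\<integral>\<^sup>+z. ennreal (f z) \<partial>\<Theta>) \<le> emeasure \<Theta> K + ennreal (e/2)" using i by (rule order_trans)
   show "?A * ennreal ?e \<le> ennreal (e/2)" unfolding a using a(2) elim
    by (subst ennreal_mult[symmetric]) (auto intro!: ennreal_leI)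
  qed
  also have "\<dots> = emeasure \<Theta> K + ennreal e"
   using e by (simp add: add.assoc ennreal_plus[symmetric] del: ennreal_plus)
  finally show ?case .
 qed
qed

text \<open>The extra killing splits u into an exit term and a killing term. In the exit term
  \<open>limit_domination\<close> replaces the perturbed exit law by \<Theta>; in the killing term w
  contributes the factor \<open>\<phi> x + \<epsilon>\<close>, which cancels the denominator of
  \<psi> and leaves \<delta>, uniformly in \<epsilon>. On P there is no killing.\<close>

lemma weighted_bound:
 assumes u [measurable]: "u \<in> borel_fun" and harm: "\<And>x. x \<in> D \<Longrightarrow> u x = X.H 0 D u x"
  and u0: "\<And>x. x \<in> V - D \<Longrightarrow> u x = 0" and ufin: "\<And>x. u x < \<top>" and ku: "(\<integral>\<^sup>+x. k x * u x \<partial>m) < \<top>"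
 shows "(\<integral>\<^sup>+x. k x * u x \<partial>m) \<le> mass k * (ennreal (C * \<delta>) * (\<integral>\<^sup>+x. indicator (V - P) x * u x \<partial>m)
  + ennreal (c * \<tau>) * (\<integral>\<^sup>+x. indicator (- V) x * (ennreal (j z0 x) * u x) \<partial>m))"
proof (rule ennreal_le_epsilon)
 fix e :: real assume e: "0 < e"
 have [measurable]: "V \<in> sets borel" "P \<in> sets borel" "j z0 \<in> borel_fun" using V PN jump_measurable by auto
 let ?T = "\<lambda>f. \<integral>\<^sup>+x. k x * X.H 0 D f x \<partial>m"
 have Hm [measurable]: "f \<in> borel_fun \<Longrightarrow> X.H 0 D f \<in> borel_fun" for f by (rule X.H_measurable)
 \<comment> \<open>\<kappa> is the exit law without extra killing, weighted by k; it is finite and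
   dominates all perturbed ones, as \<open>limit_domination\<close> requires.\<close>
 have "\<exists>\<kappa>. sets \<kappa> = sets borel \<and> (\<forall>f\<in>borel_measurable borel. ?T f = (\<integral>\<^sup>+x. f x \<partial>\<kappa>))"
 proof (rule functional_measure)
  fix f g :: "'a \<Rightarrow> ennreal" assume [measurable]: "f \<in> borel_fun" "g \<in> borel_fun"
  have "X.H 0 D (\<lambda>x. f x + g x) x = X.H 0 D f x + X.H 0 D g x" for x by (rule X.H_add) measurable
  then show "?T (\<lambda>x. f x + g x) = ?T f + ?T g" by (simp add: distrib_left nn_integral_add)
 next
  fix f :: "'a \<Rightarrow> ennreal" and a assume [measurable]: "f \<in> borel_fun"
  have "X.H 0 D (\<lambda>x. a * f x) x = a * X.H 0 D f x" for x by (rule X.H_cmult) measurable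
  then show "?T (\<lambda>x. a * f x) = a * ?T f" by (simp add: mult.left_commute[of _ a] nn_integral_cmult)
 next
  fix F :: "nat \<Rightarrow> 'a \<Rightarrow> ennreal" assume [measurable]: "\<And>i. F i \<in> borel_fun" and inc: "incseq F"
  have "X.H 0 D (\<lambda>x. SUP i. F i x) x = (SUP i. X.H 0 D (F i) x)" for x by (rule X.H_SUP[OF _ inc]) measurable
  then have "?T (\<lambda>x. SUP i. F i x) = (\<integral>\<^sup>+x. (SUP i. k x * X.H 0 D (F i) x) \<partial>m)" by (simp add: SUP_mult_left_ennreal)
  also have "\<dots> = (SUP i. ?T (F i))"
  proof (rule nn_integral_monotone_convergence_SUP)
   show "incseq (\<lambda>i x. k x * X.H 0 D (F i) x)"
    using inc by (auto simp: incseq_def le_fun_def intro!: mult_left_mono X.H_mono[OF D(1)])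
  qed measurable
  finally show "?T (\<lambda>x. SUP i. F i x) = (SUP i. ?T (F i))" .
 qed
 then obtain \<kappa> where \<kappa>: "sets \<kappa> = sets borel" "\<And>f. f \<in> borel_fun \<Longrightarrow> ?T f = (\<integral>\<^sup>+x. f x \<partial>\<kappa>)"
  by auto
 have fin: "emeasure \<kappa> UNIV < \<top>"
 proof -
  have "emeasure \<kappa> UNIV = (\<integral>\<^sup>+x. 1 \<partial>\<kappa>)" using sets_eq_imp_space_eq[OF \<kappa>(1)] by simp
  also have "\<dots> = ?T (\<lambda>_. 1)" by (rule \<kappa>(2)[symmetric]) simp
  also have "\<dots> \<le> (\<integral>\<^sup>+x. k x * 1 \<partial>m)" by (intro nn_integral_mono mult_left_mono X.H_le_const[OF D(1)]) simp_all
  finally show ?thesis using mass_finite by (simp add: le_less_trans)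
 qed
 \<comment> \<open>Since u vanishes on V - D, only exits to the complement of V count; the test sets
   may then stay off V, as in \<open>L_compact\<close>.\<close>
 have HV: "X.H l D (\<lambda>x. indicator (- V) x * u x) x = X.H l D u x" for l x
  by (rule X.H_cong[OF D(1)]) (use u0 in \<open>auto simp: indicator_def\<close>)
 have "\<forall>\<^sub>F n in sequentially. L (1 / real (Suc n)) (\<lambda>x. indicator (- V) x * u x)
   \<le> (\<integral>\<^sup>+x. indicator (- V) x * u x \<partial>\<Theta>) + ennreal e"
 proof (rule limit_domination[OF \<kappa>(1) sets_Theta fin L_add L_cmult _ _ L_compact u _ e])
  show "L (1 / real (Suc n)) f \<le> (\<integral>\<^sup>+x. f x \<partial>\<kappa>)" if f: "f \<in> borel_fun" for n f
   using L_le[OF _ f, of "1 / real (Suc n)"] \<kappa>(2)[OF f] by simp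
  have "(\<integral>\<^sup>+x. indicator (- V) x * u x \<partial>\<kappa>) = ?T (\<lambda>x. indicator (- V) x * u x)" by (rule \<kappa>(2)[symmetric]) measurable
  also have "\<dots> = (\<integral>\<^sup>+x. k x * u x \<partial>m)"
  proof (rule nn_integral_cong)
   fix x show "k x * X.H 0 D (\<lambda>x. indicator (- V) x * u x) x = k x * u x"
    unfolding HV using harm[of x] kSD[of x] by (cases "x \<in> D") auto
  qed
  finally show "(\<integral>\<^sup>+x. indicator (- V) x * u x \<partial>\<kappa>) < \<top>" using ku by simp
 qed simp_all
 then obtain n where n: "L (1 / real (Suc n)) (\<lambda>x. indicator (- V) x * u x) \<le> (\<integral>\<^sup>+x. indicator (- V) x * u x \<partial>\<Theta>) + ennreal e"
  by (auto dest: eventually_happens)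
 let ?e = "1 / real (Suc n)"
 have \<epsilon>: "0 < ?e" by simp
 have M: "0 < \<delta>/?e" using \<delta> by simp
 have [measurable]: "w k ?e \<in> borel_fun" by (rule w_measurable[OF k kB kS \<epsilon>])
 have H1: "X.H (\<delta>/?e) D (\<lambda>x. indicator (- V) x * u x) = X.H (\<delta>/?e) D u" by (rule ext) (rule HV)
 have [measurable]: "X.FKsum (\<delta>/?e) (\<psi> ?e) D (X.R (\<delta>/?e) D f) \<in> borel_fun"
  if "f \<in> borel_fun" for f by (rule X.FKsum_measurable[OF psi_measurable X.R_measurable[OF that]])
 let ?Q = "X.FKsum (\<delta>/?e) (\<psi> ?e) D (X.R (\<delta>/?e) D (\<lambda>y. ennreal (\<psi> ?e y) * u y))"
 have "(\<integral>\<^sup>+x. k x * u x \<partial>m) \<le> (\<integral>\<^sup>+x. k x * X.FKsum (\<delta>/?e) (\<psi> ?e) D (X.H (\<delta>/?e) D u) x + k x * ?Q x \<partial>m)"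
 proof (rule nn_integral_mono)
  fix x
  show "k x * u x \<le> k x * X.FKsum (\<delta>/?e) (\<psi> ?e) D (X.H (\<delta>/?e) D u) x + k x * ?Q x"
  proof (cases "x \<in> D")
   case True
   have "X.R 0 D (\<lambda>_. 1) x \<le> X.R 0 V (\<lambda>_. 1) x" by (rule X.R_mono_set[OF V(1) D]) simp
   also have "\<dots> \<le> ennreal \<tau>" by (rule \<tau>)
   finally have "X.R 0 D (\<lambda>_. 1) x < \<top>" by (rule le_less_trans) simp
   then have "u x \<le> X.FKsum (\<delta>/?e) (\<psi> ?e) D (X.H (\<delta>/?e) D u) x + ?Q x"
    using harm by (intro X.harmonic_FK[OF M psi_measurable psi_nonneg[OF \<epsilon>] psi_le[OF \<epsilon>] u D(1) _ True])
   then have "k x * u x \<le> k x * (X.FKsum (\<delta>/?e) (\<psi> ?e) D (X.H (\<delta>/?e) D u) x + ?Q x)"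
    by (rule mult_left_mono) (rule zero_le)
   then show ?thesis by (simp only: distrib_left)
  qed (simp add: kSD)
 qed
 also have "\<dots> = L ?e u + (\<integral>\<^sup>+x. k x * ?Q x \<partial>m)"
  unfolding L_def by (rule nn_integral_add) measurable
 also have "L ?e u = L ?e (\<lambda>x. indicator (- V) x * u x)" unfolding L_def H1 ..
 also have "L ?e (\<lambda>x. indicator (- V) x * u x) + (\<integral>\<^sup>+x. k x * ?Q x \<partial>m)
   \<le> ((\<integral>\<^sup>+x. indicator (- V) x * u x \<partial>\<Theta>) + ennreal e) + ennreal (C * \<delta>) * mass k * (\<integral>\<^sup>+x. indicator (V - P) x * u x \<partial>m)"
 proof (rule add_mono[OF n])
  have "(\<integral>\<^sup>+x. k x * ?Q x \<partial>m) \<le> (\<integral>\<^sup>+x. w k ?e x * (ennreal (\<psi> ?e x) * u x) \<partial>m)"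
   by (rule FKsum_dual_le[OF \<epsilon>]) measurable
  also have "\<dots> \<le> (\<integral>\<^sup>+x. (ennreal (C * \<delta>) * mass k) * (indicator (V - P) x * u x) \<partial>m)"
  proof (rule nn_integral_mono)
   fix x
   consider "x \<notin> V" | "x \<in> P" | "x \<in> V - P" by blast
   then show "w k ?e x * (ennreal (\<psi> ?e x) * u x) \<le> (ennreal (C * \<delta>) * mass k) * (indicator (V - P) x * u x)"
   proof cases
    case 1 then show ?thesis using w_outside[OF k kB kS \<epsilon> 1] by simp
   next
    case 2 then have "\<psi> ?e x = 0" using PN by (intro psi_zero) auto
    then show ?thesis by simp
   next
    case 3
    have "w k ?e x * (ennreal (\<psi> ?e x) * u x) \<le> (ennreal C * mass k * ennreal (\<phi> x + ?e)) * (ennreal (\<psi> ?e x) * u x)"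
     by (intro mult_right_mono w_barrier[OF k kB kS \<epsilon> 3]) simp
    also have "\<dots> = (ennreal C * mass k) * (ennreal (\<psi> ?e x) * ennreal (\<phi> x + ?e)) * u x" by (simp only: mult_ac)
    also have "\<dots> \<le> (ennreal C * mass k) * ennreal \<delta> * u x"
    proof (intro mult_right_mono mult_left_mono)
     have "ennreal (\<psi> ?e x) * ennreal (\<phi> x + ?e) = ennreal (\<psi> ?e x * (\<phi> x + ?e))"
      using psi_nonneg[OF \<epsilon>] by (rule ennreal_mult'[symmetric])
     also have "\<dots> \<le> ennreal \<delta>" by (rule ennreal_leI[OF psi_phi[OF \<epsilon>]])
     finally show "ennreal (\<psi> ?e x) * ennreal (\<phi> x + ?e) \<le> ennreal \<delta>" .
    qed simp_all
    also have "\<dots> = (ennreal (C * \<delta>) * mass k) * (indicator (V - P) x * u x)"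
     using 3 C_nonneg \<delta>(1) by (simp add: ennreal_mult mult_ac)
    finally show ?thesis .
   qed
  qed
  also have "\<dots> = ennreal (C * \<delta>) * mass k * (\<integral>\<^sup>+x. indicator (V - P) x * u x \<partial>m)" by (rule nn_integral_cmult) measurable
  finally show "(\<integral>\<^sup>+x. k x * ?Q x \<partial>m) \<le> ennreal (C * \<delta>) * mass k * (\<integral>\<^sup>+x. indicator (V - P) x * u x \<partial>m)" .
 qed
 also have "(\<integral>\<^sup>+x. indicator (- V) x * u x \<partial>\<Theta>) = ennreal (c * \<tau>) * mass k * (\<integral>\<^sup>+x. ennreal (j z0 x) * (indicator (- V) x * u x) \<partial>m)"
  by (rule integral_Theta) measurable
 finally show "(\<integral>\<^sup>+x. k x * u x \<partial>m) \<le> mass k * (ennreal (C * \<delta>) * (\<integral>\<^sup>+x. indicator (V - P) x * u x \<partial>m)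
  + ennreal (c * \<tau>) * (\<integral>\<^sup>+x. indicator (- V) x * (ennreal (j z0 x) * u x) \<partial>m)) + ennreal e"
  by (simp add: distrib_left ac_simps)
qed

end

text \<open>Indicators as weights give the bound off a null set only; resolvents do not charge null sets,
 and \<open>n R\<^sub>n u\<close> with the \<open>n\<close>-resolvent recovers \<open>u\<close> in the limit.\<close>

lemma pointwise_bound:
 assumes D: "open D" "D \<subseteq> V"
  and u [measurable]: "u \<in> borel_fun" and harm: "\<And>x. x \<in> D \<Longrightarrow> u x = X.H 0 D u x"
  and u0: "\<And>x. x \<in> V - D \<Longrightarrow> u x = 0" and ufin: "\<And>x. u x < \<top>" and x: "x \<in> D \<inter> S"
 shows "u x \<le> ennreal (C * \<delta>) * (\<integral>\<^sup>+x. indicator (V - P) x * u x \<partial>m)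
  + ennreal (c * \<tau>) * (\<integral>\<^sup>+x. indicator (- V) x * (ennreal (j z0 x) * u x) \<partial>m)" (is "_ \<le> ?T")
proof (cases "?T = \<top>")
 case False
 then obtain t where t: "?T = ennreal t" "0 \<le> t" by (cases ?T) auto
 have [measurable]: "D \<in> sets borel" "S \<in> sets borel" using D S by auto
 \<comment> \<open>Points where the bound fails by a margin, with u capped at n so that its integral
   against the indicator is finite, as \<open>weighted_bound\<close> requires.\<close>
 define A where "A n = {x \<in> D \<inter> S. ennreal (t + 1 / real (Suc n)) \<le> u x \<and> u x \<le> of_nat n}" for n
 have A [measurable]: "A n \<in> sets borel" for n
 proof -
  have "A n = (D \<inter> S) \<inter> {x. ennreal (t + 1 / real (Suc n)) \<le> u x} \<inter> {x. u x \<le> of_nat n}" by (auto simp: A_def)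
  also have "\<dots> \<in> sets borel" by measurable
  finally show ?thesis .
 qed
 have SV: "S \<subseteq> V" using S PN by blast
 have mAV: "emeasure m (A n) \<le> emeasure m V" for n using SV V by (intro emeasure_mono) (auto simp: A_def)
 have mA: "emeasure m (A n) < \<top>" for n using mAV V(2) by (rule le_less_trans)
 have Anull: "emeasure m (A n) = 0" for n
 proof -
  let ?k = "indicator (A n) :: 'a \<Rightarrow> ennreal"
  have km: "?k \<in> borel_fun" by measurable
  have mk: "(\<integral>\<^sup>+x. ?k x \<partial>m) = emeasure m (A n)" by simp
  have "(\<integral>\<^sup>+x. ?k x * u x \<partial>m) \<le> (\<integral>\<^sup>+x. of_nat n * ?k x \<partial>m)"
   by (rule nn_integral_mono) (auto simp: A_def indicator_def)
  also have "\<dots> = of_nat n * emeasure m (A n)" by (rule nn_integral_cmult_indicator) simp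
  also have "\<dots> < \<top>" using mA by (simp add: ennreal_mult_less_top of_nat_less_top)
  finally have ku: "(\<integral>\<^sup>+x. ?k x * u x \<partial>m) < \<top>" .
  have "emeasure m (A n) * ennreal (t + 1 / real (Suc n)) = (\<integral>\<^sup>+x. ennreal (t + 1 / real (Suc n)) * ?k x \<partial>m)"
   by (subst nn_integral_cmult_indicator) (simp_all add: mult.commute)
  also have "\<dots> \<le> (\<integral>\<^sup>+x. ?k x * u x \<partial>m)"
   by (rule nn_integral_mono) (auto simp: A_def indicator_def)
  also have "\<dots> \<le> (\<integral>\<^sup>+x. ?k x \<partial>m) * ?T"
  proof (rule weighted_bound[OF km _ _ D u _ u0 ufin ku])
   show "?k x \<le> ennreal 1" for x by (simp add: indicator_def)
   show "?k x = 0" if "x \<notin> S \<inter> D" for x using that by (auto simp: A_def indicator_def)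
   show "u x = X.H 0 D u x" if "x \<in> D" for x using that by (rule harm)
  qed
  finally have le: "emeasure m (A n) * ennreal (t + 1 / real (Suc n)) \<le> emeasure m (A n) * ennreal t" unfolding t mk .
  obtain a where a: "emeasure m (A n) = ennreal a" "0 \<le> a" using mA[of n] by (cases "emeasure m (A n)") auto
  have "a * (t + 1 / real (Suc n)) \<le> a * t"
   using le a t(2) by (simp add: ennreal_mult[symmetric] ennreal_le_iff mult_nonneg_nonneg del: ennreal_plus)
  then have "a * (1 / real (Suc n)) \<le> 0" by (simp add: distrib_left)
  then have "a = 0" using a(2) by (simp add: divide_le_0_iff mult_le_0_iff)
  then show ?thesis using a by simp
 qed
 define Nul where "Nul = (\<Union>n. A n)"
 have Nul [measurable]: "Nul \<in> sets borel" unfolding Nul_def by measurable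
 have Nul0: "Nul \<in> null_sets m" unfolding Nul_def using Anull by (intro null_sets_UN) (auto intro: null_setsI)
 let ?D' = "D \<inter> S"
 have D': "open ?D'" "?D' \<subseteq> D" using D S by auto
 have good: "u y \<le> ennreal t" if y: "y \<in> ?D'" "y \<notin> Nul" for y
 proof (rule ccontr)
  assume "\<not> u y \<le> ennreal t"
  obtain s where s: "u y = ennreal s" "0 \<le> s" using ufin[of y] by (cases "u y") auto
  have "t < s" using \<open>\<not> u y \<le> ennreal t\<close> ennreal_leI[of s t] unfolding s by (simp only: not_le[symmetric]) blast
  have "\<forall>\<^sub>F n in sequentially. t + 1 / real (Suc n) < s"
  proof (rule order_tendstoD(2))
   show "(\<lambda>n. t + 1 / real (Suc n)) \<longlonglongrightarrow> t" by real_asymp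
  qed fact
  moreover have "\<forall>\<^sub>F n in sequentially. s < real n"
   by (rule filterlim_at_top_dense[THEN iffD1, rule_format, OF filterlim_real_sequentially])
  ultimately have "\<forall>\<^sub>F n in sequentially. t + 1 / real (Suc n) < s \<and> s < real n" by (rule eventually_conj)
  then obtain n where "t + 1 / real (Suc n) < s" "s < real n" by (auto dest: eventually_happens)
  then have "y \<in> A n" using y(1) s by (auto simp: A_def ennreal_of_nat_eq_real_of_nat intro!: ennreal_leI)
  then show False using y(2) by (auto simp: Nul_def)
 qed
 have uH: "u y = X.H 0 D u y" for y using harm[of y] by (cases "y \<in> D") (simp_all add: X.H_outside)
 have H_eq: "X.H 0 D u = u" using uH by auto
 \<comment> \<open>The almost everywhere bound is known on \<open>D \<inter> S\<close> only, so u is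
   regarded as harmonic there.\<close>
 have uH': "u y = X.H 0 ?D' u y" for y using X.H_decompose[OF D(1) D' u, of 0 y] unfolding H_eq .
 then have H_eq': "X.H 0 ?D' u = u" by auto
 have "u x \<le> X.H (real n) ?D' u x + ennreal t" for n
 proof -
  have "u x = X.H (real n) ?D' u x + ennreal (real n) * X.R (real n) ?D' u x"
   using X.H_resolvent[OF u, of 0 "real n" ?D' x] unfolding H_eq' by simp
  also have "X.R (real n) ?D' u x \<le> X.R (real n) ?D' (\<lambda>y. ennreal t * 1 + \<top> * indicator Nul y) x"
   by (rule X.R_mono) (use good in \<open>auto simp: indicator_def\<close>)
  also have "\<dots> = X.R (real n) ?D' (\<lambda>y. ennreal t * 1) x + X.R (real n) ?D' (\<lambda>y. \<top> * indicator Nul y) x"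
   by (rule X.R_add) measurable
  also have "X.R (real n) ?D' (\<lambda>y. ennreal t * 1) x = ennreal t * X.R (real n) ?D' (\<lambda>y. 1) x"
   by (rule X.R_cmult) measurable
  \<comment> \<open>On the null set u was replaced by \<open>\<top>\<close>. The resolvent has a
    density with respect to m, and \<open>\<top> * 0\<close> is 0.\<close>
  also have "X.R (real n) ?D' (\<lambda>y. \<top> * indicator Nul y) x = 0"
  proof -
   have "X.R (real n) ?D' (indicator Nul) x \<le> X.R 0 ?D' (indicator Nul) x" by (rule X.R_antimono) auto
   also have "\<dots> = (\<integral>\<^sup>+y. indicator ?D' y * (indicator Nul y * G ?D' x y) \<partial>m)"
    by (rule R_green[OF D'(1)]) (use x in auto)
   also have "\<dots> = (\<integral>\<^sup>+y. 0 \<partial>m)"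
   proof (rule nn_integral_cong_AE)
    show "AE y in m. indicator ?D' y * (indicator Nul y * G ?D' x y) = 0"
     using AE_not_in[OF Nul0] by eventually_elim (simp add: indicator_def)
   qed
   finally have "X.R (real n) ?D' (indicator Nul) x = 0" by simp
   moreover have "X.R (real n) ?D' (\<lambda>y. \<top> * indicator Nul y) x = \<top> * X.R (real n) ?D' (indicator Nul) x"
    by (rule X.R_cmult) measurable
   ultimately show ?thesis by simp
  qed
  finally have "u x \<le> X.H (real n) ?D' u x + ennreal (real n) * (ennreal t * X.R (real n) ?D' (\<lambda>y. 1) x)"
   by (simp add: add_left_mono mult_left_mono)
  also have "ennreal (real n) * (ennreal t * X.R (real n) ?D' (\<lambda>y. 1) x) \<le> ennreal t * 1"
  proof (cases "n = 0")
   case False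
   have "ennreal (real n) * X.R (real n) ?D' (\<lambda>y. 1) x \<le> 1"
    using X.R_H_one[OF D'(1), of "real n" x] False by (meson add_increasing2 dual_order.trans le_iff_add of_nat_0_less_iff neq0_conv)
   then have "ennreal t * (ennreal (real n) * X.R (real n) ?D' (\<lambda>y. 1) x) \<le> ennreal t * 1" by (rule mult_left_mono) simp
   then show ?thesis by (simp add: mult.left_commute)
  qed simp
  finally show ?thesis by (simp add: add_left_mono)
 qed
 moreover have "(\<lambda>n. X.H (real n) ?D' u x + ennreal t) \<longlonglongrightarrow> 0 + ennreal t"
  by (intro tendsto_intros X.H_tendsto_0[OF D'(1) x u]) (use ufin uH' in metis)
 ultimately have "u x \<le> ennreal t" by (intro LIMSEQ_le_const) auto
 then show ?thesis unfolding t .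
next
 case True
 show ?thesis unfolding True by (rule top_greatest)
qed

end

section \<open>Estimates around the point\<close>

context hunt begin

text \<open>A path that starts in the open set D stays there for a time interval of positive
  length.\<close>

lemma R_pos:
 assumes D: "open D" and x: "x \<in> D" and h [measurable]: "h \<in> borel_fun" and pos: "\<And>y. y \<in> D \<Longrightarrow> 0 < h y"
 shows "0 < R 0 D h x"
proof (rule ccontr)
 assume "\<not> 0 < R 0 D h x"
 then have "(\<integral>\<^sup>+w. res_path 0 D h w \<partial>Pr (Some x)) = 0" by (simp add: R_def)
 moreover have "res_path 0 D h \<in> borel_measurable (Pr (Some x))" using res_path_measurable[OF h] by simp
 ultimately have "AE w in Pr (Some x). res_path 0 D h w = 0" by (subst (asm) nn_integral_0_iff_AE) auto
 moreover have "AE w in Pr (Some x). res_path 0 D h w \<noteq> 0" using AE_start[of "Some x"] AE_space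
 proof eventually_elim
  case (elim w)
  then have w: "w \<in> Om" "St 0 w = Some x" by auto
  have lp: "0 < leave D w" by (rule leave_pos[OF D w(1)]) (use w x in auto)
  define b where "b = enn2real (min 1 (leave D w))"
  have eb: "ennreal b = min 1 (leave D w)" unfolding b_def by (rule ennreal_enn2real) (simp add: min_less_iff_disj)
  have "0 < ennreal b" unfolding eb using lp by simp
  then have b: "0 < b" by simp
  show "res_path 0 D h w \<noteq> 0"
  proof
   assume 0: "res_path 0 D h w = 0"
   have "AE t in lborel. res_density 0 D h w t = 0"
    using 0 res_density_path_measurable[OF h w(1), of 0 D] unfolding res_path_def
    by (subst (asm) nn_integral_0_iff_AE) auto
   moreover have "AE t in lborel. t \<in> {0<..<b} \<longrightarrow> res_density 0 D h w t \<noteq> 0"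
   proof (rule AE_I2, rule impI)
    fix t assume t: "t \<in> {0<..<b}"
    then have "ennreal t < ennreal b" by (simp add: ennreal_lessI)
    then have tl: "ennreal t < leave D w" unfolding eb by simp
    obtain y where "y \<in> D" "St (ennreal t) w = Some y" using before_leave[OF tl] by auto
    then show "res_density 0 D h w t \<noteq> 0" using tl t pos[of y] by (simp add: res_density_def ext0_def)
   qed
   ultimately have "AE t in lborel. t \<notin> {0<..<b}" by eventually_elim auto
   then have "{0<..<b} \<in> null_sets lborel" by (subst AE_iff_null_sets) auto
   then show False using b by (simp add: null_sets_def)
  qed
 qed
 ultimately have "AE w in Pr (Some x). False" by eventually_elim simp
 then show False using prob_space.AE_False[OF prob_space_Pr, of "Some x"] by simp
qed

end

context hunt_levy begin

text \<open>Jumps from V into B occur at rate at least \<kappa>, whereas by \<open>jump_law\<close>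
  the rate integrated up to the exit is a probability.\<close>

lemma exit_time_bound:
 assumes V: "open V" and B: "B \<in> sets borel" "B \<inter> closure V = {}"
  and \<kappa>: "0 < \<kappa>" "\<And>y. y \<in> V \<Longrightarrow> ennreal \<kappa> \<le> emeasure (J y) B"
 shows "R 0 V (\<lambda>_. 1) x \<le> ennreal (1 / \<kappa>)"
proof (cases "x \<in> V")
 case True
 have "ennreal \<kappa> * R 0 V (\<lambda>_. 1) x = R 0 V (\<lambda>_. ennreal \<kappa> * 1) x" by (rule R_cmult[symmetric]) simp
 also have "\<dots> \<le> R 0 V (\<lambda>y. \<integral>\<^sup>+z. indicator B z \<partial>J y) x"
  by (rule R_mono) (use \<kappa> B in simp)
 also have "\<dots> = H 0 V (indicator B) x"
  by (rule jump_law[OF V True, symmetric]) (use B in \<open>auto simp: indicator_def\<close>)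
 also have "\<dots> \<le> 1" by (rule H_le_const[OF V]) (auto simp: indicator_def)
 finally have "ennreal (1 / \<kappa>) * (ennreal \<kappa> * R 0 V (\<lambda>_. 1) x) \<le> ennreal (1 / \<kappa>) * 1" by (rule mult_left_mono) simp
 then show ?thesis using \<kappa>(1) by (simp add: mult.assoc[symmetric] ennreal_mult[symmetric])
qed (simp add: R_outside)

end

lemma doubling_iterate:
 fixes f :: "real \<Rightarrow> real"
 assumes c: "1 < c" "\<And>r. 0 < r \<Longrightarrow> f (2 * r) \<le> c * f r" and mono: "\<And>a b. 0 < a \<Longrightarrow> a \<le> b \<Longrightarrow> f a \<le> f b"
  and A: "0 < A"
 shows "\<exists>K>0. \<forall>r>0. f (A * r) \<le> K * f r"
proof -
 obtain n :: nat where n: "A < 2 ^ n" using real_arch_pow[of 2 A] by auto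
 have it: "f (2 ^ n * r) \<le> c ^ n * f r" if "0 < r" for r
 proof (induction n)
  case (Suc n)
  have "f (2 ^ Suc n * r) = f (2 * (2 ^ n * r))" by (simp add: mult.assoc)
  also have "\<dots> \<le> c * f (2 ^ n * r)" by (rule c(2)) (use that in simp)
  also have "\<dots> \<le> c * (c ^ n * f r)" by (rule mult_left_mono[OF Suc]) (use c in simp)
  finally show ?case by (simp add: mult.assoc)
 qed simp
 have "f (A * r) \<le> c ^ n * f r" if "0 < r" for r
  using mono[of "A * r" "2 ^ n * r"] it[OF that] n that A by (meson less_imp_le mult_pos_pos mult_right_mono order_trans)
 then show ?thesis using c(1) by (intro exI[of _ "c ^ n"]) auto
qed

context dual_pair begin

text \<open>Irreducibility from the positivity of j: from a small ball around x, jumps into a small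
  ball inside F have positive rate.\<close>

lemma occupation_pos:
 assumes V: "open V" "x \<in> V" and F: "open F" "F \<noteq> {}" "F \<subseteq> V"
 shows "0 < X.R 0 V (indicator F) x"
proof -
 have Fm [measurable]: "F \<in> sets borel" using F by simp
 have im: "(indicator F :: 'a \<Rightarrow> ennreal) \<in> borel_fun" by measurable
 have inF: "0 < X.R 0 V (indicator F) y" if y: "y \<in> F" for y
 proof -
  have "0 < X.R 0 F (\<lambda>_. 1) y" by (rule X.R_pos[OF F(1) y]) auto
  also have "\<dots> = X.R 0 F (indicator F) y" by (rule X.R_cong) simp
  also have "\<dots> \<le> X.R 0 V (indicator F) y" by (rule X.R_mono_set[OF V(1) F(1,3) im])
  finally show ?thesis .
 qed
 show ?thesis
 proof (cases "x \<in> F")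
  case False
  obtain y0 where y0: "y0 \<in> F" using F by blast
  obtain a where a: "0 < a" "ball x a \<subseteq> V" using V openE by blast
  obtain b where b: "0 < b" "ball y0 b \<subseteq> F" using y0 F(1) openE by blast
  \<comment> \<open>A third of the distance keeps the closure of U disjoint from W, as
    \<open>jump_law\<close> demands.\<close>
  define \<rho> where "\<rho> = min (min a b) (dist x y0 / 3)"
  have \<rho>: "0 < \<rho>" "\<rho> \<le> a" "\<rho> \<le> b" "\<rho> \<le> dist x y0 / 3" using a b False y0 by (auto simp: \<rho>_def)
  define U where "U = ball x \<rho>"
  define W where "W = ball y0 \<rho>"
  have UV: "U \<subseteq> V" using a \<rho> by (auto simp: U_def)
  have WF: "W \<subseteq> F" using b \<rho> by (auto simp: W_def)
  have U: "open U" "x \<in> U" and Wm [measurable]: "W \<in> sets borel" using \<rho> by (auto simp: U_def W_def)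
  have disj: "z \<notin> W" if "z \<in> closure U" for z
  proof -
   have "dist x z \<le> \<rho>" using that closure_minimal[OF ball_subset_cball closed_cball, of x \<rho>] by (auto simp: U_def)
   then show ?thesis using \<rho> dist_triangle[of x y0 z] by (auto simp: W_def dist_commute)
  qed
  let ?g = "\<lambda>z. indicator W z * X.R 0 V (indicator F) z"
  have gR [measurable]: "X.R 0 V (indicator F) \<in> borel_fun" by (rule X.R_measurable[OF im])
  let ?h = "\<lambda>y. \<integral>\<^sup>+z. ?g z \<partial>density m (\<lambda>z. ennreal (j y z))"
  have "0 < X.R 0 U ?h x"
  proof (rule X.R_pos[OF U])
   show "?h \<in> borel_fun" by (rule X.J_measurable) measurable
   fix y assume y: "y \<in> U"
   have [measurable]: "j y \<in> borel_fun" by (rule jump_measurable)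
   have eq: "?h y = (\<integral>\<^sup>+z. ennreal (j y z) * ?g z \<partial>m)" by (rule nn_integral_density) measurable
   have "?h y \<noteq> 0"
   proof
    assume "?h y = 0"
    then have "AE z in m. ennreal (j y z) * ?g z = 0" unfolding eq by (subst (asm) nn_integral_0_iff_AE) auto
    moreover have "AE z in m. z \<in> W \<longrightarrow> ennreal (j y z) * ?g z \<noteq> 0"
    proof (rule AE_I2, rule impI)
     fix z assume z: "z \<in> W"
     have "y \<noteq> z" using disj[OF subsetD[OF closure_subset y]] z by blast
     then have "0 < j y z" by (rule jump_pos)
     moreover have "0 < X.R 0 V (indicator F) z" using WF z by (intro inF) auto
     ultimately show "ennreal (j y z) * ?g z \<noteq> 0" using z by simp
    qed
    ultimately have "AE z in m. z \<notin> W" by eventually_elim auto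
    then have "emeasure m W = 0" by (subst (asm) AE_iff_measurable[OF _ refl]) auto
    moreover have "0 < emeasure m W" using reference \<rho>(1) by (auto simp: reference_measure_def W_def)
    ultimately show False by simp
   qed
   then show "0 < ?h y" by (simp add: zero_less_iff_neq_zero)
  qed
  also have "X.R 0 U ?h x = X.H 0 U ?g x"
   by (rule X.jump_law[OF U, symmetric]) (use disj in \<open>auto simp: indicator_def\<close>)
  also have "\<dots> \<le> X.H 0 U (X.R 0 V (indicator F)) x"
   by (rule X.H_mono[OF U(1)]) (auto simp: indicator_def)
  also have "\<dots> \<le> X.R 0 V (indicator F) x"
   unfolding X.R_decompose[OF V(1) U(1) UV im, of 0 x] by simp
  finally show ?thesis .
 qed (rule inF)
qed

end

locale regular_point = dual_pair m X Xd j jd \<D> G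
 for m :: "'a::heine_borel measure" and X :: "('a, 'w) process" and Xd :: "('a, 'v) process"
  and j jd :: "'a \<Rightarrow> 'a \<Rightarrow> real" and \<D> :: "('a \<Rightarrow> real) set" and G :: "'a set \<Rightarrow> 'a \<Rightarrow> 'a \<Rightarrow> ennreal" +
 fixes \<Phi> :: "real \<Rightarrow> real" and z0 :: 'a and r0 :: ereal and n0 :: nat
 assumes sf: "strongly_feller X" and semipolar_polar: "\<And>A. semipolar X A \<Longrightarrow> polar X A"
  and r0: "0 < r0"
  and V1: "assumption_V1 m z0" and V2: "assumption_V2' m z0 r0 n0" and Phi: "assumption_Phi' \<Phi>"
  and B1a: "assumption_B1a m X Xd \<D> \<Phi> z0 r0" and B1c: "assumption_B1c m X Xd \<D> \<Phi> z0 r0"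
  and C1: "assumption_C1 m j jd \<Phi> z0 r0" and D1: "assumption_D1 m G \<Phi> z0 r0"
begin

section \<open>Volumes, scale function and the assumptions in real form\<close>

lemma n0: "2 \<le> n0" using V2 by (simp add: assumption_V2'_def)

lemma vol_pos: "0 < r \<Longrightarrow> 0 < vol m z0 r"
 using reference by (auto simp: reference_measure_def vol_def)

lemma vol_mono: "a \<le> b \<Longrightarrow> vol m z0 a \<le> vol m z0 b"
 unfolding vol_def by (intro emeasure_mono) auto

lemma singleton_finite: "emeasure m {z0} < \<top>"
proof -
 obtain A :: "nat \<Rightarrow> 'a set" where A: "range A \<subseteq> sets m" "(\<Union>i. A i) = space m" "\<And>i. emeasure m (A i) \<noteq> \<infinity>"
  using m.sigma_finite by blast
 have "z0 \<in> (\<Union>i. A i)" unfolding A(2) by simp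
 then obtain i where "z0 \<in> A i" by blast
 then have "emeasure m {z0} \<le> emeasure m (A i)" using A by (intro emeasure_mono) auto
 then show ?thesis using A(3)[of i] by (simp add: less_top le_less_trans)
qed

lemma radius_between: "\<exists>r>0. ereal r < r0" using ereal_dense2[OF r0] by auto

text \<open>If all these annuli were empty, z0 would be isolated; a ball and the ball n0 times
  smaller would both be the singleton, whose volume is positive and finite, and the growth in (V2')
  forbids this.\<close>

lemma annulus_nonempty: "\<exists>r>0. ereal r < r0 \<and> annulus z0 (11/20 * r) r \<noteq> {}"
proof (rule ccontr)
 assume none: "\<not> ?thesis"
 obtain r where r: "0 < r" "ereal r < r0" using radius_between by auto
 have single: "ball z0 r = {z0}"
 proof (intro equalityI subsetI)
  fix y assume y: "y \<in> ball z0 r"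
  show "y \<in> {z0}"
  proof (rule ccontr)
   assume "y \<notin> {z0}"
   then have d: "0 < dist z0 y" by auto
   \<comment> \<open>The factor 4/3 puts y inside the annulus of scale s, because 11/20 times 4/3 is
     11/15, which is below 1.\<close>
   define s where "s = min r (4/3 * dist z0 y)"
   have s: "0 < s" "s \<le> r" "11/20 * s < dist z0 y" "dist z0 y < s"
   proof -
    have "s \<le> 4/3 * dist z0 y" unfolding s_def by simp
    then show "11/20 * s < dist z0 y" using d by linarith
   qed (use d y r(1) in \<open>auto simp: s_def\<close>)
   have "ereal s \<le> ereal r" using s(2) by simp
   then have "ereal s < r0" using r(2) by (rule le_less_trans)
   moreover have "y \<in> annulus z0 (11/20 * s) s" using s by (simp add: annulus_def)
   ultimately show False using none s(1) by blast
  qed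
 qed (use r in auto)
 obtain c where c: "1 < c" "\<And>s. 0 < s \<Longrightarrow> ereal s \<le> r0 \<Longrightarrow> ennreal c * vol m z0 s \<le> vol m z0 (real n0 * s)"
  using V2 by (auto simp: assumption_V2'_def)
 define s where "s = r / real n0"
 have n: "1 \<le> real n0" "0 < real n0" using n0 by auto
 have s: "0 < s" "s \<le> r" "real n0 * s = r" using r(1) n by (auto simp: s_def field_simps)
 have "ball z0 s = {z0}" using subset_ball[OF s(2), of z0] s(1) unfolding single by auto
 have "ereal s \<le> ereal r" using s(2) by simp
 then have "ereal s \<le> r0" by (rule order_trans[OF _ less_imp_le[OF r(2)]])
 from c(2)[OF s(1) this] have le: "ennreal c * emeasure m {z0} \<le> emeasure m {z0}"
  unfolding s(3) vol_def single \<open>ball z0 s = {z0}\<close> .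
 obtain a where a: "emeasure m {z0} = ennreal a" "0 \<le> a" using singleton_finite by (cases "emeasure m {z0}") auto
 have "0 < a" using vol_pos[OF r(1)] unfolding vol_def single a by simp
 moreover have "c * a \<le> a" using le a c(1) by (simp add: ennreal_mult[symmetric] ennreal_le_iff)
 ultimately show False using c(1) by simp
qed

lemma green_ratio_bound:
 "\<exists>c>0. \<forall>r>0. ereal r < r0 \<longrightarrow> (\<forall>x y. 11/20 * r < dist z0 x \<longrightarrow> dist z0 x < r \<longrightarrow> dist z0 y < r / 2 \<longrightarrow>
   max (G (ball z0 r) x y) (G (ball z0 r) y x) \<le> ennreal c * (ennreal (\<Phi> r) / vol m z0 r))"
proof -
 have "(11/20::real) \<in> {1/2<..<1}" by simp
 with D1 obtain c where c: "0 < c" "\<And>r. 0 < r \<Longrightarrow> ereal r < r0 \<Longrightarrow>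
   (SUP x\<in>closure (annulus z0 (11/20 * r) r). SUP y\<in>ball z0 (r / 2). max (G (ball z0 r) x y) (G (ball z0 r) y x))
    \<le> ennreal c * (ennreal (\<Phi> r) / vol m z0 r)" unfolding assumption_D1_def by blast
 show ?thesis
 proof (intro exI[of _ c] conjI allI impI c(1))
  fix r x y assume r: "0 < r" "ereal r < r0" and xy: "11/20 * r < dist z0 x" "dist z0 x < r" "dist z0 y < r / 2"
  have "max (G (ball z0 r) x y) (G (ball z0 r) y x) \<le> (SUP y\<in>ball z0 (r / 2). max (G (ball z0 r) x y) (G (ball z0 r) y x))"
   by (rule SUP_upper) (use xy in simp)
  also have "\<dots> \<le> (SUP x\<in>closure (annulus z0 (11/20 * r) r). SUP y\<in>ball z0 (r / 2). max (G (ball z0 r) x y) (G (ball z0 r) y x))"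
   by (rule SUP_upper, rule subsetD[OF closure_subset]) (use xy in \<open>simp add: annulus_def\<close>)
  also have "\<dots> \<le> ennreal c * (ennreal (\<Phi> r) / vol m z0 r)" by (rule c(2)[OF r])
  finally show "max (G (ball z0 r) x y) (G (ball z0 r) y x) \<le> ennreal c * (ennreal (\<Phi> r) / vol m z0 r)" .
 qed
qed

text \<open>If either property failed, the bound in (D1) would be 0 by the conventions of
  \<open>ennreal\<close> division. The Green function from x would then vanish on the inner ball,
  contrary to \<open>occupation_pos\<close>.\<close>

lemma green_bound_nonzero:
 assumes r: "0 < r" "ereal r < r0" and ne: "annulus z0 (11/20 * r) r \<noteq> {}"
 shows "\<Phi> r \<noteq> 0" and "vol m z0 r < \<top>"
proof -
 obtain c where c: "\<And>x y. 11/20 * r < dist z0 x \<Longrightarrow> dist z0 x < r \<Longrightarrow> dist z0 y < r / 2 \<Longrightarrow>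
   max (G (ball z0 r) x y) (G (ball z0 r) y x) \<le> ennreal c * (ennreal (\<Phi> r) / vol m z0 r)"
  using green_ratio_bound r by metis
 obtain x where x: "11/20 * r < dist z0 x" "dist z0 x < r" using ne by (auto simp: annulus_def)
 then have xV: "x \<in> ball z0 r" by simp
 have "ennreal (\<Phi> r) / vol m z0 r \<noteq> 0"
 proof
  assume 0: "ennreal (\<Phi> r) / vol m z0 r = 0"
  have G0: "G (ball z0 r) x y = 0" if "y \<in> ball z0 (r/2)" for y
   using order_trans[OF max.cobounded1 c[OF x, of y]] that unfolding 0 by simp
  have "0 < X.R 0 (ball z0 r) (indicator (ball z0 (r/2))) x" by (rule occupation_pos) (use xV r in auto)
  also have "\<dots> = (\<integral>\<^sup>+y. indicator (ball z0 r) y * (indicator (ball z0 (r/2)) y * G (ball z0 r) x y) \<partial>m)"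
   by (rule R_green(1)[OF open_ball _ xV]) (rule borel_measurable_indicator, simp)
  also have "\<dots> = (\<integral>\<^sup>+y. 0 \<partial>m)" by (rule nn_integral_cong) (use G0 in \<open>simp add: indicator_def\<close>)
  finally show False by simp
 qed
 then show "\<Phi> r \<noteq> 0" "vol m z0 r < \<top>" by (auto simp: less_top)
qed

text \<open>Doubling spreads finiteness from one radius to all others.\<close>

lemma vol_finite: "vol m z0 r < \<top>"
proof -
 obtain s where s: "0 < s" "ereal s < r0" "annulus z0 (11/20 * s) s \<noteq> {}" using annulus_nonempty by auto
 obtain c where c: "\<And>r. 0 < r \<Longrightarrow> vol m z0 (2 * r) \<le> ennreal c * vol m z0 r"
  using V1 by (auto simp: assumption_V1_def)
 have fin: "vol m z0 (2 ^ n * s) < \<top>" for n :: nat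
 proof (induction n)
  case 0
  show ?case using green_bound_nonzero(2)[OF s] by simp
 next
  case (Suc n)
  have "vol m z0 (2 ^ Suc n * s) \<le> ennreal c * vol m z0 (2 ^ n * s)"
   using c[of "2 ^ n * s"] s(1) by (simp add: mult.assoc)
  also have "\<dots> < \<top>" using Suc by (simp add: ennreal_mult_less_top)
  finally show ?case .
 qed
 obtain n :: nat where "r / s < 2 ^ n" using real_arch_pow[of 2 "r / s"] by auto
 then have "r \<le> 2 ^ n * s" using s(1) by (simp add: field_simps)
 from vol_mono[OF this] fin[of n] show ?thesis by (rule le_less_trans)
qed

definition "v r = measure m (ball z0 r)"

lemma vol_v: "vol m z0 r = ennreal (v r)" "emeasure m (ball z0 r) = ennreal (v r)"
 unfolding vol_def v_def using vol_finite[of r] by (simp_all add: vol_def emeasure_eq_ennreal_measure)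

lemma v_pos: "0 < r \<Longrightarrow> 0 < v r" using vol_pos[of r] unfolding vol_v by simp

lemma v_nonneg: "0 \<le> v r" by (simp add: v_def)

lemma v_mono: "a \<le> b \<Longrightarrow> v a \<le> v b"
 using vol_mono[of a b] unfolding vol_v by (simp add: ennreal_le_iff v_nonneg)

lemma Phi_mono: "0 \<le> a \<Longrightarrow> a \<le> b \<Longrightarrow> \<Phi> a \<le> \<Phi> b"
 using Phi by (auto simp: assumption_Phi'_def mono_on_def)

lemma Phi_doubling: "0 < A \<Longrightarrow> \<exists>K>0. \<forall>r>0. \<Phi> (A * r) \<le> K * \<Phi> r"
proof -
 assume A: "0 < A"
 obtain c where "1 < c" "\<And>r. 0 < r \<Longrightarrow> \<Phi> (2 * r) \<le> c * \<Phi> r" using Phi by (auto simp: assumption_Phi'_def)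
 from doubling_iterate[of c \<Phi>, OF this _ A] show ?thesis using Phi_mono by simp
qed

lemma v_doubling: "0 < A \<Longrightarrow> \<exists>K>0. \<forall>r>0. v (A * r) \<le> K * v r"
proof -
 assume A: "0 < A"
 obtain c where c: "1 < c" "\<And>r. 0 < r \<Longrightarrow> vol m z0 (2 * r) \<le> ennreal c * vol m z0 r" using V1 by (auto simp: assumption_V1_def)
 have "v (2 * r) \<le> c * v r" if "0 < r" for r
  using c(2)[OF that] c(1) unfolding vol_v by (simp add: ennreal_mult[symmetric] v_nonneg ennreal_le_iff)
 from doubling_iterate[of c v, OF c(1) this _ A] show ?thesis using v_mono by simp
qed

text \<open>Monotonicity and doubling spread positivity from one radius to all others.\<close>

lemma Phi_pos: "0 < r \<Longrightarrow> 0 < \<Phi> r"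
proof -
 assume r: "0 < r"
 obtain s where s: "0 < s" "ereal s < r0" "annulus z0 (11/20 * s) s \<noteq> {}" using annulus_nonempty by auto
 have "0 \<le> \<Phi> s" "0 \<le> \<Phi> r" using Phi s r by (auto simp: assumption_Phi'_def)
 then have "0 < \<Phi> s" using green_bound_nonzero(1)[OF s] by simp
 have "0 < s / r" using s r by simp
 then obtain K where K: "0 < K" "\<forall>t>0. \<Phi> (s / r * t) \<le> K * \<Phi> t" using Phi_doubling by blast
 have "\<Phi> s \<le> K * \<Phi> r" using K(2)[rule_format, OF r] r by simp
 with \<open>0 < \<Phi> s\<close> have "0 < K * \<Phi> r" by linarith
 then show ?thesis using K(1) by (simp add: zero_less_mult_iff)
qed

text \<open>(C1) multiplied out into real inequalities, which is legitimate once volumes are finite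
  and \<Phi> is positive.\<close>

lemma jump_comparison:
 assumes a: "1/2 < a" "a < 1"
 shows "\<exists>c\<ge>1. \<exists>c'>0. \<forall>r>0. ereal r < r0 \<longrightarrow>
  (\<forall>x\<in>ball z0 (a * r). \<forall>y\<in>- ball z0 r.
    j z0 y \<le> c * j x y \<and> j x y \<le> c * j z0 y \<and> jd z0 y \<le> c * jd x y \<and> jd x y \<le> c * jd z0 y) \<and>
  (\<forall>y. a * r < dist z0 y \<and> dist z0 y < r \<longrightarrow> c' \<le> v r * \<Phi> r * j z0 y \<and> c' \<le> v r * \<Phi> r * jd z0 y)"
proof -
 have "a \<in> {1/2<..<1}" using a by simp
 then obtain c c' where c: "1 \<le> c" "0 < c'" "\<And>r. 0 < r \<Longrightarrow> ereal r < r0 \<Longrightarrow>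
    (\<forall>x\<in>ball z0 (a * r). \<forall>y\<in>- ball z0 r.
      inverse c * j z0 y \<le> j x y \<and> j x y \<le> c * j z0 y \<and>
      inverse c * jd z0 y \<le> jd x y \<and> jd x y \<le> c * jd z0 y) \<and>
    ennreal c' / (vol m z0 r * ennreal (\<Phi> r))
     \<le> (INF y\<in>closure (annulus z0 (a * r) r). ennreal (min (j z0 y) (jd z0 y)))"
  using C1 unfolding assumption_C1_def by blast
 show ?thesis
 proof (rule exI[of _ c], intro conjI exI[of _ c'] allI impI ballI c(1,2))
  fix r assume r: "0 < r" "ereal r < r0"
  note cr = c(3)[OF r]
  { fix x y assume "x \<in> ball z0 (a * r)" "y \<in> - ball z0 r"
   with cr have *: "inverse c * j z0 y \<le> j x y" "j x y \<le> c * j z0 y" "inverse c * jd z0 y \<le> jd x y" "jd x y \<le> c * jd z0 y"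
    by auto
   show "j x y \<le> c * j z0 y" "jd x y \<le> c * jd z0 y" by fact+
   show "j z0 y \<le> c * j x y" "jd z0 y \<le> c * jd x y" using *(1,3) c(1) by (auto simp: field_simps)
  next
   fix y assume y: "a * r < dist z0 y \<and> dist z0 y < r"
   have pos: "0 < v r * \<Phi> r" using r v_pos Phi_pos by simp
   have "ennreal (c' / (v r * \<Phi> r)) = ennreal c' / (vol m z0 r * ennreal (\<Phi> r))"
    unfolding vol_v using pos c(2) v_nonneg[of r] by (simp add: ennreal_mult'[symmetric] divide_ennreal)
   also have "\<dots> \<le> (INF y\<in>closure (annulus z0 (a * r) r). ennreal (min (j z0 y) (jd z0 y)))" using cr by blast
   also have "\<dots> \<le> ennreal (min (j z0 y) (jd z0 y))"
    by (rule INF_lower, rule subsetD[OF closure_subset]) (use y in \<open>simp add: annulus_def\<close>)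
   finally have le: "ennreal (c' / (v r * \<Phi> r)) \<le> ennreal (min (j z0 y) (jd z0 y))" .
   have cp: "0 < c' / (v r * \<Phi> r)" using pos c(2) by simp
   then have "0 < ennreal (min (j z0 y) (jd z0 y))" using le by (metis ennreal_less_zero_iff less_le_trans)
   then have "c' / (v r * \<Phi> r) \<le> min (j z0 y) (jd z0 y)" using le by (subst (asm) ennreal_le_iff) auto
   then have "c' / (v r * \<Phi> r) \<le> j z0 y" "c' / (v r * \<Phi> r) \<le> jd z0 y" by auto
   then show "c' \<le> v r * \<Phi> r * j z0 y" "c' \<le> v r * \<Phi> r * jd z0 y" using pos by (auto simp: divide_le_eq mult.commute)
  }
 qed
qed

lemma green_bound:
 "\<exists>c>0. \<forall>r>0. ereal r < r0 \<longrightarrow> (\<forall>x y. dist z0 x < r / 2 \<longrightarrow> 11/20 * r < dist z0 y \<longrightarrow> dist z0 y < r \<longrightarrow>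
   G (ball z0 r) x y \<le> ennreal (c * \<Phi> r / v r))"
proof -
 obtain c where c: "0 < c" "\<And>r x y. 0 < r \<Longrightarrow> ereal r < r0 \<Longrightarrow> 11/20 * r < dist z0 x \<Longrightarrow> dist z0 x < r \<Longrightarrow> dist z0 y < r / 2 \<Longrightarrow>
   max (G (ball z0 r) x y) (G (ball z0 r) y x) \<le> ennreal c * (ennreal (\<Phi> r) / vol m z0 r)"
  using green_ratio_bound by blast
 have "ennreal c * (ennreal (\<Phi> r) / vol m z0 r) = ennreal (c * \<Phi> r / v r)" if "0 < r" for r
  unfolding vol_v using c(1) v_pos[OF that] Phi_pos[OF that] by (simp add: divide_ennreal ennreal_mult[symmetric])
 then show ?thesis using c by (intro exI[of _ c]) force
qed

text \<open>The infimum over cutoffs need not be attained; doubling the constant makes the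
  inequality strict and yields an actual function.\<close>

lemma INF_SUP_less:
 fixes F :: "'b \<Rightarrow> 'c \<Rightarrow> real"
 assumes "(INF f\<in>T. SUP x. ereal (F f x)) \<le> ereal c / ereal p" "0 < c" "0 < p"
 shows "\<exists>f\<in>T. \<forall>x. F f x \<le> 2 * c / p"
proof -
 have "ereal c / ereal p < ereal (2 * c / p)" using assms(2,3) by (simp add: divide_strict_right_mono)
 with assms(1) have "(INF f\<in>T. SUP x. ereal (F f x)) < ereal (2 * c / p)" by (rule le_less_trans)
 then obtain f where f: "f \<in> T" "(SUP x. ereal (F f x)) < ereal (2 * c / p)" by (auto simp: INF_less_iff)
 have "F f x \<le> 2 * c / p" for x
 proof -
  have "ereal (F f x) \<le> (SUP x. ereal (F f x))" by (rule SUP_upper) simp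
  then have "ereal (F f x) < ereal (2 * c / p)" using f(2) by (rule le_less_trans)
  then show ?thesis by simp
 qed
 then show ?thesis using f(1) by blast
qed

text \<open>Only the bound on the dual generator is recorded, since this cutoff serves as barrier
  for the dual process.\<close>

lemma ball_cutoff:
 "\<exists>c>0. \<forall>r>0. ereal r < r0 \<longrightarrow> (\<exists>f\<in>\<D>. (\<forall>x. 0 \<le> f x \<and> f x \<le> 1) \<and> (\<forall>x. dist z0 x < 9/10 * r \<longrightarrow> f x = 1) \<and>
   (\<forall>x. r \<le> dist z0 x \<longrightarrow> f x = 0) \<and> (\<forall>x. gen Xd f x \<le> c / \<Phi> r))"
proof -
 have "(9/10::real) \<in> {1/2<..<1}" by simp
 with B1a obtain c where c: "0 < c" "\<And>r. 0 < r \<Longrightarrow> ereal r < r0 \<Longrightarrow>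
   (INF f\<in>test_functions m \<D> (closure (ball z0 (9/10 * r))) (ball z0 r).
      SUP x. ereal (max (gen X f x) (gen Xd f x))) \<le> ereal c / ereal (\<Phi> r)"
  unfolding assumption_B1a_def by blast
 show ?thesis
 proof (intro exI[of _ "2 * c"] conjI allI impI)
  fix r assume r: "0 < r" "ereal r < r0"
  obtain f where f: "f \<in> test_functions m \<D> (closure (ball z0 (9/10 * r))) (ball z0 r)"
    "\<And>x. max (gen X f x) (gen Xd f x) \<le> 2 * c / \<Phi> r"
   using INF_SUP_less[OF c(2)[OF r] c(1) Phi_pos[OF r(1)]] by auto
  have "f x = 1" if "dist z0 x < 9/10 * r" for x
  proof -
   have "x \<in> closure (ball z0 (9/10 * r))" by (rule subsetD[OF closure_subset]) (use that in simp)
   then show ?thesis using f(1) by (simp add: test_functions_def)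
  qed
  moreover have "gen Xd f x \<le> 2 * c / \<Phi> r" for x using f(2)[of x] by simp
  ultimately show "\<exists>f\<in>\<D>. (\<forall>x. 0 \<le> f x \<and> f x \<le> 1) \<and> (\<forall>x. dist z0 x < 9/10 * r \<longrightarrow> f x = 1) \<and>
    (\<forall>x. r \<le> dist z0 x \<longrightarrow> f x = 0) \<and> (\<forall>x. gen Xd f x \<le> 2 * c / \<Phi> r)"
   using f(1) by (intro bexI[of _ f]) (auto simp: test_functions_def)
 qed (use c in simp)
qed

text \<open>The ratios are tuned to the scale \<open>s = 11/20 * r\<close>: there f is 1 for
  distances between 0.297 r and r/2, which covers the part of the ball of radius r/2 outside the
  ball of radius 3r/10, and it is 0 up to 0.275 r, a range that includes the ball of radius
  r/8.\<close>

lemma annulus_cutoff: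
 "\<exists>c>0. \<forall>r>0. ereal r < r0 \<longrightarrow> (\<exists>f\<in>\<D>. (\<forall>x. 0 \<le> f x \<and> f x \<le> 1) \<and>
   (\<forall>x. 27/50 * r < dist z0 x \<longrightarrow> dist z0 x < 10/11 * r \<longrightarrow> f x = 1) \<and>
   (\<forall>x. dist z0 x \<le> r / 2 \<longrightarrow> f x = 0) \<and> (\<forall>x. gen X f x \<le> c / \<Phi> r))"
proof -
 have "1/2 < (27/50::real)" "27/50 < (10/11::real)" "10/11 < (1::real)" by auto
 with B1c obtain c where c: "0 < c" "\<And>r. 0 < r \<Longrightarrow> ereal r < r0 \<Longrightarrow>
   (INF f\<in>test_functions m \<D> (closure (annulus z0 (27/50 * r) (10/11 * r))) (annulus z0 (r / 2) r).
      SUP x. ereal (max (gen X f x) (gen Xd f x))) \<le> ereal c / ereal (\<Phi> r)"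
  unfolding assumption_B1c_def by blast
 show ?thesis
 proof (intro exI[of _ "2 * c"] conjI allI impI)
  fix r assume r: "0 < r" "ereal r < r0"
  obtain f where f: "f \<in> test_functions m \<D> (closure (annulus z0 (27/50 * r) (10/11 * r))) (annulus z0 (r / 2) r)"
    "\<And>x. max (gen X f x) (gen Xd f x) \<le> 2 * c / \<Phi> r"
   using INF_SUP_less[OF c(2)[OF r] c(1) Phi_pos[OF r(1)]] by auto
  have "f x = 1" if "27/50 * r < dist z0 x" "dist z0 x < 10/11 * r" for x
  proof -
   have "x \<in> closure (annulus z0 (27/50 * r) (10/11 * r))"
    by (rule subsetD[OF closure_subset]) (use that in \<open>simp add: annulus_def\<close>)
   then show ?thesis using f(1) by (simp add: test_functions_def)
  qed
  moreover have "f x = 0" if "dist z0 x \<le> r / 2" for x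
   using f(1) that by (auto simp: test_functions_def annulus_def)
  moreover have "gen X f x \<le> 2 * c / \<Phi> r" for x using f(2)[of x] by simp
  ultimately show "\<exists>f\<in>\<D>. (\<forall>x. 0 \<le> f x \<and> f x \<le> 1) \<and>
    (\<forall>x. 27/50 * r < dist z0 x \<longrightarrow> dist z0 x < 10/11 * r \<longrightarrow> f x = 1) \<and>
    (\<forall>x. dist z0 x \<le> r / 2 \<longrightarrow> f x = 0) \<and> (\<forall>x. gen X f x \<le> 2 * c / \<Phi> r)"
   using f(1) by (intro bexI[of _ f]) (auto simp: test_functions_def)
 qed (use c in simp)
qed

section \<open>Exit times from small balls\<close>

definition "small r \<longleftrightarrow> 0 < r \<and> ereal r < r0 / ereal (2 * real n0)"

lemma small_scale:
 assumes r: "small r" and t: "t \<le> 2 * real n0 * r" shows "ereal t < r0"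
proof -
 have n: "0 < ereal (2 * real n0)" "ereal (2 * real n0) \<noteq> \<infinity>" using n0 by auto
 have "ereal r < r0 / ereal (2 * real n0)" using r by (simp add: small_def)
 then have "ereal (2 * real n0) * ereal r < r0" unfolding ereal_less_divide_pos[OF n] .
 then have "ereal (2 * real n0 * r) < r0" by simp
 moreover have "ereal t \<le> ereal (2 * real n0 * r)" using t by simp
 ultimately show ?thesis by (rule le_less_trans[rotated])
qed

lemma small_le:
 assumes r: "small r" and t: "t \<le> 4 * r" shows "ereal t < r0"
proof (rule small_scale[OF r])
 have "4 * r \<le> 2 * real n0 * r" using r n0 by (intro mult_right_mono) (auto simp: small_def)
 then show "t \<le> 2 * real n0 * r" using t by linarith
qed

text \<open>(V2') provides an annulus outside the ball whose volume is at least a multiple of that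
  of the ball. There j(z0, .) is bounded below by (C1) at a radius adapted to the point, and
  doubling brings volume and scale back to r.\<close>

lemma outer_annulus_mass:
 "\<exists>\<kappa>>0. \<forall>r. small r \<longrightarrow> (\<exists>A\<in>sets borel. A \<inter> closure (ball z0 r) = {} \<and> (\<forall>y\<in>ball z0 r.
   ennreal (\<kappa> / \<Phi> r) \<le> emeasure (density m (\<lambda>z. ennreal (j y z))) A \<and>
   ennreal (\<kappa> / \<Phi> r) \<le> emeasure (density m (\<lambda>z. ennreal (jd y z))) A))"
proof -
 have "1/2 < (10/11::real)" "(10/11::real) < 1" by auto
 from jump_comparison[OF this] obtain c where c: "1 \<le> c" "\<And>r x y. 0 < r \<Longrightarrow> ereal r < r0 \<Longrightarrow> x \<in> ball z0 (10/11 * r) \<Longrightarrow> y \<in> - ball z0 r \<Longrightarrow>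
    j z0 y \<le> c * j x y \<and> jd z0 y \<le> c * jd x y" by blast
 have "1/2 < (3/5::real)" "(3/5::real) < 1" by auto
 from jump_comparison[OF this] obtain c' where c': "0 < c'" "\<And>r y. 0 < r \<Longrightarrow> ereal r < r0 \<Longrightarrow> 3/5 * r < dist z0 y \<Longrightarrow> dist z0 y < r \<Longrightarrow>
    c' \<le> v r * \<Phi> r * j z0 y \<and> c' \<le> v r * \<Phi> r * jd z0 y" by blast
 obtain b where b: "1 < b" "\<And>s. 0 < s \<Longrightarrow> ereal s \<le> r0 \<Longrightarrow> ennreal b * vol m z0 s \<le> vol m z0 (real n0 * s)"
  using V2 by (auto simp: assumption_V2'_def)
 have n: "0 < real n0" "2 \<le> real n0" using n0 by auto
 have np: "0 < 2 * real n0" using n by simp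
 obtain K1 where K1: "0 < K1" "\<And>r. 0 < r \<Longrightarrow> v (2 * real n0 * r) \<le> K1 * v r" using v_doubling[OF np] by blast
 obtain K2 where K2: "0 < K2" "\<And>r. 0 < r \<Longrightarrow> \<Phi> (2 * real n0 * r) \<le> K2 * \<Phi> r" using Phi_doubling[OF np] by blast
 define \<kappa> where "\<kappa> = c' * (b - 1) / (c * K1 * K2)"
 show ?thesis
 proof (intro exI[of _ \<kappa>] conjI allI impI)
  show "0 < \<kappa>" using c c' b K1 K2 by (simp add: \<kappa>_def)
  fix r assume sm: "small r"
  then have r: "0 < r" by (simp add: small_def)
  \<comment> \<open>Slightly larger than r: the ball of radius r is
    \<open>ball z0 (10/11 * s)\<close>, and the annulus stays off its closure.\<close>
  define s where "s = 11/10 * r"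
  define A where "A = ball z0 (real n0 * s) - ball z0 s"
  have s: "0 < s" "r < s" "s \<le> 4 * r" using r by (auto simp: s_def)
  have s0: "ereal s < r0" by (rule small_le[OF sm s(3)])
  have A: "A \<in> sets borel" by (simp add: A_def)
  have vr: "0 < v r" "0 < \<Phi> r" using v_pos Phi_pos r by auto
  define \<eta> where "\<eta> = c' / (c * K1 * K2 * (v r * \<Phi> r))"
  have e0: "0 < \<eta>" using c c' K1 K2 vr by (simp add: \<eta>_def)
  have lower: "\<eta> \<le> j y z \<and> \<eta> \<le> jd y z" if y: "y \<in> ball z0 r" and z: "z \<in> A" for y z
  proof -
   \<comment> \<open>The lower bound in (C1) concerns points in the outer part of a ball, so its
     radius t must slightly exceed the distance of z. As this distance can come close to
     \<open>11/10 * n0 * r\<close>, t can come close to \<open>33/25 * n0 * r\<close>; the room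
     comes from r being below \<open>r0 / (2 * n0)\<close>.\<close>
   define t where "t = 6/5 * dist z0 z"
   have z': "s \<le> dist z0 z" "dist z0 z < real n0 * s" using z by (auto simp: A_def)
   have "t \<le> 6/5 * (real n0 * s)" using z' by (simp add: t_def)
   also have "\<dots> = 33/25 * (real n0 * r)" by (simp add: s_def)
   also have "\<dots> \<le> 2 * (real n0 * r)" using r n by (intro mult_right_mono) auto
   finally have t: "t \<le> 2 * real n0 * r" by (simp add: mult.assoc)
   have tp: "0 < t" "3/5 * t < dist z0 z" "dist z0 z < t" using z' s by (auto simp: t_def)
   have lo: "c' \<le> v t * \<Phi> t * j z0 z \<and> c' \<le> v t * \<Phi> t * jd z0 z"
    by (rule c'(2)[OF tp(1) small_scale[OF sm t] tp(2,3)])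
   have vt: "0 < v t * \<Phi> t" using v_pos Phi_pos tp by simp
   have "v t * \<Phi> t \<le> (K1 * v r) * (K2 * \<Phi> r)"
   proof (rule mult_mono)
    show "v t \<le> K1 * v r" using v_mono[OF t] K1(2)[OF r] by linarith
    show "\<Phi> t \<le> K2 * \<Phi> r" using Phi_mono[OF less_imp_le[OF tp(1)] t] K2(2)[OF r] by linarith
    show "0 \<le> K1 * v r" using K1 vr by simp
    show "0 \<le> \<Phi> t" using Phi_pos[OF tp(1)] by simp
   qed
   then have K: "v t * \<Phi> t \<le> K1 * K2 * (v r * \<Phi> r)" by (simp only: mult_ac)
   have zz: "z \<in> - ball z0 s" "y \<in> ball z0 (10/11 * s)" using z y by (auto simp: A_def s_def)
   have up: "j z0 z \<le> c * j y z \<and> jd z0 z \<le> c * jd y z" by (rule c(2)[OF s(1) s0 zz(2,1)])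
   have gen: "\<eta> \<le> g" if g: "c' \<le> v t * \<Phi> t * g0" "g0 \<le> c * g" for g g0 :: real
   proof -
    have "0 < v t * \<Phi> t * g0" using g(1) c'(1) by linarith
    then have "0 < g0" using vt by (simp add: zero_less_mult_iff)
    have "c' \<le> K1 * K2 * (v r * \<Phi> r) * g0"
     using g(1) mult_right_mono[OF K less_imp_le[OF \<open>0 < g0\<close>]] by linarith
    also have "\<dots> \<le> K1 * K2 * (v r * \<Phi> r) * (c * g)"
     by (rule mult_left_mono[OF g(2)]) (use K1 K2 vr in simp)
    finally have "c' \<le> g * (c * K1 * K2 * (v r * \<Phi> r))" by (simp only: mult_ac)
    moreover have "0 < c * K1 * K2 * (v r * \<Phi> r)" using c K1 K2 vr by simp
    ultimately show ?thesis unfolding \<eta>_def by (simp add: pos_divide_le_eq)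
   qed
   show ?thesis using gen lo up by blast
  qed
  have mA: "ennreal ((b - 1) * v r) \<le> emeasure m A"
  proof -
   have "ennreal b * vol m z0 s \<le> vol m z0 (real n0 * s)" by (rule b(2)[OF s(1)]) (use s0 in simp)
   then have 1: "b * v s \<le> v (real n0 * s)" unfolding vol_v using b(1) by (simp add: ennreal_mult[symmetric] v_nonneg ennreal_le_iff)
   have sub: "s \<le> real n0 * s" using s n by simp
   have "emeasure m A = emeasure m (ball z0 (real n0 * s)) - emeasure m (ball z0 s)"
    unfolding A_def by (rule emeasure_Diff) (use subset_ball[OF sub] vol_v in auto)
   also have "\<dots> = ennreal (v (real n0 * s) - v s)" unfolding vol_v by (simp add: ennreal_minus v_nonneg)
   finally have eA: "emeasure m A = ennreal (v (real n0 * s) - v s)" .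
   have "(b - 1) * v r \<le> (b - 1) * v s" using b(1) v_mono[of r s] s by (intro mult_left_mono) auto
   also have "\<dots> \<le> v (real n0 * s) - v s" using 1 by (simp add: algebra_simps)
   finally show ?thesis unfolding eA by (rule ennreal_leI)
  qed
  have mass: "ennreal (\<kappa> / \<Phi> r) \<le> emeasure (density m (\<lambda>z. ennreal (g z))) A"
   if g: "g \<in> borel_fun" "\<And>z. z \<in> A \<Longrightarrow> \<eta> \<le> g z" for g
  proof -
   have "ennreal (\<kappa> / \<Phi> r) = ennreal (\<eta> * ((b - 1) * v r))"
    using vr by (simp add: \<kappa>_def \<eta>_def mult.assoc)
   also have "\<dots> = ennreal \<eta> * ennreal ((b - 1) * v r)" using e0 by (rule ennreal_mult'[OF less_imp_le])
   also have "\<dots> \<le> ennreal \<eta> * emeasure m A" by (rule mult_left_mono[OF mA]) simp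
   also have "\<dots> = (\<integral>\<^sup>+z. ennreal \<eta> * indicator A z \<partial>m)" by (rule nn_integral_cmult_indicator[symmetric]) (use A in simp)
   also have "\<dots> \<le> (\<integral>\<^sup>+z. ennreal (g z) * indicator A z \<partial>m)"
    by (rule nn_integral_mono) (use g(2) in \<open>auto simp: indicator_def intro: ennreal_leI\<close>)
   also have "\<dots> = emeasure (density m (\<lambda>z. ennreal (g z))) A"
    by (rule emeasure_density[symmetric]) (use g A in simp_all)
   finally show ?thesis .
  qed
  show "\<exists>A\<in>sets borel. A \<inter> closure (ball z0 r) = {} \<and> (\<forall>y\<in>ball z0 r.
    ennreal (\<kappa> / \<Phi> r) \<le> emeasure (density m (\<lambda>z. ennreal (j y z))) A \<and>
    ennreal (\<kappa> / \<Phi> r) \<le> emeasure (density m (\<lambda>z. ennreal (jd y z))) A)"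
  proof (intro bexI[OF _ A] conjI ballI)
   have "closure (ball z0 r) \<subseteq> cball z0 r" by (rule closure_minimal) auto
   then show "A \<inter> closure (ball z0 r) = {}" using s by (auto simp: A_def)
  qed (rule mass; use lower jump_measurable in auto)+
 qed
qed

lemma exit_time:
 "\<exists>C>0. \<forall>r. small r \<longrightarrow> (\<forall>x. X.R 0 (ball z0 r) (\<lambda>_. 1) x \<le> ennreal (C * \<Phi> r) \<and> Y.R 0 (ball z0 r) (\<lambda>_. 1) x \<le> ennreal (C * \<Phi> r))"
proof -
 obtain \<kappa> where \<kappa>: "0 < \<kappa>" "\<And>r. small r \<Longrightarrow> \<exists>A\<in>sets borel. A \<inter> closure (ball z0 r) = {} \<and> (\<forall>y\<in>ball z0 r.
   ennreal (\<kappa> / \<Phi> r) \<le> emeasure (density m (\<lambda>z. ennreal (j y z))) A \<and>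
   ennreal (\<kappa> / \<Phi> r) \<le> emeasure (density m (\<lambda>z. ennreal (jd y z))) A)"
  using outer_annulus_mass by blast
 show ?thesis
 proof (intro exI[of _ "1/\<kappa>"] conjI allI impI)
  fix r x assume sm: "small r"
  then have p: "0 < \<kappa> / \<Phi> r" using \<kappa>(1) Phi_pos[of r] by (simp add: small_def)
  have eq: "1 / (\<kappa> / \<Phi> r) = 1 / \<kappa> * \<Phi> r" by simp
  obtain A where A: "A \<in> sets borel" "A \<inter> closure (ball z0 r) = {}" "\<And>y. y \<in> ball z0 r \<Longrightarrow>
    ennreal (\<kappa> / \<Phi> r) \<le> emeasure (density m (\<lambda>z. ennreal (j y z))) A \<and>
    ennreal (\<kappa> / \<Phi> r) \<le> emeasure (density m (\<lambda>z. ennreal (jd y z))) A"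
   using \<kappa>(2)[OF sm] by auto
  show "X.R 0 (ball z0 r) (\<lambda>_. 1) x \<le> ennreal (1 / \<kappa> * \<Phi> r)"
   unfolding eq[symmetric] by (rule X.exit_time_bound[OF open_ball A(1,2) p]) (use A(3) in blast)
  show "Y.R 0 (ball z0 r) (\<lambda>_. 1) x \<le> ennreal (1 / \<kappa> * \<Phi> r)"
   unfolding eq[symmetric] by (rule Y.exit_time_bound[OF open_ball A(1,2) p]) (use A(3) in blast)
 qed (use \<kappa> in simp)
qed

section \<open>Comparison with the mean exit time and the tail\<close>

definition "tail r u = (\<integral>\<^sup>+y. indicator (- ball z0 (r/2)) y * (ennreal (j z0 y) * u y) \<partial>m)"

text \<open>Extended values and vanishing on all of \<open>ball z0 r - D\<close> fit the kernels; a
  regular harmonic function is brought into this form by altering it on a polar set.\<close>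

definition vanishing_solution :: "real \<Rightarrow> 'a set \<Rightarrow> ('a \<Rightarrow> ennreal) \<Rightarrow> bool" where
 "vanishing_solution r D u \<longleftrightarrow> open D \<and> D \<subseteq> ball z0 r \<and> u \<in> borel_fun \<and>
   (\<forall>x\<in>D. u x = X.H 0 D u x) \<and> (\<forall>x\<in>ball z0 r - D. u x = 0) \<and> (\<forall>x. u x < \<top>)"

text \<open>The barrier estimate for nested balls. Its annulus term is absorbed by the tail, since
  (C1) bounds j(z0, .) on the annulus from below by a multiple of
  \<open>1 / (v r * \<Phi> r)\<close>.\<close>

lemma inner_bound:
 "\<exists>C>0. \<forall>r D u x. small r \<longrightarrow> vanishing_solution r D u \<longrightarrow>
   x \<in> D \<inter> ball z0 (r/2) \<longrightarrow> u x \<le> ennreal (C * \<Phi> r) * tail r u"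
proof -
 obtain c\<tau> where c\<tau>: "0 < c\<tau>" "\<And>r x. small r \<Longrightarrow> X.R 0 (ball z0 r) (\<lambda>_. 1) x \<le> ennreal (c\<tau> * \<Phi> r) \<and> Y.R 0 (ball z0 r) (\<lambda>_. 1) x \<le> ennreal (c\<tau> * \<Phi> r)"
  using exit_time by blast
 obtain cG where cG: "0 < cG" "\<And>r x y. 0 < r \<Longrightarrow> ereal r < r0 \<Longrightarrow> dist z0 x < r / 2 \<Longrightarrow> 11/20 * r < dist z0 y \<Longrightarrow> dist z0 y < r \<Longrightarrow>
   G (ball z0 r) x y \<le> ennreal (cG * \<Phi> r / v r)" using green_bound by blast
 obtain c\<phi> where c\<phi>: "0 < c\<phi>" "\<And>r. 0 < r \<Longrightarrow> ereal r < r0 \<Longrightarrow> \<exists>f\<in>\<D>. (\<forall>x. 0 \<le> f x \<and> f x \<le> 1) \<and> (\<forall>x. dist z0 x < 9/10 * r \<longrightarrow> f x = 1) \<and>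
   (\<forall>x. r \<le> dist z0 x \<longrightarrow> f x = 0) \<and> (\<forall>x. gen Xd f x \<le> c\<phi> / \<Phi> r)" using ball_cutoff by blast
 have "1/2 < (6/7::real)" "(6/7::real) < 1" by auto
 from jump_comparison[OF this] obtain c1 where c1: "1 \<le> c1" "\<And>r x y. 0 < r \<Longrightarrow> ereal r < r0 \<Longrightarrow> x \<in> ball z0 (6/7 * r) \<Longrightarrow> y \<in> - ball z0 r \<Longrightarrow>
    j z0 y \<le> c1 * j x y \<and> j x y \<le> c1 * j z0 y" by blast
 have "1/2 < (19/20::real)" "(19/20::real) < 1" by auto
 from jump_comparison[OF this] obtain c2 where c2: "1 \<le> c2" "\<And>r x y. 0 < r \<Longrightarrow> ereal r < r0 \<Longrightarrow> x \<in> ball z0 (19/20 * r) \<Longrightarrow> y \<in> - ball z0 r \<Longrightarrow>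
    j z0 y \<le> c2 * j x y \<and> j x y \<le> c2 * j z0 y" by blast
 have "1/2 < (11/20::real)" "(11/20::real) < 1" by auto
 from jump_comparison[OF this] obtain c3 where c3: "0 < c3" "\<And>r y. 0 < r \<Longrightarrow> ereal r < r0 \<Longrightarrow> 11/20 * r < dist z0 y \<Longrightarrow> dist z0 y < r \<Longrightarrow>
    c3 \<le> v r * \<Phi> r * j z0 y" by blast
 obtain Kv where Kv: "0 < Kv" "\<And>r. 0 < r \<Longrightarrow> v (5/3 * r) \<le> Kv * v r" using v_doubling[of "5/3"] by auto
 obtain Kp where Kp: "0 < Kp" "\<And>r. 0 < r \<Longrightarrow> \<Phi> (10/9 * r) \<le> Kp * \<Phi> r" using Phi_doubling[of "10/9"] by auto
 define c where "c = max c1 c2"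
 have c: "1 \<le> c" "c1 \<le> c" "c2 \<le> c" using c1 by (auto simp: c_def)
 \<comment> \<open>Chosen so that the barrier constant times \<delta> is at most
   \<open>A / v r\<close>: Kv returns the volume from radius 3r/5 to r, Kp the scale from 9r/10 to
   r.\<close>
 define A where "A = (cG + c\<^sup>2 * c\<tau> * Kv) * (c\<phi> * Kp)"
 have A: "0 < A" using cG c\<tau> Kv c\<phi> Kp c by (simp add: A_def add_pos_nonneg)
 show ?thesis
 proof (intro exI[of _ "A / c3 + c * c\<tau>"] conjI allI impI)
  show "0 < A / c3 + c * c\<tau>" using A c3 c c\<tau> by (simp add: add_pos_pos)
  fix r D u x
  assume sm: "small r" and sol: "vanishing_solution r D u" and x: "x \<in> D \<inter> ball z0 (r/2)"
  then have D: "open D" "D \<subseteq> ball z0 r" and u: "u \<in> borel_fun"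
   and harm: "\<forall>x\<in>D. u x = X.H 0 D u x" and u0: "\<forall>x\<in>ball z0 r - D. u x = 0" and ufin: "\<forall>x. u x < \<top>"
   unfolding vanishing_solution_def by blast+
  have [measurable]: "u \<in> borel_fun" "ball z0 a \<in> sets borel" for a using u by auto
  have jm [measurable]: "j z0 \<in> borel_fun" by (rule jump_measurable)
  have r: "0 < r" using sm by (simp add: small_def)
  have sc: "ereal t < r0" if "t \<le> r" for t by (rule small_le[OF sm]) (use that r in linarith)
  have vr: "0 < v r" "0 < \<Phi> r" using v_pos Phi_pos r by auto
  have r9: "0 < 9/10 * r" "ereal (9/10 * r) < r0" using r sc[of "9/10 * r"] by auto
  obtain \<phi> where \<phi>: "\<phi> \<in> \<D>" "\<And>x. 0 \<le> \<phi> x \<and> \<phi> x \<le> 1" "\<And>x. dist z0 x < 9/10 * (9/10 * r) \<Longrightarrow> \<phi> x = 1"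
    "\<And>x. 9/10 * r \<le> dist z0 x \<Longrightarrow> \<phi> x = 0" "\<And>x. gen Xd \<phi> x \<le> c\<phi> / \<Phi> (9/10 * r)"
   using c\<phi>(2)[OF r9] by blast
  have p9: "0 < \<Phi> (9/10 * r)" by (rule Phi_pos[OF r9(1)])
  have jn: "0 \<le> j z0 y" if "y \<noteq> z0" for y using jump_pos[of z0 y] that by simp
  have jn': "0 \<le> j w y" if "w \<noteq> y" for w y using jump_pos[OF that] by simp
  \<comment> \<open>Radii in units of r: 1/2 for S, 3/5 for P, 7/10 for N, 9/10 for E, 24/25 for E'
    and 1 for V. The cutoff of radius 9/10 is 1 up to 81/100, beyond N. (C1) is used at 7/10 with
    ratio 6/7, giving 3/5, and at 24/25 with ratio 19/20, giving 0.912, beyond E.\<close>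
  interpret b: barrier m X Xd j jd \<D> G z0 "ball z0 r" "ball z0 (3/5 * r)" "cball z0 (7/10 * r)" "ball z0 (r/2)"
   "cball z0 (9/10 * r)" "cball z0 (24/25 * r)" \<phi> "cG * \<Phi> r / v r" "c\<tau> * \<Phi> r" "c\<phi> / \<Phi> (9/10 * r)" c
  proof
   show "emeasure m (ball z0 r) < \<top>" by (simp add: vol_v)
   show "0 \<le> c\<tau> * \<Phi> r" "0 \<le> cG * \<Phi> r / v r" "0 < c\<phi> / \<Phi> (9/10 * r)" "0 < c" using c\<tau> vr cG c\<phi> p9 c by simp_all
   show "X.R 0 (ball z0 r) (\<lambda>_. 1) x \<le> ennreal (c\<tau> * \<Phi> r)" "Y.R 0 (ball z0 r) (\<lambda>_. 1) x \<le> ennreal (c\<tau> * \<Phi> r)" for x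
    using c\<tau>(2)[OF sm] by blast+
   show "G (ball z0 r) x y \<le> ennreal (cG * \<Phi> r / v r)"
    if "x \<in> ball z0 (r/2)" "y \<in> cball z0 (7/10 * r) - ball z0 (3/5 * r)" for x y
    by (rule cG(2)[OF r sc]) (use that r in auto)
   show "\<phi> y = 1" if "y \<in> cball z0 (7/10 * r)" for y by (rule \<phi>(3)) (use that r in auto)
   show "\<phi> y = 0" if "y \<notin> cball z0 (9/10 * r)" for y by (rule \<phi>(4)) (use that in auto)
   show "gen Xd \<phi> y \<le> c\<phi> / \<Phi> (9/10 * r)" for y by (rule \<phi>(5))
   show "j x y \<le> c * j z0 y" "j z0 y \<le> c * j x y" if xy: "x \<in> ball z0 (3/5 * r)" "y \<notin> cball z0 (7/10 * r)" for x y
   proof -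
    have r7: "0 < 7/10 * r" "ereal (7/10 * r) < r0" using r sc[of "7/10 * r"] by auto
    have *: "j z0 y \<le> c1 * j x y \<and> j x y \<le> c1 * j z0 y" by (rule c1(2)[OF r7]) (use xy in auto)
    have "x \<noteq> y" "z0 \<noteq> y" using xy r by auto
    then show "j x y \<le> c * j z0 y" "j z0 y \<le> c * j x y"
     using * mult_right_mono[OF c(2) jn'[of z0 y]] mult_right_mono[OF c(2) jn'[of x y]] by auto
   qed
   show "j x z \<le> c * j z0 z" if xz: "x \<in> cball z0 (9/10 * r)" "z \<notin> cball z0 (24/25 * r)" for x z
   proof -
    have r7: "0 < 24/25 * r" "ereal (24/25 * r) < r0" using r sc[of "24/25 * r"] by auto
    have *: "j z0 z \<le> c2 * j x z \<and> j x z \<le> c2 * j z0 z" by (rule c2(2)[OF r7]) (use xz r in auto)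
    have "z0 \<noteq> z" using xz r by auto
    then show ?thesis using * mult_right_mono[OF c(3) jn'[of z0 z]] by auto
   qed
  qed (use \<phi> r in auto)
  have v35: "v r \<le> Kv * v (3/5 * r)" using Kv(2)[of "3/5 * r"] r by simp
  have p910: "\<Phi> r \<le> Kp * \<Phi> (9/10 * r)" using Kp(2)[of "9/10 * r"] r by simp
  have mu: "b.\<mu> = v (3/5 * r)" unfolding b.\<mu>_def v_def ..
  have v35p: "0 < v (3/5 * r)" using r by (intro v_pos) simp
  have Cd: "b.C * (c\<phi> / \<Phi> (9/10 * r)) \<le> A / v r"
  proof -
   have "c\<^sup>2 * (c\<tau> * \<Phi> r) / b.\<mu> \<le> c\<^sup>2 * c\<tau> * Kv * (\<Phi> r / v r)"
   proof -
    have "1 / v (3/5 * r) \<le> Kv / v r" using v35 v35p vr by (simp add: field_simps)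
    from mult_left_mono[OF this, of "c\<^sup>2 * (c\<tau> * \<Phi> r)"] show ?thesis
     unfolding mu using c\<tau>(1) vr by (simp add: field_simps)
   qed
   then have 1: "b.C \<le> (cG + c\<^sup>2 * c\<tau> * Kv) * (\<Phi> r / v r)" unfolding b.C_def distrib_right times_divide_eq_right add_divide_distrib by (rule add_left_mono)
   have 2: "c\<phi> / \<Phi> (9/10 * r) \<le> c\<phi> * Kp / \<Phi> r"
   proof -
    have "1 / \<Phi> (9/10 * r) \<le> Kp / \<Phi> r" using p910 p9 vr by (simp add: field_simps)
    from mult_left_mono[OF this, of c\<phi>] show ?thesis using c\<phi>(1) by simp
   qed
   have "b.C * (c\<phi> / \<Phi> (9/10 * r)) \<le> ((cG + c\<^sup>2 * c\<tau> * Kv) * (\<Phi> r / v r)) * (c\<phi> * Kp / \<Phi> r)"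
    by (rule mult_mono[OF 1 2]) (use cG c\<tau> Kv c vr c\<phi> p9 in \<open>auto intro!: mult_nonneg_nonneg add_nonneg_nonneg\<close>)
   also have "\<dots> = A / v r" using vr unfolding A_def by simp
   finally show ?thesis .
  qed
  have T1: "ennreal (b.C * (c\<phi> / \<Phi> (9/10 * r))) * (\<integral>\<^sup>+x. indicator (ball z0 r - ball z0 (3/5 * r)) x * u x \<partial>m)
    \<le> ennreal (A / c3 * \<Phi> r) * tail r u"
  proof -
   have "ennreal (b.C * (c\<phi> / \<Phi> (9/10 * r))) * (\<integral>\<^sup>+x. indicator (ball z0 r - ball z0 (3/5 * r)) x * u x \<partial>m)
    \<le> ennreal (A / v r) * (\<integral>\<^sup>+x. indicator (ball z0 r - ball z0 (3/5 * r)) x * u x \<partial>m)"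
    by (intro mult_right_mono ennreal_leI Cd) simp
   also have "\<dots> = (\<integral>\<^sup>+x. ennreal (A / v r) * (indicator (ball z0 r - ball z0 (3/5 * r)) x * u x) \<partial>m)"
    by (rule nn_integral_cmult[symmetric]) measurable
   also have "\<dots> \<le> (\<integral>\<^sup>+x. ennreal (A / c3 * \<Phi> r) * (indicator (- ball z0 (r/2)) x * (ennreal (j z0 x) * u x)) \<partial>m)"
   proof (rule nn_integral_mono)
    fix y
    show "ennreal (A / v r) * (indicator (ball z0 r - ball z0 (3/5 * r)) y * u y)
      \<le> ennreal (A / c3 * \<Phi> r) * (indicator (- ball z0 (r/2)) y * (ennreal (j z0 y) * u y))"
    proof (cases "y \<in> ball z0 r - ball z0 (3/5 * r)")
     case True
     have "c3 \<le> v r * \<Phi> r * j z0 y" by (rule c3(2)[OF r sc]) (use True r in auto)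
     then have "A / v r \<le> A / c3 * \<Phi> r * j z0 y" using A c3(1) vr by (simp add: field_simps)
     moreover have "y \<noteq> z0" using True r by auto
     ultimately have "ennreal (A / v r) \<le> ennreal (A / c3 * \<Phi> r) * ennreal (j z0 y)"
      using jn[of y] by (simp add: ennreal_mult''[symmetric] ennreal_leI)
     from mult_right_mono[OF this, of "u y"] show ?thesis using True r by (auto simp: indicator_def mult.assoc)
    qed simp
   qed
   also have "\<dots> = ennreal (A / c3 * \<Phi> r) * tail r u" unfolding tail_def by (rule nn_integral_cmult) measurable
   finally show ?thesis .
  qed
  have T2: "ennreal (c * (c\<tau> * \<Phi> r)) * (\<integral>\<^sup>+x. indicator (- ball z0 r) x * (ennreal (j z0 x) * u x) \<partial>m)
    \<le> ennreal (c * c\<tau> * \<Phi> r) * tail r u" unfolding tail_def mult.assoc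
   by (intro mult_left_mono nn_integral_mono) (use r in \<open>auto simp: indicator_def\<close>)
  have "u x \<le> ennreal (b.C * (c\<phi> / \<Phi> (9/10 * r))) * (\<integral>\<^sup>+x. indicator (ball z0 r - ball z0 (3/5 * r)) x * u x \<partial>m)
   + ennreal (c * (c\<tau> * \<Phi> r)) * (\<integral>\<^sup>+x. indicator (- ball z0 r) x * (ennreal (j z0 x) * u x) \<partial>m)"
   by (rule b.pointwise_bound[OF D u]) (use harm u0 ufin x in auto)
  also have "\<dots> \<le> ennreal (A / c3 * \<Phi> r) * tail r u + ennreal (c * c\<tau> * \<Phi> r) * tail r u" by (rule add_mono[OF T1 T2])
  also have "\<dots> = ennreal ((A / c3 + c * c\<tau>) * \<Phi> r) * tail r u"
  proof -
   have "ennreal ((A / c3 + c * c\<tau>) * \<Phi> r) = ennreal (A / c3 * \<Phi> r) + ennreal (c * c\<tau> * \<Phi> r)"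
    unfolding distrib_right using A c3(1) vr c(1) c\<tau>(1) by (intro ennreal_plus) auto
   then show ?thesis by (simp only: distrib_right)
  qed
  finally show "u x \<le> ennreal ((A / c3 + c * c\<tau>) * \<Phi> r) * tail r u" .
 qed
qed

end

text \<open>Dynkin's formula with f vanishing at the start. Where f is 1, this bounds the
  probability of exiting there by the mean exit time.\<close>

lemma (in hunt) H_cutoff:
 assumes U: "open U" "x \<in> U" and f: "f \<in> gen_domain Z" "\<And>y. 0 \<le> f y" and fel: "feller Z" and fx: "f x = 0"
  and b: "\<And>y. gen Z f y \<le> b"
 shows "H 0 U (\<lambda>y. ennreal (f y)) x \<le> ennreal b * R 0 U (\<lambda>_. 1) x"
proof -
 have fm [measurable]: "f \<in> borel_fun"
  using generates_gen[OF f(1)] by (auto simp: generates_def intro: C0_measurable)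
 have "H l U (\<lambda>y. ennreal (f y)) x \<le> ennreal b * R 0 U (\<lambda>_. 1) x" if l: "0 < l" for l
 proof -
  have "H l U (\<lambda>y. ennreal (f y)) x \<le> R l U (\<lambda>y. ennreal (l * f y) + ennreal (- gen Z f y)) x + H l U (\<lambda>y. ennreal (f y)) x"
   by simp
  also have "\<dots> = R l U (\<lambda>y. ennreal (gen Z f y)) x" using dynkin[OF U(1) f fel l, of x] fx by simp
  also have "\<dots> \<le> R l U (\<lambda>_. ennreal b * 1) x" by (rule R_mono) (use b in \<open>simp add: ennreal_leI\<close>)
  also have "\<dots> = ennreal b * R l U (\<lambda>_. 1) x" by (rule R_cmult) simp
  also have "\<dots> \<le> ennreal b * R 0 U (\<lambda>_. 1) x" by (intro mult_left_mono R_antimono) (use l in auto)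
  finally show ?thesis .
 qed
 then show ?thesis by (subst H_0_SUP) (auto intro!: SUP_least)
qed

text \<open>e and e' stand for the mean exit times at the two points, s and t for the tails of the
  two functions; the exit times cancel within each quotient.\<close>

lemma ratio_comparison:
 fixes a b s t :: real
 assumes a: "0 < a" and b: "0 < b" and e: "0 < e" "0 < e'" and st: "0 \<le> s" "0 \<le> t"
  and x: "a * (e * s) \<le> ux" "ux \<le> b * (e * s)" "a * (e * t) \<le> vx" "vx \<le> b * (e * t)"
  and y: "a * (e' * s) \<le> uy" "uy \<le> b * (e' * s)" "a * (e' * t) \<le> vy" "vy \<le> b * (e' * t)"
 shows "ux / vx \<le> (b/a)\<^sup>2 * (uy / vy)"
\<comment> \<open>A vanishing tail makes the denominator vanish at both points; both quotients are
  then 0, because division by 0 gives 0.\<close>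
proof (cases "t = 0")
 case True
 then have "vx = 0" "vy = 0" using x y by auto
 then show ?thesis by simp
next
 case False
 then have t: "0 < t" using st by simp
 have pos: "0 < a * (e * t)" "0 < a * (e' * t)" using a e t by simp_all
 then have vp: "0 < vx" "0 < vy" using x y by linarith+
 have "0 \<le> a * (e * s)" "0 \<le> a * (e' * s)" using a e st by simp_all
 then have up: "0 \<le> ux" "0 \<le> uy" using x y by linarith+
 have "ux / vx \<le> (b * (e * s)) / (a * (e * t))" by (rule frac_le) (use x pos up vp in auto)
 also have "\<dots> = (b/a)\<^sup>2 * ((a * (e' * s)) / (b * (e' * t)))" using a b e t by (simp add: power2_eq_square field_simps)
 also have "\<dots> \<le> (b/a)\<^sup>2 * (uy / vy)"
 proof (rule mult_left_mono)
  show "(a * (e' * s)) / (b * (e' * t)) \<le> uy / vy" by (rule frac_le) (use y vp up a e st in auto)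
 qed simp
 finally show ?thesis .
qed

context regular_point begin

text \<open>Exits beyond the ball of radius r/2 give the product up to constants, and by themselves
  the lower bound. For the upper bound, exits to points of D inside that ball are weighted with
  \<open>inner_bound\<close> and their probability is estimated by \<open>H_cutoff\<close>; the
  factors \<Phi> cancel up to doubling.\<close>

lemma two_sided_bound:
 "\<exists>a>0. \<exists>b>0. \<forall>r D u x. small r \<longrightarrow> vanishing_solution r D u \<longrightarrow>
   x \<in> D \<inter> ball z0 (r/8) \<longrightarrow>
   ennreal a * (X.R 0 (D \<inter> ball z0 (3/10 * r)) (\<lambda>_. 1) x * tail r u) \<le> u x \<and>
   u x \<le> ennreal b * (X.R 0 (D \<inter> ball z0 (3/10 * r)) (\<lambda>_. 1) x * tail r u)"
proof -
 obtain C where C: "0 < C" "\<And>r D u x. small r \<Longrightarrow> vanishing_solution r D u \<Longrightarrow>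
   x \<in> D \<inter> ball z0 (r/2) \<Longrightarrow> u x \<le> ennreal (C * \<Phi> r) * tail r u"
  using inner_bound by blast
 \<comment> \<open>(C1) at radius r/2 with ratio 3/5 admits starting points in the ball of radius
   3r/10, which fixes the size of U.\<close>
 have "1/2 < (3/5::real)" "(3/5::real) < 1" by auto
 from jump_comparison[OF this] obtain c where c: "1 \<le> c" "\<And>r x y. 0 < r \<Longrightarrow> ereal r < r0 \<Longrightarrow> x \<in> ball z0 (3/5 * r) \<Longrightarrow> y \<in> - ball z0 r \<Longrightarrow>
    j z0 y \<le> c * j x y \<and> j x y \<le> c * j z0 y" by blast
 obtain cf where cf: "0 < cf" "\<And>r. 0 < r \<Longrightarrow> ereal r < r0 \<Longrightarrow> \<exists>f\<in>\<D>. (\<forall>x. 0 \<le> f x \<and> f x \<le> 1) \<and>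
   (\<forall>x. 27/50 * r < dist z0 x \<longrightarrow> dist z0 x < 10/11 * r \<longrightarrow> f x = 1) \<and>
   (\<forall>x. dist z0 x \<le> r / 2 \<longrightarrow> f x = 0) \<and> (\<forall>x. gen X f x \<le> cf / \<Phi> r)"
  using annulus_cutoff by blast
 obtain K where K: "0 < K" "\<And>r. 0 < r \<Longrightarrow> \<Phi> (20/11 * r) \<le> K * \<Phi> r" using Phi_doubling[of "20/11"] by auto
 show ?thesis
 proof (rule exI[of _ "1/c"], rule conjI[rotated], rule exI[of _ "c + C * (cf * K)"], intro conjI allI impI)
  show "0 < 1/c" using c by simp
  show "0 < c + C * (cf * K)" using c C cf K by (simp add: add_pos_pos)
  fix r D u x
  assume sm: "small r" and sol: "vanishing_solution r D u" and x: "x \<in> D \<inter> ball z0 (r/8)"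
  then have D: "open D" "D \<subseteq> ball z0 r" and u: "u \<in> borel_fun"
   and harm: "\<forall>x\<in>D. u x = X.H 0 D u x" and u0: "\<forall>x\<in>ball z0 r - D. u x = 0"
   unfolding vanishing_solution_def by blast+
  have [measurable]: "u \<in> borel_fun" "ball z0 a \<in> sets borel" for a using u by auto
  have r: "0 < r" using sm by (simp add: small_def)
  have sc: "ereal t < r0" if "t \<le> r" for t by (rule small_le[OF sm]) (use that r in linarith)
  have p: "0 < \<Phi> r" by (rule Phi_pos[OF r])
  define U where "U = D \<inter> ball z0 (3/10 * r)"
  have U: "open U" "U \<subseteq> D" "x \<in> U" using D x by (auto simp: U_def)
  let ?e = "X.R 0 U (\<lambda>_. 1) x" and ?t = "tail r u"
  have uH: "X.H 0 D u = u"
  proof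
   fix y show "X.H 0 D u y = u y" using harm by (cases "y \<in> D") (auto simp: X.H_outside)
  qed
  have uU: "u x = X.H 0 U u x" using X.H_decompose[OF D(1) U(1,2) u, of 0 x] unfolding uH .
  let ?g = "\<lambda>y. indicator (- ball z0 (r/2)) y * u y"
  have gm: "?g \<in> borel_fun" by measurable
  have clU: "closure U \<subseteq> cball z0 (3/10 * r)" by (rule closure_minimal) (auto simp: U_def)
  have far: "X.H 0 U ?g x = X.R 0 U (\<lambda>y. \<integral>\<^sup>+z. ?g z \<partial>density m (\<lambda>z. ennreal (j y z))) x"
  proof (rule X.jump_law[OF U(1,3) _ gm])
   fix z assume "z \<in> closure U"
   then show "?g z = 0" using clU r by (auto simp: indicator_def)
  qed simp
  have dens: "(\<integral>\<^sup>+z. ?g z \<partial>density m (\<lambda>z. ennreal (j y z))) = (\<integral>\<^sup>+z. ennreal (j y z) * ?g z \<partial>m)" for y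
   by (rule nn_integral_density) (use jump_measurable(1)[of y] in measurable)
  have tm: "(\<lambda>z. ennreal (j w z) * ?g z) \<in> borel_measurable m" for w
   using jump_measurable(1)[of w] by measurable
  have te: "?t = (\<integral>\<^sup>+z. ennreal (j z0 z) * ?g z \<partial>m)" unfolding tail_def by (simp add: mult.left_commute)
  have r2: "0 < r/2" "ereal (r/2) < r0" using r sc[of "r/2"] by auto
  have jj: "ennreal (j z0 z) \<le> ennreal c * ennreal (j y z) \<and> ennreal (j y z) \<le> ennreal c * ennreal (j z0 z)"
   if y: "y \<in> U" and z: "z \<in> - ball z0 (r/2)" for y z
  proof -
   have *: "j z0 z \<le> c * j y z \<and> j y z \<le> c * j z0 z" by (rule c(2)[OF r2 _ z]) (use y in \<open>simp add: U_def\<close>)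
   have "z0 \<noteq> z" "y \<noteq> z" using y z r by (auto simp: U_def)
   then have "0 < j z0 z" "0 < j y z" using jump_pos by auto
   then show ?thesis using * c(1) by (auto simp: ennreal_mult[symmetric] intro!: ennreal_leI)
  qed
  have up: "(\<integral>\<^sup>+z. ennreal (j y z) * ?g z \<partial>m) \<le> ennreal c * ?t" if y: "y \<in> U" for y
  proof -
   have "(\<integral>\<^sup>+z. ennreal (j y z) * ?g z \<partial>m) \<le> (\<integral>\<^sup>+z. ennreal c * (ennreal (j z0 z) * ?g z) \<partial>m)"
   proof (rule nn_integral_mono)
    fix z show "ennreal (j y z) * ?g z \<le> ennreal c * (ennreal (j z0 z) * ?g z)"
     using mult_right_mono[OF conjunct2[OF jj[OF y, of z]], of "?g z"]
     by (cases "z \<in> - ball z0 (r/2)") (simp_all add: mult.assoc)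
   qed
   also have "\<dots> = ennreal c * ?t" unfolding te by (rule nn_integral_cmult[OF tm])
   finally show ?thesis .
  qed
  have lo: "ennreal (1/c) * ?t \<le> (\<integral>\<^sup>+z. ennreal (j y z) * ?g z \<partial>m)" if y: "y \<in> U" for y
  proof -
   have "?t \<le> (\<integral>\<^sup>+z. ennreal c * (ennreal (j y z) * ?g z) \<partial>m)" unfolding te
   proof (rule nn_integral_mono)
    fix z show "ennreal (j z0 z) * ?g z \<le> ennreal c * (ennreal (j y z) * ?g z)"
     using mult_right_mono[OF conjunct1[OF jj[OF y, of z]], of "?g z"]
     by (cases "z \<in> - ball z0 (r/2)") (simp_all add: mult.assoc)
   qed
   also have "\<dots> = ennreal c * (\<integral>\<^sup>+z. ennreal (j y z) * ?g z \<partial>m)" by (rule nn_integral_cmult[OF tm])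
   finally have "ennreal (1/c) * ?t \<le> ennreal (1/c) * (ennreal c * (\<integral>\<^sup>+z. ennreal (j y z) * ?g z \<partial>m))"
    by (rule mult_left_mono) simp
   also have "\<dots> = (\<integral>\<^sup>+z. ennreal (j y z) * ?g z \<partial>m)" using c(1) by (simp add: mult.assoc[symmetric] ennreal_mult[symmetric])
   finally show ?thesis .
  qed
  have far_le: "X.H 0 U ?g x \<le> ennreal c * ?t * ?e"
  proof -
   have "X.H 0 U ?g x \<le> X.R 0 U (\<lambda>_. (ennreal c * ?t) * 1) x"
    unfolding far by (rule X.R_mono) (use up in \<open>simp add: dens\<close>)
   also have "\<dots> = ennreal c * ?t * ?e" by (rule X.R_cmult) simp
   finally show ?thesis .
  qed
  have far_ge: "ennreal (1/c) * ?t * ?e \<le> X.H 0 U ?g x"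
  proof -
   have "ennreal (1/c) * ?t * ?e = X.R 0 U (\<lambda>_. (ennreal (1/c) * ?t) * 1) x" by (rule X.R_cmult[symmetric]) simp
   also have "\<dots> \<le> X.H 0 U ?g x" unfolding far by (rule X.R_mono) (use lo in \<open>simp add: dens\<close>)
   finally show ?thesis .
  qed
  have "ennreal (1/c) * ?t * ?e \<le> X.H 0 U u x"
   by (rule order_trans[OF far_ge X.H_mono[OF U(1)]]) (auto simp: indicator_def)
  then show "ennreal (1/c) * (X.R 0 (D \<inter> ball z0 (3/10 * r)) (\<lambda>_. 1) x * tail r u) \<le> u x"
   unfolding U_def[symmetric] uU[symmetric] by (simp add: mult_ac)
  define s where "s = 11/20 * r"
  have s: "0 < s" "ereal s < r0" using r sc[of s] by (auto simp: s_def)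
  obtain f where f: "f \<in> \<D>" "\<And>x. 0 \<le> f x \<and> f x \<le> 1" "\<And>x. 27/50 * s < dist z0 x \<Longrightarrow> dist z0 x < 10/11 * s \<Longrightarrow> f x = 1"
    "\<And>x. dist z0 x \<le> s / 2 \<Longrightarrow> f x = 0" "\<And>x. gen X f x \<le> cf / \<Phi> s"
   using cf(2)[OF s] by blast
  have fm [measurable]: "f \<in> borel_fun" by (rule X.test_measurable[OF f(1)])
  have "X.H 0 U u x \<le> X.H 0 U (\<lambda>y. ?g y + (ennreal (C * \<Phi> r) * ?t) * ennreal (f y)) x"
  proof (rule X.H_mono[OF U(1)])
   fix y assume y: "y \<notin> U"
   show "u y \<le> ?g y + (ennreal (C * \<Phi> r) * ?t) * ennreal (f y)"
   proof (cases "y \<in> ball z0 (r/2)")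
    case True
    show ?thesis
    proof (cases "y \<in> D")
     case yD: True
     have "f y = 1" by (rule f(3)) (use y yD True r in \<open>auto simp: U_def s_def\<close>)
     moreover have "u y \<le> ennreal (C * \<Phi> r) * ?t" by (rule C(2)[OF sm sol]) (use yD True in simp)
     ultimately show ?thesis by (simp add: add_increasing)
    next
     case False
     then have "u y = 0" using u0 True r by auto
     then show ?thesis by simp
    qed
   qed simp
  qed
  also have "\<dots> = X.H 0 U ?g x + X.H 0 U (\<lambda>y. (ennreal (C * \<Phi> r) * ?t) * ennreal (f y)) x"
   by (rule X.H_add) measurable
  also have "X.H 0 U (\<lambda>y. (ennreal (C * \<Phi> r) * ?t) * ennreal (f y)) x = (ennreal (C * \<Phi> r) * ?t) * X.H 0 U (\<lambda>y. ennreal (f y)) x"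
   by (rule X.H_cmult) measurable
  also have "X.H 0 U ?g x + (ennreal (C * \<Phi> r) * ?t) * X.H 0 U (\<lambda>y. ennreal (f y)) x
    \<le> ennreal c * ?t * ?e + (ennreal (C * \<Phi> r) * ?t) * (ennreal (cf / \<Phi> s) * ?e)"
  proof (intro add_mono far_le mult_left_mono X.H_cutoff[OF U(1,3) _ _ X.feller_Z])
   show "f \<in> gen_domain X" using X.dom f(1) by blast
   show "f x = 0" by (rule f(4)) (use x r in \<open>auto simp: s_def\<close>)
  qed (use f in auto)
  also have "\<dots> = (ennreal c + ennreal (C * \<Phi> r * (cf / \<Phi> s))) * (?e * ?t)"
  proof -
   have "0 < \<Phi> s" by (rule Phi_pos[OF s(1)])
   then have e: "ennreal (C * \<Phi> r * (cf / \<Phi> s)) = ennreal (C * \<Phi> r) * ennreal (cf / \<Phi> s)"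
    using C(1) p cf(1) by (intro ennreal_mult) auto
   show ?thesis unfolding e distrib_right by (simp only: mult_ac)
  qed
  also have "\<dots> \<le> ennreal (c + C * (cf * K)) * (?e * ?t)"
  proof (rule mult_right_mono)
   have ps: "0 < \<Phi> s" by (rule Phi_pos[OF s(1)])
   have "\<Phi> r \<le> K * \<Phi> s" using K(2)[OF s(1)] by (simp add: s_def)
   then have "\<Phi> r / \<Phi> s \<le> K" using ps by (simp add: divide_le_eq)
   from mult_left_mono[OF this, of "C * cf"] have "C * \<Phi> r * (cf / \<Phi> s) \<le> C * (cf * K)"
    using C(1) cf(1) by (simp add: field_simps)
   moreover have "0 \<le> C * \<Phi> r * (cf / \<Phi> s)" using C(1) p cf(1) ps by simp
   ultimately show "ennreal c + ennreal (C * \<Phi> r * (cf / \<Phi> s)) \<le> ennreal (c + C * (cf * K))"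
    using c(1) by (simp add: ennreal_plus[symmetric] ennreal_leI del: ennreal_plus)
  qed simp
  finally show "u x \<le> ennreal (c + C * (cf * K)) * (X.R 0 (D \<inter> ball z0 (3/10 * r)) (\<lambda>_. 1) x * tail r u)"
   unfolding U_def[symmetric] uU[symmetric] .
 qed
qed

text \<open>Returns to real numbers. The tail is finite because u is finite at one point of the
  small ball and the mean exit time there is positive; hence the condition that D meets this
  ball.\<close>

lemma harmonic_comparison:
 "\<exists>a>0. \<exists>b>0. \<forall>r D u. small r \<longrightarrow> open D \<longrightarrow> D \<subseteq> ball z0 r \<longrightarrow> regular_harmonic X D u \<longrightarrow>
   (\<forall>x\<in>ball z0 r \<inter> (- closure D \<union> regular_points X D). u x = 0) \<longrightarrow> D \<inter> ball z0 (r/8) \<noteq> {} \<longrightarrow>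
   (\<exists>t\<ge>0. \<forall>x\<in>D \<inter> ball z0 (r/8).
    a * (enn2real (X.R 0 (D \<inter> ball z0 (3/10 * r)) (\<lambda>_. 1) x) * t) \<le> u x \<and>
    u x \<le> b * (enn2real (X.R 0 (D \<inter> ball z0 (3/10 * r)) (\<lambda>_. 1) x) * t))"
proof -
 obtain a b where a: "0 < a" and b: "0 < b" and ab: "\<And>r D u x. small r \<Longrightarrow> vanishing_solution r D u \<Longrightarrow>
   x \<in> D \<inter> ball z0 (r/8) \<Longrightarrow>
   ennreal a * (X.R 0 (D \<inter> ball z0 (3/10 * r)) (\<lambda>_. 1) x * tail r u) \<le> u x \<and>
   u x \<le> ennreal b * (X.R 0 (D \<inter> ball z0 (3/10 * r)) (\<lambda>_. 1) x * tail r u)"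
  using two_sided_bound by blast
 obtain C where C: "0 < C" "\<And>r x. small r \<Longrightarrow> X.R 0 (ball z0 r) (\<lambda>_. 1) x \<le> ennreal (C * \<Phi> r) \<and> Y.R 0 (ball z0 r) (\<lambda>_. 1) x \<le> ennreal (C * \<Phi> r)"
  using exit_time by blast
 show ?thesis
 proof (rule exI[of _ a], rule conjI[OF a], rule exI[of _ b], rule conjI[OF b], intro allI impI)
  fix r D u
  assume sm: "small r" and D: "open D" "D \<subseteq> ball z0 r" and u: "regular_harmonic X D u"
   and u0: "\<forall>x\<in>ball z0 r \<inter> (- closure D \<union> regular_points X D). u x = 0" and ne: "D \<inter> ball z0 (r/8) \<noteq> {}"
  have r: "0 < r" using sm by (simp add: small_def)
  have um: "u \<in> borel_fun" and un: "\<And>x. 0 \<le> u x" using u by (auto simp: regular_harmonic_def)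
  have Dm: "D \<in> sets borel" "ball z0 r \<in> sets borel" using D by auto
  note [measurable] = um Dm
  \<comment> \<open>Differs from u only at irregular boundary points, a polar set that the exit
    avoids.\<close>
  define f where "f y = (if y \<in> ball z0 r \<and> y \<notin> D then 0 else ennreal (u y))" for y
  have fm: "f \<in> borel_fun" unfolding f_def by measurable
  have fD: "f x = ennreal (u x)" if "x \<in> D" for x using that by (simp add: f_def)
  have pol: "polar X (frontier D - regular_points X D)"
   using semipolar_polar by (rule X.irregular_points_polar[OF D(1) sf])
  have harm: "f x = X.H 0 D f x" if x: "x \<in> D" for x
  proof -
   have "f x = X.H 0 D (\<lambda>y. ennreal (u y)) x" unfolding fD[OF x] by (rule X.regular_harmonic_H[OF D(1) u x])
   also have "\<dots> = X.H 0 D f x" unfolding f_def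
    by (rule X.H_vanishing_boundary[OF pol D(1) x _ D(1)]) (use u0 in auto)
   finally show ?thesis .
  qed
  have sol: "vanishing_solution r D f" unfolding vanishing_solution_def using D fm harm by (auto simp: f_def)
  let ?U = "D \<inter> ball z0 (3/10 * r)"
  let ?e = "X.R 0 ?U (\<lambda>_. 1)"
  have U: "open ?U" "?U \<subseteq> ball z0 r" using D by auto
  have efin: "?e x = ennreal (enn2real (?e x))" for x
  proof -
   have "?e x \<le> X.R 0 (ball z0 r) (\<lambda>_. 1) x" by (rule X.R_mono_set[OF open_ball U]) simp
   also have "\<dots> \<le> ennreal (C * \<Phi> r)" using C(2)[OF sm] by blast
   finally have "?e x < \<top>" by (rule le_less_trans) simp
   then show ?thesis by simp
  qed
  have bound: "ennreal a * (?e x * tail r f) \<le> ennreal (u x)" "ennreal (u x) \<le> ennreal b * (?e x * tail r f)"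
   if x: "x \<in> D \<inter> ball z0 (r/8)" for x using ab[OF sm sol x] x by (simp_all add: fD)
  obtain x0 where x0: "x0 \<in> D \<inter> ball z0 (r/8)" using ne by blast
  have "tail r f < \<top>"
  proof (rule ccontr)
   assume "\<not> tail r f < \<top>"
   then have T: "tail r f = \<top>" using top.not_eq_extremum by blast
   have "0 < ?e x0" by (rule X.R_pos[OF U(1)]) (use x0 r in auto)
   then have "ennreal a * (?e x0 * tail r f) = \<top>" unfolding T using a by (simp add: ennreal_mult_top)
   then show False using bound(1)[OF x0] by (simp add: top_unique)
  qed
  then obtain t where t: "tail r f = ennreal t" "0 \<le> t" by (cases "tail r f") auto
  show "\<exists>t\<ge>0. \<forall>x\<in>D \<inter> ball z0 (r/8). a * (enn2real (?e x) * t) \<le> u x \<and> u x \<le> b * (enn2real (?e x) * t)"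
  proof (rule exI[of _ t], rule conjI[OF t(2)], rule ballI)
   fix x assume x: "x \<in> D \<inter> ball z0 (r/8)"
   obtain q where q: "?e x = ennreal q" "0 \<le> q" using efin[of x] by (intro that[of "enn2real (?e x)"]) auto
   have eq: "ennreal k * (?e x * tail r f) = ennreal (k * (enn2real (?e x) * t))" if "0 < k" for k
    unfolding t q(1) using that t(2) q(2) by (simp add: ennreal_mult)
   have le: "ennreal (a * (enn2real (?e x) * t)) \<le> ennreal (u x)" "ennreal (u x) \<le> ennreal (b * (enn2real (?e x) * t))"
    using bound[OF x] unfolding eq[OF a] eq[OF b] .
   have "0 \<le> b * (enn2real (?e x) * t)" using b t(2) by simp
   then show "a * (enn2real (?e x) * t) \<le> u x \<and> u x \<le> b * (enn2real (?e x) * t)"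
    using le un[of x] by (simp only: ennreal_le_iff)
  qed
 qed
qed

lemma boundary_harnack:
 "\<exists>C>1. \<forall>r>0. ereal r < r0 / ereal (2 * real n0) \<longrightarrow>
  (\<forall>D u v. open D \<and> D \<subseteq> ball z0 r \<and> regular_harmonic X D u \<and> regular_harmonic X D v \<and>
    (\<forall>x\<in>ball z0 r \<inter> (- closure D \<union> regular_points X D). u x = 0 \<and> v x = 0) \<longrightarrow>
    (\<forall>x\<in>D \<inter> ball z0 (r / 8). \<forall>y\<in>D \<inter> ball z0 (r / 8).
     inverse C * (u y / v y) \<le> u x / v x \<and> u x / v x \<le> C * (u y / v y)))"
proof -
 obtain a b where a: "0 < a" and b: "0 < b" and ab: "\<And>r D u. small r \<Longrightarrow> open D \<Longrightarrow> D \<subseteq> ball z0 r \<Longrightarrow> regular_harmonic X D u \<Longrightarrow>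
   (\<forall>x\<in>ball z0 r \<inter> (- closure D \<union> regular_points X D). u x = 0) \<Longrightarrow> D \<inter> ball z0 (r/8) \<noteq> {} \<Longrightarrow>
   (\<exists>t\<ge>0. \<forall>x\<in>D \<inter> ball z0 (r/8).
    a * (enn2real (X.R 0 (D \<inter> ball z0 (3/10 * r)) (\<lambda>_. 1) x) * t) \<le> u x \<and>
    u x \<le> b * (enn2real (X.R 0 (D \<inter> ball z0 (3/10 * r)) (\<lambda>_. 1) x) * t))"
  using harmonic_comparison by blast
 obtain C where C: "0 < C" "\<And>r x. small r \<Longrightarrow> X.R 0 (ball z0 r) (\<lambda>_. 1) x \<le> ennreal (C * \<Phi> r) \<and> Y.R 0 (ball z0 r) (\<lambda>_. 1) x \<le> ennreal (C * \<Phi> r)"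
  using exit_time by blast
 \<comment> \<open>The summand 1 ensures the strict inequality \<open>1 < K\<close>.\<close>
 define K where "K = (b/a)\<^sup>2 + 1"
 have K: "1 < K" "(b/a)\<^sup>2 \<le> K" using a b by (auto simp: K_def)
 have "\<forall>x\<in>D \<inter> ball z0 (r / 8). \<forall>y\<in>D \<inter> ball z0 (r / 8). inverse K * (u y / v y) \<le> u x / v x \<and> u x / v x \<le> K * (u y / v y)"
  if sm: "small r" and D: "open D" "D \<subseteq> ball z0 r" and h: "regular_harmonic X D u" "regular_harmonic X D v"
   and z: "\<forall>x\<in>ball z0 r \<inter> (- closure D \<union> regular_points X D). u x = 0 \<and> v x = 0" for r D u v
 proof (cases "D \<inter> ball z0 (r / 8) = {}")
  case False
  have r: "0 < r" using sm by (simp add: small_def)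
  let ?U = "D \<inter> ball z0 (3/10 * r)"
  define e where "e x = enn2real (X.R 0 ?U (\<lambda>_. 1) x)" for x
  have zu: "\<forall>x\<in>ball z0 r \<inter> (- closure D \<union> regular_points X D). u x = 0"
   and zv: "\<forall>x\<in>ball z0 r \<inter> (- closure D \<union> regular_points X D). v x = 0" using z by auto
  obtain s where s: "0 \<le> s" "\<And>x. x \<in> D \<inter> ball z0 (r/8) \<Longrightarrow> a * (e x * s) \<le> u x \<and> u x \<le> b * (e x * s)"
   using ab[OF sm D h(1) zu False] unfolding e_def by blast
  obtain t where t: "0 \<le> t" "\<And>x. x \<in> D \<inter> ball z0 (r/8) \<Longrightarrow> a * (e x * t) \<le> v x \<and> v x \<le> b * (e x * t)"
   using ab[OF sm D h(2) zv False] unfolding e_def by blast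
  have e: "0 < e x" if x: "x \<in> D \<inter> ball z0 (r/8)" for x
  proof -
   have U: "open ?U" "?U \<subseteq> ball z0 r" using D by auto
   have "0 < X.R 0 ?U (\<lambda>_. 1) x" by (rule X.R_pos[OF U(1)]) (use x r in auto)
   moreover have "X.R 0 ?U (\<lambda>_. 1) x < \<top>"
   proof -
    have "X.R 0 ?U (\<lambda>_. 1) x \<le> X.R 0 (ball z0 r) (\<lambda>_. 1) x" by (rule X.R_mono_set[OF open_ball U]) simp
    also have "\<dots> \<le> ennreal (C * \<Phi> r)" using C(2)[OF sm] by blast
    finally show ?thesis by (rule le_less_trans) simp
   qed
   ultimately show ?thesis unfolding e_def by (simp add: enn2real_positive_iff)
  qed
  have un: "0 \<le> u x / v x" for x using h by (simp add: regular_harmonic_def)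
  have cmp: "u x / v x \<le> K * (u y / v y)" if x: "x \<in> D \<inter> ball z0 (r/8)" and y: "y \<in> D \<inter> ball z0 (r/8)" for x y
  proof -
   have "u x / v x \<le> (b/a)\<^sup>2 * (u y / v y)"
    by (rule ratio_comparison[OF a b e[OF x] e[OF y] s(1) t(1)]) (use s(2) t(2) x y in blast)+
   also have "\<dots> \<le> K * (u y / v y)" by (rule mult_right_mono[OF K(2) un])
   finally show ?thesis .
  qed
  have cmp': "inverse K * (u y / v y) \<le> u x / v x" if x: "x \<in> D \<inter> ball z0 (r/8)" and y: "y \<in> D \<inter> ball z0 (r/8)" for x y
  proof -
   have "inverse K * (u y / v y) \<le> inverse K * (K * (u x / v x))" by (rule mult_left_mono[OF cmp[OF y x]]) (use K in simp)
   also have "\<dots> = u x / v x" using K by simp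
   finally show ?thesis .
  qed
  show ?thesis using cmp cmp' by blast
 qed simp
 then show ?thesis using K(1) unfolding small_def by blast
qed

end

theorem corollary4p2:
  fixes m :: "'a::heine_borel measure"
    and X :: "('a, 'w) process"
    and Xd :: "('a, 'v) process"
    and G :: "'a set \<Rightarrow> 'a \<Rightarrow> 'a \<Rightarrow> ennreal"
    and \<D> :: "('a \<Rightarrow> real) set"
    and j jd :: "'a \<Rightarrow> 'a \<Rightarrow> real"
    and \<Phi> :: "real \<Rightarrow> real"
    and z\<^sub>0 :: 'a and R\<^sub>0 r\<^sub>0 :: ereal and n\<^sub>0 :: nat
  assumes "reference_measure m"
    and "localization_radius TYPE('a) R\<^sub>0"
    and "assumption_A m X Xd"
    and "\<And>D. open D \<Longrightarrow> green_function m X Xd D (G D)"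
    and "assumption_B m X Xd \<D>"
    and "assumption_C m X Xd j jd"
    and "0 < r\<^sub>0" and "r\<^sub>0 \<le> R\<^sub>0"
    and "assumption_V1 m z\<^sub>0"
    and "assumption_V2' m z\<^sub>0 r\<^sub>0 n\<^sub>0"
    and "assumption_Phi' \<Phi>"
    and "assumption_B1a m X Xd \<D> \<Phi> z\<^sub>0 r\<^sub>0"
    and "assumption_B1b m X Xd \<D> j z\<^sub>0 r\<^sub>0"
    and "assumption_B1c m X Xd \<D> \<Phi> z\<^sub>0 r\<^sub>0"
    and "assumption_C1 m j jd \<Phi> z\<^sub>0 r\<^sub>0"
    and "assumption_D1 m G \<Phi> z\<^sub>0 r\<^sub>0"
  shows "\<exists>C\<^sub>2>1. \<forall>r>0. ereal r < r\<^sub>0 / ereal (2 * real n\<^sub>0) \<longrightarrow>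
    (\<forall>D u v. open D \<and> D \<subseteq> ball z\<^sub>0 r \<and>
       regular_harmonic X D u \<and> regular_harmonic X D v \<and>
       (\<forall>x\<in>ball z\<^sub>0 r \<inter> (- closure D \<union> regular_points X D). u x = 0 \<and> v x = 0) \<longrightarrow>
       (\<forall>x\<in>D \<inter> ball z\<^sub>0 (r / 8). \<forall>y\<in>D \<inter> ball z\<^sub>0 (r / 8).
          inverse C\<^sub>2 * (u y / v y) \<le> u x / v x \<and> u x / v x \<le> C\<^sub>2 * (u y / v y)))"
proof -
  have A: "hunt_process X" "hunt_process Xd" "feller X" "feller Xd" "strongly_feller X" "\<And>A. semipolar X A \<Longrightarrow> polar X A"
    using assms(3) by (auto simp: assumption_A_def)
  have B: "\<D> \<subseteq> gen_domain X" "\<D> \<subseteq> gen_domain Xd" "\<And>K U. compact K \<Longrightarrow> open U \<Longrightarrow> K \<subseteq> U \<Longrightarrow> test_functions m \<D> K U \<noteq> {}"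
    using assms(5) by (auto simp: assumption_B_def)
  have test: "\<exists>f\<in>\<D>. (\<forall>x\<in>K. f x = 1) \<and> (\<forall>x\<in>-U. f x = 0) \<and> (\<forall>x. 0 \<le> f x \<and> f x \<le> 1)"
    if KU: "compact K" "open U" "K \<subseteq> U" for K U
  proof -
    obtain f where "f \<in> test_functions m \<D> K U" using B(3)[OF KU] by blast
    then show ?thesis unfolding test_functions_def by blast
  qed
  have C: "\<And>x. j x \<in> borel_fun" "\<And>x. jd x \<in> borel_fun"
     "levy_kernel X (\<lambda>x. density m (\<lambda>y. ennreal (j x y)))" "levy_kernel Xd (\<lambda>x. density m (\<lambda>y. ennreal (jd x y)))"
     "\<And>x y. x \<noteq> y \<Longrightarrow> j x y = jd y x" "\<And>x y. x \<noteq> y \<Longrightarrow> 0 < j x y"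
    using assms(6) unfolding assumption_C_def by blast+
  interpret regular_point m X Xd j jd \<D> G \<Phi> z\<^sub>0 r\<^sub>0 n\<^sub>0
    by unfold_locales (fact A B C test assms)+
  show ?thesis by (rule boundary_harnack)
qed

end
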